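(* Let $k\ge3$. Let $(Z_k)_{red}\subset(\mathbb{P}^1_{\mathbb{C}})^k$ be the space of $k$ pairwise distinct points, with projections $|p_i|\colon(Z_k)_{red}\to\mathbb{P}^1_{\mathbb{C}}$, and let $Q$ be the cokernel of the map of vector bundles over $(Z_k)_{red}$ $$\mathfrak{SUSY}^1\colon(Z_k)_{red}\times\bigl(H^0(S)\otimes\mathcal{O}_{\mathbb{R}^{0|1}}\bigr)_0\to N_{Z_k/(Z_k)_{red}}=\bigoplus_{i=1}^k|p_i|^*S,\qquad s\mapsto\bigoplus_{i=1}^k|p_i|^*s,$$ so that there is a short exact sequence $0\to(Z_k)_{red}\times(H^0(S)\otimes\mathcal{O}_{\mathbb{R}^{0|1}})_0\to N_{Z_k/(Z_k)_{red}}\to Q\to0$. This sequence is equivariant with respect to $\mathrm{SL}_{\mathbb{C}}(2)$ and with respect to the $\mathbb{C}^*$-action rescaling fibers, and the two actions commute. The bundle $Q/\mathrm{SL}_{\mathbb{C}}(2)$ over $M_{0,k}=(Z_k)_{red}/\mathrm{SL}_{\mathbb{C}}(2)$ is $\mathbb{C}^*$-equivariantly isomorphic to the bundle $N_k/\mathbb{Z}_2=\underline{\mathcal{M}_{0,k}}(\mathbb{R}^{0|1})$, where $N_k$ is the normal bundle of the reduced space $(\tilde Z_{k-3})_{red}$ in $\mathbb{C}^{0|1}\times\tilde Z_{k-3}$.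
   Context: $B$ denotes a superpoint $\mathbb{R}^{0|s}$ with Grassmann algebra $\mathcal{O}_B$. For a supermanifold $X$ with reduced manifold $X_{red}$, $N_{X/X_{red}}$ is the normal bundle, the cokernel of $TX_{red}\to TX|_{X_{red}}$; its total space, parity forgotten, is $\underline{X}(\mathbb{R}^{0|1})$, the manifold of $\mathbb{R}^{0|1}$-points. $\mathbb{P}^{1|1}_{\mathbb{C}}$ has $B$-points $[Z_1:Z_2:\Theta]$ ($Z_i$ even, one invertible, $\Theta$ odd) modulo even invertible scalars, with reduced space $\mathbb{P}^1_{\mathbb{C}}$ and normal bundle $S=\mathcal{O}(1)$, the spinor bundle, $S\otimes S=T\mathbb{P}^1_{\mathbb{C}}$; local frames are $s_1$ over $Z_2\ne0$ (coordinate $z_1=Z_1/Z_2$) and $s_2$ over $Z_1\neq0$ (coordinate $z_2=-Z_2/Z_1$), with $s_1=-z_2s_2$. Special points: $0=[0:1:0]$, $1_\epsilon=[1:1:\epsilon]$, $1=1_0$, $\infty=[1:0:0]$. $\mathrm{SC}(\mathbb{P}^{1|1}_{\mathbb{C}})$ is the super Lie group of superconformal automorphisms, with $B$-points the matrices $\begin{pmatrix} a & c & \gamma \\ b & d & \delta \\ \alpha & \beta & e \end{pmatrix}$ (even $a,b,c,d,e$, odd $\alpha,\beta,\gamma,\delta$ in $\mathcal{O}_B\otimes\mathbb{C}$) with $ad-bc-\gamma\delta=1$, $e^2+2\alpha\beta=1$, $c\alpha-a\beta=e\gamma$, $d\alpha-b\beta=e\delta$, $e_{red}=1$, acting by right multiplication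 on $[Z_1:Z_2:\Theta]$. $\mathrm{SL}_{\mathbb{C}}(2)$ is the subgroup with $\alpha=\beta=\gamma=\delta=0$, $e=1$. The automorphism $\Xi$ given by $\begin{pmatrix} a & c \\ b & d \end{pmatrix}\in\mathrm{SL}_{\mathbb{C}}(2)$ induces the Möbius transformation $\xi\colon z_1\mapsto\frac{az_1+b}{cz_1+d}$ and the bundle map $s_\Xi\colon S\to\xi^*S$, $s_\Xi(s_1)=\frac1{cz_1+d}\xi^*s_1$. $Z_k\subset(\mathbb{P}^{1|1}_{\mathbb{C}})^k$ is the open subsupermanifold where no two reduced points coincide, and $\mathcal{M}_{0,k}=Z_k/\mathrm{SC}(\mathbb{P}^{1|1}_{\mathbb{C}})$ is the quotient superorbifold, with orbit functor $\underline{\mathcal{M}_{0,k}}(B)=\underline{Z_k}(B)/\underline{\mathrm{SC}(\mathbb{P}^{1|1}_{\mathbb{C}})}(B)$. Equivalently $\mathcal{M}_{0,k}=(\mathbb{C}^{0|1}\times\tilde Z_{k-3})/\mathbb{Z}_2$, where $\tilde Z_{k-3}\subset Z_{k-3}$ is the open part where no reduced point is $0$, $1$ or $\infty$, embedded by $(\epsilon,z_1,\dots,z_{k-3})\mapsto(0,1_\epsilon,\infty,z_1,\dots,z_{k-3})$, and $\mathbb{Z}_2$ acts by multiplying all odd coordinates by $-1$. $M_{0,k}=\underline{\mathcal{M}_{0,k}}(\mathbb{R}^{0|0})=(\tilde Z_{k-3})_{red}$ is the classical moduli space of $k$ distinct points on $\mathbb{P}^1_{\mathbb{C}}$. $\mathrm{SL}_{\mathbb{C}}(2)$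 acts on $(Z_k)_{red}$ by $\xi$ on each factor, on $(Z_k)_{red}\times(H^0(S)\otimes\mathcal{O}_{\mathbb{R}^{0|1}})_0$ by $((|p_i|),s)\mapsto((\xi\circ|p_i|),s_\Xi s)$, and on $\bigoplus|p_i|^*S$ by $|p_i|^*s_\Xi$ on each summand. $\mathbb{C}^*$ acts on all vector bundles, including $N_k$, by fiberwise complex multiplication; $\mathbb{Z}_2$ acts on $N_k$ by $-1$ on fibers, so quotients by $\mathrm{SL}_{\mathbb{C}}(2)$ have fibers that are vector spaces modulo $\pm1$. *)

theory Defs
  imports "HOL-Analysis.Analysis" "HOL-Algebra.Group_Action"
begin

section \<open>Complexified Grassmann algebras\<close>

text \<open>
  The type contains the Grassmann algebras of all superpoints at once: an element is a family of
  coefficients of the monomials \<open>\<eta>\<^sub>A = \<eta>\<^sub>i\<^sub>1 \<cdots> \<eta>\<^sub>i\<^sub>m\<close>, where \<open>A = {i\<^sub>1 < \<dots> < i\<^sub>m}\<close> is a finite set of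
  generator indices.  The algebra \<open>\<O>\<^sub>B \<otimes> \<complex>\<close> of \<open>B = \<real>\<^bsup>0|s\<^esup>\<close> is the subset \<open>grassmann_alg s\<close>.
\<close>

typedef grassmann = "{f :: nat set \<Rightarrow> complex. \<forall>A. infinite A \<longrightarrow> f A = 0}"
  morphisms gcoeff Abs_grassmann
  by (rule exI[of _ "\<lambda>_. 0"]) simp

setup_lifting type_definition_grassmann

definition inversions :: "nat set \<Rightarrow> nat set \<Rightarrow> nat" where
  "inversions B C = card {(i, j). i \<in> B \<and> j \<in> C \<and> j < i}"

lemma inversions_Un_left:
  assumes "finite B" "finite C" "finite D" "B \<inter> C = {}"
  shows "inversions (B \<union> C) D = inversions B D + inversions C D"
proof -
  have "{(i, j). i \<in> B \<union> C \<and> j \<in> D \<and> j < i} =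
      {(i, j). i \<in> B \<and> j \<in> D \<and> j < i} \<union> {(i, j). i \<in> C \<and> j \<in> D \<and> j < i}" by auto
  moreover have "finite {(i, j). i \<in> B \<and> j \<in> D \<and> j < i}" "finite {(i, j). i \<in> C \<and> j \<in> D \<and> j < i}"
    using assms by (auto intro: finite_subset[of _ "B \<times> D"] finite_subset[of _ "C \<times> D"])
  moreover have "{(i, j). i \<in> B \<and> j \<in> D \<and> j < i} \<inter> {(i, j). i \<in> C \<and> j \<in> D \<and> j < i} = {}"
    using assms by auto
  ultimately show ?thesis unfolding inversions_def by (simp add: card_Un_disjoint)
qed

lemma inversions_Un_right:
  assumes "finite B" "finite C" "finite D" "C \<inter> D = {}"
  shows "inversions B (C \<union> D) = inversions B C + inversions B D"
proof -
  have "{(i, j). i \<in> B \<and> j \<in> C \<union> D \<and> j < i} =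
      {(i, j). i \<in> B \<and> j \<in> C \<and> j < i} \<union> {(i, j). i \<in> B \<and> j \<in> D \<and> j < i}" by auto
  moreover have "finite {(i, j). i \<in> B \<and> j \<in> C \<and> j < i}" "finite {(i, j). i \<in> B \<and> j \<in> D \<and> j < i}"
    using assms by (auto intro: finite_subset[of _ "B \<times> C"] finite_subset[of _ "B \<times> D"])
  moreover have "{(i, j). i \<in> B \<and> j \<in> C \<and> j < i} \<inter> {(i, j). i \<in> B \<and> j \<in> D \<and> j < i} = {}"
    using assms by auto
  ultimately show ?thesis unfolding inversions_def by (simp add: card_Un_disjoint)
qed

lemma inversions_empty [simp]: "inversions {} A = 0" "inversions A {} = 0"
  by (simp_all add: inversions_def)

instantiation grassmann :: ring_1
begin

lift_definition zero_grassmann :: grassmann is "\<lambda>_. 0" by simp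
lift_definition one_grassmann :: grassmann is "\<lambda>A. if A = {} then 1 else 0" by auto
lift_definition plus_grassmann :: "grassmann \<Rightarrow> grassmann \<Rightarrow> grassmann" is "\<lambda>f g A. f A + g A" by simp
lift_definition minus_grassmann :: "grassmann \<Rightarrow> grassmann \<Rightarrow> grassmann" is "\<lambda>f g A. f A - g A" by simp
lift_definition uminus_grassmann :: "grassmann \<Rightarrow> grassmann" is "\<lambda>f A. - f A" by simp
lift_definition times_grassmann :: "grassmann \<Rightarrow> grassmann \<Rightarrow> grassmann" is
  "\<lambda>f g A. \<Sum>B\<in>Pow A. (-1) ^ inversions B (A - B) * f B * g (A - B)"
  by (simp add: finite_Pow_iff)

instance
proof
  fix a b c :: grassmann
  show "a * b * c = a * (b * c)"
  proof transfer
    fix f g h :: "nat set \<Rightarrow> complex"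
    show "(\<lambda>A. \<Sum>B\<in>Pow A. (-1) ^ inversions B (A - B) *
             (\<Sum>C\<in>Pow B. (-1) ^ inversions C (B - C) * f C * g (B - C)) * h (A - B)) =
          (\<lambda>A. \<Sum>B\<in>Pow A. (-1) ^ inversions B (A - B) * f B *
             (\<Sum>C\<in>Pow (A - B). (-1) ^ inversions C (A - B - C) * g C * h (A - B - C)))"
    proof
      fix A :: "nat set"
      show "(\<Sum>B\<in>Pow A. (-1) ^ inversions B (A - B) *
             (\<Sum>C\<in>Pow B. (-1) ^ inversions C (B - C) * f C * g (B - C)) * h (A - B)) =
          (\<Sum>B\<in>Pow A. (-1) ^ inversions B (A - B) * f B *
             (\<Sum>C\<in>Pow (A - B). (-1) ^ inversions C (A - B - C) * g C * h (A - B - C)))"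
        (is "?l = ?r")
      proof (cases "finite A")
        case False
        then show ?thesis by (simp add: finite_Pow_iff)
      next
        case True
        have "?l = (\<Sum>(B, C)\<in>Sigma (Pow A) Pow. (-1) ^ inversions B (A - B) *
             ((-1) ^ inversions C (B - C) * f C * g (B - C)) * h (A - B))"
          using True by (subst sum.Sigma[symmetric])
            (auto simp: sum_distrib_left sum_distrib_right finite_subset)
        also have "\<dots> = (\<Sum>(B, C)\<in>(SIGMA B:Pow A. Pow (A - B)). (-1) ^ inversions B (A - B) * f B *
             ((-1) ^ inversions C (A - B - C) * g C * h (A - B - C)))"
        proof (rule sum.reindex_bij_witness
            [where i = "\<lambda>(B, C). (B \<union> C, B)" and j = "\<lambda>(B, C). (C, B - C)"], goal_cases)
          case (5 x)
          then obtain B C where x: "x = (B, C)" "C \<subseteq> B" "B \<subseteq> A" by auto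
          define D E where "D = B - C" and "E = A - B"
          have fin: "finite C" "finite D" "finite E"
            using x True unfolding D_def E_def by (auto intro: finite_subset)
          have B: "B = C \<union> D" "C \<inter> D = {}" using x unfolding D_def by auto
          have sets: "A - C = D \<union> E" "D \<inter> E = {}" "A - C - D = E" using x unfolding D_def E_def by auto
          have "inversions B E = inversions C E + inversions D E"
            using B fin by (simp add: inversions_Un_left)
          moreover have "inversions C (A - C) = inversions C D + inversions C E"
            using sets fin by (simp add: inversions_Un_right)
          ultimately show ?case
            by (simp add: x(1) sets(3) power_add mult_ac flip: D_def E_def)
        qed auto
        also have "\<dots> = ?r"
          using True by (subst sum.Sigma[symmetric])
            (auto simp: sum_distrib_left sum_distrib_right finite_subset)
        finally show ?thesis .
      qed
    qed
  qed
  show "1 * a = a"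
  proof transfer
    fix f :: "nat set \<Rightarrow> complex" assume f: "\<forall>A. infinite A \<longrightarrow> f A = 0"
    show "(\<lambda>A. \<Sum>B\<in>Pow A. (-1) ^ inversions B (A - B) * (if B = {} then 1 else 0) * f (A - B)) = f"
    proof
      fix A :: "nat set"
      show "(\<Sum>B\<in>Pow A. (-1) ^ inversions B (A - B) * (if B = {} then 1 else 0) * f (A - B)) = f A"
      proof (cases "finite A")
        case True
        have "(\<Sum>B\<in>Pow A. (-1) ^ inversions B (A - B) * (if B = {} then 1 else 0) * f (A - B)) =
            (\<Sum>B\<in>Pow A. if B = {} then f A else 0)" by (rule sum.cong) auto
        then show ?thesis using True by simp
      qed (simp add: f finite_Pow_iff)
    qed
  qed
  show "a * 1 = a"
  proof transfer
    fix f :: "nat set \<Rightarrow> complex" assume f: "\<forall>A. infinite A \<longrightarrow> f A = 0"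
    show "(\<lambda>A. \<Sum>B\<in>Pow A. (-1) ^ inversions B (A - B) * f B * (if A - B = {} then 1 else 0)) = f"
    proof
      fix A :: "nat set"
      show "(\<Sum>B\<in>Pow A. (-1) ^ inversions B (A - B) * f B * (if A - B = {} then 1 else 0)) = f A"
      proof (cases "finite A")
        case True
        have "(\<Sum>B\<in>Pow A. (-1) ^ inversions B (A - B) * f B * (if A - B = {} then 1 else 0)) =
            (\<Sum>B\<in>Pow A. if B = A then f A else 0)"
        proof (rule sum.cong)
          fix B assume "B \<in> Pow A"
          then have "A - B = {} \<longleftrightarrow> B = A" by auto
          then show "(-1) ^ inversions B (A - B) * f B * (if A - B = {} then 1 else 0) =
              (if B = A then f A else 0)" by auto
        qed simp
        then show ?thesis using True by simp
      qed (simp add: f finite_Pow_iff)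
    qed
  qed
  show "a + b + c = a + (b + c)" by transfer (simp add: add.assoc)
  show "a + b = b + a" by transfer (simp add: add.commute)
  show "0 + a = a" by transfer simp
  show "- a + a = 0" by transfer simp
  show "a - b = a + - b" by transfer simp
  show "(a + b) * c = a * c + b * c" by transfer (simp add: algebra_simps sum.distrib)
  show "a * (b + c) = a * b + a * c" by transfer (simp add: algebra_simps sum.distrib)
  show "(0::grassmann) \<noteq> 1" by transfer (auto simp: fun_eq_iff)
qed

end

lift_definition gconst :: "complex \<Rightarrow> grassmann" is "\<lambda>c A. if A = {} then c else 0" by auto

lift_definition geta :: grassmann is "\<lambda>A. if A = {0} then 1 else 0" by auto

definition gbody :: "grassmann \<Rightarrow> complex" where
  "gbody x = gcoeff x {}"

definition grassmann_alg :: "nat \<Rightarrow> grassmann set" where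
  "grassmann_alg s = {x. \<forall>A. \<not> A \<subseteq> {..<s} \<longrightarrow> gcoeff x A = 0}"

definition gr_even :: "nat \<Rightarrow> grassmann set" where
  "gr_even s = {x \<in> grassmann_alg s. \<forall>A. odd (card A) \<longrightarrow> gcoeff x A = 0}"

definition gr_odd :: "nat \<Rightarrow> grassmann set" where
  "gr_odd s = {x \<in> grassmann_alg s. \<forall>A. even (card A) \<longrightarrow> gcoeff x A = 0}"

definition gr_units :: "nat \<Rightarrow> grassmann set" where
  "gr_units s = {u \<in> gr_even s. \<exists>v \<in> gr_even s. u * v = 1}"


section \<open>Functors of points\<close>

text \<open>
  All objects depend on \<open>s\<close>, the odd dimension of the superpoint \<open>B = \<real>\<^bsup>0|s\<^esup>\<close>.  A \<open>B\<close>-point of the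
  superprojective line is the set of all its homogeneous coordinate triples over \<open>B\<close>.
\<close>

type_synonym triple = "grassmann \<times> grassmann \<times> grassmann"
type_synonym spoint = "triple set"

definition homog :: "nat \<Rightarrow> triple set" where
  "homog s = {(Z1, Z2, \<Theta>). Z1 \<in> gr_even s \<and> Z2 \<in> gr_even s \<and> \<Theta> \<in> gr_odd s
                \<and> (Z1 \<in> gr_units s \<or> Z2 \<in> gr_units s)}"

definition spt :: "nat \<Rightarrow> triple \<Rightarrow> spoint" where
  "spt s = (\<lambda>(Z1, Z2, \<Theta>). {(u * Z1, u * Z2, u * \<Theta>) | u. u \<in> gr_units s})"

definition P11 :: "nat \<Rightarrow> spoint set" where
  "P11 s = spt s ` homog s"

text \<open>Restriction of a \<open>B\<close>-point along \<open>\<real>\<^bsup>0|0\<^esup> \<rightarrow> B\<close>; for \<open>s = 1\<close> this is the projection of \<open>S\<close>.\<close>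

definition pt_red :: "spoint \<Rightarrow> spoint" where
  "pt_red p = (\<lambda>(Z1, Z2, \<Theta>). (gconst (gbody Z1), gconst (gbody Z2), 0)) ` p"

definition odd_neg :: "spoint \<Rightarrow> spoint" where
  "odd_neg p = (\<lambda>(Z1, Z2, \<Theta>). (Z1, Z2, - \<Theta>)) ` p"

definition sp_zero :: "nat \<Rightarrow> spoint" where
  "sp_zero s = spt s (0, 1, 0)"

definition sp_one :: "nat \<Rightarrow> grassmann \<Rightarrow> spoint" where
  "sp_one s \<epsilon> = spt s (1, 1, \<epsilon>)"

definition sp_infinity :: "nat \<Rightarrow> spoint" where
  "sp_infinity s = spt s (1, 0, 0)"

text \<open>Tuples of \<open>k\<close> points are extensional functions on \<open>{..<k}\<close>.\<close>

definition Zk :: "nat \<Rightarrow> nat \<Rightarrow> (nat \<Rightarrow> spoint) set" where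
  "Zk k s = {p \<in> {..<k} \<rightarrow>\<^sub>E P11 s. inj_on (\<lambda>i. pt_red (p i)) {..<k}}"

definition Ztilde :: "nat \<Rightarrow> nat \<Rightarrow> (nat \<Rightarrow> spoint) set" where
  "Ztilde m s = {p \<in> Zk m s. \<forall>i<m. pt_red (p i) \<notin> {sp_zero 0, sp_one 0 0, sp_infinity 0}}"

definition tuple_red :: "nat \<Rightarrow> (nat \<Rightarrow> spoint) \<Rightarrow> (nat \<Rightarrow> spoint)" where
  "tuple_red k p = (\<lambda>i\<in>{..<k}. pt_red (p i))"

text \<open>\<open>slice k\<close> is \<open>\<complex>\<^bsup>0|1\<^esup> \<times> Z~\<^bsub>k-3\<^esub>\<close> with its embedding into \<open>Z\<^sub>k\<close> and its \<open>\<int>\<^sub>2\<close>-action.\<close>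

type_synonym slicept = "grassmann \<times> (nat \<Rightarrow> spoint)"

definition slice :: "nat \<Rightarrow> nat \<Rightarrow> slicept set" where
  "slice k s = gr_odd s \<times> Ztilde (k - 3) s"

definition slice_embed :: "nat \<Rightarrow> nat \<Rightarrow> slicept \<Rightarrow> (nat \<Rightarrow> spoint)" where
  "slice_embed k s = (\<lambda>(\<epsilon>, z). \<lambda>i\<in>{..<k}.
     if i = 0 then sp_zero s else if i = 1 then sp_one s \<epsilon> else if i = 2 then sp_infinity s
     else z (i - 3))"

definition slice_neg :: "nat \<Rightarrow> slicept \<Rightarrow> slicept" where
  "slice_neg k = (\<lambda>(\<epsilon>, z). (- \<epsilon>, \<lambda>i\<in>{..<k - 3}. odd_neg (z i)))"

definition slice_red :: "nat \<Rightarrow> slicept \<Rightarrow> slicept" where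
  "slice_red k = (\<lambda>(\<epsilon>, z). (0, tuple_red (k - 3) z))"


section \<open>Superconformal automorphisms\<close>

text \<open>The rows of the matrix are \<open>(a c \<gamma>)\<close>, \<open>(b d \<delta>)\<close>, \<open>(\<alpha> \<beta> e)\<close>.\<close>

record scmat =
  sc_a :: grassmann
  sc_c :: grassmann
  sc_gamma :: grassmann
  sc_b :: grassmann
  sc_d :: grassmann
  sc_delta :: grassmann
  sc_alpha :: grassmann
  sc_beta :: grassmann
  sc_e :: grassmann

definition sc_matmul :: "scmat \<Rightarrow> scmat \<Rightarrow> scmat" where
  "sc_matmul N M = \<lparr>
     sc_a = sc_a N * sc_a M + sc_c N * sc_b M + sc_gamma N * sc_alpha M,
     sc_c = sc_a N * sc_c M + sc_c N * sc_d M + sc_gamma N * sc_beta M,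
     sc_gamma = sc_a N * sc_gamma M + sc_c N * sc_delta M + sc_gamma N * sc_e M,
     sc_b = sc_b N * sc_a M + sc_d N * sc_b M + sc_delta N * sc_alpha M,
     sc_d = sc_b N * sc_c M + sc_d N * sc_d M + sc_delta N * sc_beta M,
     sc_delta = sc_b N * sc_gamma M + sc_d N * sc_delta M + sc_delta N * sc_e M,
     sc_alpha = sc_alpha N * sc_a M + sc_beta N * sc_b M + sc_e N * sc_alpha M,
     sc_beta = sc_alpha N * sc_c M + sc_beta N * sc_d M + sc_e N * sc_beta M,
     sc_e = sc_alpha N * sc_gamma M + sc_beta N * sc_delta M + sc_e N * sc_e M\<rparr>"

definition sc_one :: scmat where
  "sc_one = \<lparr>sc_a = 1, sc_c = 0, sc_gamma = 0, sc_b = 0, sc_d = 1, sc_delta = 0,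
             sc_alpha = 0, sc_beta = 0, sc_e = 1\<rparr>"

text \<open>
  Matrices act by multiplication from the right on row vectors.  The group multiplication is
  composition of automorphisms, that is, the opposite of matrix multiplication.
\<close>

definition SC :: "nat \<Rightarrow> scmat monoid" where
  "SC s = \<lparr>carrier = {M.
      {sc_a M, sc_b M, sc_c M, sc_d M, sc_e M} \<subseteq> gr_even s \<and>
      {sc_alpha M, sc_beta M, sc_gamma M, sc_delta M} \<subseteq> gr_odd s \<and>
      sc_a M * sc_d M - sc_b M * sc_c M - sc_gamma M * sc_delta M = 1 \<and>
      sc_e M * sc_e M + 2 * sc_alpha M * sc_beta M = 1 \<and>
      sc_c M * sc_alpha M - sc_a M * sc_beta M = sc_e M * sc_gamma M \<and>
      sc_d M * sc_alpha M - sc_b M * sc_beta M = sc_e M * sc_delta M \<and>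
      gbody (sc_e M) = 1},
    mult = (\<lambda>M N. sc_matmul N M), one = sc_one\<rparr>"

definition sl2_mat :: "complex \<Rightarrow> complex \<Rightarrow> complex \<Rightarrow> complex \<Rightarrow> scmat" where
  "sl2_mat a b c d = \<lparr>sc_a = gconst a, sc_c = gconst c, sc_gamma = 0, sc_b = gconst b,
     sc_d = gconst d, sc_delta = 0, sc_alpha = 0, sc_beta = 0, sc_e = 1\<rparr>"

definition SL2 :: "scmat monoid" where
  "SL2 = \<lparr>carrier = {sl2_mat a b c d | a b c d. a * d - b * c = 1},
    mult = (\<lambda>M N. sc_matmul N M), one = sc_one\<rparr>"

definition pt_act :: "scmat \<Rightarrow> spoint \<Rightarrow> spoint" where
  "pt_act M p = (\<lambda>(Z1, Z2, \<Theta>).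
     (Z1 * sc_a M + Z2 * sc_b M + \<Theta> * sc_alpha M,
      Z1 * sc_c M + Z2 * sc_d M + \<Theta> * sc_beta M,
      Z1 * sc_gamma M + Z2 * sc_delta M + \<Theta> * sc_e M)) ` p"

definition tuple_act :: "nat \<Rightarrow> scmat \<Rightarrow> (nat \<Rightarrow> spoint) \<Rightarrow> (nat \<Rightarrow> spoint)" where
  "tuple_act k M p = (\<lambda>i\<in>{..<k}. pt_act M (p i))"

text \<open>The orbit functor of \<open>\<M>\<^bsub>0,k\<^esub>\<close>.\<close>

definition moduli_pts :: "nat \<Rightarrow> nat \<Rightarrow> (nat \<Rightarrow> spoint) set set" where
  "moduli_pts k s = orbits (SC s) (Zk k s) (tuple_act k)"


lemma gconst_times: "gcoeff (gconst c * x) A = c * gcoeff x A"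
proof (cases "finite A")
  case True
  have "gcoeff (gconst c * x) A = (\<Sum>B\<in>Pow A. if B = {} then c * gcoeff x A else 0)"
    unfolding times_grassmann.rep_eq gconst.rep_eq by (rule sum.cong) auto
  then show ?thesis using True by simp
next
  case False
  then show ?thesis using gcoeff[of x] gcoeff[of "gconst c * x"] by simp
qed

lemma times_gconst: "gcoeff (x * gconst c) A = gcoeff x A * c"
proof (cases "finite A")
  case True
  have "gcoeff (x * gconst c) A = (\<Sum>B\<in>Pow A. if B = A then gcoeff x A * c else 0)"
    unfolding times_grassmann.rep_eq gconst.rep_eq
  proof (rule sum.cong)
    fix B assume "B \<in> Pow A"
    then have "A - B = {} \<longleftrightarrow> B = A" by auto
    then show "(-1) ^ inversions B (A - B) * gcoeff x B * (if A - B = {} then c else 0) =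
        (if B = A then gcoeff x A * c else 0)" by auto
  qed simp
  then show ?thesis using True by simp
next
  case False
  then show ?thesis using gcoeff[of x] gcoeff[of "x * gconst c"] by simp
qed

lemma gconst_commute: "gconst c * x = x * gconst c"
  by (intro gcoeff_inject[THEN iffD1] ext) (simp add: gconst_times times_gconst)

lemma gconst_0 [simp]: "gconst 0 = 0" and gconst_1 [simp]: "gconst 1 = 1"
  by (transfer, auto)+

lemma gconst_mult: "gconst (c * d) = gconst c * gconst d"
  by (intro gcoeff_inject[THEN iffD1] ext) (simp add: gconst_times gconst.rep_eq)

lemma gconst_add: "gconst (c + d) = gconst c + gconst d"
  by transfer auto

lemma gconst_minus: "gconst (- c) = - gconst c"
  by transfer auto

lemma gr_units_mult_gconst:
  assumes "u \<in> gr_units s" "c \<noteq> 0"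
  shows "u * gconst c \<in> gr_units s"
proof -
  obtain v where v: "v \<in> gr_even s" "u * v = 1" and u: "u \<in> gr_even s"
    using assms by (auto simp: gr_units_def)
  have "u * gconst c * (gconst (1 / c) * v) = u * (gconst c * gconst (1 / c)) * v"
    by (simp only: mult.assoc)
  also have "\<dots> = 1" using assms v by (simp flip: gconst_mult)
  finally have "u * gconst c * (gconst (1 / c) * v) = 1" .
  moreover have "u * gconst c \<in> gr_even s" "gconst (1 / c) * v \<in> gr_even s"
    using u v by (auto simp: gr_even_def grassmann_alg_def gconst_times times_gconst)
  ultimately show ?thesis by (auto simp: gr_units_def)
qed

lemma spt_gconst_scale:
  assumes "c \<noteq> 0"
  shows "spt s (gconst c * Z1, gconst c * Z2, gconst c * \<Theta>) = spt s (Z1, Z2, \<Theta>)"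
proof
  show "spt s (gconst c * Z1, gconst c * Z2, gconst c * \<Theta>) \<subseteq> spt s (Z1, Z2, \<Theta>)"
    using gr_units_mult_gconst[OF _ assms] by (fastforce simp: spt_def simp flip: mult.assoc)
  show "spt s (Z1, Z2, \<Theta>) \<subseteq> spt s (gconst c * Z1, gconst c * Z2, gconst c * \<Theta>)"
  proof
    fix x assume "x \<in> spt s (Z1, Z2, \<Theta>)"
    then obtain u where u: "u \<in> gr_units s" "x = (u * Z1, u * Z2, u * \<Theta>)" by (auto simp: spt_def)
    have "u * gconst (1 / c) * (gconst c * y) = u * y" for y
    proof -
      have "u * gconst (1 / c) * (gconst c * y) = u * (gconst (1 / c) * gconst c) * y"
        by (simp only: mult.assoc)
      then show ?thesis using assms by (simp flip: gconst_mult)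
    qed
    then have "x = (u * gconst (1 / c) * (gconst c * Z1), u * gconst (1 / c) * (gconst c * Z2),
        u * gconst (1 / c) * (gconst c * \<Theta>))"
      using u(2) by simp
    moreover have "u * gconst (1 / c) \<in> gr_units s"
      using gr_units_mult_gconst[OF u(1), of "1 / c"] assms by simp
    ultimately show "x \<in> spt s (gconst c * Z1, gconst c * Z2, gconst c * \<Theta>)"
      unfolding spt_def by blast
  qed
qed

text \<open>The action on \<open>\<real>\<^bsup>0|1\<^esup>\<close>-points is \<open>\<xi>(z\<^sub>1) = (a z\<^sub>1 + b)/(c z\<^sub>1 + d)\<close> and \<open>s\<^sub>1 \<mapsto> (c z\<^sub>1 + d)\<^bsup>-1\<^esup> \<xi>\<^sup>*s\<^sub>1\<close>.\<close>

lemma pt_act_frame: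
  assumes "c * z + d \<noteq> 0"
  shows "pt_act (sl2_mat a b c d) (spt 1 (gconst z, 1, gconst v * geta)) =
    spt 1 (gconst ((a * z + b) / (c * z + d)), 1, gconst (v / (c * z + d)) * geta)"
proof -
  have "pt_act (sl2_mat a b c d) (spt 1 (gconst z, 1, gconst v * geta)) =
      spt 1 (gconst (a * z + b), gconst (c * z + d), gconst v * geta)"
  proof -
    have 1: "u * gconst z * gconst a + u * 1 * gconst b + u * (gconst v * geta) * 0 = u * gconst (a * z + b)" for u
      by (simp add: gconst_add gconst_mult gconst_commute[of a] distrib_left mult.assoc)
    have 2: "u * gconst z * gconst c + u * 1 * gconst d + u * (gconst v * geta) * 0 = u * gconst (c * z + d)" for u
      by (simp add: gconst_add gconst_mult gconst_commute[of c] distrib_left mult.assoc)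
    have 3: "(u * gconst z) * 0 + (u * 1) * 0 + u * (gconst v * geta) * 1 = u * (gconst v * geta)" for u
      by simp
    show ?thesis
      unfolding pt_act_def spt_def sl2_mat_def by (auto simp add: 1[simplified] 2[simplified] image_iff)
  qed
  also have "\<dots> = spt 1 (gconst (c * z + d) * gconst ((a * z + b) / (c * z + d)), gconst (c * z + d) * 1,
      gconst (c * z + d) * (gconst (v / (c * z + d)) * geta))"
    using assms by (simp add: mult.assoc[symmetric] gconst_mult[symmetric])
  also have "\<dots> = spt 1 (gconst ((a * z + b) / (c * z + d)), 1, gconst (v / (c * z + d)) * geta)"
    by (rule spt_gconst_scale[OF assms])
  finally show ?thesis .
qed


section \<open>Complex manifolds and holomorphic vector bundles\<close>

text \<open>\<open>\<complex>\<^sup>n\<close> is encoded as in \<^const>\<open>Euclidean_space\<close>, so that \<open>n\<close> can be a term.\<close>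

definition Cn :: "nat \<Rightarrow> (nat \<Rightarrow> complex) set" where
  "Cn n = {x. \<forall>i\<ge>n. x i = 0}"

definition has_cderiv :: "nat \<Rightarrow> ((nat \<Rightarrow> complex) \<Rightarrow> complex) \<Rightarrow> (nat \<Rightarrow> complex) \<Rightarrow> (nat \<Rightarrow> complex) \<Rightarrow> bool" where
  "has_cderiv n f a x \<longleftrightarrow>
     ((\<lambda>y. norm (f y - f x - (\<Sum>i<n. a i * (y i - x i))) / (\<Sum>i<n. norm (y i - x i))) \<longlongrightarrow> 0)
       (at x within Cn n)"

definition holo_Cn :: "nat \<Rightarrow> (nat \<Rightarrow> complex) set \<Rightarrow> ((nat \<Rightarrow> complex) \<Rightarrow> complex) \<Rightarrow> bool" where
  "holo_Cn n W f \<longleftrightarrow> openin (top_of_set (Cn n)) W \<and> (\<forall>x\<in>W. \<exists>a. has_cderiv n f a x)"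

record 'x cmfd =
  mdim :: nat
  mpoints :: "'x set"
  charts :: "('x set \<times> ('x \<Rightarrow> nat \<Rightarrow> complex)) set"

definition mopen :: "'x cmfd \<Rightarrow> 'x set \<Rightarrow> bool" where
  "mopen X W \<longleftrightarrow> W \<subseteq> mpoints X \<and>
     (\<forall>(U, \<phi>) \<in> charts X. openin (top_of_set (Cn (mdim X))) (\<phi> ` (U \<inter> W)))"

definition holo_fun :: "'x cmfd \<Rightarrow> 'x set \<Rightarrow> ('x \<Rightarrow> complex) \<Rightarrow> bool" where
  "holo_fun X W f \<longleftrightarrow> mopen X W \<and>
     (\<forall>(U, \<phi>) \<in> charts X. holo_Cn (mdim X) (\<phi> ` (U \<inter> W)) (\<lambda>y. f (inv_into U \<phi> y)))"

definition complex_manifold :: "'x cmfd \<Rightarrow> bool" where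
  "complex_manifold X \<longleftrightarrow>
     (\<forall>(U, \<phi>) \<in> charts X. U \<subseteq> mpoints X \<and> inj_on \<phi> U \<and> openin (top_of_set (Cn (mdim X))) (\<phi> ` U)) \<and>
     (\<forall>(U, \<phi>) \<in> charts X. \<forall>(V, \<psi>) \<in> charts X.
        openin (top_of_set (Cn (mdim X))) (\<phi> ` (U \<inter> V)) \<and>
        (\<forall>j<mdim X. holo_Cn (mdim X) (\<phi> ` (U \<inter> V)) (\<lambda>y. \<psi> (inv_into U \<phi> y) j))) \<and>
     (\<exists>\<C>\<subseteq>charts X. countable \<C> \<and> \<Union> (fst ` \<C>) = mpoints X) \<and>
     (\<forall>x\<in>mpoints X. \<forall>y\<in>mpoints X. x \<noteq> y \<longrightarrow>
        (\<exists>V W. mopen X V \<and> mopen X W \<and> x \<in> V \<and> y \<in> W \<and> V \<inter> W = {}))"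

definition holo_map :: "'x cmfd \<Rightarrow> 'x set \<Rightarrow> 'y cmfd \<Rightarrow> ('x \<Rightarrow> 'y) \<Rightarrow> bool" where
  "holo_map X W Y f \<longleftrightarrow> mopen X W \<and> f ` W \<subseteq> mpoints Y \<and>
     (\<forall>(V, \<psi>) \<in> charts Y. mopen X {x \<in> W. f x \<in> V} \<and>
        (\<forall>j<mdim Y. holo_fun X {x \<in> W. f x \<in> V} (\<lambda>x. \<psi> (f x) j)))"

text \<open>
  A vector bundle is given by its total space with fibrewise operations and a family of local
  trivializations \<open>(U, \<tau>)\<close>, where \<open>\<tau>\<close> is the fibre coordinate over \<open>U\<close>.  That the fibres are complex
  vector spaces follows from \<open>\<tau>\<close> being bijective and compatible with the operations.
\<close>

record ('x, 'e) vbundle =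
  base :: "'x cmfd"
  total :: "'e set"
  bproj :: "'e \<Rightarrow> 'x"
  vadd :: "'e \<Rightarrow> 'e \<Rightarrow> 'e"
  vscale :: "complex \<Rightarrow> 'e \<Rightarrow> 'e"
  vrank :: nat
  trivs :: "('x set \<times> ('e \<Rightarrow> nat \<Rightarrow> complex)) set"

definition bfibre :: "('x, 'e) vbundle \<Rightarrow> 'x \<Rightarrow> 'e set" where
  "bfibre E x = {e \<in> total E. bproj E e = x}"

definition fibre_iso :: "('x, 'e) vbundle \<Rightarrow> 'x set \<Rightarrow> ('e \<Rightarrow> nat \<Rightarrow> complex) \<Rightarrow> bool" where
  "fibre_iso E U \<tau> \<longleftrightarrow> (\<forall>x\<in>U.
     bij_betw \<tau> (bfibre E x) (Cn (vrank E)) \<and>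
     (\<forall>e\<in>bfibre E x. \<forall>e'\<in>bfibre E x. vadd E e e' \<in> bfibre E x \<and>
        \<tau> (vadd E e e') = (\<lambda>j. \<tau> e j + \<tau> e' j)) \<and>
     (\<forall>t. \<forall>e\<in>bfibre E x. vscale E t e \<in> bfibre E x \<and> \<tau> (vscale E t e) = (\<lambda>j. t * \<tau> e j)))"

definition holo_matrix ::
  "'x cmfd \<Rightarrow> 'x set \<Rightarrow> nat \<Rightarrow> nat \<Rightarrow> 'e set \<Rightarrow> ('e \<Rightarrow> 'x) \<Rightarrow> ('e \<Rightarrow> nat \<Rightarrow> complex) \<Rightarrow> ('e \<Rightarrow> nat \<Rightarrow> complex) \<Rightarrow> bool"
where
  "holo_matrix X W m n T \<pi> \<sigma> \<tau> \<longleftrightarrow>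
     (\<exists>h. (\<forall>i<m. \<forall>j<n. holo_fun X W (h i j)) \<and>
          (\<forall>e\<in>T. \<pi> e \<in> W \<longrightarrow> (\<forall>i<m. \<tau> e i = (\<Sum>j<n. h i j (\<pi> e) * \<sigma> e j))))"

definition holo_vbundle :: "('x, 'e) vbundle \<Rightarrow> bool" where
  "holo_vbundle E \<longleftrightarrow>
     complex_manifold (base E) \<and>
     bproj E ` total E \<subseteq> mpoints (base E) \<and>
     \<Union> (fst ` trivs E) = mpoints (base E) \<and>
     (\<forall>(U, \<tau>) \<in> trivs E. mopen (base E) U \<and> fibre_iso E U \<tau>) \<and>
     (\<forall>(U, \<sigma>) \<in> trivs E. \<forall>(V, \<tau>) \<in> trivs E.
        holo_matrix (base E) (U \<inter> V) (vrank E) (vrank E) (total E) (bproj E) \<sigma> \<tau>)"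

definition bundle_map_on ::
  "'x set \<Rightarrow> ('x, 'e) vbundle \<Rightarrow> ('y, 'f) vbundle \<Rightarrow> ('x \<Rightarrow> 'y) \<Rightarrow> ('e \<Rightarrow> 'f) \<Rightarrow> bool"
where
  "bundle_map_on W E E' f F \<longleftrightarrow>
     holo_map (base E) W (base E') f \<and>
     (\<forall>e\<in>total E. bproj E e \<in> W \<longrightarrow> F e \<in> total E' \<and> bproj E' (F e) = f (bproj E e)) \<and>
     (\<forall>(U, \<sigma>) \<in> trivs E. \<forall>(V, \<tau>) \<in> trivs E'.
        holo_matrix (base E) {x \<in> W \<inter> U. f x \<in> V} (vrank E') (vrank E) (total E) (bproj E)
          \<sigma> (\<lambda>e. \<tau> (F e)))"

definition holo_sections :: "('x, 'e) vbundle \<Rightarrow> ('x \<Rightarrow> 'e) set" where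
  "holo_sections E = {s \<in> extensional (mpoints (base E)).
     (\<forall>x\<in>mpoints (base E). s x \<in> bfibre E x) \<and>
     (\<forall>(U, \<tau>) \<in> trivs E. \<forall>j<vrank E. holo_fun (base E) U (\<lambda>x. \<tau> (s x) j))}"

definition is_vzero :: "('x, 'e) vbundle \<Rightarrow> 'e \<Rightarrow> bool" where
  "is_vzero E e \<longleftrightarrow> vscale E 0 e = e"

definition short_exact ::
  "('x, 'd) vbundle \<Rightarrow> ('x, 'e) vbundle \<Rightarrow> ('x, 'f) vbundle \<Rightarrow> ('d \<Rightarrow> 'e) \<Rightarrow> ('e \<Rightarrow> 'f) \<Rightarrow> bool"
where
  "short_exact D E Q F G \<longleftrightarrow>
     holo_vbundle D \<and> holo_vbundle E \<and> holo_vbundle Q \<and>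
     base D = base E \<and> base E = base Q \<and>
     bundle_map_on (mpoints (base E)) D E id F \<and>
     bundle_map_on (mpoints (base E)) E Q id G \<and>
     inj_on F (total D) \<and>
     F ` total D = {e \<in> total E. is_vzero Q (G e)} \<and>
     G ` total E = total Q"

text \<open>
  Cokernel of a bundle map \<open>F\<close> over the identity: the fibres are the quotients by the image of \<open>F\<close>, and
  the trivializations are those fibrewise linear coordinates that make the projection holomorphic.
  (If \<open>F\<close> is not injective, the rank is meaningless and there are no trivializations.)
\<close>

definition coker_proj ::
  "('x, 'd) vbundle \<Rightarrow> ('x, 'e) vbundle \<Rightarrow> ('d \<Rightarrow> 'e) \<Rightarrow> 'e \<Rightarrow> 'e set"
where
  "coker_proj D E F e = {vadd E e (F d) | d. d \<in> bfibre D (bproj E e)}"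

definition coker_prebundle ::
  "('x, 'd) vbundle \<Rightarrow> ('x, 'e) vbundle \<Rightarrow> ('d \<Rightarrow> 'e) \<Rightarrow> ('x, 'e set) vbundle"
where
  "coker_prebundle D E F = \<lparr>
     base = base E,
     total = coker_proj D E F ` total E,
     bproj = (\<lambda>q. the_elem (bproj E ` q)),
     vadd = (\<lambda>q q'. {vadd E e e' | e e'. e \<in> q \<and> e' \<in> q'}),
     vscale = (\<lambda>t q. \<Union>e\<in>q. coker_proj D E F (vscale E t e)),
     vrank = vrank E - vrank D,
     trivs = {}\<rparr>"

definition cokernel ::
  "('x, 'd) vbundle \<Rightarrow> ('x, 'e) vbundle \<Rightarrow> ('d \<Rightarrow> 'e) \<Rightarrow> ('x, 'e set) vbundle"
where
  "cokernel D E F = (coker_prebundle D E F) \<lparr> trivs := {(U, \<tau>).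
     mopen (base E) U \<and> fibre_iso (coker_prebundle D E F) U \<tau> \<and>
     (\<forall>(V, \<sigma>) \<in> trivs E. holo_matrix (base E) (U \<inter> V) (vrank E - vrank D) (vrank E)
        (total E) (bproj E) \<sigma> (\<lambda>e. \<tau> (coker_proj D E F e)))} \<rparr>"

text \<open>Actions of \<open>SL\<^sub>\<complex>(2)\<close> on a bundle by bundle automorphisms covering an action on the base.\<close>

definition SL2_action :: "('x, 'e) vbundle \<Rightarrow> (scmat \<Rightarrow> 'x \<Rightarrow> 'x) \<Rightarrow> (scmat \<Rightarrow> 'e \<Rightarrow> 'e) \<Rightarrow> bool" where
  "SL2_action E \<xi> \<Xi> \<longleftrightarrow>
     group_action SL2 (mpoints (base E)) (\<lambda>M. restrict (\<xi> M) (mpoints (base E))) \<and>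
     group_action SL2 (total E) (\<lambda>M. restrict (\<Xi> M) (total E)) \<and>
     (\<forall>M\<in>carrier SL2. bundle_map_on (mpoints (base E)) E E (\<xi> M) (\<Xi> M))"

definition SL2_equivariant ::
  "('x, 'd) vbundle \<Rightarrow> (scmat \<Rightarrow> 'd \<Rightarrow> 'd) \<Rightarrow> (scmat \<Rightarrow> 'e \<Rightarrow> 'e) \<Rightarrow> ('d \<Rightarrow> 'e) \<Rightarrow> bool"
where
  "SL2_equivariant D \<Xi> \<Xi>' F \<longleftrightarrow> (\<forall>M\<in>carrier SL2. \<forall>d\<in>total D. F (\<Xi> M d) = \<Xi>' M (F d))"

definition Cstar_equivariant :: "('x, 'd) vbundle \<Rightarrow> ('x, 'e) vbundle \<Rightarrow> ('d \<Rightarrow> 'e) \<Rightarrow> bool" where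
  "Cstar_equivariant D E F \<longleftrightarrow> (\<forall>t. t \<noteq> 0 \<longrightarrow> (\<forall>d\<in>total D. F (vscale D t d) = vscale E t (F d)))"

definition actions_commute :: "('x, 'e) vbundle \<Rightarrow> (scmat \<Rightarrow> 'e \<Rightarrow> 'e) \<Rightarrow> bool" where
  "actions_commute E \<Xi> \<longleftrightarrow>
     (\<forall>M\<in>carrier SL2. \<forall>t. t \<noteq> 0 \<longrightarrow> (\<forall>e\<in>total E. \<Xi> M (vscale E t e) = vscale E t (\<Xi> M e)))"

text \<open>
  Isomorphisms of quotients of vector bundles.  \<open>\<E>\<close> and \<open>\<E>'\<close> are partitions of the total spaces into
  orbits, and \<open>\<mu>\<close>, \<open>\<mu>'\<close> are the projections of the total spaces to the common quotient of the base
  spaces.  The quotients are orbifold bundles with fibres like \<open>V/\<plusminus>1\<close>, so holomorphic and linear means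
  that the map is induced, over a neighbourhood of each point of the base, by a holomorphic fibrewise
  linear map of the vector bundles upstairs.
\<close>

definition locally_lifts ::
  "('x, 'e) vbundle \<Rightarrow> ('y, 'f) vbundle \<Rightarrow> 'e set set \<Rightarrow> ('e set \<Rightarrow> 'f set) \<Rightarrow> bool"
where
  "locally_lifts E E' \<E> \<Phi> \<longleftrightarrow>
     (\<forall>x\<in>mpoints (base E). \<exists>W f F. x \<in> W \<and> bundle_map_on W E E' f F \<and>
        (\<forall>C\<in>\<E>. \<forall>e\<in>C. bproj E e \<in> W \<longrightarrow> F e \<in> \<Phi> C))"

definition quotient_bundle_iso ::
  "('x, 'e) vbundle \<Rightarrow> 'e set set \<Rightarrow> ('e \<Rightarrow> 'm) \<Rightarrow> ('y, 'f) vbundle \<Rightarrow> 'f set set \<Rightarrow> ('f \<Rightarrow> 'm) \<Rightarrow>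
   ('e set \<Rightarrow> 'f set) \<Rightarrow> bool"
where
  "quotient_bundle_iso E \<E> \<mu> E' \<E>' \<mu>' \<Phi> \<longleftrightarrow>
     bij_betw \<Phi> \<E> \<E>' \<and>
     (\<forall>C\<in>\<E>. \<forall>e\<in>C. \<forall>e'\<in>\<Phi> C. \<mu> e = \<mu>' e') \<and>
     (\<forall>t. t \<noteq> 0 \<longrightarrow> (\<forall>C\<in>\<E>. \<Phi> (vscale E t ` C) = vscale E' t ` \<Phi> C)) \<and>
     locally_lifts E E' \<E> \<Phi> \<and>
     locally_lifts E' E \<E>' (inv_into \<E> \<Phi>)"


section \<open>The spinor bundle\<close>

text \<open>
  Index \<open>False\<close> belongs to \<open>Z\<^sub>2 \<noteq> 0\<close> with coordinate \<open>z\<^sub>1 = Z\<^sub>1/Z\<^sub>2\<close> and frame \<open>s\<^sub>1\<close>,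
  index \<open>True\<close> to \<open>Z\<^sub>1 \<noteq> 0\<close> with coordinate \<open>z\<^sub>2 = -Z\<^sub>2/Z\<^sub>1\<close> and frame \<open>s\<^sub>2\<close>.
\<close>

definition affine_pt :: "bool \<Rightarrow> complex \<Rightarrow> spoint" where
  "affine_pt b w = (if b then spt 0 (1, - gconst w, 0) else spt 0 (gconst w, 1, 0))"

definition affine_coord :: "bool \<Rightarrow> spoint \<Rightarrow> complex" where
  "affine_coord b = inv_into UNIV (affine_pt b)"

definition P1_mfd :: "spoint cmfd" where
  "P1_mfd = \<lparr>mdim = 1, mpoints = P11 0,
     charts = {(range (affine_pt b), \<lambda>p i. if i = 0 then affine_coord b p else 0) | b. True}\<rparr>"

definition spinor_frame :: "bool \<Rightarrow> spoint \<Rightarrow> spoint" where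
  "spinor_frame b p = (if b then spt 1 (1, - gconst (affine_coord b p), geta)
                       else spt 1 (gconst (affine_coord b p), 1, geta))"

definition S_add :: "spoint \<Rightarrow> spoint \<Rightarrow> spoint" where
  "S_add p q = {(Z1, Z2, \<Theta> + \<Theta>') | Z1 Z2 \<Theta> \<Theta>'. (Z1, Z2, \<Theta>) \<in> p \<and> (Z1, Z2, \<Theta>') \<in> q}"

definition S_scale :: "complex \<Rightarrow> spoint \<Rightarrow> spoint" where
  "S_scale t p = (\<lambda>(Z1, Z2, \<Theta>). (Z1, Z2, gconst t * \<Theta>)) ` p"

definition spinor_coord :: "bool \<Rightarrow> spoint \<Rightarrow> complex" where
  "spinor_coord b e = (THE v. e = S_scale v (spinor_frame b (pt_red e)))"

lemma S_scale_spt: "S_scale t (spt s (Z1, Z2, \<Theta>)) = spt s (Z1, Z2, gconst t * \<Theta>)"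
proof -
  have "gconst t * (u * \<Theta>) = u * (gconst t * \<Theta>)" for u
    by (metis gconst_commute mult.assoc)
  moreover have "S_scale t (spt s (Z1, Z2, \<Theta>)) = {(u * Z1, u * Z2, gconst t * (u * \<Theta>)) | u. u \<in> gr_units s}"
    unfolding S_scale_def spt_def by force
  ultimately show ?thesis by (simp add: spt_def)
qed

text \<open>The transition function \<open>s\<^sub>1 = -z\<^sub>2 s\<^sub>2\<close>.\<close>

lemma spinor_frame_transition:
  assumes "z1 * z2 = -1"
  shows "spt 1 (gconst z1, 1, geta) = S_scale (- z2) (spt 1 (1, - gconst z2, geta))"
proof -
  have "spt 1 (1, - gconst z2, gconst (- z2) * geta) =
      spt 1 (gconst (- z2) * gconst z1, gconst (- z2) * 1, gconst (- z2) * geta)"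
    using assms by (simp add: gconst_minus[symmetric] gconst_mult[symmetric] mult.commute)
  also have "\<dots> = spt 1 (gconst z1, 1, geta)"
    using assms by (intro spt_gconst_scale) auto
  finally show ?thesis by (simp add: S_scale_spt)
qed

text \<open>
  The spinor bundle is the normal bundle of the reduced space, so its total space consists of the
  \<open>\<real>\<^bsup>0|1\<^esup>\<close>-points \<open>[Z\<^sub>1 : Z\<^sub>2 : v \<eta>]\<close>.
\<close>

definition spinor_bundle :: "(spoint, spoint) vbundle" where
  "spinor_bundle = \<lparr>base = P1_mfd, total = P11 1, bproj = pt_red, vadd = S_add, vscale = S_scale,
     vrank = 1,
     trivs = {(range (affine_pt b), \<lambda>e i. if i = 0 then spinor_coord b e else 0) | b. True}\<rparr>"

text \<open>
  As values of sections carry the factor \<open>\<eta>\<close>, holomorphic sections of \<^const>\<open>spinor_bundle\<close> are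
  the elements \<open>s \<otimes> \<eta>\<close> of \<open>(H\<^sup>0(S) \<otimes> \<O>)\<^sub>0\<close> over \<open>\<real>\<^bsup>0|1\<^esup>\<close>.
\<close>

definition H0 :: "(spoint \<Rightarrow> spoint) set" where
  "H0 = holo_sections spinor_bundle"

definition H0_add :: "(spoint \<Rightarrow> spoint) \<Rightarrow> (spoint \<Rightarrow> spoint) \<Rightarrow> spoint \<Rightarrow> spoint" where
  "H0_add s s' = (\<lambda>p\<in>P11 0. S_add (s p) (s' p))"

definition H0_scale :: "complex \<Rightarrow> (spoint \<Rightarrow> spoint) \<Rightarrow> spoint \<Rightarrow> spoint" where
  "H0_scale t s = (\<lambda>p\<in>P11 0. S_scale t (s p))"

definition H0_act :: "scmat \<Rightarrow> (spoint \<Rightarrow> spoint) \<Rightarrow> spoint \<Rightarrow> spoint" where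
  "H0_act M s = (\<lambda>p\<in>P11 0. pt_act M (s (inv_into (P11 0) (pt_act M) p)))"


section \<open>The bundles over the configuration space\<close>

text \<open>A chart of \<open>(Z\<^sub>k)\<^sub>r\<^sub>e\<^sub>d\<close> uses the coordinate \<open>z\<^sub>2\<close> for the points with index in \<open>J\<close>, otherwise \<open>z\<^sub>1\<close>.\<close>

definition Zk_dom :: "nat \<Rightarrow> nat set \<Rightarrow> (nat \<Rightarrow> spoint) set" where
  "Zk_dom k J = {p \<in> Zk k 0. \<forall>i<k. p i \<in> range (affine_pt (i \<in> J))}"

definition Zk_mfd :: "nat \<Rightarrow> (nat \<Rightarrow> spoint) cmfd" where
  "Zk_mfd k = \<lparr>mdim = k, mpoints = Zk k 0,
     charts = {(Zk_dom k J, \<lambda>p i. if i < k then affine_coord (i \<in> J) (p i) else 0) | J. J \<subseteq> {..<k}}\<rparr>"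

type_synonym susyvec = "(nat \<Rightarrow> spoint) \<times> (spoint \<Rightarrow> spoint)"

definition H0_coordinates :: "((spoint \<Rightarrow> spoint) \<Rightarrow> nat \<Rightarrow> complex) set" where
  "H0_coordinates = {\<beta>. bij_betw \<beta> H0 (Cn 2) \<and>
     (\<forall>s\<in>H0. \<forall>s'\<in>H0. \<beta> (H0_add s s') = (\<lambda>j. \<beta> s j + \<beta> s' j)) \<and>
     (\<forall>t. \<forall>s\<in>H0. \<beta> (H0_scale t s) = (\<lambda>j. t * \<beta> s j))}"

definition susy_bundle :: "nat \<Rightarrow> (nat \<Rightarrow> spoint, susyvec) vbundle" where
  "susy_bundle k = \<lparr>base = Zk_mfd k, total = Zk k 0 \<times> H0, bproj = fst,
     vadd = (\<lambda>(x, s) (_, s'). (x, H0_add s s')), vscale = (\<lambda>t (x, s). (x, H0_scale t s)),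
     vrank = 2,
     trivs = {(Zk k 0, \<lambda>(x, s). \<beta> s) | \<beta>. \<beta> \<in> H0_coordinates}\<rparr>"

text \<open>\<open>\<Oplus> |p\<^sub>i|\<^sup>*S\<close>: a vector is the tuple of its components, which determine the base point.\<close>

definition normal_Zk :: "nat \<Rightarrow> (nat \<Rightarrow> spoint, nat \<Rightarrow> spoint) vbundle" where
  "normal_Zk k = \<lparr>base = Zk_mfd k,
     total = {v \<in> {..<k} \<rightarrow>\<^sub>E total spinor_bundle. tuple_red k v \<in> Zk k 0},
     bproj = tuple_red k,
     vadd = (\<lambda>v w. \<lambda>i\<in>{..<k}. S_add (v i) (w i)),
     vscale = (\<lambda>t v. \<lambda>i\<in>{..<k}. S_scale t (v i)),
     vrank = k,
     trivs = {(Zk_dom k J, \<lambda>v i. if i < k then spinor_coord (i \<in> J) (v i) else 0) | J. J \<subseteq> {..<k}}\<rparr>"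

definition SUSY :: "nat \<Rightarrow> susyvec \<Rightarrow> (nat \<Rightarrow> spoint)" where
  "SUSY k = (\<lambda>(x, s). \<lambda>i\<in>{..<k}. s (x i))"

definition susy_act :: "nat \<Rightarrow> scmat \<Rightarrow> susyvec \<Rightarrow> susyvec" where
  "susy_act k M = (\<lambda>(x, s). (tuple_act k M x, H0_act M s))"

definition Qbundle :: "nat \<Rightarrow> (nat \<Rightarrow> spoint, (nat \<Rightarrow> spoint) set) vbundle" where
  "Qbundle k = cokernel (susy_bundle k) (normal_Zk k) (SUSY k)"

definition Qproj :: "nat \<Rightarrow> (nat \<Rightarrow> spoint) \<Rightarrow> (nat \<Rightarrow> spoint) set" where
  "Qproj k = coker_proj (susy_bundle k) (normal_Zk k) (SUSY k)"

definition Q_act :: "nat \<Rightarrow> scmat \<Rightarrow> (nat \<Rightarrow> spoint) set \<Rightarrow> (nat \<Rightarrow> spoint) set" where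
  "Q_act k M q = tuple_act k M ` q"


section \<open>The normal bundle of the slice\<close>

text \<open>No point of \<open>(Z~\<^bsub>k-3\<^esub>)\<^sub>r\<^sub>e\<^sub>d\<close> is \<open>\<infinity>\<close>, so \<open>z\<^sub>1\<close> and \<open>s\<^sub>1\<close> give global coordinates.\<close>

definition slice_mfd :: "nat \<Rightarrow> slicept cmfd" where
  "slice_mfd k = \<lparr>mdim = k - 3, mpoints = slice k 0,
     charts = {(slice k 0, \<lambda>(_, z) i. if i < k - 3 then affine_coord False (z i) else 0)}\<rparr>"

definition normal_slice :: "nat \<Rightarrow> (slicept, slicept) vbundle" where
  "normal_slice k = \<lparr>base = slice_mfd k, total = slice k 1, bproj = slice_red k,
     vadd = (\<lambda>(\<epsilon>, z) (\<epsilon>', z'). (\<epsilon> + \<epsilon>', \<lambda>i\<in>{..<k - 3}. S_add (z i) (z' i))),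
     vscale = (\<lambda>t (\<epsilon>, z). (gconst t * \<epsilon>, \<lambda>i\<in>{..<k - 3}. S_scale t (z i))),
     vrank = k - 2,
     trivs = {(slice k 0, \<lambda>(\<epsilon>, z) i. if i = 0 then gcoeff \<epsilon> {0}
                else if i < k - 2 then spinor_coord False (z (i - 1)) else 0)}\<rparr>"

definition slice_classes :: "nat \<Rightarrow> nat \<Rightarrow> slicept set set" where
  "slice_classes k s = {{n, slice_neg k n} | n. n \<in> slice k s}"

text \<open>The map \<open>(\<complex>\<^bsup>0|1\<^esup> \<times> Z~\<^bsub>k-3\<^esub>)/\<int>\<^sub>2 \<rightarrow> \<M>\<^bsub>0,k\<^esub>\<close> on \<open>\<real>\<^bsup>0|s\<^esup>\<close>-points that is induced by the embedding.\<close>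

definition slice_to_moduli :: "nat \<Rightarrow> nat \<Rightarrow> slicept set \<Rightarrow> (nat \<Rightarrow> spoint) set" where
  "slice_to_moduli k s C = (\<Union>n\<in>C. orbit (SC s) (tuple_act k) (slice_embed k s n))"

text \<open>\<open>M\<^bsub>0,k\<^esub> = (Z\<^sub>k)\<^sub>r\<^sub>e\<^sub>d/SL\<^sub>\<complex>(2)\<close>, and its point under a configuration.\<close>

definition M0 :: "nat \<Rightarrow> (nat \<Rightarrow> spoint) set set" where
  "M0 k = orbits SL2 (Zk k 0) (tuple_act k)"

definition M0_pt :: "nat \<Rightarrow> (nat \<Rightarrow> spoint) \<Rightarrow> (nat \<Rightarrow> spoint) set" where
  "M0_pt k = orbit SL2 (tuple_act k)"

end

theory Submission
  imports Defs "HOL-Complex_Analysis.Complex_Analysis" "Jordan_Normal_Form.Determinant"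
begin

text \<open>
  Over \<open>\<real>\<^bsup>0|1\<^esup>\<close> every point is \<open>[x : y : v \<eta>]\<close> with complex \<open>x\<close>, \<open>y\<close>, \<open>v\<close>, and \<open>SC\<close> is the semidirect product of
  \<open>SL\<^sub>\<complex>(2)\<close> with the translations \<open>v \<mapsto> v + x g + y h\<close>.  By Liouville's theorem the sections of \<open>S\<close> are exactly
  the linear forms \<open>x g + y h\<close>.  Hence the translations are the addition of the image of \<open>SUSY\<close>, and
  \<open>SC\<close>-orbits on \<open>\<real>\<^bsup>0|1\<^esup>\<close>-points of \<open>Z\<^sub>k\<close> are unions of the cosets in one \<open>SL\<^sub>\<complex>(2)\<close>-orbit on \<open>Q\<close>.  Linear forms
  are determined by their values at two distinct points, which makes \<open>SUSY\<close> injective and trivializes \<open>Q\<close> by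
  Cramer's rule.  A configuration is moved into the slice by a matrix that is unique up to sign and
  holomorphic up to the choice of a square root, followed by killing the odd parts at \<open>0\<close> and \<open>\<infinity>\<close>; the
  sign is the \<open>\<int>\<^sub>2\<close>-action.
\<close>

section \<open>Differentiability on \<open>\<complex>\<^sup>n\<close>\<close>

text \<open>Two features of the definitions shape the argument. The trivializations of the cokernel
  are all fibrewise linear coordinates compatible with the projection, not a chosen list, so the
  transition functions of Q must be shown holomorphic for coordinates about which nothing explicit
  is known; the normal form of a coset gives every such coordinate an invertible square matrix. And
  the matrix moving a configuration into the slice must have determinant 1, which requires a square
  root of \<open>disc\<close>. Holomorphic branches are taken only locally, so the isomorphism is
  lifted by local maps, one for each branch. The map itself needs no choice: the vectors in all
  cosets of one orbit on Q form one superconformal orbit, and each superconformal orbit meets the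
  slice in one sign class, so both sides are matched through the moduli points. Two pairs of
  reference points occur: points 0 and 1 trivialize Q, while points 0 and 2, which go to 0 and
  infinity, fix the translation into the slice, so that the odd part at point 1 survives as the
  parameter of 1_\<epsilon>.\<close>

definition cdiff :: "nat \<Rightarrow> ((nat \<Rightarrow> complex) \<Rightarrow> complex) \<Rightarrow> (nat \<Rightarrow> complex) \<Rightarrow> bool" where
  "cdiff n f x \<longleftrightarrow> (\<exists>a. has_cderiv n f a x)"

lemma holo_Cn_iff:
  "holo_Cn n W f \<longleftrightarrow> openin (top_of_set (Cn n)) W \<and> (\<forall>x\<in>W. cdiff n f x)"
  by (simp add: holo_Cn_def cdiff_def)

text \<open>The remainder r is spread over the coordinates: since \<open>cnj (sgn w) * w\<close> is
  the norm of w, adding r/D times this conjugate phase to each coefficient reproduces r exactly. The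
  resulting factorization makes the product and chain rules algebraic.\<close>

lemma has_cderiv_imp_caratheodory:
  assumes "has_cderiv n f a x"
  obtains q where "\<And>y. y \<in> Cn n \<Longrightarrow> x \<in> Cn n \<Longrightarrow> f y - f x = (\<Sum>i<n. q i y * (y i - x i))"
    "\<And>i. i < n \<Longrightarrow> (q i \<longlongrightarrow> q i x) (at x within Cn n)"
proof -
  define r where "r y = f y - f x - (\<Sum>i<n. a i * (y i - x i))" for y
  define D where "D y = (\<Sum>i<n. norm (y i - x i))" for y :: "nat \<Rightarrow> complex"
  \<comment> \<open>At y = x the denominator D vanishes and HOL division gives 0, so
    \<open>q i x\<close> equals \<open>a i\<close>.\<close>
  define q where "q i y = a i + r y / of_real (D y) * cnj (sgn (y i - x i))" for i y
  have lim: "((\<lambda>y. norm (r y) / D y) \<longlongrightarrow> 0) (at x within Cn n)"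
    using assms unfolding has_cderiv_def r_def D_def .
  have "f y - f x = (\<Sum>i<n. q i y * (y i - x i))" if y: "y \<in> Cn n" and x: "x \<in> Cn n" for y
  proof (cases "D y = 0")
    case True
    then have "\<And>i. i < n \<Longrightarrow> y i = x i"
      unfolding D_def by (subst (asm) sum_nonneg_eq_0_iff) auto
    then have "y = x" using x y by (auto simp: Cn_def fun_eq_iff) (metis not_le)
    then show ?thesis by simp
  next
    case False
    have *: "cnj (sgn w) * w = of_real (norm w)" for w :: complex
      by (cases "w = 0") (auto simp: sgn_eq complex_norm_square[symmetric] field_simps power2_eq_square)
    have "q i y * (y i - x i) = a i * (y i - x i) + r y / of_real (D y) * of_real (norm (y i - x i))" for i
      unfolding q_def using *[of "y i - x i"] by (simp add: distrib_right mult.assoc)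
    then have "(\<Sum>i<n. q i y * (y i - x i)) =
        (\<Sum>i<n. a i * (y i - x i)) + r y / of_real (D y) * of_real (D y)"
      by (simp add: sum.distrib D_def sum_distrib_left)
    then show ?thesis using False by (simp add: r_def)
  qed
  moreover have "(q i \<longlongrightarrow> q i x) (at x within Cn n)" for i
  proof -
    have "((\<lambda>y. r y / of_real (D y) * cnj (sgn (y i - x i))) \<longlongrightarrow> 0) (at x within Cn n)"
    proof (rule Lim_null_comparison[OF _ lim])
      have "D y \<ge> 0" for y by (auto simp: D_def intro: sum_nonneg)
      then have "norm (r y / of_real (D y) * cnj (sgn (y i - x i))) \<le> norm (r y) / D y" for y
        by (simp add: norm_mult norm_divide norm_sgn mult_left_le)
      then show "\<forall>\<^sub>F y in at x within Cn n. norm (r y / of_real (D y) * cnj (sgn (y i - x i))) \<le> norm (r y) / D y"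
        by simp
    qed
    then have "(q i \<longlongrightarrow> a i + 0) (at x within Cn n)"
      unfolding q_def by (intro tendsto_intros)
    then show ?thesis by (simp add: q_def)
  qed
  ultimately show ?thesis by (rule that)
qed

text \<open>The error of the linear approximation is the sum of (q i y - a i)(y i - x i), at most D
  times a sum that tends to 0. The factorization is asked for only near x, so that it can be checked
  on an open set.\<close>

lemma caratheodory_imp_cdiff:
  assumes eq: "\<forall>\<^sub>F y in at x within Cn n. f y - f x = (\<Sum>i<n. q i y * (y i - x i))"
    and lim: "\<And>i. i < n \<Longrightarrow> (q i \<longlongrightarrow> a i) (at x within Cn n)"
  shows "cdiff n f x"
proof -
  define D where "D y = (\<Sum>i<n. norm (y i - x i))" for y :: "nat \<Rightarrow> complex"
  have "((\<lambda>y. \<Sum>i<n. norm (q i y - a i)) \<longlongrightarrow> (\<Sum>i<n. norm (a i - a i))) (at x within Cn n)"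
    by (intro tendsto_intros lim) auto
  then have lim0: "((\<lambda>y. \<Sum>i<n. norm (q i y - a i)) \<longlongrightarrow> 0) (at x within Cn n)" by simp
  have "has_cderiv n f a x"
    unfolding has_cderiv_def D_def[symmetric]
  proof (rule Lim_null_comparison[OF _ lim0])
    show "\<forall>\<^sub>F y in at x within Cn n.
        norm (norm (f y - f x - (\<Sum>i<n. a i * (y i - x i))) / D y) \<le> (\<Sum>i<n. norm (q i y - a i))"
      using eq
    proof eventually_elim
      case (elim y)
      have D: "D y \<ge> 0" "\<And>i. i < n \<Longrightarrow> norm (y i - x i) \<le> D y"
        unfolding D_def by (auto intro!: sum_nonneg member_le_sum)
      have "f y - f x - (\<Sum>i<n. a i * (y i - x i)) = (\<Sum>i<n. (q i y - a i) * (y i - x i))"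
        using elim by (simp add: sum_subtractf left_diff_distrib)
      also have "norm \<dots> \<le> (\<Sum>i<n. norm (q i y - a i) * D y)"
        by (rule sum_norm_le) (simp add: norm_mult mult_left_mono D)
      finally have "norm (f y - f x - (\<Sum>i<n. a i * (y i - x i))) \<le> (\<Sum>i<n. norm (q i y - a i)) * D y"
        by (simp add: sum_distrib_right)
      then show ?case using D(1)
        by (cases "D y = 0") (auto simp: divide_le_eq intro!: sum_nonneg)
    qed
  qed
  then show ?thesis by (auto simp: cdiff_def)
qed

lemma cdiffE:
  assumes "cdiff n f x" "x \<in> Cn n"
  obtains q where "\<And>y. y \<in> Cn n \<Longrightarrow> f y - f x = (\<Sum>i<n. q i y * (y i - x i))"
    "\<And>i. i < n \<Longrightarrow> (q i \<longlongrightarrow> q i x) (at x within Cn n)"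
proof -
  obtain a where "has_cderiv n f a x" using assms(1) by (auto simp: cdiff_def)
  then show ?thesis by (rule has_cderiv_imp_caratheodory) (use assms(2) that in blast)
qed

lemma coord_tendsto: "((\<lambda>y. y i) \<longlongrightarrow> x i) (at x within S)"
  for x :: "nat \<Rightarrow> complex"
proof -
  have "((\<lambda>y. y i) \<longlongrightarrow> x i) (at x)"
    using continuous_on_product_coordinates[where 'b = complex, of i] by (simp add: continuous_on_def)
  then show ?thesis by (rule tendsto_within_subset) simp
qed

lemma cdiff_tendsto:
  assumes "cdiff n f x" "x \<in> Cn n"
  shows "(f \<longlongrightarrow> f x) (at x within Cn n)"
proof -
  obtain q where q: "\<And>y. y \<in> Cn n \<Longrightarrow> f y - f x = (\<Sum>i<n. q i y * (y i - x i))"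
    "\<And>i. i < n \<Longrightarrow> (q i \<longlongrightarrow> q i x) (at x within Cn n)" using cdiffE[OF assms] by metis
  have "((\<lambda>y. f x + (\<Sum>i<n. q i y * (y i - x i))) \<longlongrightarrow> f x + (\<Sum>i<n. q i x * (x i - x i))) (at x within Cn n)"
    by (intro tendsto_intros q coord_tendsto) auto
  moreover have "\<forall>\<^sub>F y in at x within Cn n. f x + (\<Sum>i<n. q i y * (y i - x i)) = f y"
    using q(1) by (auto simp: eventually_at_filter algebra_simps)
  ultimately show ?thesis by (auto intro: Lim_transform_eventually)
qed

lemma cdiff_const: "cdiff n (\<lambda>_. c) x"
  by (rule caratheodory_imp_cdiff[where q = "\<lambda>_ _. 0"]) auto

text \<open>Also covers j at least n: there y j and x j vanish on \<open>Cn n\<close>, and the sum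
  contains no term with i = j.\<close>

lemma cdiff_coord: "cdiff n (\<lambda>y. y j) x" if "x \<in> Cn n"
proof (rule caratheodory_imp_cdiff[where q = "\<lambda>i _. if i = j then 1 else 0"])
  show "\<forall>\<^sub>F y in at x within Cn n. y j - x j = (\<Sum>i<n. (if i = j then 1 else 0) * (y i - x i))"
    using that by (auto simp: eventually_at_filter if_distrib[of "\<lambda>t. t * _"] Cn_def cong: if_cong)
qed (rule tendsto_const)

lemma cdiff_add:
  assumes "cdiff n f x" "cdiff n g x" and x: "x \<in> Cn n"
  shows "cdiff n (\<lambda>y. f y + g y) x"
proof -
  obtain q where q: "\<And>y. y \<in> Cn n \<Longrightarrow> f y - f x = (\<Sum>i<n. q i y * (y i - x i))"
    "\<And>i. i < n \<Longrightarrow> (q i \<longlongrightarrow> q i x) (at x within Cn n)" using cdiffE[OF assms(1) x] by metis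
  obtain p where p: "\<And>y. y \<in> Cn n \<Longrightarrow> g y - g x = (\<Sum>i<n. p i y * (y i - x i))"
    "\<And>i. i < n \<Longrightarrow> (p i \<longlongrightarrow> p i x) (at x within Cn n)" using cdiffE[OF assms(2) x] by metis
  show ?thesis
  proof (rule caratheodory_imp_cdiff[where q = "\<lambda>i y. q i y + p i y" and a = "\<lambda>i. q i x + p i x"])
    have "(f y + g y) - (f x + g x) = (\<Sum>i<n. (q i y + p i y) * (y i - x i))" if "y \<in> Cn n" for y
      using p(1)[OF that] q(1)[OF that] by (simp add: distrib_right sum.distrib) (simp add: algebra_simps)
    then show "\<forall>\<^sub>F y in at x within Cn n. (f y + g y) - (f x + g x) = (\<Sum>i<n. (q i y + p i y) * (y i - x i))"
      by (auto simp: eventually_at_filter)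
  qed (intro tendsto_intros p q)
qed

text \<open>Splitting the increment as (f y - f x) g y + f x (g y - g x) gives the coefficients;
  their limit uses continuity of g at x.\<close>

lemma cdiff_mult:
  assumes "cdiff n f x" "cdiff n g x" and x: "x \<in> Cn n"
  shows "cdiff n (\<lambda>y. f y * g y) x"
proof -
  obtain q where q: "\<And>y. y \<in> Cn n \<Longrightarrow> f y - f x = (\<Sum>i<n. q i y * (y i - x i))"
    "\<And>i. i < n \<Longrightarrow> (q i \<longlongrightarrow> q i x) (at x within Cn n)" using cdiffE[OF assms(1) x] by metis
  obtain p where p: "\<And>y. y \<in> Cn n \<Longrightarrow> g y - g x = (\<Sum>i<n. p i y * (y i - x i))"
    "\<And>i. i < n \<Longrightarrow> (p i \<longlongrightarrow> p i x) (at x within Cn n)" using cdiffE[OF assms(2) x] by metis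
  show ?thesis
  proof (rule caratheodory_imp_cdiff[where q = "\<lambda>i y. q i y * g y + f x * p i y" and a = "\<lambda>i. q i x * g x + f x * p i x"])
    have "(f y * g y) - (f x * g x) = (\<Sum>i<n. (q i y * g y + f x * p i y) * (y i - x i))" if "y \<in> Cn n" for y
    proof -
      have "(f y * g y) - (f x * g x) = (f y - f x) * g y + f x * (g y - g x)" by (simp add: algebra_simps)
      then show ?thesis unfolding p(1)[OF that] q(1)[OF that]
        by (simp only: distrib_right sum.distrib sum_distrib_left sum_distrib_right mult.assoc)
          (simp only: mult_ac)
    qed
    then show "\<forall>\<^sub>F y in at x within Cn n. (f y * g y) - (f x * g x) = (\<Sum>i<n. (q i y * g y + f x * p i y) * (y i - x i))"
      by (auto simp: eventually_at_filter)
  qed (intro tendsto_intros p q cdiff_tendsto assms)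
qed

lemma cdiff_comp1:
  assumes "cdiff n f x" "g field_differentiable at (f x)" and x: "x \<in> Cn n"
  shows "cdiff n (\<lambda>y. g (f y)) x"
proof -
  obtain q where q: "\<And>y. y \<in> Cn n \<Longrightarrow> f y - f x = (\<Sum>i<n. q i y * (y i - x i))"
    "\<And>i. i < n \<Longrightarrow> (q i \<longlongrightarrow> q i x) (at x within Cn n)" using cdiffE[OF assms(1) x] by metis
  obtain h where h: "\<And>z. g z - g (f x) = h z * (z - f x)" "isCont h (f x)"
    using assms(2) unfolding field_differentiable_def CARAT_DERIV by blast
  show ?thesis
  proof (rule caratheodory_imp_cdiff[where q = "\<lambda>i y. h (f y) * q i y" and a = "\<lambda>i. h (f x) * q i x"])
    have "g (f y) - g (f x) = (\<Sum>i<n. (h (f y) * q i y) * (y i - x i))" if "y \<in> Cn n" for y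
      unfolding h(1)[of "f y"] q(1)[OF that] by (simp add: sum_distrib_left mult_ac)
    then show "\<forall>\<^sub>F y in at x within Cn n. g (f y) - g (f x) = (\<Sum>i<n. (h (f y) * q i y) * (y i - x i))"
      by (auto simp: eventually_at_filter)
  qed (intro tendsto_intros q isCont_tendsto_compose[OF h(2)] cdiff_tendsto assms)
qed

lemma eventually_openin:
  assumes "openin (top_of_set S) W" "x \<in> W"
  shows "\<forall>\<^sub>F y in at x within S. y \<in> W"
proof -
  obtain T where "open T" "W = S \<inter> T" using assms(1) by (auto simp: openin_open)
  then show ?thesis using assms(2) by (auto simp: eventually_at_topological)
qed

lemma cdiff_cong:
  assumes "openin (top_of_set (Cn n)) W" "x \<in> W" "\<And>y. y \<in> W \<Longrightarrow> f y = g y" "cdiff n f x"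
  shows "cdiff n g x"
proof -
  have x: "x \<in> Cn n" using assms by (auto simp: openin_open)
  obtain q where q: "\<And>y. y \<in> Cn n \<Longrightarrow> f y - f x = (\<Sum>i<n. q i y * (y i - x i))"
    "\<And>i. i < n \<Longrightarrow> (q i \<longlongrightarrow> q i x) (at x within Cn n)" using cdiffE[OF assms(4) x] by metis
  show ?thesis
  proof (rule caratheodory_imp_cdiff[where q = q])
    have "W \<subseteq> Cn n" using assms(1) by (auto simp: openin_open)
    then have "y \<in> W \<Longrightarrow> g y - g x = (\<Sum>i<n. q i y * (y i - x i))" for y
      using q(1)[of y] assms(3)[of y] assms(3)[OF assms(2)] by auto
    then show "\<forall>\<^sub>F y in at x within Cn n. g y - g x = (\<Sum>i<n. q i y * (y i - x i))"
      by (rule eventually_mono[OF eventually_openin[OF assms(1,2)]])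
  qed (use q in auto)
qed

lemma holo_Cn_cong:
  assumes "\<And>y. y \<in> W \<Longrightarrow> f y = g y" "holo_Cn n W f"
  shows "holo_Cn n W g"
  unfolding holo_Cn_iff
proof (intro conjI ballI)
  show W: "openin (top_of_set (Cn n)) W" using assms(2) by (simp add: holo_Cn_iff)
  show "cdiff n g x" if "x \<in> W" for x
    by (rule cdiff_cong[OF W that assms(1)]) (use that assms(2) in \<open>auto simp: holo_Cn_iff\<close>)
qed

lemma holo_Cn_continuous_on: "holo_Cn n W f \<Longrightarrow> continuous_on W f"
  unfolding holo_Cn_iff continuous_on_def
  by (auto simp: openin_open intro!: tendsto_within_subset[OF cdiff_tendsto])

lemma holo_Cn_subset:
  "holo_Cn n W f \<Longrightarrow> openin (top_of_set (Cn n)) W' \<Longrightarrow> W' \<subseteq> W \<Longrightarrow> holo_Cn n W' f"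
  unfolding holo_Cn_iff by auto

text \<open>Continuity into a function type is coordinatewise in the product topology, and the
  coordinates from m on are constantly 0 on \<open>Cn m\<close>.\<close>

lemma continuous_on_into_Cn:
  fixes F :: "'a::topological_space \<Rightarrow> nat \<Rightarrow> complex"
  assumes "\<And>j. j < m \<Longrightarrow> continuous_on W (\<lambda>y. F y j)" "\<And>y. y \<in> W \<Longrightarrow> F y \<in> Cn m"
  shows "continuous_on W F"
proof (rule continuous_on_coordinatewise_then_product)
  fix j show "continuous_on W (\<lambda>y. F y j)"
  proof (cases "j < m")
    case False
    then have "\<And>y. y \<in> W \<Longrightarrow> F y j = 0" using assms(2) by (auto simp: Cn_def)
    then show ?thesis by (simp cong: continuous_on_cong)
  qed (use assms in auto)
qed

text \<open>Chain rule: inserting the factorizations of the components of F into that of g gives, as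
  coefficient of y i - x i, the sum over j of \<open>q j (F y) * p j i y\<close>.\<close>

lemma holo_Cn_compose:
  assumes F: "\<And>j. j < m \<Longrightarrow> holo_Cn n W (\<lambda>y. F y j)" and W: "openin (top_of_set (Cn n)) W"
    and Fm: "\<And>y. y \<in> W \<Longrightarrow> F y \<in> Cn m" and FO: "F ` W \<subseteq> V" and g: "holo_Cn m V g"
  shows "holo_Cn n W (\<lambda>y. g (F y))"
  unfolding holo_Cn_iff
proof (intro conjI W ballI)
  fix x assume xW: "x \<in> W"
  then have x: "x \<in> Cn n" using W by (auto simp: openin_open)
  have cF: "continuous_on W F"
    by (rule continuous_on_into_Cn[OF holo_Cn_continuous_on[OF F] Fm])
  have "cdiff m g (F x)" using g FO xW by (auto simp: holo_Cn_iff)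
  then obtain q where q: "\<And>y. y \<in> Cn m \<Longrightarrow> g y - g (F x) = (\<Sum>i<m. q i y * (y i - F x i))"
    "\<And>i. i < m \<Longrightarrow> (q i \<longlongrightarrow> q i (F x)) (at (F x) within Cn m)"
    by (rule cdiffE[OF _ Fm[OF xW]]) blast
  have "\<forall>j\<in>{..<m}. \<exists>p. (\<forall>y\<in>Cn n. F y j - F x j = (\<Sum>i<n. p i y * (y i - x i))) \<and>
    (\<forall>i<n. (p i \<longlongrightarrow> p i x) (at x within Cn n))"
  proof
    fix j assume "j \<in> {..<m}"
    then have "cdiff n (\<lambda>y. F y j) x" using F xW by (auto simp: holo_Cn_iff)
    then show "\<exists>p. (\<forall>y\<in>Cn n. F y j - F x j = (\<Sum>i<n. p i y * (y i - x i))) \<and>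
        (\<forall>i<n. (p i \<longlongrightarrow> p i x) (at x within Cn n))"
      by (rule cdiffE[OF _ x]) blast
  qed
  from bchoice[OF this] obtain p where "\<forall>j\<in>{..<m}. (\<forall>y\<in>Cn n. F y j - F x j = (\<Sum>i<n. p j i y * (y i - x i))) \<and>
    (\<forall>i<n. (p j i \<longlongrightarrow> p j i x) (at x within Cn n))" ..
  then have p: "\<And>j y. j < m \<Longrightarrow> y \<in> Cn n \<Longrightarrow> F y j - F x j = (\<Sum>i<n. p j i y * (y i - x i))"
    "\<And>i j. j < m \<Longrightarrow> i < n \<Longrightarrow> (p j i \<longlongrightarrow> p j i x) (at x within Cn n)" by auto
  \<comment> \<open>W is relatively open, so limits at x within W and within \<open>Cn n\<close>
    agree; continuity of F is available only on W.\<close>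
  have at: "at x within W = at x within Cn n"
  proof -
    obtain T where "open T" "W = Cn n \<inter> T" using W by (auto simp: openin_open)
    then show ?thesis using xW by (intro at_within_nhd[of _ T]) auto
  qed
  show "cdiff n (\<lambda>y. g (F y)) x"
  proof (rule caratheodory_imp_cdiff[where q = "\<lambda>i y. \<Sum>j<m. q j (F y) * p j i y"
        and a = "\<lambda>i. \<Sum>j<m. q j (F x) * p j i x"])
    show "\<forall>\<^sub>F y in at x within Cn n. g (F y) - g (F x) = (\<Sum>i<n. (\<Sum>j<m. q j (F y) * p j i y) * (y i - x i))"
      using eventually_openin[OF W xW]
    proof eventually_elim
      case (elim y)
      then have y: "y \<in> Cn n" using W by (auto simp: openin_open)
      have "g (F y) - g (F x) = (\<Sum>j<m. \<Sum>i<n. q j (F y) * p j i y * (y i - x i))"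
        unfolding q(1)[OF Fm[OF elim]] by (rule sum.cong) (auto simp: p(1)[OF _ y] sum_distrib_left mult_ac)
      also have "\<dots> = (\<Sum>i<n. (\<Sum>j<m. q j (F y) * p j i y) * (y i - x i))"
        by (subst sum.swap) (simp add: sum_distrib_right)
      finally show ?case .
    qed
    fix i assume "i < n"
    have lim: "((\<lambda>y. q j (F y)) \<longlongrightarrow> q j (F x)) (at x within Cn n)" if "j < m" for j
    proof -
      have "continuous (at (F x) within Cn m) (q j)" using q(2)[OF that] by (simp add: continuous_within)
      moreover have "(F \<longlongrightarrow> F x) (at x within W)" using cF xW by (simp add: continuous_on_def)
      moreover have "\<forall>\<^sub>F y in at x within W. F y \<in> Cn m"
        using Fm by (auto simp: eventually_at_filter)
      ultimately show ?thesis unfolding at[symmetric]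
        by (metis continuous_within_tendsto_compose)
    qed
    show "((\<lambda>y. \<Sum>j<m. q j (F y) * p j i y) \<longlongrightarrow> (\<Sum>j<m. q j (F x) * p j i x)) (at x within Cn n)"
      by (intro tendsto_intros lim p \<open>i < n\<close>) auto
  qed
qed

lemma coord_continuous_on: "continuous_on S (\<lambda>y. y i)" for S :: "(nat \<Rightarrow> complex) set"
  by (rule continuous_on_subset[OF continuous_on_product_coordinates subset_UNIV])

lemma openin_Cn_preimage:
  fixes F :: "(nat \<Rightarrow> complex) \<Rightarrow> 'a::topological_space"
  assumes "openin (top_of_set (Cn n)) W" "continuous_on W F" "open S"
  shows "openin (top_of_set (Cn n)) {y \<in> W. F y \<in> S}"
proof -
  have "openin (top_of_set W) (W \<inter> F -` S)" by (rule continuous_openin_preimage_gen[OF assms(2,3)])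
  moreover have "W \<inter> F -` S = {y \<in> W. F y \<in> S}" by auto
  ultimately show ?thesis using openin_trans[OF _ assms(1), of "W \<inter> F -` S"] by simp
qed

text \<open>The chart images and overlaps below are cut out by finitely many nonvanishing
  conditions, so this is the source of their openness.\<close>

lemma openin_Cn_nonzero:
  assumes "finite I" "\<And>i. i \<in> I \<Longrightarrow> continuous_on (Cn n) (f i)"
  shows "openin (top_of_set (Cn n)) {y \<in> Cn n. \<forall>i\<in>I. f i y \<noteq> (0::complex)}"
proof -
  have "{y \<in> Cn n. \<forall>i\<in>I. f i y \<noteq> 0} = Cn n \<inter> (\<Inter>i\<in>I. {y \<in> Cn n. f i y \<in> - {0}})" by auto
  moreover have "openin (top_of_set (Cn n)) {y \<in> Cn n. f i y \<in> - {0}}" if "i \<in> I" for i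
    using assms(2)[OF that] by (intro openin_Cn_preimage) auto
  ultimately show ?thesis using assms(1)
    by (cases "I = {}") (auto intro!: openin_Inter openin_Int)
qed

section \<open>Holomorphic functions on charted spaces\<close>

text \<open>Isolates the chart conditions of \<open>complex_manifold\<close>, so that the calculus
  of open sets and holomorphic functions is already available when the Hausdorff property of a space
  is being proved.\<close>

definition holo_atlas :: "'x cmfd \<Rightarrow> bool" where
  "holo_atlas X \<longleftrightarrow>
     (\<forall>(U, \<phi>) \<in> charts X. U \<subseteq> mpoints X \<and> inj_on \<phi> U \<and> openin (top_of_set (Cn (mdim X))) (\<phi> ` U)) \<and>
     (\<forall>(U, \<phi>) \<in> charts X. \<forall>(V, \<psi>) \<in> charts X.
        openin (top_of_set (Cn (mdim X))) (\<phi> ` (U \<inter> V)) \<and>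
        (\<forall>j<mdim X. holo_Cn (mdim X) (\<phi> ` (U \<inter> V)) (\<lambda>y. \<psi> (inv_into U \<phi> y) j))) \<and>
     \<Union> (fst ` charts X) = mpoints X"

lemma complex_manifold_atlas:
  assumes "complex_manifold X"
  shows "holo_atlas X"
  unfolding holo_atlas_def
proof (intro conjI)
  have 1: "\<forall>(U, \<phi>) \<in> charts X. U \<subseteq> mpoints X \<and> inj_on \<phi> U \<and> openin (top_of_set (Cn (mdim X))) (\<phi> ` U)"
    using assms unfolding complex_manifold_def by (elim conjE)
  have "\<exists>\<C>\<subseteq>charts X. countable \<C> \<and> \<Union> (fst ` \<C>) = mpoints X"
    using assms unfolding complex_manifold_def by (elim conjE)
  then obtain \<C> where \<C>: "\<C> \<subseteq> charts X" "\<Union> (fst ` \<C>) = mpoints X" by (elim exE conjE)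
  have "fst c \<subseteq> mpoints X" if "c \<in> charts X" for c
    using bspec[OF 1 that] by (simp add: case_prod_beta)
  then have "\<Union> (fst ` charts X) \<subseteq> mpoints X" by (rule UN_least)
  moreover have "mpoints X \<subseteq> \<Union> (fst ` charts X)"
    unfolding \<C>(2)[symmetric] by (rule Union_mono[OF image_mono[OF \<C>(1)]])
  ultimately show "\<Union> (fst ` charts X) = mpoints X" by (rule equalityI)
  show "\<forall>(U, \<phi>) \<in> charts X. U \<subseteq> mpoints X \<and> inj_on \<phi> U \<and> openin (top_of_set (Cn (mdim X))) (\<phi> ` U)"
    by (rule 1)
  show "\<forall>(U, \<phi>) \<in> charts X. \<forall>(V, \<psi>) \<in> charts X.
        openin (top_of_set (Cn (mdim X))) (\<phi> ` (U \<inter> V)) \<and>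
        (\<forall>j<mdim X. holo_Cn (mdim X) (\<phi> ` (U \<inter> V)) (\<lambda>y. \<psi> (inv_into U \<phi> y) j))"
    using assms unfolding complex_manifold_def by (elim conjE)
qed

context
  fixes X :: "'x cmfd"
  assumes atlas: "holo_atlas X"
begin

lemma chart_facts:
  assumes "(U, \<phi>) \<in> charts X"
  shows "U \<subseteq> mpoints X" "inj_on \<phi> U" "openin (top_of_set (Cn (mdim X))) (\<phi> ` U)"
proof -
  have "\<forall>(U, \<phi>) \<in> charts X. U \<subseteq> mpoints X \<and> inj_on \<phi> U \<and> openin (top_of_set (Cn (mdim X))) (\<phi> ` U)"
    using atlas unfolding holo_atlas_def by (elim conjE)
  from bspec[OF this assms]
  show "U \<subseteq> mpoints X" "inj_on \<phi> U" "openin (top_of_set (Cn (mdim X))) (\<phi> ` U)" by simp_all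
qed

lemma chart_transition:
  assumes "(U, \<phi>) \<in> charts X" "(V, \<psi>) \<in> charts X"
  shows "openin (top_of_set (Cn (mdim X))) (\<phi> ` (U \<inter> V))"
    "j < mdim X \<Longrightarrow> holo_Cn (mdim X) (\<phi> ` (U \<inter> V)) (\<lambda>y. \<psi> (inv_into U \<phi> y) j)"
proof -
  have "\<forall>(U, \<phi>) \<in> charts X. \<forall>(V, \<psi>) \<in> charts X.
        openin (top_of_set (Cn (mdim X))) (\<phi> ` (U \<inter> V)) \<and>
        (\<forall>j<mdim X. holo_Cn (mdim X) (\<phi> ` (U \<inter> V)) (\<lambda>y. \<psi> (inv_into U \<phi> y) j))"
    using atlas unfolding holo_atlas_def by (elim conjE)
  from bspec[OF this assms(1), unfolded prod.case, THEN bspec, OF assms(2)]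
  show "openin (top_of_set (Cn (mdim X))) (\<phi> ` (U \<inter> V))"
    "j < mdim X \<Longrightarrow> holo_Cn (mdim X) (\<phi> ` (U \<inter> V)) (\<lambda>y. \<psi> (inv_into U \<phi> y) j)" by simp_all
qed

lemma chart_in_Cn: "(U, \<phi>) \<in> charts X \<Longrightarrow> p \<in> U \<Longrightarrow> \<phi> p \<in> Cn (mdim X)"
  using openin_imp_subset[OF chart_facts(3)] by blast

lemma chart_at:
  assumes "x \<in> mpoints X"
  obtains U \<phi> where "(U, \<phi>) \<in> charts X" "x \<in> U"
proof -
  have "\<Union> (fst ` charts X) = mpoints X" using atlas unfolding holo_atlas_def by (elim conjE)
  then obtain c where "c \<in> charts X" "x \<in> fst c" using assms by blast
  then show ?thesis using that[of "fst c" "snd c"] by simp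
qed

lemma mopenI:
  assumes "W \<subseteq> mpoints X"
    "\<And>U \<phi>. (U, \<phi>) \<in> charts X \<Longrightarrow> openin (top_of_set (Cn (mdim X))) (\<phi> ` (U \<inter> W))"
  shows "mopen X W"
  using assms unfolding mopen_def Ball_def split_paired_All prod.case by blast+

lemma mopenD:
  assumes "mopen X W"
  shows "W \<subseteq> mpoints X"
    "(U, \<phi>) \<in> charts X \<Longrightarrow> openin (top_of_set (Cn (mdim X))) (\<phi> ` (U \<inter> W))"
  using assms unfolding mopen_def Ball_def split_paired_All prod.case by blast+

lemma mopen_chart:
  assumes "(U, \<phi>) \<in> charts X"
  shows "mopen X U"
  using chart_transition(1)[OF _ assms] chart_facts(1)[OF assms] by (intro mopenI) auto

lemma mopen_Int:
  assumes "mopen X V" "mopen X W"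
  shows "mopen X (V \<inter> W)"
proof (rule mopenI)
  fix U \<phi> assume U: "(U, \<phi>) \<in> charts X"
  have "\<phi> ` (U \<inter> (V \<inter> W)) = \<phi> ` (U \<inter> V) \<inter> \<phi> ` (U \<inter> W)"
    using inj_on_image_Int[OF chart_facts(2)[OF U], of "U \<inter> V" "U \<inter> W"] by (simp add: Int_ac)
  then show "openin (top_of_set (Cn (mdim X))) (\<phi> ` (U \<inter> (V \<inter> W)))"
    using mopenD(2)[OF assms(1) U] mopenD(2)[OF assms(2) U] by (simp add: openin_Int)
qed (use mopenD(1)[OF assms(1)] in auto)

lemma mopen_Union:
  assumes "\<And>W. W \<in> \<W> \<Longrightarrow> mopen X W"
  shows "mopen X (\<Union> \<W>)"
proof (rule mopenI)
  fix U \<phi> assume U: "(U, \<phi>) \<in> charts X"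
  have "\<phi> ` (U \<inter> \<Union> \<W>) = \<Union> ((\<lambda>W. \<phi> ` (U \<inter> W)) ` \<W>)" by auto
  then show "openin (top_of_set (Cn (mdim X))) (\<phi> ` (U \<inter> \<Union> \<W>))"
    using mopenD(2)[OF assms U] by (auto intro!: openin_Union)
qed (use mopenD(1)[OF assms] in blast)

lemma mopen_local:
  assumes "\<And>x. x \<in> W \<Longrightarrow> \<exists>V. x \<in> V \<and> V \<subseteq> W \<and> mopen X V"
  shows "mopen X W"
proof -
  have "W = \<Union> {V. V \<subseteq> W \<and> mopen X V}" using assms by blast
  then show ?thesis using mopen_Union[of "{V. V \<subseteq> W \<and> mopen X V}"] by simp
qed

lemma mopen_mpoints: "mopen X (mpoints X)"
proof (rule mopen_local)
  fix x assume "x \<in> mpoints X"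
  then obtain U \<phi> where "(U, \<phi>) \<in> charts X" "x \<in> U" by (rule chart_at)
  then show "\<exists>V. x \<in> V \<and> V \<subseteq> mpoints X \<and> mopen X V"
    using mopen_chart chart_facts(1) by blast
qed

lemma holo_funI:
  assumes "mopen X W"
    "\<And>U \<phi>. (U, \<phi>) \<in> charts X \<Longrightarrow> holo_Cn (mdim X) (\<phi> ` (U \<inter> W)) (\<lambda>y. f (inv_into U \<phi> y))"
  shows "holo_fun X W f"
  using assms unfolding holo_fun_def Ball_def split_paired_All prod.case by blast+

lemma holo_funD:
  assumes "holo_fun X W f"
  shows "mopen X W"
    "(U, \<phi>) \<in> charts X \<Longrightarrow> holo_Cn (mdim X) (\<phi> ` (U \<inter> W)) (\<lambda>y. f (inv_into U \<phi> y))"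
  using assms unfolding holo_fun_def Ball_def split_paired_All prod.case by blast+

lemma chart_image_Cn:
  "mopen X W \<Longrightarrow> (U, \<phi>) \<in> charts X \<Longrightarrow> y \<in> \<phi> ` (U \<inter> W) \<Longrightarrow> y \<in> Cn (mdim X)"
  using chart_in_Cn[of U \<phi>] by (elim imageE) simp

lemma holo_fun_subset:
  assumes "holo_fun X W f" "mopen X V" "V \<subseteq> W"
  shows "holo_fun X V f"
proof (rule holo_funI[OF assms(2)])
  fix U \<phi> assume U: "(U, \<phi>) \<in> charts X"
  show "holo_Cn (mdim X) (\<phi> ` (U \<inter> V)) (\<lambda>y. f (inv_into U \<phi> y))"
    using holo_Cn_subset[OF holo_funD(2)[OF assms(1) U] mopenD(2)[OF assms(2) U]] assms(3) by blast
qed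

lemma holo_fun_cong:
  assumes "holo_fun X W f" "\<And>x. x \<in> W \<Longrightarrow> f x = g x"
  shows "holo_fun X W g"
proof (rule holo_funI[OF holo_funD(1)[OF assms(1)]])
  fix U \<phi> assume U: "(U, \<phi>) \<in> charts X"
  show "holo_Cn (mdim X) (\<phi> ` (U \<inter> W)) (\<lambda>y. g (inv_into U \<phi> y))"
  proof (rule holo_Cn_cong[OF _ holo_funD(2)[OF assms(1) U]])
    fix y assume "y \<in> \<phi> ` (U \<inter> W)"
    then have "inv_into U \<phi> y \<in> W" using chart_facts(2)[OF U] by (auto simp: inv_into_f_f)
    then show "f (inv_into U \<phi> y) = g (inv_into U \<phi> y)" by (rule assms(2))
  qed
qed

lemma holo_fun_local:
  assumes "\<And>x. x \<in> W \<Longrightarrow> \<exists>V. x \<in> V \<and> V \<subseteq> W \<and> holo_fun X V f"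
  shows "holo_fun X W f"
proof (rule holo_funI)
  show W: "mopen X W"
  proof (rule mopen_local)
    fix x assume "x \<in> W"
    from assms[OF this] show "\<exists>V. x \<in> V \<and> V \<subseteq> W \<and> mopen X V" using holo_funD(1) by blast
  qed
  fix U \<phi> assume U: "(U, \<phi>) \<in> charts X"
  show "holo_Cn (mdim X) (\<phi> ` (U \<inter> W)) (\<lambda>y. f (inv_into U \<phi> y))"
    unfolding holo_Cn_iff
  proof (intro conjI ballI)
    show "openin (top_of_set (Cn (mdim X))) (\<phi> ` (U \<inter> W))" by (rule mopenD(2)[OF W U])
    fix y assume "y \<in> \<phi> ` (U \<inter> W)"
    then obtain x where x: "x \<in> U" "x \<in> W" "y = \<phi> x" by auto
    then obtain V where V: "x \<in> V" "V \<subseteq> W" "holo_fun X V f" using assms by blast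
    then show "cdiff (mdim X) (\<lambda>y. f (inv_into U \<phi> y)) y"
      using holo_funD(2)[OF V(3) U] x by (auto simp: holo_Cn_iff)
  qed
qed

lemma holo_fun_cdiffI:
  assumes "mopen X W"
    "\<And>U \<phi> y. (U, \<phi>) \<in> charts X \<Longrightarrow> y \<in> \<phi> ` (U \<inter> W) \<Longrightarrow> y \<in> Cn (mdim X) \<Longrightarrow> inv_into U \<phi> y \<in> W
      \<Longrightarrow> cdiff (mdim X) (\<lambda>y. f (inv_into U \<phi> y)) y"
  shows "holo_fun X W f"
proof (rule holo_funI[OF assms(1)])
  fix U \<phi> assume U: "(U, \<phi>) \<in> charts X"
  have "inv_into U \<phi> y \<in> W" if "y \<in> \<phi> ` (U \<inter> W)" for y
    using that chart_facts(2)[OF U] by (auto simp: inv_into_f_f)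
  then show "holo_Cn (mdim X) (\<phi> ` (U \<inter> W)) (\<lambda>y. f (inv_into U \<phi> y))"
    unfolding holo_Cn_iff using mopenD(2)[OF assms(1) U] assms(2)[OF U] chart_image_Cn[OF assms(1) U] by blast
qed

lemma holo_fun_cdiffD:
  assumes "holo_fun X W f" "(U, \<phi>) \<in> charts X" "y \<in> \<phi> ` (U \<inter> W)"
  shows "cdiff (mdim X) (\<lambda>y. f (inv_into U \<phi> y)) y"
  using holo_funD(2)[OF assms(1,2)] assms(3) unfolding holo_Cn_iff by blast

lemma holo_fun_const: "mopen X W \<Longrightarrow> holo_fun X W (\<lambda>_. c)"
  by (rule holo_fun_cdiffI) (auto intro: cdiff_const)

lemma holo_fun_add:
  assumes "holo_fun X W f" "holo_fun X W g"
  shows "holo_fun X W (\<lambda>x. f x + g x)"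
  by (rule holo_fun_cdiffI[OF holo_funD(1)[OF assms(1)]])
    (rule cdiff_add[OF holo_fun_cdiffD[OF assms(1)] holo_fun_cdiffD[OF assms(2)]])

lemma holo_fun_mult:
  assumes "holo_fun X W f" "holo_fun X W g"
  shows "holo_fun X W (\<lambda>x. f x * g x)"
  by (rule holo_fun_cdiffI[OF holo_funD(1)[OF assms(1)]])
    (rule cdiff_mult[OF holo_fun_cdiffD[OF assms(1)] holo_fun_cdiffD[OF assms(2)]])

lemma holo_fun_comp1:
  assumes "holo_fun X W f" "\<And>x. x \<in> W \<Longrightarrow> g field_differentiable at (f x)"
  shows "holo_fun X W (\<lambda>x. g (f x))"
  by (rule holo_fun_cdiffI[OF holo_funD(1)[OF assms(1)]])
    (rule cdiff_comp1[OF holo_fun_cdiffD[OF assms(1)] assms(2)])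

lemma holo_fun_uminus: "holo_fun X W f \<Longrightarrow> holo_fun X W (\<lambda>x. - f x)"
  using holo_fun_mult[OF holo_fun_const[OF holo_funD(1)[of W f]], of f "-1"] by simp

lemma holo_fun_diff: "holo_fun X W f \<Longrightarrow> holo_fun X W g \<Longrightarrow> holo_fun X W (\<lambda>x. f x - g x)"
  using holo_fun_add[OF _ holo_fun_uminus[of W g], of f] by simp

lemma holo_fun_inverse:
  assumes "holo_fun X W f" "\<And>x. x \<in> W \<Longrightarrow> f x \<noteq> 0"
  shows "holo_fun X W (\<lambda>x. inverse (f x))"
  by (rule holo_fun_comp1[OF assms(1)])
    (use assms(2) in \<open>auto intro!: field_differentiable_inverse field_differentiable_ident\<close>)

lemma holo_fun_divide:
  assumes "holo_fun X W f" "holo_fun X W g" "\<And>x. x \<in> W \<Longrightarrow> g x \<noteq> 0"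
  shows "holo_fun X W (\<lambda>x. f x / g x)"
  using holo_fun_mult[OF assms(1) holo_fun_inverse[OF assms(2,3)]] by (simp add: divide_inverse)

lemma holo_fun_sum:
  assumes "mopen X W" "\<And>i. i \<in> I \<Longrightarrow> holo_fun X W (f i)"
  shows "holo_fun X W (\<lambda>x. \<Sum>i\<in>I. f i x)"
  using assms(2)
proof (induction I rule: infinite_finite_induct)
  case (insert i I)
  then show ?case using holo_fun_add[of W "f i" "\<lambda>x. \<Sum>i\<in>I. f i x"] by simp
qed (simp_all add: holo_fun_const[OF assms(1)])

lemma holo_fun_prod:
  assumes "mopen X W" "\<And>i. i \<in> I \<Longrightarrow> holo_fun X W (f i)"
  shows "holo_fun X W (\<lambda>x. \<Prod>i\<in>I. f i x)"
  using assms(2)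
proof (induction I rule: infinite_finite_induct)
  case (insert i I)
  then show ?case using holo_fun_mult[of W "f i" "\<lambda>x. \<Prod>i\<in>I. f i x"] by simp
qed (simp_all add: holo_fun_const[OF assms(1)])

lemma holo_fun_chart:
  assumes "(U, \<phi>) \<in> charts X"
  shows "holo_fun X U (\<lambda>x. \<phi> x j)"
proof (cases "j < mdim X")
  case True
  have "holo_Cn (mdim X) (\<psi> ` (V \<inter> U)) (\<lambda>y. \<phi> (inv_into V \<psi> y) j)" if "(V, \<psi>) \<in> charts X" for V \<psi>
    using chart_transition(2)[OF that assms True] .
  then show ?thesis by (intro holo_funI mopen_chart[OF assms])
next
  case False
  have "holo_fun X U (\<lambda>_. 0)" by (rule holo_fun_const[OF mopen_chart[OF assms]])
  then show ?thesis
    by (rule holo_fun_cong) (use chart_in_Cn[OF assms] False in \<open>auto simp: Cn_def\<close>)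
qed

lemma mopen_preimage_Cn:
  assumes F: "\<And>j. j < m \<Longrightarrow> holo_fun X W (\<lambda>x. F x j)" and W: "mopen X W"
    and Fm: "\<And>x. x \<in> W \<Longrightarrow> F x \<in> Cn m" and V: "openin (top_of_set (Cn m)) V"
  shows "mopen X {x \<in> W. F x \<in> V}"
proof (rule mopenI)
  obtain S where S: "open S" "V = Cn m \<inter> S" using V by (auto simp: openin_open)
  fix U \<phi> assume U: "(U, \<phi>) \<in> charts X"
  have inv: "\<And>x. x \<in> U \<Longrightarrow> inv_into U \<phi> (\<phi> x) = x" using chart_facts(2)[OF U] by simp
  have "continuous_on (\<phi> ` (U \<inter> W)) (\<lambda>y. F (inv_into U \<phi> y))"
    by (rule continuous_on_into_Cn[where m = m])
      (use holo_Cn_continuous_on[OF holo_funD(2)[OF F U]] Fm inv in auto)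
  from openin_Cn_preimage[OF mopenD(2)[OF W U] this S(1)]
  have "openin (top_of_set (Cn (mdim X))) {y \<in> \<phi> ` (U \<inter> W). F (inv_into U \<phi> y) \<in> S}" .
  moreover have "{y \<in> \<phi> ` (U \<inter> W). F (inv_into U \<phi> y) \<in> S} = \<phi> ` (U \<inter> {x \<in> W. F x \<in> V})"
    using inv Fm by (auto simp: S(2))
  ultimately show "openin (top_of_set (Cn (mdim X))) (\<phi> ` (U \<inter> {x \<in> W. F x \<in> V}))" by simp
qed (use mopenD(1)[OF W] in auto)

lemma mopen_preimage:
  assumes f: "holo_fun X W f" and S: "open S"
  shows "mopen X {x \<in> W. f x \<in> S}"
proof -
  have W: "mopen X W" by (rule holo_funD(1)[OF f])
  define F where "F x j = (if j = 0 then f x else 0)" for x and j :: nat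
  have "mopen X {x \<in> W. F x \<in> {y \<in> Cn 1. y 0 \<in> S}}"
  proof (rule mopen_preimage_Cn[OF _ W])
    show "holo_fun X W (\<lambda>x. F x j)" if "j < 1" for j using f that by (simp add: F_def)
    show "openin (top_of_set (Cn 1)) {y \<in> Cn 1. y 0 \<in> S}"
      by (rule openin_Cn_preimage[OF _ coord_continuous_on S]) simp
  qed (auto simp: F_def Cn_def)
  moreover have "{x \<in> W. F x \<in> {y \<in> Cn 1. y 0 \<in> S}} = {x \<in> W. f x \<in> S}"
    by (auto simp: F_def Cn_def)
  ultimately show ?thesis by simp
qed

lemma holo_fun_compose_Cn:
  assumes F: "\<And>j. j < m \<Longrightarrow> holo_fun X W (\<lambda>x. F x j)" and W: "mopen X W"
    and Fm: "\<And>x. x \<in> W \<Longrightarrow> F x \<in> Cn m" and FV: "F ` W \<subseteq> V" and g: "holo_Cn m V g"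
  shows "holo_fun X W (\<lambda>x. g (F x))"
proof (rule holo_funI[OF W])
  fix U \<phi> assume U: "(U, \<phi>) \<in> charts X"
  have inv: "inv_into U \<phi> y \<in> W" if "y \<in> \<phi> ` (U \<inter> W)" for y
    using that chart_facts(2)[OF U] by (auto simp: inv_into_f_f)
  show "holo_Cn (mdim X) (\<phi> ` (U \<inter> W)) (\<lambda>y. g (F (inv_into U \<phi> y)))"
    by (rule holo_Cn_compose[OF holo_funD(2)[OF F U] mopenD(2)[OF W U] _ _ g]) (use inv Fm FV in auto)
qed

end

section \<open>Holomorphic maps between charted spaces\<close>

lemma holo_mapD:
  assumes "holo_map X W Y f"
  shows "mopen X W" "x \<in> W \<Longrightarrow> f x \<in> mpoints Y"
    "(V, \<psi>) \<in> charts Y \<Longrightarrow> mopen X {x \<in> W. f x \<in> V}"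
    "(V, \<psi>) \<in> charts Y \<Longrightarrow> j < mdim Y \<Longrightarrow> holo_fun X {x \<in> W. f x \<in> V} (\<lambda>x. \<psi> (f x) j)"
proof -
  note d = assms[unfolded holo_map_def]
  show "mopen X W" using d by (elim conjE)
  have "f ` W \<subseteq> mpoints Y" using d by (elim conjE)
  then show "x \<in> W \<Longrightarrow> f x \<in> mpoints Y" by (auto simp: image_subset_iff)
  have 3: "\<forall>(V, \<psi>) \<in> charts Y. mopen X {x \<in> W. f x \<in> V} \<and>
        (\<forall>j<mdim Y. holo_fun X {x \<in> W. f x \<in> V} (\<lambda>x. \<psi> (f x) j))" using d by (elim conjE)
  show "(V, \<psi>) \<in> charts Y \<Longrightarrow> mopen X {x \<in> W. f x \<in> V}"
    "(V, \<psi>) \<in> charts Y \<Longrightarrow> j < mdim Y \<Longrightarrow> holo_fun X {x \<in> W. f x \<in> V} (\<lambda>x. \<psi> (f x) j)"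
    by (drule bspec[OF 3], simp)+
qed

lemma holo_mapI:
  assumes "mopen X W" "\<And>x. x \<in> W \<Longrightarrow> f x \<in> mpoints Y"
    "\<And>V \<psi>. (V, \<psi>) \<in> charts Y \<Longrightarrow> mopen X {x \<in> W. f x \<in> V}"
    "\<And>V \<psi> j. (V, \<psi>) \<in> charts Y \<Longrightarrow> j < mdim Y \<Longrightarrow> holo_fun X {x \<in> W. f x \<in> V} (\<lambda>x. \<psi> (f x) j)"
  shows "holo_map X W Y f"
  unfolding holo_map_def
proof (intro conjI ballI image_subsetI)
  fix c assume c: "c \<in> charts Y"
  obtain V \<psi> where c': "c = (V, \<psi>)" by (cases c)
  show "case c of (V, \<psi>) \<Rightarrow> mopen X {x \<in> W. f x \<in> V} \<and>
      (\<forall>j<mdim Y. holo_fun X {x \<in> W. f x \<in> V} (\<lambda>x. \<psi> (f x) j))"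
    using assms(3,4)[OF c[unfolded c']] by (simp add: c')
qed (rule assms(1), rule assms(2))

context
  fixes X :: "'x cmfd" and Y :: "'y cmfd"
  assumes X: "holo_atlas X" and Y: "holo_atlas Y"
begin

text \<open>A holomorphic map is known only through chart coordinates; injectivity of \<psi> on V
  turns membership of f x in V and W' into membership of \<open>\<psi> (f x)\<close> in an open
  subset of \<open>Cn\<close>.\<close>

lemma holo_map_chart_preimage:
  assumes f: "holo_map X W Y f" and V: "(V, \<psi>) \<in> charts Y" and W': "mopen Y W'"
  shows "mopen X {x \<in> W. f x \<in> V \<inter> W'}"
proof -
  have "mopen X {x \<in> {x \<in> W. f x \<in> V}. \<psi> (f x) \<in> \<psi> ` (V \<inter> W')}"
    by (rule mopen_preimage_Cn[OF X holo_mapD(4)[OF f V] holo_mapD(3)[OF f V] _ mopenD(2)[OF Y W' V]])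
      (use chart_in_Cn[OF Y V] in auto)
  moreover have "{x \<in> {x \<in> W. f x \<in> V}. \<psi> (f x) \<in> \<psi> ` (V \<inter> W')} = {x \<in> W. f x \<in> V \<inter> W'}"
    using chart_facts(2)[OF Y V] by (auto dest: inj_onD)
  ultimately show ?thesis by simp
qed

lemma holo_map_preimage:
  assumes f: "holo_map X W Y f" and W': "mopen Y W'"
  shows "mopen X {x \<in> W. f x \<in> W'}"
proof (rule mopen_local[OF X])
  fix x assume x: "x \<in> {x \<in> W. f x \<in> W'}"
  then have "f x \<in> mpoints Y" using holo_mapD(2)[OF f] by simp
  then obtain V \<psi> where V: "(V, \<psi>) \<in> charts Y" "f x \<in> V" by (rule chart_at[OF Y])
  show "\<exists>V. x \<in> V \<and> V \<subseteq> {x \<in> W. f x \<in> W'} \<and> mopen X V"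
    by (rule exI[of _ "{x \<in> W. f x \<in> V \<inter> W'}"]) (use x V holo_map_chart_preimage[OF f V(1) W'] in auto)
qed

lemma holo_fun_pullback:
  assumes f: "holo_map X W Y f" and g: "holo_fun Y W' g"
  shows "holo_fun X {x \<in> W. f x \<in> W'} (\<lambda>x. g (f x))"
proof (rule holo_fun_local[OF X])
  have W': "mopen Y W'" by (rule holo_funD(1)[OF Y g])
  fix x assume x: "x \<in> {x \<in> W. f x \<in> W'}"
  then have "f x \<in> mpoints Y" using holo_mapD(2)[OF f] by simp
  then obtain V \<psi> where V: "(V, \<psi>) \<in> charts Y" "f x \<in> V" by (rule chart_at[OF Y])
  let ?N = "{x \<in> W. f x \<in> V \<inter> W'}"
  have N: "mopen X ?N" by (rule holo_map_chart_preimage[OF f V(1) W'])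
  have "holo_fun X ?N (\<lambda>x. g (inv_into V \<psi> (\<psi> (f x))))"
  proof (rule holo_fun_compose_Cn[OF X _ N _ _ holo_funD(2)[OF Y g V(1)]])
    show "holo_fun X ?N (\<lambda>x. \<psi> (f x) j)" if "j < mdim Y" for j
      by (rule holo_fun_subset[OF X holo_mapD(4)[OF f V(1) that] N]) auto
  qed (use chart_in_Cn[OF Y V(1)] in auto)
  then have "holo_fun X ?N (\<lambda>x. g (f x))"
    by (rule holo_fun_cong[OF X]) (use chart_facts(2)[OF Y V(1)] in auto)
  then show "\<exists>V. x \<in> V \<and> V \<subseteq> {x \<in> W. f x \<in> W'} \<and> holo_fun X V (\<lambda>x. g (f x))"
    using x V by (intro exI[of _ ?N]) auto
qed

lemma holo_map_compose:
  assumes f: "holo_map X W Y f" and g: "holo_map Y W' Z g"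
  shows "holo_map X {x \<in> W. f x \<in> W'} Z (\<lambda>x. g (f x))"
proof -
  have *: "{x \<in> {x \<in> W. f x \<in> W'}. g (f x) \<in> V} = {x \<in> W. f x \<in> {y \<in> W'. g y \<in> V}}" for V by auto
  show ?thesis
  proof (rule holo_mapI)
    show "mopen X {x \<in> W. f x \<in> W'}" by (rule holo_map_preimage[OF f holo_mapD(1)[OF g]])
    fix V \<psi> j assume V: "(V, \<psi>) \<in> charts Z"
    show "mopen X {x \<in> {x \<in> W. f x \<in> W'}. g (f x) \<in> V}"
      unfolding * by (rule holo_map_preimage[OF f holo_mapD(3)[OF g V]])
    assume "j < mdim Z"
    then show "holo_fun X {x \<in> {x \<in> W. f x \<in> W'}. g (f x) \<in> V} (\<lambda>x. \<psi> (g (f x)) j)"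
      unfolding * by (rule holo_fun_pullback[OF f holo_mapD(4)[OF g V]])
  qed (use holo_mapD(2)[OF g] in auto)
qed

end

lemma holo_map_id:
  assumes X: "holo_atlas X" and W: "mopen X W"
  shows "holo_map X W X (\<lambda>x. x)"
proof (rule holo_mapI[OF W])
  fix V \<psi> j assume V: "(V, \<psi>) \<in> charts X"
  have *: "{x \<in> W. x \<in> V} = W \<inter> V" by auto
  show "mopen X {x \<in> W. x \<in> V}" unfolding * by (rule mopen_Int[OF X W mopen_chart[OF X V]])
  then show "holo_fun X {x \<in> W. x \<in> V} (\<lambda>x. \<psi> x j)"
    by (rule holo_fun_subset[OF X holo_fun_chart[OF X V]]) auto
qed (use mopenD(1)[OF X W] in auto)

section \<open>Bundle maps\<close>

lemma holo_vbundleD: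
  assumes "holo_vbundle E"
  shows "complex_manifold (base E)" "holo_atlas (base E)"
    "e \<in> total E \<Longrightarrow> bproj E e \<in> mpoints (base E)"
    "\<Union> (fst ` trivs E) = mpoints (base E)"
    "(U, \<sigma>) \<in> trivs E \<Longrightarrow> mopen (base E) U"
    "(U, \<sigma>) \<in> trivs E \<Longrightarrow> fibre_iso E U \<sigma>"
    "(U, \<sigma>) \<in> trivs E \<Longrightarrow> (V, \<tau>) \<in> trivs E \<Longrightarrow>
      holo_matrix (base E) (U \<inter> V) (vrank E) (vrank E) (total E) (bproj E) \<sigma> \<tau>"
proof -
  note d = assms[unfolded holo_vbundle_def]
  show cm: "complex_manifold (base E)" using d by (elim conjE)
  then show "holo_atlas (base E)" by (rule complex_manifold_atlas)
  have "bproj E ` total E \<subseteq> mpoints (base E)" using d by (elim conjE)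
  then show "e \<in> total E \<Longrightarrow> bproj E e \<in> mpoints (base E)" by blast
  show "\<Union> (fst ` trivs E) = mpoints (base E)" using d by (elim conjE)
  have 1: "\<forall>(U, \<tau>) \<in> trivs E. mopen (base E) U \<and> fibre_iso E U \<tau>" using d by (elim conjE)
  show "(U, \<sigma>) \<in> trivs E \<Longrightarrow> mopen (base E) U" "(U, \<sigma>) \<in> trivs E \<Longrightarrow> fibre_iso E U \<sigma>"
    by (drule bspec[OF 1], simp)+
  have 2: "\<forall>(U, \<sigma>) \<in> trivs E. \<forall>(V, \<tau>) \<in> trivs E.
        holo_matrix (base E) (U \<inter> V) (vrank E) (vrank E) (total E) (bproj E) \<sigma> \<tau>" using d by (elim conjE)
  show "(U, \<sigma>) \<in> trivs E \<Longrightarrow> (V, \<tau>) \<in> trivs E \<Longrightarrow>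
      holo_matrix (base E) (U \<inter> V) (vrank E) (vrank E) (total E) (bproj E) \<sigma> \<tau>"
    using 2 unfolding Ball_def split_paired_All prod.case by blast
qed

lemma holo_matrixI:
  assumes "\<And>i j. i < m \<Longrightarrow> j < n \<Longrightarrow> holo_fun X W (h i j)"
    "\<And>e i. e \<in> T \<Longrightarrow> \<pi> e \<in> W \<Longrightarrow> i < m \<Longrightarrow> \<tau> e i = (\<Sum>j<n. h i j (\<pi> e) * \<sigma> e j)"
  shows "holo_matrix X W m n T \<pi> \<sigma> \<tau>"
  unfolding holo_matrix_def
  by (intro exI[of _ h] conjI allI impI ballI) (rule assms(1), assumption+, rule assms(2))

lemma holo_matrixE:
  assumes "holo_matrix X W m n T \<pi> \<sigma> \<tau>"
  obtains h where "\<And>i j. i < m \<Longrightarrow> j < n \<Longrightarrow> holo_fun X W (h i j)"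
    "\<And>e i. e \<in> T \<Longrightarrow> \<pi> e \<in> W \<Longrightarrow> i < m \<Longrightarrow> \<tau> e i = (\<Sum>j<n. h i j (\<pi> e) * \<sigma> e j)"
  using assms unfolding holo_matrix_def by blast

lemma holo_matrix_subset:
  assumes X: "holo_atlas X" and "holo_matrix X W m n T \<pi> \<sigma> \<tau>" "mopen X W'" "W' \<subseteq> W"
  shows "holo_matrix X W' m n T \<pi> \<sigma> \<tau>"
proof -
  obtain h where h: "\<And>i j. i < m \<Longrightarrow> j < n \<Longrightarrow> holo_fun X W (h i j)"
    "\<And>e i. e \<in> T \<Longrightarrow> \<pi> e \<in> W \<Longrightarrow> i < m \<Longrightarrow> \<tau> e i = (\<Sum>j<n. h i j (\<pi> e) * \<sigma> e j)"
    by (rule holo_matrixE[OF assms(2)]) blast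
  show ?thesis
  proof (rule holo_matrixI[where h = h])
    show "holo_fun X W' (h i j)" if "i < m" "j < n" for i j
      by (rule holo_fun_subset[OF X h(1)[OF that] assms(3,4)])
    show "\<tau> e i = (\<Sum>j<n. h i j (\<pi> e) * \<sigma> e j)" if "e \<in> T" "\<pi> e \<in> W'" "i < m" for e i
      by (rule h(2)[OF that(1) subsetD[OF assms(4) that(2)] that(3)])
  qed
qed

text \<open>Surjectivity of \<open>\<sigma>\<close> on fibres makes the matrix unique, so local matrices agree on overlaps.\<close>

lemma holo_matrix_local:
  assumes X: "holo_atlas X"
    and sur: "\<And>x y. x \<in> W \<Longrightarrow> y \<in> Cn n \<Longrightarrow> \<exists>e\<in>T. \<pi> e = x \<and> \<sigma> e = y"
    and loc: "\<And>x. x \<in> W \<Longrightarrow> \<exists>V. x \<in> V \<and> V \<subseteq> W \<and> holo_matrix X V m n T \<pi> \<sigma> \<tau>"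
  shows "holo_matrix X W m n T \<pi> \<sigma> \<tau>"
proof -
  have "\<exists>V h. x \<in> V \<and> V \<subseteq> W \<and> (\<forall>i<m. \<forall>j<n. holo_fun X V (h i j)) \<and>
      (\<forall>e\<in>T. \<pi> e \<in> V \<longrightarrow> (\<forall>i<m. \<tau> e i = (\<Sum>j<n. h i j (\<pi> e) * \<sigma> e j)))" if "x \<in> W" for x
    using loc[OF that] unfolding holo_matrix_def by (elim exE conjE) (intro exI conjI)
  then have "\<forall>x\<in>W. \<exists>V h. x \<in> V \<and> V \<subseteq> W \<and> (\<forall>i<m. \<forall>j<n. holo_fun X V (h i j)) \<and>
      (\<forall>e\<in>T. \<pi> e \<in> V \<longrightarrow> (\<forall>i<m. \<tau> e i = (\<Sum>j<n. h i j (\<pi> e) * \<sigma> e j)))" by (rule ballI)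
  from bchoice[OF this] obtain V where "\<forall>x\<in>W. \<exists>h. x \<in> V x \<and> V x \<subseteq> W \<and> (\<forall>i<m. \<forall>j<n. holo_fun X (V x) (h i j)) \<and>
      (\<forall>e\<in>T. \<pi> e \<in> V x \<longrightarrow> (\<forall>i<m. \<tau> e i = (\<Sum>j<n. h i j (\<pi> e) * \<sigma> e j)))" ..
  from bchoice[OF this] obtain h where
    h: "\<forall>x\<in>W. x \<in> V x \<and> V x \<subseteq> W \<and> (\<forall>i<m. \<forall>j<n. holo_fun X (V x) (h x i j)) \<and>
      (\<forall>e\<in>T. \<pi> e \<in> V x \<longrightarrow> (\<forall>i<m. \<tau> e i = (\<Sum>j<n. h x i j (\<pi> e) * \<sigma> e j)))" ..
  have h1: "x \<in> V x" and h2: "V x \<subseteq> W"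
    and h3: "i < m \<Longrightarrow> j < n \<Longrightarrow> holo_fun X (V x) (h x i j)"
    and h4: "e \<in> T \<Longrightarrow> \<pi> e \<in> V x \<Longrightarrow> i < m \<Longrightarrow> \<tau> e i = (\<Sum>j<n. h x i j (\<pi> e) * \<sigma> e j)"
    if "x \<in> W" for x i j e
    using bspec[OF h that] by simp_all
  have uniq: "h x i j y = h y i j y" if x: "x \<in> W" and y: "y \<in> V x" and ij: "i < m" "j < n" for x y i j
  proof -
    have yW: "y \<in> W" using h2[OF x] y by (rule subsetD)
    \<comment> \<open>The j-th unit vector: an element of T with these \<sigma>-coordinates reads
      off column j of any matrix valid at y.\<close>
    define u :: "nat \<Rightarrow> complex" where "u l = (if l = j then 1 else 0)" for l
    have "u \<in> Cn n" using ij by (auto simp: u_def Cn_def)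
    from sur[OF yW this] obtain e where e: "e \<in> T" "\<pi> e = y" "\<sigma> e = u" by (elim bexE conjE)
    have *: "(\<Sum>l<n. a l * u l) = a j" for a :: "nat \<Rightarrow> complex"
      using ij by (simp add: u_def if_distrib[of "\<lambda>t. _ * t"] cong: if_cong)
    show ?thesis
      using h4[OF x e(1) _ ij(1)] h4[OF yW e(1) _ ij(1)] y h1[OF yW] by (simp add: e *)
  qed
  show ?thesis
  proof (rule holo_matrixI[where h = "\<lambda>i j y. h y i j y"])
    fix i j assume ij: "i < m" "j < n"
    show "holo_fun X W (\<lambda>y. h y i j y)"
    proof (rule holo_fun_local[OF X])
      fix x assume x: "x \<in> W"
      have "holo_fun X (V x) (\<lambda>y. h y i j y)"
        by (rule holo_fun_cong[OF X h3[OF x ij]]) (rule uniq[OF x _ ij])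
      then show "\<exists>V. x \<in> V \<and> V \<subseteq> W \<and> holo_fun X V (\<lambda>y. h y i j y)"
        using h1[OF x] h2[OF x] by (intro exI[of _ "V x"] conjI)
    qed
  next
    fix e i assume "e \<in> T" "\<pi> e \<in> W" "i < m"
    then show "\<tau> e i = (\<Sum>j<n. h (\<pi> e) i j (\<pi> e) * \<sigma> e j)" using h4 h1 by simp
  qed
qed

lemma fibre_iso_surj:
  assumes "fibre_iso E U \<sigma>" "x \<in> U" "y \<in> Cn (vrank E)"
  shows "\<exists>e\<in>total E. bproj E e = x \<and> \<sigma> e = y"
proof -
  have "bij_betw \<sigma> (bfibre E x) (Cn (vrank E))" using assms by (simp add: fibre_iso_def)
  then have "y \<in> \<sigma> ` bfibre E x" using assms(3) by (simp add: bij_betw_def)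
  then show ?thesis by (auto simp: bfibre_def)
qed

lemma fibre_iso_inj:
  assumes "fibre_iso E U \<sigma>" "bproj E e \<in> U" "e \<in> total E" "e' \<in> total E" "bproj E e = bproj E e'" "\<sigma> e = \<sigma> e'"
  shows "e = e'"
proof -
  have "inj_on \<sigma> (bfibre E (bproj E e))" using assms by (simp add: fibre_iso_def bij_betw_def)
  then show ?thesis using assms by (auto simp: bfibre_def dest: inj_onD)
qed

lemma fibre_iso_Cn:
  assumes "fibre_iso E U \<sigma>" "bproj E e \<in> U" "e \<in> total E"
  shows "\<sigma> e \<in> Cn (vrank E)"
proof -
  have "bij_betw \<sigma> (bfibre E (bproj E e)) (Cn (vrank E))" using assms by (simp add: fibre_iso_def)
  then show ?thesis using assms by (auto simp: bfibre_def bij_betw_def)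
qed

lemma bundle_map_onI:
  assumes "holo_map (base E) W (base E') f"
    "\<And>e. e \<in> total E \<Longrightarrow> bproj E e \<in> W \<Longrightarrow> F e \<in> total E' \<and> bproj E' (F e) = f (bproj E e)"
    "\<And>U \<sigma> V \<tau>. (U, \<sigma>) \<in> trivs E \<Longrightarrow> (V, \<tau>) \<in> trivs E' \<Longrightarrow>
      holo_matrix (base E) {x \<in> W \<inter> U. f x \<in> V} (vrank E') (vrank E) (total E) (bproj E) \<sigma> (\<lambda>e. \<tau> (F e))"
  shows "bundle_map_on W E E' f F"
  unfolding bundle_map_on_def Ball_def split_paired_All prod.case
proof (intro conjI allI impI)
  fix e assume "e \<in> total E" "bproj E e \<in> W"
  from assms(2)[OF this] show "F e \<in> total E'" "bproj E' (F e) = f (bproj E e)" by simp_all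
qed (rule assms(1), rule assms(3))

lemma bundle_map_onD:
  assumes "bundle_map_on W E E' f F"
  shows "holo_map (base E) W (base E') f"
    "e \<in> total E \<Longrightarrow> bproj E e \<in> W \<Longrightarrow> F e \<in> total E'"
    "e \<in> total E \<Longrightarrow> bproj E e \<in> W \<Longrightarrow> bproj E' (F e) = f (bproj E e)"
    "(U, \<sigma>) \<in> trivs E \<Longrightarrow> (V, \<tau>) \<in> trivs E' \<Longrightarrow>
      holo_matrix (base E) {x \<in> W \<inter> U. f x \<in> V} (vrank E') (vrank E) (total E) (bproj E) \<sigma> (\<lambda>e. \<tau> (F e))"
proof -
  note d = assms[unfolded bundle_map_on_def]
  show "holo_map (base E) W (base E') f" using d by (elim conjE)
  have 2: "\<forall>e\<in>total E. bproj E e \<in> W \<longrightarrow> F e \<in> total E' \<and> bproj E' (F e) = f (bproj E e)"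
    using d by (elim conjE)
  then show "e \<in> total E \<Longrightarrow> bproj E e \<in> W \<Longrightarrow> F e \<in> total E'"
    "e \<in> total E \<Longrightarrow> bproj E e \<in> W \<Longrightarrow> bproj E' (F e) = f (bproj E e)" by simp_all
  have 3: "\<forall>(U, \<sigma>) \<in> trivs E. \<forall>(V, \<tau>) \<in> trivs E'.
        holo_matrix (base E) {x \<in> W \<inter> U. f x \<in> V} (vrank E') (vrank E) (total E) (bproj E)
          \<sigma> (\<lambda>e. \<tau> (F e))"
    using d by (elim conjE)
  show "(U, \<sigma>) \<in> trivs E \<Longrightarrow> (V, \<tau>) \<in> trivs E' \<Longrightarrow>
      holo_matrix (base E) {x \<in> W \<inter> U. f x \<in> V} (vrank E') (vrank E) (total E) (bproj E) \<sigma> (\<lambda>e. \<tau> (F e))"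
    using 3 unfolding Ball_def split_paired_All prod.case by blast
qed

text \<open>Lets a bundle map over W be replaced by a formula that agrees with it only over
  W.\<close>

lemma bundle_map_on_cong:
  assumes "bundle_map_on W E E' f F" "\<And>x. x \<in> W \<Longrightarrow> f x = g x"
    "\<And>e. e \<in> total E \<Longrightarrow> bproj E e \<in> W \<Longrightarrow> F e = G e" and X: "holo_atlas (base E)"
  shows "bundle_map_on W E E' g G"
proof (rule bundle_map_onI)
  have *: "{x \<in> W. f x \<in> V} = {x \<in> W. g x \<in> V}" for V using assms(2) by auto
  show "holo_map (base E) W (base E') g"
  proof (rule holo_mapI)
    note f = bundle_map_onD(1)[OF assms(1)]
    show "mopen (base E) W" by (rule holo_mapD(1)[OF f])
    show "g x \<in> mpoints (base E')" if "x \<in> W" for x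
      using holo_mapD(2)[OF f that] assms(2)[OF that] by simp
    fix V \<psi> j assume V: "(V, \<psi>) \<in> charts (base E')"
    show "mopen (base E) {x \<in> W. g x \<in> V}" using holo_mapD(3)[OF f V] by (simp add: *)
    assume "j < mdim (base E')"
    from holo_mapD(4)[OF f V this]
    have "holo_fun (base E) {x \<in> W. f x \<in> V} (\<lambda>x. \<psi> (g x) j)"
      by (rule holo_fun_cong[OF X]) (simp add: assms(2))
    then show "holo_fun (base E) {x \<in> W. g x \<in> V} (\<lambda>x. \<psi> (g x) j)" by (simp add: *)
  qed
  show "G e \<in> total E' \<and> bproj E' (G e) = g (bproj E e)" if "e \<in> total E" "bproj E e \<in> W" for e
    using bundle_map_onD(2,3)[OF assms(1) that] assms(2,3) that by auto
  fix U \<sigma> V \<tau> assume UV: "(U, \<sigma>) \<in> trivs E" "(V, \<tau>) \<in> trivs E'"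
  have **: "{x \<in> W \<inter> U. f x \<in> V} = {x \<in> W \<inter> U. g x \<in> V}" using assms(2) by auto
  obtain h where h: "\<And>i j. i < vrank E' \<Longrightarrow> j < vrank E \<Longrightarrow> holo_fun (base E) {x \<in> W \<inter> U. g x \<in> V} (h i j)"
    "\<And>e i. e \<in> total E \<Longrightarrow> bproj E e \<in> {x \<in> W \<inter> U. g x \<in> V} \<Longrightarrow> i < vrank E' \<Longrightarrow> \<tau> (F e) i = (\<Sum>j<vrank E. h i j (bproj E e) * \<sigma> e j)"
    by (rule holo_matrixE[OF bundle_map_onD(4)[OF assms(1) UV, unfolded **]]) blast
  show "holo_matrix (base E) {x \<in> W \<inter> U. g x \<in> V} (vrank E') (vrank E) (total E) (bproj E) \<sigma> (\<lambda>e. \<tau> (G e))"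
  proof (rule holo_matrixI[where h = h])
    fix e i assume e: "e \<in> total E" "bproj E e \<in> {x \<in> W \<inter> U. g x \<in> V}" "i < vrank E'"
    show "\<tau> (G e) i = (\<Sum>j<vrank E. h i j (bproj E e) * \<sigma> e j)"
      using h(2)[OF e] assms(3)[OF e(1)] e(2) by simp
  qed (rule h(1))
qed

text \<open>The matrix of the composite is the product of the two matrices, but a trivialization of
  the middle bundle is available only near f x; uniqueness of matrices glues the local
  products.\<close>

lemma bundle_map_compose:
  assumes E: "holo_vbundle E" and E': "holo_vbundle E'" and Z: "holo_atlas (base E'')"
    and V: "\<And>V \<tau>. (V, \<tau>) \<in> trivs E'' \<Longrightarrow> mopen (base E'') V"
    and F: "bundle_map_on W E E' f F" and G: "bundle_map_on W' E' E'' g G"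
  shows "bundle_map_on {x \<in> W. f x \<in> W'} E E'' (\<lambda>x. g (f x)) (\<lambda>e. G (F e))"
proof (rule bundle_map_onI)
  have X: "holo_atlas (base E)" and Y: "holo_atlas (base E')"
    by (rule holo_vbundleD(2)[OF E], rule holo_vbundleD(2)[OF E'])
  have fm: "holo_map (base E) W (base E') f" by (rule bundle_map_onD(1)[OF F])
  show gf: "holo_map (base E) {x \<in> W. f x \<in> W'} (base E'') (\<lambda>x. g (f x))"
    by (rule holo_map_compose[OF X Y fm bundle_map_onD(1)[OF G]])
  show "G (F e) \<in> total E'' \<and> bproj E'' (G (F e)) = g (f (bproj E e))"
    if "e \<in> total E" "bproj E e \<in> {x \<in> W. f x \<in> W'}" for e
    using bundle_map_onD(2,3)[OF F] bundle_map_onD(2,3)[OF G] that by auto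
  fix U \<sigma> V \<tau> assume UV: "(U, \<sigma>) \<in> trivs E" "(V, \<tau>) \<in> trivs E''"
  have U: "mopen (base E) U" "fibre_iso E U \<sigma>" by (rule holo_vbundleD(5,6)[OF E UV(1)])+
  let ?D = "{x \<in> {x \<in> W. f x \<in> W'} \<inter> U. g (f x) \<in> V}"
  show "holo_matrix (base E) ?D (vrank E'') (vrank E) (total E) (bproj E) \<sigma> (\<lambda>e. \<tau> (G (F e)))"
  proof (rule holo_matrix_local[OF X])
    show "\<exists>e\<in>total E. bproj E e = x \<and> \<sigma> e = y" if "x \<in> ?D" "y \<in> Cn (vrank E)" for x y
      by (rule fibre_iso_surj[OF U(2)]) (use that in auto)
    fix x assume x: "x \<in> ?D"
    then have "f x \<in> mpoints (base E')" using holo_mapD(2)[OF fm] by auto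
    then obtain c where "c \<in> trivs E'" "f x \<in> fst c" unfolding holo_vbundleD(4)[OF E', symmetric] by blast
    then obtain C \<rho> where C: "(C, \<rho>) \<in> trivs E'" "f x \<in> C" by (metis prod.collapse)
    have Cm: "mopen (base E') C" by (rule holo_vbundleD(5)[OF E' C(1)])
    let ?C = "{x \<in> W \<inter> U. f x \<in> C}" and ?B = "{y \<in> W' \<inter> C. g y \<in> V}"
    obtain h where h: "\<And>i j. i < vrank E' \<Longrightarrow> j < vrank E \<Longrightarrow> holo_fun (base E) ?C (h i j)"
      "\<And>e i. e \<in> total E \<Longrightarrow> bproj E e \<in> ?C \<Longrightarrow> i < vrank E' \<Longrightarrow> \<rho> (F e) i = (\<Sum>j<vrank E. h i j (bproj E e) * \<sigma> e j)"
      by (rule holo_matrixE[OF bundle_map_onD(4)[OF F UV(1) C(1)]]) blast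
    obtain l where l: "\<And>i j. i < vrank E'' \<Longrightarrow> j < vrank E' \<Longrightarrow> holo_fun (base E') ?B (l i j)"
      "\<And>e i. e \<in> total E' \<Longrightarrow> bproj E' e \<in> ?B \<Longrightarrow> i < vrank E'' \<Longrightarrow> \<tau> (G e) i = (\<Sum>j<vrank E'. l i j (bproj E' e) * \<rho> e j)"
      by (rule holo_matrixE[OF bundle_map_onD(4)[OF G C(1) UV(2)]]) blast
    let ?A = "U \<inter> ({x \<in> {x \<in> W. f x \<in> W'}. g (f x) \<in> V} \<inter> {x \<in> W. f x \<in> C})"
    have A: "mopen (base E) ?A"
      by (intro mopen_Int[OF X] U holo_map_preimage[OF X Y fm Cm] holo_map_preimage[OF X Z gf V[OF UV(2)]])
    show "\<exists>A. x \<in> A \<and> A \<subseteq> ?D \<and> holo_matrix (base E) A (vrank E'') (vrank E) (total E) (bproj E) \<sigma> (\<lambda>e. \<tau> (G (F e)))"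
    proof (intro exI[of _ ?A] conjI)
      show "x \<in> ?A" using x C by auto
      show "holo_matrix (base E) ?A (vrank E'') (vrank E) (total E) (bproj E) \<sigma> (\<lambda>e. \<tau> (G (F e)))"
      proof (rule holo_matrixI[where h = "\<lambda>i j x. \<Sum>p<vrank E'. l i p (f x) * h p j x"])
        fix i j assume ij: "i < vrank E''" "j < vrank E"
        show "holo_fun (base E) ?A (\<lambda>x. \<Sum>p<vrank E'. l i p (f x) * h p j x)"
        proof (intro holo_fun_sum[OF X A] holo_fun_mult[OF X])
          fix p assume p: "p \<in> {..<vrank E'}"
          show "holo_fun (base E) ?A (h p j)"
            using p ij by (intro holo_fun_subset[OF X h(1) A]) auto
          show "holo_fun (base E) ?A (\<lambda>x. l i p (f x))"
            using p ij by (intro holo_fun_subset[OF X holo_fun_pullback[OF X Y fm l(1)] A]) auto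
        qed
      next
        fix e i assume e: "e \<in> total E" "bproj E e \<in> ?A" and i: "i < vrank E''"
        have Fe: "F e \<in> total E'" "bproj E' (F e) = f (bproj E e)"
          using bundle_map_onD(2,3)[OF F e(1)] e(2) by auto
        then have "\<tau> (G (F e)) i = (\<Sum>p<vrank E'. l i p (f (bproj E e)) * \<rho> (F e) p)"
          using l(2)[OF Fe(1) _ i] e by simp
        also have "\<dots> = (\<Sum>p<vrank E'. \<Sum>j<vrank E. l i p (f (bproj E e)) * h p j (bproj E e) * \<sigma> e j)"
          using e by (intro sum.cong refl) (simp add: h(2) sum_distrib_left mult.assoc)
        also have "\<dots> = (\<Sum>j<vrank E. (\<Sum>p<vrank E'. l i p (f (bproj E e)) * h p j (bproj E e)) * \<sigma> e j)"
          by (subst sum.swap) (simp add: sum_distrib_right)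
        finally show "\<tau> (G (F e)) i = (\<Sum>j<vrank E. (\<Sum>p<vrank E'. l i p (f (bproj E e)) * h p j (bproj E e)) * \<sigma> e j)" .
      qed
    qed auto
  qed
qed

text \<open>The numeral 1 must survive simplification, since the lemmas below are phrased with
  \<open>gr_odd 1\<close>, \<open>P11 1\<close>, \<open>Zk k 1\<close> and
  \<open>SC 1\<close>.\<close>

declare One_nat_def [simp del]

section \<open>Points over \<open>\<real>\<^bsup>0|0\<^esup>\<close> and \<open>\<real>\<^bsup>0|1\<^esup>\<close>\<close>

lemma grassmann_eqI: "(\<And>A. gcoeff x A = gcoeff y A) \<Longrightarrow> x = y"
  by (simp add: gcoeff_inject[symmetric] fun_eq_iff)

lemma gcoeff_simps [simp]:
  "gcoeff 0 A = 0" "gcoeff 1 A = (if A = {} then 1 else 0)"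
  "gcoeff (x + y) A = gcoeff x A + gcoeff y A"
  "gcoeff (x - y) A = gcoeff x A - gcoeff y A"
  "gcoeff (- x) A = - gcoeff x A"
  "gcoeff (gconst c) A = (if A = {} then c else 0)"
  "gcoeff geta A = (if A = {0} then 1 else 0)"
  by (simp_all add: zero_grassmann.rep_eq one_grassmann.rep_eq plus_grassmann.rep_eq
      minus_grassmann.rep_eq uminus_grassmann.rep_eq gconst.rep_eq geta.rep_eq)

lemma gconst_eq_iff [simp]: "gconst c = gconst d \<longleftrightarrow> c = d"
  by (auto dest: arg_cong[where f = "\<lambda>x. gcoeff x {}"])

lemma gconst_eq_1_iff [simp]: "gconst c = 1 \<longleftrightarrow> c = 1"
  using gconst_eq_iff[of c 1] by simp

lemma gconst_diff: "gconst (c - d) = gconst c - gconst d"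
  using gconst_add[of c "- d"] by (simp add: gconst_minus)

lemma gbody_gconst [simp]: "gbody (gconst c) = c"
  by (simp add: gbody_def)

definition godd :: "complex \<Rightarrow> grassmann" where
  "godd v = gconst v * geta"

lemma gcoeff_godd [simp]: "gcoeff (godd v) A = (if A = {0} then v else 0)"
  by (simp add: godd_def gconst_times)

lemma godd_eq_iff [simp]: "godd v = godd w \<longleftrightarrow> v = w"
  by (auto dest: arg_cong[where f = "\<lambda>x. gcoeff x {0}"])

lemma godd_simps: "godd 0 = 0" "godd (v + w) = godd v + godd w" "godd (- v) = - godd v"
  "gconst c * godd v = godd (c * v)" "godd v * gconst c = godd (c * v)"
  by (rule grassmann_eqI; simp add: gconst_times times_gconst)+

lemma godd_diff: "godd (v - w) = godd v - godd w"
  by (rule grassmann_eqI) simp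

text \<open>A nonzero term needs B = {0} and A - B = {0} at once, which is impossible.\<close>

lemma godd_mult_godd [simp]: "godd v * godd w = 0"
proof (rule grassmann_eqI)
  fix A
  have "(-1) ^ inversions B (A - B) * gcoeff (godd v) B * gcoeff (godd w) (A - B) = 0" for B
    by (cases "B = {0}") auto
  then show "gcoeff (godd v * godd w) A = gcoeff 0 A"
    unfolding times_grassmann.rep_eq by (simp only: sum.neutral_const gcoeff_simps)
qed

lemma subset_lessThan_1: "A \<subseteq> {..<1::nat} \<longleftrightarrow> A = {} \<or> A = {0}"
  by (auto simp: lessThan_Suc)

lemma gr_evenI:
  assumes "\<And>A. A \<noteq> {} \<Longrightarrow> gcoeff x A = 0"
  shows "x \<in> gr_even s"
  unfolding gr_even_def grassmann_alg_def mem_Collect_eq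
  by (intro conjI allI impI; rule assms) (rule notI, simp)+

lemma gr_oddI:
  assumes "\<And>A. A \<noteq> {0} \<Longrightarrow> gcoeff x A = 0" "0 < s"
  shows "x \<in> gr_odd s"
  unfolding gr_odd_def grassmann_alg_def mem_Collect_eq
  by (intro conjI allI impI; rule assms) (rule notI, simp add: assms(2))+

lemma gr_evenD:
  assumes "x \<in> gr_even s"
  shows "\<not> A \<subseteq> {..<s} \<Longrightarrow> gcoeff x A = 0" "odd (card A) \<Longrightarrow> gcoeff x A = 0"
  using assms unfolding gr_even_def grassmann_alg_def mem_Collect_eq by simp_all

lemma gr_oddD:
  assumes "x \<in> gr_odd s"
  shows "\<not> A \<subseteq> {..<s} \<Longrightarrow> gcoeff x A = 0" "even (card A) \<Longrightarrow> gcoeff x A = 0"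
  using assms unfolding gr_odd_def grassmann_alg_def mem_Collect_eq by simp_all

text \<open>With at most one generator the only possible nonempty index set is {0}, which has odd
  cardinality.\<close>

lemma gr_even_01:
  assumes "s \<le> 1"
  shows "gr_even s = range gconst"
proof (intro equalityI subsetI)
  fix x assume x: "x \<in> gr_even s"
  have "gcoeff x A = 0" if "A \<noteq> {}" for A
  proof (cases "A = {0}")
    case True
    then show ?thesis by (intro gr_evenD(2)[OF x]) simp
  next
    case False
    have *: "{..<s} \<subseteq> {..<1}" using assms by simp
    have "\<not> A \<subseteq> {..<1}" using False that by (simp add: subset_lessThan_1)
    then have "\<not> A \<subseteq> {..<s}" by (rule contrapos_nn[OF _ subset_trans[OF _ *]])
    then show ?thesis by (rule gr_evenD(1)[OF x])
  qed
  then have "x = gconst (gcoeff x {})" by (intro grassmann_eqI) simp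
  then show "x \<in> range gconst" by (rule range_eqI[of _ gconst])
next
  fix x assume "x \<in> range gconst"
  then obtain c where "x = gconst c" by (elim rangeE)
  then show "x \<in> gr_even s" by (intro gr_evenI) simp
qed

lemma gr_odd_0: "gr_odd 0 = {0}"
proof (intro equalityI subsetI)
  fix x assume x: "x \<in> gr_odd 0"
  have "gcoeff x A = 0" for A
  proof (cases "A = {}")
    case True
    then show ?thesis by (intro gr_oddD(2)[OF x]) simp
  next
    case False
    then show ?thesis by (intro gr_oddD(1)[OF x]) simp
  qed
  then have "x = 0" by (intro grassmann_eqI) simp
  then show "x \<in> {0}" by simp
next
  fix x :: grassmann assume "x \<in> {0}"
  then show "x \<in> gr_odd 0" by (simp add: gr_odd_def grassmann_alg_def)
qed

lemma gr_odd_1: "gr_odd 1 = range godd"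
proof (intro equalityI subsetI)
  fix x assume x: "x \<in> gr_odd 1"
  have "gcoeff x A = 0" if "A \<noteq> {0}" for A
  proof (cases "A = {}")
    case True
    then show ?thesis by (intro gr_oddD(2)[OF x]) simp
  next
    case False
    then have "\<not> A \<subseteq> {..<1}" using that by (simp add: subset_lessThan_1)
    then show ?thesis by (rule gr_oddD(1)[OF x])
  qed
  then have "x = godd (gcoeff x {0})" by (intro grassmann_eqI) simp
  then show "x \<in> range godd" by (rule range_eqI[of _ godd])
next
  fix x assume "x \<in> range godd"
  then obtain c where "x = godd c" by (elim rangeE)
  then show "x \<in> gr_odd 1" by (intro gr_oddI) simp_all
qed

lemma gr_units_01:
  assumes "s \<le> 1"
  shows "gr_units s = gconst ` (- {0})"
proof (intro equalityI subsetI)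
  fix x assume "x \<in> gr_units s"
  then obtain u v where "x = gconst u" "gconst u * gconst v = 1"
    by (auto simp: gr_units_def gr_even_01[OF assms])
  then show "x \<in> gconst ` (- {0})" by (auto simp flip: gconst_mult)
next
  fix x assume "x \<in> gconst ` (- {0})"
  then obtain u where u: "x = gconst u" "u \<noteq> 0" by auto
  then have "gconst u * gconst (inverse u) = 1" by (simp flip: gconst_mult)
  then show "x \<in> gr_units s" using u unfolding gr_units_def gr_even_01[OF assms] by blast
qed

text \<open>For s at most 1 the even units are the nonzero complex numbers, so a point is a class of
  triples under complex scaling. With v = 0 the same class also represents a point over s = 0; thus
  the reduced points sit inside \<open>P11 1\<close> as the zero section.\<close>

definition pt :: "complex \<Rightarrow> complex \<Rightarrow> complex \<Rightarrow> spoint" where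
  "pt x y v = {(gconst (u * x), gconst (u * y), godd (u * v)) | u. u \<noteq> 0}"

lemma pt_image: "pt x y v = (\<lambda>u. (gconst (u * x), gconst (u * y), godd (u * v))) ` (- {0})"
  unfolding pt_def by auto

lemma spt_eq_pt:
  assumes "s \<le> 1"
  shows "spt s (gconst x, gconst y, godd v) = pt x y v"
proof -
  have "spt s (gconst x, gconst y, godd v) = (\<lambda>u. (u * gconst x, u * gconst y, u * godd v)) ` gr_units s"
    unfolding spt_def by auto
  also have "\<dots> = pt x y v"
    unfolding gr_units_01[OF assms] image_image pt_image by (simp add: gconst_mult godd_simps)
  finally show ?thesis .
qed

lemma spt_eq_pt_0:
  assumes "s \<le> 1"
  shows "spt s (gconst x, gconst y, 0) = pt x y 0"
  using spt_eq_pt[OF assms, of x y 0] by (simp add: godd_simps)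

lemma pt_mem: "(gconst x, gconst y, godd v) \<in> pt x y v"
  unfolding pt_def by (rule CollectI, rule exI[of _ 1]) simp

lemma pt_eq_iff:
  "pt x y v = pt x' y' v' \<longleftrightarrow> (\<exists>u. u \<noteq> 0 \<and> x' = u * x \<and> y' = u * y \<and> v' = u * v)"
proof
  assume "pt x y v = pt x' y' v'"
  then have "(gconst x', gconst y', godd v') \<in> pt x y v" using pt_mem by simp
  then show "\<exists>u. u \<noteq> 0 \<and> x' = u * x \<and> y' = u * y \<and> v' = u * v" by (auto simp: pt_def)
next
  assume "\<exists>u. u \<noteq> 0 \<and> x' = u * x \<and> y' = u * y \<and> v' = u * v"
  then obtain u where u: "u \<noteq> 0" "x' = u * x" "y' = u * y" "v' = u * v" by blast
  show "pt x y v = pt x' y' v'"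
  proof (intro equalityI subsetI)
    fix z assume "z \<in> pt x y v"
    then obtain w where w: "w \<noteq> 0" "z = (gconst (w * x), gconst (w * y), godd (w * v))" by (auto simp: pt_def)
    show "z \<in> pt x' y' v'" unfolding pt_def
      by (rule CollectI, rule exI[of _ "w / u"]) (use u w in auto)
  next
    fix z assume "z \<in> pt x' y' v'"
    then obtain w where w: "w \<noteq> 0" "z = (gconst (w * x'), gconst (w * y'), godd (w * v'))" by (auto simp: pt_def)
    show "z \<in> pt x y v" unfolding pt_def
      by (rule CollectI, rule exI[of _ "w * u"]) (use u w in \<open>auto simp: mult.assoc\<close>)
  qed
qed

lemma pt_eqD: "pt x y v = pt x y w \<Longrightarrow> x \<noteq> 0 \<or> y \<noteq> 0 \<Longrightarrow> v = w"
  unfolding pt_eq_iff by (elim exE) auto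

lemma P11_1: "P11 1 = {pt x y v | x y v. x \<noteq> 0 \<or> y \<noteq> 0}"
proof -
  have eq: "homog 1 = {(gconst x, gconst y, godd v) | x y v. x \<noteq> 0 \<or> y \<noteq> 0}"
    unfolding homog_def gr_even_01[OF order_refl] gr_odd_1 gr_units_01[OF order_refl] by auto
  show ?thesis
  proof (intro equalityI subsetI)
    fix p assume "p \<in> P11 1"
    then obtain t where t: "t \<in> homog 1" "p = spt 1 t" unfolding P11_def by (elim imageE)
    from t(1) have "\<exists>x y v. t = (gconst x, gconst y, godd v) \<and> (x \<noteq> 0 \<or> y \<noteq> 0)"
      unfolding eq by (rule CollectD)
    then obtain x y v where xy: "t = (gconst x, gconst y, godd v)" "x \<noteq> 0 \<or> y \<noteq> 0" by (elim exE conjE)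
    have "p = pt x y v" unfolding t(2) xy(1) by (rule spt_eq_pt[OF order_refl])
    with xy(2) show "p \<in> {pt x y v | x y v. x \<noteq> 0 \<or> y \<noteq> 0}" by blast
  next
    fix p assume "p \<in> {pt x y v | x y v. x \<noteq> 0 \<or> y \<noteq> 0}"
    then have "\<exists>x y v. p = pt x y v \<and> (x \<noteq> 0 \<or> y \<noteq> 0)" by (rule CollectD)
    then obtain x y v where xy: "p = pt x y v" "x \<noteq> 0 \<or> y \<noteq> 0" by (elim exE conjE)
    have "(gconst x, gconst y, godd v) \<in> homog 1" unfolding eq using xy(2) by (intro CollectI exI conjI) (rule refl)
    moreover have "p = spt 1 (gconst x, gconst y, godd v)" unfolding xy(1) by (rule spt_eq_pt[OF order_refl, symmetric])
    ultimately show "p \<in> P11 1" unfolding P11_def by (rule rev_image_eqI)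
  qed
qed

lemma P11_0: "P11 0 = {pt x y 0 | x y. x \<noteq> 0 \<or> y \<noteq> 0}"
proof -
  have eq: "homog 0 = {(gconst x, gconst y, 0) | x y. x \<noteq> 0 \<or> y \<noteq> 0}"
    unfolding homog_def gr_even_01[of 0, simplified] gr_odd_0 gr_units_01[of 0, simplified] by auto
  show ?thesis
  proof (intro equalityI subsetI)
    fix p assume "p \<in> P11 0"
    then obtain t where t: "t \<in> homog 0" "p = spt 0 t" unfolding P11_def by (elim imageE)
    from t(1) have "\<exists>x y. t = (gconst x, gconst y, 0) \<and> (x \<noteq> 0 \<or> y \<noteq> 0)"
      unfolding eq by (rule CollectD)
    then obtain x y where xy: "t = (gconst x, gconst y, 0)" "x \<noteq> 0 \<or> y \<noteq> 0" by (elim exE conjE)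
    have "p = pt x y 0" unfolding t(2) xy(1) by (rule spt_eq_pt_0[OF zero_le])
    with xy(2) show "p \<in> {pt x y 0 | x y. x \<noteq> 0 \<or> y \<noteq> 0}" by blast
  next
    fix p assume "p \<in> {pt x y 0 | x y. x \<noteq> 0 \<or> y \<noteq> 0}"
    then have "\<exists>x y. p = pt x y 0 \<and> (x \<noteq> 0 \<or> y \<noteq> 0)" by (rule CollectD)
    then obtain x y where xy: "p = pt x y 0" "x \<noteq> 0 \<or> y \<noteq> 0" by (elim exE conjE)
    have "(gconst x, gconst y, 0) \<in> homog 0" unfolding eq using xy(2) by (intro CollectI exI conjI) (rule refl)
    moreover have "p = spt 0 (gconst x, gconst y, 0)" unfolding xy(1) by (rule spt_eq_pt_0[OF zero_le, symmetric])
    ultimately show "p \<in> P11 0" unfolding P11_def by (rule rev_image_eqI)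
  qed
qed

lemma pt_in_P11 [simp]: "x \<noteq> 0 \<or> y \<noteq> 0 \<Longrightarrow> pt x y v \<in> P11 1" "x \<noteq> 0 \<or> y \<noteq> 0 \<Longrightarrow> pt x y 0 \<in> P11 0"
  unfolding P11_1 P11_0 by (rule CollectI, intro exI conjI, rule refl, assumption)+

lemma P11_0_subset: "P11 0 \<subseteq> P11 1"
  unfolding P11_1 P11_0 by (intro Collect_mono impI) (elim exE, intro exI)

lemma P11_1_cases:
  assumes "p \<in> P11 1"
  obtains x y v where "p = pt x y v" "x \<noteq> 0 \<or> y \<noteq> 0"
  using assms by (auto simp: P11_1)

lemma P11_0_cases:
  assumes "p \<in> P11 0"
  obtains x y where "p = pt x y 0" "x \<noteq> 0 \<or> y \<noteq> 0"
  using assms by (auto simp: P11_0)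

text \<open>\<open>pt_red\<close>, \<open>odd_neg\<close>, \<open>S_scale\<close> and
  \<open>pt_act\<close> are images of sets of representatives, so it suffices to compare the
  representatives with the same scalar u.\<close>

lemma image_pt:
  "(\<lambda>(Z1, Z2, \<Theta>). (f Z1 Z2 \<Theta>, g Z1 Z2 \<Theta>, h Z1 Z2 \<Theta>)) ` pt x y v = pt x' y' v'"
  if "\<And>u. u \<noteq> 0 \<Longrightarrow> f (gconst (u * x)) (gconst (u * y)) (godd (u * v)) = gconst (u * x')"
    "\<And>u. u \<noteq> 0 \<Longrightarrow> g (gconst (u * x)) (gconst (u * y)) (godd (u * v)) = gconst (u * y')"
    "\<And>u. u \<noteq> 0 \<Longrightarrow> h (gconst (u * x)) (gconst (u * y)) (godd (u * v)) = godd (u * v')"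
proof -
  let ?F = "\<lambda>(Z1, Z2, \<Theta>). (f Z1 Z2 \<Theta>, g Z1 Z2 \<Theta>, h Z1 Z2 \<Theta>)"
  show ?thesis unfolding pt_image image_image by (rule image_cong) (use that in auto)
qed

lemma pt_red_pt [simp]: "pt_red (pt x y v) = pt x y 0"
  unfolding pt_red_def by (rule image_pt) (simp_all add: godd_simps)

lemma odd_neg_pt [simp]: "odd_neg (pt x y v) = pt x y (- v)"
  unfolding odd_neg_def by (rule image_pt) (simp_all add: godd_simps(3)[symmetric])

lemma S_scale_pt [simp]: "S_scale t (pt x y v) = pt x y (t * v)"
  unfolding S_scale_def by (rule image_pt) (simp_all add: godd_simps(4) mult.left_commute)

text \<open>Since x or y is nonzero, two representatives with the same even coordinates have the
  same scalar; therefore adding odd coordinates stays in one class.\<close>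

lemma S_add_pt [simp]:
  assumes "x \<noteq> 0 \<or> y \<noteq> 0"
  shows "S_add (pt x y v) (pt x y w) = pt x y (v + w)"
proof (intro equalityI subsetI)
  fix z assume "z \<in> S_add (pt x y v) (pt x y w)"
  then obtain Z1 Z2 T T' where z: "z = (Z1, Z2, T + T')" "(Z1, Z2, T) \<in> pt x y v" "(Z1, Z2, T') \<in> pt x y w"
    unfolding S_add_def by blast
  from z(2) obtain u where "u \<noteq> 0 \<and> (Z1, Z2, T) = (gconst (u * x), gconst (u * y), godd (u * v))"
    unfolding pt_def by blast
  moreover from z(3) obtain u' where "u' \<noteq> 0 \<and> (Z1, Z2, T') = (gconst (u' * x), gconst (u' * y), godd (u' * w))"
    unfolding pt_def by blast
  ultimately have u: "u \<noteq> 0" "Z1 = gconst (u * x)" "Z2 = gconst (u * y)" "T = godd (u * v)"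
    "gconst (u * x) = gconst (u' * x)" "gconst (u * y) = gconst (u' * y)" "T' = godd (u' * w)" by auto
  then have "u = u'" using assms by auto
  then show "z \<in> pt x y (v + w)" unfolding pt_def
    by (intro CollectI exI[of _ u]) (use u z in \<open>simp add: godd_simps distrib_left\<close>)
next
  fix z assume "z \<in> pt x y (v + w)"
  then obtain u where u: "u \<noteq> 0" "z = (gconst (u * x), gconst (u * y), godd (u * (v + w)))"
    by (auto simp: pt_def)
  have "(gconst (u * x), gconst (u * y), godd (u * a)) \<in> pt x y a" for a
    using u(1) unfolding pt_def by blast
  moreover have "z = (gconst (u * x), gconst (u * y), godd (u * v) + godd (u * w))"
    using u(2) by (simp add: distrib_left godd_simps)
  ultimately show "z \<in> S_add (pt x y v) (pt x y w)" unfolding S_add_def by blast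
qed

text \<open>
  Products of odd elements over \<open>\<real>\<^bsup>0|1\<^esup>\<close> vanish, so the equations for \<open>\<gamma>\<close> and \<open>\<delta>\<close> are linear in
  \<open>\<alpha>\<close> and \<open>\<beta>\<close> with determinant \<open>ad - bc = 1\<close>.  Hence \<open>\<gamma>\<close> and \<open>\<delta>\<close> are free parameters, which translate
  \<open>\<Theta>\<close> by a section of \<open>S\<close>.
\<close>

definition sc1_mat :: "complex \<Rightarrow> complex \<Rightarrow> complex \<Rightarrow> complex \<Rightarrow> complex \<Rightarrow> complex \<Rightarrow> scmat" where
  "sc1_mat a b c d g h = \<lparr>sc_a = gconst a, sc_c = gconst c, sc_gamma = godd g, sc_b = gconst b,
     sc_d = gconst d, sc_delta = godd h, sc_alpha = godd (a * h - b * g), sc_beta = godd (c * h - d * g), sc_e = 1\<rparr>"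

lemma sc1_mat_eq_sl2: "sc1_mat a b c d 0 0 = sl2_mat a b c d"
  by (simp add: sc1_mat_def sl2_mat_def godd_simps)

text \<open>Over s = 0 the only odd element is 0, and a complex e with body 1 is 1, so the
  determinant condition is what remains. This identifies the moduli points over s = 0 with
  \<open>M0\<close>.\<close>

lemma SC_0_carrier: "carrier (SC 0) = carrier SL2"
proof (intro equalityI subsetI)
  fix M assume M: "M \<in> carrier (SC 0)"
  obtain a c g b d h al be e where M': "M = \<lparr>sc_a = a, sc_c = c, sc_gamma = g, sc_b = b, sc_d = d, sc_delta = h,
    sc_alpha = al, sc_beta = be, sc_e = e\<rparr>" by (cases M)
  from M have "a \<in> range gconst" "b \<in> range gconst" "c \<in> range gconst" "d \<in> range gconst" "e \<in> range gconst"
    "al = 0" "be = 0" "g = 0" "h = 0" "a * d - b * c = 1" "gbody e = 1"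
    unfolding SC_def M' gr_odd_0 gr_even_01[of 0, simplified] by auto
  then obtain a' b' c' d' where *: "a = gconst a'" "b = gconst b'" "c = gconst c'" "d = gconst d'" "e = 1"
    "al = 0" "be = 0" "g = 0" "h = 0" "gconst a' * gconst d' - gconst b' * gconst c' = 1" by auto
  then have "a' * d' - b' * c' = 1" by (simp flip: gconst_mult gconst_diff)
  moreover have "M = sl2_mat a' b' c' d'" unfolding M' sl2_mat_def using * by simp
  ultimately show "M \<in> carrier SL2" unfolding SL2_def by auto
next
  fix M assume "M \<in> carrier SL2"
  then obtain a b c d where "M = sl2_mat a b c d" "a * d - b * c = 1" by (auto simp: SL2_def)
  then show "M \<in> carrier (SC 0)" unfolding SC_def gr_odd_0 gr_even_01[of 0, simplified]
    by (auto simp: sl2_mat_def gbody_def simp flip: gconst_mult gconst_diff)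
qed

lemma SC_1_carrier: "carrier (SC 1) = {sc1_mat a b c d g h | a b c d g h. a * d - b * c = 1}"
proof (intro equalityI subsetI)
  fix M assume M: "M \<in> carrier (SC 1)"
  obtain a c g b d h al be e where M': "M = \<lparr>sc_a = a, sc_c = c, sc_gamma = g, sc_b = b, sc_d = d, sc_delta = h,
    sc_alpha = al, sc_beta = be, sc_e = e\<rparr>" by (cases M)
  from M have "a \<in> range gconst" "b \<in> range gconst" "c \<in> range gconst" "d \<in> range gconst" "e \<in> range gconst"
    "al \<in> range godd" "be \<in> range godd" "g \<in> range godd" "h \<in> range godd" "gbody e = 1" and
    eqs: "a * d - b * c - g * h = 1" "c * al - a * be = e * g" "d * al - b * be = e * h"
    unfolding SC_def M' gr_odd_1 gr_even_01[OF order_refl] by auto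
  then obtain a' b' c' d' al' be' g' h' where *: "a = gconst a'" "b = gconst b'" "c = gconst c'" "d = gconst d'" "e = 1"
    "al = godd al'" "be = godd be'" "g = godd g'" "h = godd h'" by auto
  have "a' * d' - b' * c' = 1" using eqs(1) by (simp add: * flip: gconst_mult gconst_diff)
  moreover have g': "g' = c' * al' - a' * be'" "h' = d' * al' - b' * be'"
    using eqs(2,3) by (auto simp: * godd_simps simp flip: godd_diff)
  have "a' * h' - b' * g' = (a' * d' - b' * c') * al'" "c' * h' - d' * g' = (a' * d' - b' * c') * be'"
    unfolding g' by (simp_all add: algebra_simps)
  then have "a' * h' - b' * g' = al'" "c' * h' - d' * g' = be'"
    using \<open>a' * d' - b' * c' = 1\<close> by simp_all
  ultimately have "M = sc1_mat a' b' c' d' g' h'" "a' * d' - b' * c' = 1" unfolding M' sc1_mat_def * by simp_all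
  then show "M \<in> {sc1_mat a b c d g h | a b c d g h. a * d - b * c = 1}" by blast
next
  fix M assume "M \<in> {sc1_mat a b c d g h | a b c d g h. a * d - b * c = 1}"
  then obtain a b c d g h where M: "M = sc1_mat a b c d g h" and det: "a * d - b * c = 1" by blast
  have "c * (a * h - b * g) - a * (c * h - d * g) = (a * d - b * c) * g"
    "d * (a * h - b * g) - b * (c * h - d * g) = (a * d - b * c) * h" by (simp_all add: algebra_simps)
  then have "c * (a * h - b * g) - a * (c * h - d * g) = g"
    "d * (a * h - b * g) - b * (c * h - d * g) = h" using det by simp_all
  then show "M \<in> carrier (SC 1)" using det unfolding SC_def gr_odd_1 gr_even_01[OF order_refl] M sc1_mat_def
    by (auto simp: godd_simps mult.assoc gbody_def simp flip: gconst_mult gconst_diff godd_diff)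
qed

lemma pt_act_sc1 [simp]:
  "pt_act (sc1_mat a b c d g h) (pt x y v) = pt (x * a + y * b) (x * c + y * d) (x * g + y * h + v)"
proof -
  have "gconst x * gconst a + gconst y * gconst b + godd v * godd w = gconst (x * a + y * b)" for x y a b v w
    by (simp add: gconst_add gconst_mult)
  then show ?thesis
    unfolding pt_act_def sc1_mat_def
    by (intro image_pt) (simp_all add: godd_simps algebra_simps)
qed

lemma pt_act_sl2 [simp]: "pt_act (sl2_mat a b c d) (pt x y v) = pt (x * a + y * b) (x * c + y * d) v"
  using pt_act_sc1[of a b c d 0 0 x y v] by (simp add: sc1_mat_eq_sl2)

lemma pt_eqI: "u \<noteq> 0 \<Longrightarrow> x' = u * x \<Longrightarrow> y' = u * y \<Longrightarrow> v' = u * v \<Longrightarrow> pt x y v = pt x' y' v'"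
  unfolding pt_eq_iff by (intro exI[of _ u] conjI)

text \<open>Multiplying the row vector by the adjugate returns (x, y), because the determinant is
  1.\<close>

lemma sl2_nonzero:
  assumes "a * d - b * c = (1::complex)" "x \<noteq> 0 \<or> y \<noteq> 0"
  shows "x * a + y * b \<noteq> 0 \<or> x * c + y * d \<noteq> 0"
proof (rule ccontr)
  assume "\<not> ?thesis"
  then have "x * a + y * b = 0" "x * c + y * d = 0" by auto
  moreover have "x * (a * d - b * c) = (x * a + y * b) * d - (x * c + y * d) * b"
    "y * (a * d - b * c) = (x * c + y * d) * a - (x * a + y * b) * c" by (simp_all add: algebra_simps)
  ultimately show False using assms by simp
qed

text \<open>Turns distinctness of points of the projective line into nonvanishing of a determinant,
  an open condition on holomorphic data.\<close>

lemma pt_zero_eq_iff: "x \<noteq> 0 \<or> y \<noteq> 0 \<Longrightarrow> x' \<noteq> 0 \<or> y' \<noteq> 0 \<Longrightarrow> pt x y 0 = pt x' y' 0 \<longleftrightarrow> x * y' = x' * y"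
proof
  assume "pt x y 0 = pt x' y' 0"
  then show "x * y' = x' * y" by (auto simp: pt_eq_iff)
next
  assume nz: "x \<noteq> 0 \<or> y \<noteq> 0" "x' \<noteq> 0 \<or> y' \<noteq> 0" and eq: "x * y' = x' * y"
  show "pt x y 0 = pt x' y' 0"
  proof (cases "x = 0")
    case True
    then have "y \<noteq> 0" "x' = 0" using nz eq by auto
    then show ?thesis using True nz by (intro pt_eqI[of "y' / y"]) auto
  next
    case False
    then have "x' \<noteq> 0" using nz eq by auto
    then show ?thesis using False eq by (intro pt_eqI[of "x' / x"]) (auto simp: field_simps)
  qed
qed

section \<open>Affine coordinates\<close>

text \<open>\<open>(hx b w, hy b w)\<close> are the homogeneous coordinates of the affine point w
  normalized in chart b, \<open>den\<close> is the coordinate that chart b requires to be nonzero,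
  and \<open>rat\<close> is the affine coordinate. The sign in the True case is that of z_2 =
  -Z_2/Z_1. Both charts are thereby handled by single formulas.\<close>

definition hx :: "bool \<Rightarrow> complex \<Rightarrow> complex" where "hx b w = (if b then 1 else w)"
definition hy :: "bool \<Rightarrow> complex \<Rightarrow> complex" where "hy b w = (if b then - w else 1)"
definition den :: "bool \<Rightarrow> complex \<Rightarrow> complex \<Rightarrow> complex" where "den b x y = (if b then x else y)"
definition rat :: "bool \<Rightarrow> complex \<Rightarrow> complex \<Rightarrow> complex" where "rat b x y = (if b then - y / x else x / y)"

lemma h_nonzero: "hx b w \<noteq> 0 \<or> hy b w \<noteq> 0"
  by (simp add: hx_def hy_def)

lemma den_h [simp]: "den b (hx b w) (hy b w) = 1"
  by (simp add: den_def hx_def hy_def)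

text \<open>Normalizing a representative also divides its odd coordinate, which is why fibre
  coordinates below carry the denominator \<open>den\<close>.\<close>

lemma pt_normal:
  assumes "den b x y \<noteq> 0"
  shows "pt (hx b (rat b x y)) (hy b (rat b x y)) (v / den b x y) = pt x y v"
  by (rule pt_eqI[of "den b x y"]) (use assms in \<open>auto simp: den_def hx_def hy_def rat_def\<close>)

lemma P11_0_iff: "p \<in> P11 0 \<longleftrightarrow> p \<in> P11 1 \<and> pt_red p = p"
proof
  assume "p \<in> P11 0"
  then obtain x y where "p = pt x y 0" "x \<noteq> 0 \<or> y \<noteq> 0" by (rule P11_0_cases)
  then show "p \<in> P11 1 \<and> pt_red p = p" by simp
next
  assume p: "p \<in> P11 1 \<and> pt_red p = p"
  then obtain x y v where "p = pt x y v" "x \<noteq> 0 \<or> y \<noteq> 0" by (metis P11_1_cases)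
  then show "p \<in> P11 0" using p by (metis pt_red_pt pt_in_P11(2))
qed

lemma pt_red_P11: "p \<in> P11 1 \<Longrightarrow> pt_red p \<in> P11 0"
  by (elim P11_1_cases) simp

lemma pt_red_P11_0: "p \<in> P11 0 \<Longrightarrow> pt_red p = p"
  by (simp add: P11_0_iff)

lemma affine_pt_eq: "affine_pt b w = pt (hx b w) (hy b w) 0"
  using spt_eq_pt_0[of 0 1 "-w"] spt_eq_pt_0[of 0 w 1]
  by (simp add: affine_pt_def hx_def hy_def gconst_minus)

lemma affine_pt_inj: "inj (affine_pt b)"
  by (rule injI) (auto simp: affine_pt_eq pt_eq_iff hx_def hy_def split: if_splits)

lemma affine_coord_affine_pt [simp]: "affine_coord b (affine_pt b w) = w"
  by (simp add: affine_coord_def inv_f_f affine_pt_inj)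

lemma affine_pt_rat: "den b x y \<noteq> 0 \<Longrightarrow> affine_pt b (rat b x y) = pt x y 0"
  using pt_normal[of b x y 0] by (simp add: affine_pt_eq)

lemma affine_coord_pt: "den b x y \<noteq> 0 \<Longrightarrow> affine_coord b (pt x y 0) = rat b x y"
  by (metis affine_pt_rat affine_coord_affine_pt)

lemma pt_in_range_affine: "pt x y 0 \<in> range (affine_pt b) \<longleftrightarrow> den b x y \<noteq> 0"
proof
  assume "pt x y 0 \<in> range (affine_pt b)"
  then obtain w where "pt (hx b w) (hy b w) 0 = pt x y 0" by (auto simp: affine_pt_eq)
  then show "den b x y \<noteq> 0" by (auto simp: pt_eq_iff hx_def hy_def den_def)
next
  assume "den b x y \<noteq> 0"
  then show "pt x y 0 \<in> range (affine_pt b)" by (metis affine_pt_rat rangeI)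
qed

lemma affine_pt_in_P11 [simp]: "affine_pt b w \<in> P11 0"
  unfolding affine_pt_eq by (rule pt_in_P11(2)[OF h_nonzero])

lemma affine_pt_coord: "p \<in> range (affine_pt b) \<Longrightarrow> affine_pt b (affine_coord b p) = p"
  by (elim rangeE) simp

lemma geta_eq: "geta = godd 1"
  by (simp add: godd_def)

lemma spinor_frame_affine: "spinor_frame b (affine_pt b w) = pt (hx b w) (hy b w) 1"
  using spt_eq_pt[OF order_refl, of 1 "-w" 1] spt_eq_pt[OF order_refl, of w 1 1]
  unfolding spinor_frame_def geta_eq by (simp add: gconst_minus hx_def hy_def)

lemma spinor_coord_pt:
  assumes "den b x y \<noteq> 0"
  shows "spinor_coord b (pt x y v) = v / den b x y"
proof -
  define w where "w = rat b x y"
  have 1: "pt x y v = pt (hx b w) (hy b w) (v / den b x y)"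
    unfolding w_def by (rule pt_normal[OF assms, symmetric])
  have 2: "spinor_frame b (pt_red (pt x y v)) = pt (hx b w) (hy b w) 1"
    using spinor_frame_affine[of b w] affine_pt_rat[OF assms] by (simp add: w_def)
  show ?thesis unfolding spinor_coord_def 2 S_scale_pt mult_1_right
  proof (rule the_equality)
    fix v' assume "pt x y v = pt (hx b w) (hy b w) v'"
    from pt_eqD[OF trans[OF 1[symmetric] this] h_nonzero] show "v' = v / den b x y" by (rule sym)
  qed (rule 1)
qed

lemma spinor_coord_h [simp]: "spinor_coord b (pt (hx b w) (hy b w) v) = v"
  using spinor_coord_pt[of b "hx b w" "hy b w" v] by simp

lemma spinor_rep:
  assumes "e \<in> P11 1" "pt_red e \<in> range (affine_pt b)"
  shows "e = pt (hx b (affine_coord b (pt_red e))) (hy b (affine_coord b (pt_red e))) (spinor_coord b e)"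
proof -
  obtain x y v where e: "e = pt x y v" "x \<noteq> 0 \<or> y \<noteq> 0" using assms(1) by (rule P11_1_cases)
  then have "den b x y \<noteq> 0" using assms(2) by (simp add: pt_in_range_affine)
  then show ?thesis using pt_normal[of b x y v] by (simp add: e spinor_coord_pt affine_coord_pt)
qed

lemma P11_0_affine:
  assumes "p \<in> P11 0"
  obtains b w where "p = affine_pt b w"
proof -
  obtain x y where p: "p = pt x y 0" "x \<noteq> 0 \<or> y \<noteq> 0" using assms by (rule P11_0_cases)
  then have "den True x y \<noteq> 0 \<or> den False x y \<noteq> 0" by (simp add: den_def)
  then show ?thesis using that affine_pt_rat p(1) by metis
qed

section \<open>Global sections of the spinor bundle\<close>

text \<open>The linear form x g + y h on homogeneous coordinates, viewed as a section. Writing it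
  with a unipotent superconformal matrix ties the sections to the translations in
  \<open>SC 1\<close>.\<close>

definition spin_sec :: "complex \<Rightarrow> complex \<Rightarrow> spoint \<Rightarrow> spoint" where
  "spin_sec g h = (\<lambda>p\<in>P11 0. pt_act (sc1_mat 1 0 0 1 g h) p)"

lemma spin_sec_pt [simp]: "x \<noteq> 0 \<or> y \<noteq> 0 \<Longrightarrow> spin_sec g h (pt x y 0) = pt x y (x * g + y * h)"
  by (simp add: spin_sec_def)

lemma spin_sec_closed: "p \<in> P11 0 \<Longrightarrow> spin_sec g h p \<in> P11 1 \<and> pt_red (spin_sec g h p) = p"
  by (elim P11_0_cases) simp

lemma spin_sec_cong:
  assumes "s \<in> extensional (P11 0)" "\<And>x y. x \<noteq> 0 \<or> y \<noteq> 0 \<Longrightarrow> s (pt x y 0) = pt x y (x * g + y * h)"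
  shows "s = spin_sec g h"
proof (rule extensionalityI[OF assms(1)])
  show "spin_sec g h \<in> extensional (P11 0)" by (simp add: spin_sec_def)
  fix p assume "p \<in> P11 0"
  then obtain x y where "p = pt x y 0" "x \<noteq> 0 \<or> y \<noteq> 0" by (rule P11_0_cases)
  then show "s p = spin_sec g h p" using assms(2) by simp
qed

lemma P1_charts:
  "charts P1_mfd = range (\<lambda>b. (range (affine_pt b), \<lambda>p i. if i = 0 then affine_coord b p else 0))"
  by (auto simp: P1_mfd_def)

lemma spinor_trivs:
  "trivs spinor_bundle = range (\<lambda>b. (range (affine_pt b), \<lambda>e i. if i = 0 then spinor_coord b e else 0))"
  by (auto simp: spinor_bundle_def)

definition C1 :: "complex \<Rightarrow> nat \<Rightarrow> complex" where "C1 w = (\<lambda>i. if i = 0 then w else 0)"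

lemma C1_0: "C1 w 0 = w" by (simp add: C1_def)

lemma Cn_1: "Cn 1 = range C1"
proof (intro equalityI subsetI)
  fix y assume y: "y \<in> Cn 1"
  have "y = C1 (y 0)"
  proof
    fix i show "y i = C1 (y 0) i" using y by (cases "i = 0") (auto simp: C1_def Cn_def)
  qed
  then show "y \<in> range C1" by (rule range_eqI[of _ C1])
qed (auto simp: Cn_def C1_def)

lemma P1_chart_inv:
  "inv_into (range (affine_pt b)) (\<lambda>p i. if i = 0 then affine_coord b p else 0) (C1 w) = affine_pt b w"
proof -
  have *: "(\<lambda>p i. if i = 0 then affine_coord b p else 0) = (\<lambda>p. C1 (affine_coord b p))"
    by (simp add: C1_def)
  have "inj_on (\<lambda>p. C1 (affine_coord b p)) (range (affine_pt b))"
  proof (rule inj_onI)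
    fix p q assume pq: "p \<in> range (affine_pt b)" "q \<in> range (affine_pt b)"
      and "C1 (affine_coord b p) = C1 (affine_coord b q)"
    then have "affine_coord b p = affine_coord b q" by (auto simp: C1_def dest: fun_cong[where x = 0])
    then show "p = q" using pq affine_pt_coord by metis
  qed
  from inv_into_f_f[OF this, of "affine_pt b w"] show ?thesis unfolding * by simp
qed

text \<open>Holomorphy is given in the sense of \<open>Cn 1\<close>; its slope factor composed with
  the embedding \<open>C1\<close> is a continuous slope function for the one-variable Caratheodory
  criterion.\<close>

lemma holo_section_entire:
  assumes s: "s \<in> holo_sections spinor_bundle"
  shows "(\<lambda>z. spinor_coord b (s (affine_pt b z))) holomorphic_on UNIV"
proof -
  let ?\<phi> = "\<lambda>p i. if i = (0::nat) then affine_coord b p else 0"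
  let ?\<tau> = "\<lambda>e i. if i = (0::nat) then spinor_coord b e else 0"
  have chart: "(range (affine_pt b), ?\<phi>) \<in> charts P1_mfd" unfolding P1_charts by (rule rangeI)
  have triv: "(range (affine_pt b), ?\<tau>) \<in> trivs spinor_bundle" unfolding spinor_trivs by (rule rangeI)
  have "\<forall>(U, \<tau>) \<in> trivs spinor_bundle. \<forall>j<vrank spinor_bundle. holo_fun (base spinor_bundle) U (\<lambda>x. \<tau> (s x) j)"
    using s unfolding holo_sections_def mem_Collect_eq by (elim conjE)
  from bspec[OF this triv] have "holo_fun P1_mfd (range (affine_pt b)) (\<lambda>x. spinor_coord b (s x))"
    by (simp add: spinor_bundle_def)
  then have "\<forall>(U, \<phi>) \<in> charts P1_mfd. holo_Cn (mdim P1_mfd) (\<phi> ` (U \<inter> range (affine_pt b)))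
      (\<lambda>y. spinor_coord b (s (inv_into U \<phi> y)))" unfolding holo_fun_def by (elim conjE)
  from bspec[OF this chart] have h: "holo_Cn 1 (?\<phi> ` range (affine_pt b))
      (\<lambda>y. spinor_coord b (s (inv_into (range (affine_pt b)) ?\<phi> y)))" by (simp add: P1_mfd_def)
  let ?f = "\<lambda>y. spinor_coord b (s (inv_into (range (affine_pt b)) ?\<phi> y))"
  have "(\<lambda>z. spinor_coord b (s (affine_pt b z))) field_differentiable at w" for w
  proof -
    have "C1 w \<in> ?\<phi> ` range (affine_pt b)"
      by (rule image_eqI[of _ _ "affine_pt b w"]) (rule ext, simp_all add: C1_def)
    then have "cdiff 1 ?f (C1 w)" using h unfolding holo_Cn_iff by (elim conjE bspec)
    moreover have "C1 w \<in> Cn 1" by (simp add: Cn_1)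
    ultimately obtain q where q: "\<And>y. y \<in> Cn 1 \<Longrightarrow> ?f y - ?f (C1 w) = (\<Sum>i<1. q i y * (y i - C1 w i))"
      "\<And>i. i < 1 \<Longrightarrow> (q i \<longlongrightarrow> q i (C1 w)) (at (C1 w) within Cn 1)" by (rule cdiffE) blast
    have f: "?f (C1 z) = spinor_coord b (s (affine_pt b z))" for z by (simp only: P1_chart_inv)
    have 1: "spinor_coord b (s (affine_pt b z)) - spinor_coord b (s (affine_pt b w)) = q 0 (C1 z) * (z - w)" for z
    proof -
      have "{..<1} = {0::nat}" by auto
      then show ?thesis using q(1)[of "C1 z"] unfolding f by (simp add: Cn_1 C1_0)
    qed
    have "isCont (\<lambda>z. q 0 (C1 z)) w"
      unfolding isCont_def
    proof (rule continuous_within_tendsto_compose[where a = "C1 w" and S = "Cn 1" and f = "q 0" and x = C1 and F = "at w"])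
      show "continuous (at (C1 w) within Cn 1) (q 0)" using q(2)[of 0] by (simp add: continuous_within)
      show "\<forall>\<^sub>F z in at w. C1 z \<in> Cn 1" by (simp add: Cn_1)
      have "continuous_on UNIV C1"
        by (rule continuous_on_into_Cn[of 1]) (auto simp: C1_def Cn_def)
      then show "(C1 \<longlongrightarrow> C1 w) (at w)" by (simp add: continuous_on_def)
    qed
    then have "DERIV (\<lambda>z. spinor_coord b (s (affine_pt b z))) w :> q 0 (C1 w)"
      unfolding CARAT_DERIV using 1 by (intro exI[of _ "\<lambda>z. q 0 (C1 z)"]) blast
    then show ?thesis by (auto simp: field_differentiable_def)
  qed
  then show ?thesis by (simp add: holomorphic_on_def)
qed

text \<open>By the transition rule \<open>s\<^sub>1 = -z\<^sub>2 s\<^sub>2\<close> a section grows at most linearly in the frame \<open>s\<^sub>1\<close>.\<close>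

lemma holo_sections_subset: "holo_sections spinor_bundle \<subseteq> {spin_sec g h | g h. True}"
proof
  fix s assume s: "s \<in> holo_sections spinor_bundle"
  define f where "f z = spinor_coord False (s (affine_pt False z))" for z
  define g where "g z = spinor_coord True (s (affine_pt True z))" for z
  have fh: "f holomorphic_on UNIV" and gh: "g holomorphic_on UNIV"
    unfolding f_def g_def by (rule holo_section_entire[OF s])+
  have fib: "s p \<in> P11 1 \<and> pt_red (s p) = p" if "p \<in> P11 0" for p
  proof -
    have "\<forall>x\<in>mpoints (base spinor_bundle). s x \<in> bfibre spinor_bundle x"
      using s unfolding holo_sections_def mem_Collect_eq by (elim conjE)
    then show ?thesis using that by (simp add: spinor_bundle_def P1_mfd_def bfibre_def)
  qed
  have sF: "s (affine_pt False z) = pt z 1 (f z)" for z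
    using spinor_rep[of "s (affine_pt False z)" False] fib[of "affine_pt False z"]
    by (simp add: f_def hx_def hy_def)
  have sT: "s (affine_pt True z) = pt 1 (- z) (g z)" for z
    using spinor_rep[of "s (affine_pt True z)" True] fib[of "affine_pt True z"]
    by (simp add: g_def hx_def hy_def)
  \<comment> \<open>The chart change is z_2 = -1/z_1, and the odd coordinate scales with the
    representative.\<close>
  have fg: "f z = z * g (- 1 / z)" if "z \<noteq> 0" for z
  proof -
    have "affine_pt False z = affine_pt True (- 1 / z)"
      unfolding affine_pt_eq by (rule pt_eqI[of "1 / z"]) (use that in \<open>auto simp: hx_def hy_def\<close>)
    then have "pt z 1 (f z) = pt 1 (1 / z) (g (- 1 / z))" using sF[of z] sT[of "- 1 / z"] by simp
    moreover have "pt z 1 (z * g (- 1 / z)) = pt 1 (1 / z) (g (- 1 / z))"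
      by (rule pt_eqI[of "1 / z"]) (use that in auto)
    ultimately have "pt z 1 (f z) = pt z 1 (z * g (- 1 / z))" by simp
    then show ?thesis by (rule pt_eqD) simp
  qed
  have "compact (g ` cball 0 1)"
    by (intro compact_continuous_image holomorphic_on_imp_continuous_on holomorphic_on_subset[OF gh]) auto
  then have "bounded (g ` cball 0 1)" by (rule compact_imp_bounded)
  then obtain B where "\<forall>x\<in>g ` cball 0 1. norm x \<le> B" unfolding bounded_iff by (elim exE)
  then have B: "norm w \<le> 1 \<Longrightarrow> norm (g w) \<le> B" for w by simp
  \<comment> \<open>For z outside the open unit disc, -1/z lies in the closed one, where g is
    bounded; the growth exponent 1 restricts f to degree at most 1.\<close>
  have bd: "norm (f z) \<le> B * norm z ^ 1" if "1 \<le> norm z" for z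
  proof -
    have z: "z \<noteq> 0" using that by auto
    have "norm (- 1 / z) \<le> 1" using that z by (simp add: norm_divide)
    then have "norm (g (- 1 / z)) \<le> B" by (rule B)
    then have "norm z * norm (g (- 1 / z)) \<le> norm z * B" by (rule mult_left_mono) simp
    then show ?thesis using fg[OF z] by (simp add: norm_mult mult.commute)
  qed
  define a c where "a = deriv f 0" and "c = f 0"
  have f: "f z = c + a * z" for z
    using Liouville_polynomial[OF fh bd, where \<xi> = z] by (simp add: a_def c_def One_nat_def)
  have g1: "g w = a - c * w" if "w \<noteq> 0" for w
  proof -
    have "f (- 1 / w) = - 1 / w * g w" using fg[of "- 1 / w"] that by simp
    then have "c + a * (- 1 / w) = - 1 / w * g w" by (simp add: f)
    then have "w * (g w + c * w) = w * a" using that by (simp add: field_simps)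
    then show ?thesis using that by (simp add: eq_diff_eq)
  qed
  \<comment> \<open>The transition formula says nothing about z_2 = 0, so the value at infinity
    comes from continuity of g.\<close>
  have g0: "g 0 = a"
  proof -
    have "(g \<longlongrightarrow> g 0) (at 0)"
      using holomorphic_on_imp_continuous_on[OF gh] by (simp add: continuous_on_def)
    moreover have lim: "((\<lambda>w. a - c * w) \<longlongrightarrow> a - c * 0) (at 0)" by (intro tendsto_intros)
    have "\<forall>\<^sub>F w in at 0. a - c * w = g w" by (simp add: eventually_at_filter g1)
    from Lim_transform_eventually[OF lim this] have "(g \<longlongrightarrow> a) (at 0)" by simp
    ultimately show ?thesis by (rule LIM_unique)
  qed
  have "s = spin_sec a c"
  proof (rule spin_sec_cong)
    show "s \<in> extensional (P11 0)"
      using s by (simp add: holo_sections_def spinor_bundle_def P1_mfd_def)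
    fix x y :: complex assume xy: "x \<noteq> 0 \<or> y \<noteq> 0"
    show "s (pt x y 0) = pt x y (x * a + y * c)"
    proof (cases "y = 0")
      case False
      then have "s (pt x y 0) = pt (x / y) 1 (f (x / y))"
        using sF[of "x / y"] affine_pt_rat[of False x y] by (simp add: den_def rat_def)
      also have "\<dots> = pt x y (x * a + y * c)"
        by (rule pt_eqI[of y]) (use False in \<open>auto simp: f field_simps\<close>)
      finally show ?thesis .
    next
      case True
      then have x: "x \<noteq> 0" using xy by simp
      then have "s (pt x y 0) = pt 1 0 a"
        using sT[of 0] affine_pt_rat[of True x y] True by (simp add: den_def rat_def g0)
      also have "\<dots> = pt x y (x * a + y * c)"
        by (rule pt_eqI[of x]) (use True x in auto)
      finally show ?thesis .
    qed
  qed
  then show "s \<in> {spin_sec g h | g h. True}" by blast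
qed

section \<open>Holomorphy of the affine coordinate formulas\<close>

lemma cdiff_uminus: "cdiff n f x \<Longrightarrow> x \<in> Cn n \<Longrightarrow> cdiff n (\<lambda>y. - f y) x"
  using cdiff_mult[OF cdiff_const, of n f x "-1"] by simp

lemma cdiff_divide:
  assumes "cdiff n f x" "cdiff n g x" "x \<in> Cn n" "g x \<noteq> 0"
  shows "cdiff n (\<lambda>y. f y / g y) x"
proof -
  have "cdiff n (\<lambda>y. inverse (g y)) x"
    by (rule cdiff_comp1[OF assms(2) _ assms(3)])
      (use assms(4) in \<open>auto intro!: field_differentiable_inverse field_differentiable_ident\<close>)
  from cdiff_mult[OF assms(1) this assms(3)] show ?thesis by (simp add: divide_inverse)
qed

lemma cdiff_h:
  assumes "cdiff n f x" "x \<in> Cn n"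
  shows "cdiff n (\<lambda>y. hx b (f y)) x" "cdiff n (\<lambda>y. hy b (f y)) x"
  using assms cdiff_uminus[OF assms] by (cases b; simp add: hx_def hy_def cdiff_const)+

lemma cdiff_den:
  assumes "cdiff n f x" "cdiff n g x"
  shows "cdiff n (\<lambda>y. den b (f y) (g y)) x"
  using assms by (cases b) (simp_all add: den_def)

lemma cdiff_rat:
  assumes "cdiff n f x" "cdiff n g x" "x \<in> Cn n" "den b (f x) (g x) \<noteq> 0"
  shows "cdiff n (\<lambda>y. rat b (f y) (g y)) x"
  using assms cdiff_divide[OF assms(1,2,3)] cdiff_divide[OF cdiff_uminus[OF assms(2,3)] assms(1,3)]
  by (cases b) (simp_all add: den_def rat_def)

lemma continuous_on_h:
  assumes "continuous_on S f"
  shows "continuous_on S (\<lambda>y. hx b (f y))" "continuous_on S (\<lambda>y. hy b (f y))"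
  using assms continuous_on_minus[OF assms] by (cases b; simp add: hx_def hy_def)+

lemma continuous_on_den:
  assumes "continuous_on S f" "continuous_on S g"
  shows "continuous_on S (\<lambda>y. den b (f y) (g y))"
  using assms by (cases b) (simp_all add: den_def)

text \<open>Seen from chart b', the coordinate in the frame of chart b is (x g + y h)/den with x and
  y normalized in b', and den is nonzero exactly on the overlap of the two charts.\<close>

lemma spin_sec_in_holo_sections: "spin_sec g h \<in> holo_sections spinor_bundle"
  unfolding holo_sections_def mem_Collect_eq
proof (intro conjI ballI)
  show "spin_sec g h \<in> extensional (mpoints (base spinor_bundle))"
    by (simp add: spin_sec_def spinor_bundle_def P1_mfd_def)
  show "spin_sec g h x \<in> bfibre spinor_bundle x" if "x \<in> mpoints (base spinor_bundle)" for x
    using that spin_sec_closed by (simp add: spinor_bundle_def P1_mfd_def bfibre_def)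
next
  fix c assume "c \<in> trivs spinor_bundle"
  then obtain b where c: "c = (range (affine_pt b), \<lambda>e i. if i = 0 then spinor_coord b e else 0)"
    unfolding spinor_trivs by (elim rangeE)
  let ?f = "\<lambda>x. spinor_coord b (spin_sec g h x)"
  have nz: "affine_pt b' w \<in> range (affine_pt b) \<longleftrightarrow> den b (hx b' w) (hy b' w) \<noteq> 0" for b' w
    unfolding affine_pt_eq[of b'] by (rule pt_in_range_affine)
  have img: "(\<lambda>p i. if i = 0 then affine_coord b' p else 0) ` (range (affine_pt b') \<inter> range (affine_pt b)) =
      {y \<in> Cn 1. \<forall>i\<in>{0::nat}. den b (hx b' (y i)) (hy b' (y i)) \<noteq> 0}" (is "?l = ?r") for b'
  proof -
    have "?l = (\<lambda>p. C1 (affine_coord b' p)) ` (affine_pt b' ` {w. den b (hx b' w) (hy b' w) \<noteq> 0})"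
      by (rule image_cong) (use nz in \<open>auto simp: C1_def\<close>)
    also have "\<dots> = C1 ` {w. den b (hx b' w) (hy b' w) \<noteq> 0}" by (simp add: image_image)
    also have "\<dots> = ?r" unfolding Cn_1 by (auto simp: C1_0)
    finally show ?thesis .
  qed
  have op: "openin (top_of_set (Cn 1)) {y \<in> Cn 1. \<forall>i\<in>{0::nat}. den b (hx b' (y i)) (hy b' (y i)) \<noteq> 0}" for b'
    by (rule openin_Cn_nonzero) (simp, intro continuous_on_den continuous_on_h coord_continuous_on)
  have "holo_fun P1_mfd (range (affine_pt b)) ?f"
    unfolding holo_fun_def mopen_def
  proof (intro conjI ballI)
    show "range (affine_pt b) \<subseteq> mpoints P1_mfd" by (auto simp: P1_mfd_def)
  next
    fix c assume "c \<in> charts P1_mfd"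
    then obtain b' where c: "c = (range (affine_pt b'), \<lambda>p i. if i = 0 then affine_coord b' p else 0)"
      unfolding P1_charts by (elim rangeE)
    show "case c of (U, \<phi>) \<Rightarrow> openin (top_of_set (Cn (mdim P1_mfd))) (\<phi> ` (U \<inter> range (affine_pt b)))"
      using op[of b'] unfolding c prod.case img by (simp add: P1_mfd_def)
  next
    fix c assume "c \<in> charts P1_mfd"
    then obtain b' where c: "c = (range (affine_pt b'), \<lambda>p i. if i = 0 then affine_coord b' p else 0)"
      unfolding P1_charts by (elim rangeE)
    let ?W = "{y \<in> Cn 1. \<forall>i\<in>{0::nat}. den b (hx b' (y i)) (hy b' (y i)) \<noteq> 0}"
    let ?inv = "inv_into (range (affine_pt b')) (\<lambda>p i. if i = (0::nat) then affine_coord b' p else 0)"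
    have "holo_Cn 1 ?W (\<lambda>y. ?f (?inv y))"
    proof (rule holo_Cn_cong)
      fix y assume y: "y \<in> ?W"
      then obtain w where w: "y = C1 w" unfolding Cn_1 by blast
      have 1: "?inv y = pt (hx b' w) (hy b' w) 0" unfolding w P1_chart_inv by (rule affine_pt_eq)
      have 2: "den b (hx b' w) (hy b' w) \<noteq> 0" using y by (simp add: w C1_0)
      show "(hx b' (y 0) * g + hy b' (y 0) * h) / den b (hx b' (y 0)) (hy b' (y 0)) = ?f (?inv y)"
        unfolding 1 spin_sec_pt[OF h_nonzero] spinor_coord_pt[OF 2] by (simp add: w C1_0)
    next
      show "holo_Cn 1 ?W (\<lambda>y. (hx b' (y 0) * g + hy b' (y 0) * h) / den b (hx b' (y 0)) (hy b' (y 0)))"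
        unfolding holo_Cn_iff
        by (intro conjI op ballI cdiff_divide cdiff_add cdiff_mult cdiff_const cdiff_den cdiff_h cdiff_coord) auto
    qed
    then show "case c of (U, \<phi>) \<Rightarrow> holo_Cn (mdim P1_mfd) (\<phi> ` (U \<inter> range (affine_pt b))) (\<lambda>y. ?f (inv_into U \<phi> y))"
      unfolding c prod.case img by (simp add: P1_mfd_def)
  qed
  then show "case c of (U, \<tau>) \<Rightarrow> \<forall>j<vrank spinor_bundle. holo_fun (base spinor_bundle) U (\<lambda>x. \<tau> (spin_sec g h x) j)"
    unfolding c prod.case by (simp add: spinor_bundle_def)
qed

section \<open>Linear structure and group action on the space of sections\<close>

lemma H0_eq: "H0 = {spin_sec g h | g h. True}"
  unfolding H0_def using holo_sections_subset spin_sec_in_holo_sections by (intro equalityI subsetI) auto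

lemma H0_add_spin_sec: "H0_add (spin_sec g h) (spin_sec g' h') = spin_sec (g + g') (h + h')"
  by (rule spin_sec_cong) (simp_all add: H0_add_def algebra_simps)

lemma H0_scale_spin_sec: "H0_scale t (spin_sec g h) = spin_sec (t * g) (t * h)"
  by (rule spin_sec_cong) (simp_all add: H0_scale_def algebra_simps)

lemma sl2_inverse_act:
  assumes "a * d - b * c = 1"
  shows "pt_act (sl2_mat a b c d) (pt (x * d - y * b) (y * a - x * c) v) = pt x y v"
proof -
  have "(x * d - y * b) * a + (y * a - x * c) * b = x * (a * d - b * c)"
    "(x * d - y * b) * c + (y * a - x * c) * d = y * (a * d - b * c)" by (simp_all add: algebra_simps)
  then show ?thesis using assms by simp
qed

text \<open>\<open>H0_act\<close> is defined with an abstract inverse; the adjugate matrix computes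
  it.\<close>

lemma inv_into_sl2_act:
  assumes M: "a * d - b * c = 1" and xy: "x \<noteq> 0 \<or> y \<noteq> 0"
  shows "inv_into (P11 0) (pt_act (sl2_mat a b c d)) (pt x y 0) = pt (x * d - y * b) (y * a - x * c) 0"
proof -
  have "d * a - (-c) * (-b) = 1" using M by (simp add: mult.commute)
  from sl2_nonzero[OF this xy] have nz: "x * d - y * b \<noteq> 0 \<or> y * a - x * c \<noteq> 0"
    using sl2_nonzero[of d a "-b" "-c" x y] M xy by (simp add: mult.commute)
  have "inj_on (pt_act (sl2_mat a b c d)) (P11 0)"
  proof (rule inj_onI)
    fix p q assume p: "p \<in> P11 0" and q: "q \<in> P11 0" and eq: "pt_act (sl2_mat a b c d) p = pt_act (sl2_mat a b c d) q"
    obtain x y where p': "p = pt x y 0" "x \<noteq> 0 \<or> y \<noteq> 0" using p by (rule P11_0_cases)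
    obtain x' y' where q': "q = pt x' y' 0" "x' \<noteq> 0 \<or> y' \<noteq> 0" using q by (rule P11_0_cases)
    obtain u where u: "u \<noteq> 0" "x' * a + y' * b = u * (x * a + y * b)" "x' * c + y' * d = u * (x * c + y * d)"
      using eq unfolding p' q' pt_act_sl2 pt_eq_iff by blast
    have "x' * (a * d - b * c) = (x' * a + y' * b) * d - (x' * c + y' * d) * b"
      "y' * (a * d - b * c) = (x' * c + y' * d) * a - (x' * a + y' * b) * c" by (simp_all add: algebra_simps)
    moreover have "(u * (x * a + y * b)) * d - (u * (x * c + y * d)) * b = u * (x * (a * d - b * c))"
      "(u * (x * c + y * d)) * a - (u * (x * a + y * b)) * c = u * (y * (a * d - b * c))"
      by (simp_all add: algebra_simps)
    ultimately have "x' = u * x" "y' = u * y" unfolding u M by simp_all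
    then show "p = q" unfolding p' q' using u(1) by (intro pt_eqI[of u]) simp_all
  qed
  from inv_into_f_f[OF this pt_in_P11(2)[OF nz]] show ?thesis unfolding sl2_inverse_act[OF M] .
qed

text \<open>The action keeps the odd coordinate of a representative, so the linear form is composed
  with the inverse matrix, and (g, h) transforms by the adjugate.\<close>

lemma H0_act_spin_sec:
  assumes M: "a * d - b * c = 1"
  shows "H0_act (sl2_mat a b c d) (spin_sec g h) = spin_sec (d * g - c * h) (a * h - b * g)"
proof (rule spin_sec_cong)
  fix x y :: complex assume xy: "x \<noteq> 0 \<or> y \<noteq> 0"
  have "x * d - y * b \<noteq> 0 \<or> y * a - x * c \<noteq> 0"
    using sl2_nonzero[of d a "-b" "-c" x y] M xy by (simp add: mult.commute)
  then show "H0_act (sl2_mat a b c d) (spin_sec g h) (pt x y 0) = pt x y (x * (d * g - c * h) + y * (a * h - b * g))"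
    using xy unfolding H0_act_def by (simp add: inv_into_sl2_act[OF M xy] sl2_inverse_act[OF M] del: pt_act_sl2)
      (simp add: algebra_simps)
qed (simp add: H0_act_def)

text \<open>Evaluation at infinity in the frame s_2 and at 0 in the frame s_1 returns g and h. Such
  a coordinate system shows that the bundle of sections has a trivialization at all.\<close>

definition H0_values :: "(spoint \<Rightarrow> spoint) \<Rightarrow> nat \<Rightarrow> complex" where
  "H0_values s j = (if j = 0 then spinor_coord True (s (pt 1 0 0)) else if j = 1 then spinor_coord False (s (pt 0 1 0)) else 0)"

lemma H0_values_spin_sec: "H0_values (spin_sec g h) = (\<lambda>j. if j = 0 then g else if j = 1 then h else 0)"
  by (rule ext) (simp add: H0_values_def spinor_coord_pt den_def)

lemma H0_values_coordinates: "H0_values \<in> H0_coordinates"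
  unfolding H0_coordinates_def mem_Collect_eq
proof (intro conjI ballI allI)
  show "bij_betw H0_values H0 (Cn 2)"
  proof (rule bij_betwI')
    show "H0_values s = H0_values s' \<longleftrightarrow> s = s'" if ss: "s \<in> H0" "s' \<in> H0" for s s'
    proof -
      obtain g h where "s = spin_sec g h" using ss(1) unfolding H0_eq by blast
      moreover obtain g' h' where "s' = spin_sec g' h'" using ss(2) unfolding H0_eq by blast
      ultimately have s: "s = spin_sec g h" "s' = spin_sec g' h'" by simp_all
      have "g = g' \<and> h = h'" if "H0_values s = H0_values s'"
        using fun_cong[OF that, of 0] fun_cong[OF that, of 1] by (simp add: s H0_values_spin_sec)
      then show ?thesis using s by blast
    qed
    show "H0_values s \<in> Cn 2" if "s \<in> H0" for s by (simp add: H0_values_def Cn_def)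
    show "\<exists>s\<in>H0. y = H0_values s" if "y \<in> Cn 2" for y
    proof (rule bexI[of _ "spin_sec (y 0) (y 1)"])
      show "y = H0_values (spin_sec (y 0) (y 1))" unfolding H0_values_spin_sec
      proof
        fix j :: nat consider "j = 0" | "j = 1" | "j \<ge> 2" by linarith
        then show "y j = (if j = 0 then y 0 else if j = 1 then y 1 else 0)"
          using that by cases (auto simp: Cn_def)
      qed
      show "spin_sec (y 0) (y 1) \<in> H0" unfolding H0_eq by blast
    qed
  qed
  show "H0_values (H0_add s s') = (\<lambda>j. H0_values s j + H0_values s' j)" if "s \<in> H0" "s' \<in> H0" for s s'
    using that unfolding H0_eq by (auto simp: H0_values_spin_sec H0_add_spin_sec)
  show "H0_values (H0_scale t s) = (\<lambda>j. t * H0_values s j)" if "s \<in> H0" for t s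
    using that unfolding H0_eq by (auto simp: H0_values_spin_sec H0_scale_spin_sec)
qed

text \<open>The preimages of the two unit vectors under \<beta> form a basis, and linearity
  expresses every section in it. This makes arbitrary linear coordinates on the sections as usable
  as g and h.\<close>

lemma H0_coordinates_inverse:
  assumes "\<beta> \<in> H0_coordinates"
  shows "\<exists>g0 g1 h0 h1. \<forall>s\<in>H0. s = spin_sec (g0 * \<beta> s 0 + g1 * \<beta> s 1) (h0 * \<beta> s 0 + h1 * \<beta> s 1)"
proof -
  have bij: "bij_betw \<beta> H0 (Cn 2)"
    and add: "\<And>s s'. s \<in> H0 \<Longrightarrow> s' \<in> H0 \<Longrightarrow> \<beta> (H0_add s s') = (\<lambda>j. \<beta> s j + \<beta> s' j)"
    and scale: "\<And>t s. s \<in> H0 \<Longrightarrow> \<beta> (H0_scale t s) = (\<lambda>j. t * \<beta> s j)"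
    using assms unfolding H0_coordinates_def by simp_all
  have surj: "\<exists>s\<in>H0. \<beta> s = y" if "y \<in> Cn 2" for y
  proof -
    have "y \<in> \<beta> ` H0" using that bij by (simp add: bij_betw_def)
    then show ?thesis by blast
  qed
  define u :: "nat \<Rightarrow> nat \<Rightarrow> complex" where "u l j = (if j = l then 1 else 0)" for l j
  have "u 0 \<in> Cn 2" "u 1 \<in> Cn 2" by (auto simp: u_def Cn_def)
  then obtain s0 s1 where s01: "s0 \<in> H0" "\<beta> s0 = u 0" "s1 \<in> H0" "\<beta> s1 = u 1" using surj by meson
  obtain g0 h0 where s0: "s0 = spin_sec g0 h0" using s01(1) unfolding H0_eq by blast
  obtain g1 h1 where s1: "s1 = spin_sec g1 h1" using s01(3) unfolding H0_eq by blast
  have "s = spin_sec (g0 * \<beta> s 0 + g1 * \<beta> s 1) (h0 * \<beta> s 0 + h1 * \<beta> s 1)" if s: "s \<in> H0" for s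
  proof -
    let ?s0 = "H0_scale (\<beta> s 0) s0" and ?s1 = "H0_scale (\<beta> s 1) s1"
    have in01: "?s0 \<in> H0" "?s1 \<in> H0" unfolding s0 s1 H0_scale_spin_sec H0_eq by blast+
    have eq: "H0_add ?s0 ?s1 = spin_sec (g0 * \<beta> s 0 + g1 * \<beta> s 1) (h0 * \<beta> s 0 + h1 * \<beta> s 1)"
      unfolding s0 s1 H0_scale_spin_sec H0_add_spin_sec by (simp add: mult.commute)
    have "\<beta> (H0_add ?s0 ?s1) = (\<lambda>j. \<beta> s 0 * u 0 j + \<beta> s 1 * u 1 j)"
      unfolding add[OF in01] scale[OF s01(1)] scale[OF s01(3)] s01 ..
    also have "\<dots> = \<beta> s"
    proof
      fix j :: nat
      have "\<beta> s \<in> Cn 2" using bij s by (auto simp: bij_betw_def)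
      moreover consider "j = 0" | "j = 1" | "j \<ge> 2" by linarith
      ultimately show "\<beta> s 0 * u 0 j + \<beta> s 1 * u 1 j = \<beta> s j"
        by cases (auto simp: u_def Cn_def)
    qed
    finally have "\<beta> (H0_add ?s0 ?s1) = \<beta> s" .
    moreover have "H0_add ?s0 ?s1 \<in> H0" unfolding eq H0_eq by blast
    ultimately have "H0_add ?s0 ?s1 = s" using bij s by (auto simp: bij_betw_def dest: inj_onD)
    then show ?thesis using eq by simp
  qed
  then show ?thesis by (intro exI ballI)
qed

section \<open>The configuration space and its normal bundle\<close>

lemma P11_01: "p \<in> P11 0 \<Longrightarrow> p \<in> P11 1"
  using P11_0_subset by blast

lemma Zk_0_iff: "p \<in> Zk k 0 \<longleftrightarrow> p \<in> {..<k} \<rightarrow>\<^sub>E P11 0 \<and> inj_on p {..<k}"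
proof -
  have "inj_on (\<lambda>i. pt_red (p i)) {..<k} \<longleftrightarrow> inj_on p {..<k}" if "p \<in> {..<k} \<rightarrow>\<^sub>E P11 0"
    by (rule inj_on_cong) (use that in \<open>auto simp: pt_red_P11_0 PiE_iff\<close>)
  then show ?thesis unfolding Zk_def by blast
qed

lemma Zk_ext: "p \<in> Zk k s \<Longrightarrow> p \<in> extensional {..<k}"
  by (simp add: Zk_def PiE_iff)

lemma Zk_0_P11: "p \<in> Zk k 0 \<Longrightarrow> i < k \<Longrightarrow> p i \<in> P11 0"
  by (auto simp: Zk_def)

lemma Zk_0_distinct: "p \<in> Zk k 0 \<Longrightarrow> i < k \<Longrightarrow> j < k \<Longrightarrow> i \<noteq> j \<Longrightarrow> p i \<noteq> p j"
  unfolding Zk_0_iff by (auto dest: inj_onD)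

lemma tuple_red_Zk_iff:
  assumes "p \<in> {..<k} \<rightarrow>\<^sub>E P11 1"
  shows "tuple_red k p \<in> Zk k 0 \<longleftrightarrow> inj_on (\<lambda>i. pt_red (p i)) {..<k}"
proof -
  have 1: "tuple_red k p \<in> {..<k} \<rightarrow>\<^sub>E P11 0"
    using assms by (auto simp: tuple_red_def PiE_iff pt_red_P11)
  have "inj_on (tuple_red k p) {..<k} \<longleftrightarrow> inj_on (\<lambda>i. pt_red (p i)) {..<k}"
    by (rule inj_on_cong) (simp add: tuple_red_def)
  then show ?thesis unfolding Zk_0_iff using 1 by blast
qed

lemma total_normal_Zk: "total (normal_Zk k) = Zk k 1"
  using tuple_red_Zk_iff by (auto simp: normal_Zk_def Zk_def spinor_bundle_def)

definition Zcoord :: "nat \<Rightarrow> nat set \<Rightarrow> (nat \<Rightarrow> spoint) \<Rightarrow> nat \<Rightarrow> complex" where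
  "Zcoord k J p = (\<lambda>i. if i < k then affine_coord (i \<in> J) (p i) else 0)"

definition Zpt :: "nat \<Rightarrow> nat set \<Rightarrow> (nat \<Rightarrow> complex) \<Rightarrow> (nat \<Rightarrow> spoint)" where
  "Zpt k J y = (\<lambda>i\<in>{..<k}. affine_pt (i \<in> J) (y i))"

text \<open>The i-th point in homogeneous coordinates normalized by its chart. On
  \<open>Zk_dom k J\<close> these are holomorphic functions of the configuration, in which
  determinants and linear forms can be written down.\<close>

definition Zx :: "nat set \<Rightarrow> (nat \<Rightarrow> spoint) \<Rightarrow> nat \<Rightarrow> complex" where
  "Zx J p i = hx (i \<in> J) (affine_coord (i \<in> J) (p i))"

definition Zy :: "nat set \<Rightarrow> (nat \<Rightarrow> spoint) \<Rightarrow> nat \<Rightarrow> complex" where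
  "Zy J p i = hy (i \<in> J) (affine_coord (i \<in> J) (p i))"

definition cross :: "nat set \<Rightarrow> (nat \<Rightarrow> complex) \<Rightarrow> nat \<Rightarrow> nat \<Rightarrow> complex" where
  "cross J y i j = hx (i \<in> J) (y i) * hy (j \<in> J) (y j) - hx (j \<in> J) (y j) * hy (i \<in> J) (y i)"

text \<open>The image of the chart J, written with determinants so that its openness is immediate
  and points in different affine charts can be compared.\<close>

definition Zimg :: "nat \<Rightarrow> nat set \<Rightarrow> (nat \<Rightarrow> complex) set" where
  "Zimg k J = {y \<in> Cn k. \<forall>q\<in>{q \<in> {..<k} \<times> {..<k}. fst q \<noteq> snd q}. cross J y (fst q) (snd q) \<noteq> 0}"

lemma Zk_charts: "charts (Zk_mfd k) = (\<lambda>J. (Zk_dom k J, Zcoord k J)) ` {J. J \<subseteq> {..<k}}"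
  unfolding Zk_mfd_def Zcoord_def by auto

lemma Zk_chart_mem: "J \<subseteq> {..<k} \<Longrightarrow> (Zk_dom k J, Zcoord k J) \<in> charts (Zk_mfd k)"
  unfolding Zk_charts by blast

lemma Zk_mfd_simps [simp]: "mdim (Zk_mfd k) = k" "mpoints (Zk_mfd k) = Zk k 0"
  by (simp_all add: Zk_mfd_def)

lemma Zk_domD: "p \<in> Zk_dom k J \<Longrightarrow> p \<in> Zk k 0" "p \<in> Zk_dom k J \<Longrightarrow> i < k \<Longrightarrow> p i \<in> range (affine_pt (i \<in> J))"
  by (simp_all add: Zk_dom_def)

lemma Zk_dom_rep:
  assumes "p \<in> Zk_dom k J" "i < k"
  shows "p i = pt (Zx J p i) (Zy J p i) 0"
  using affine_pt_coord[OF Zk_domD(2)[OF assms]] by (simp add: Zx_def Zy_def affine_pt_eq)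

lemma Zxy_nonzero: "Zx J p i \<noteq> 0 \<or> Zy J p i \<noteq> 0"
  unfolding Zx_def Zy_def by (rule h_nonzero)

lemma affine_pt_neq_iff:
  "affine_pt b w \<noteq> affine_pt b' w' \<longleftrightarrow> hx b w * hy b' w' - hx b' w' * hy b w \<noteq> 0"
  unfolding affine_pt_eq using pt_zero_eq_iff[OF h_nonzero h_nonzero, of b w b' w'] by simp

lemma Zpt_in_dom:
  assumes "y \<in> Zimg k J"
  shows "Zpt k J y \<in> Zk_dom k J"
proof -
  have "inj_on (Zpt k J y) {..<k}"
  proof (rule inj_onI, rule ccontr)
    fix i j assume ij: "i \<in> {..<k}" "j \<in> {..<k}" "Zpt k J y i = Zpt k J y j" "i \<noteq> j"
    then have "(i, j) \<in> {q \<in> {..<k} \<times> {..<k}. fst q \<noteq> snd q}" by simp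
    then have "cross J y i j \<noteq> 0" using assms unfolding Zimg_def by fastforce
    then have "affine_pt (i \<in> J) (y i) \<noteq> affine_pt (j \<in> J) (y j)" unfolding affine_pt_neq_iff cross_def .
    then show False using ij by (simp add: Zpt_def)
  qed
  then show ?thesis by (auto simp: Zk_dom_def Zk_0_iff Zpt_def)
qed

lemma Zcoord_Zpt: "y \<in> Cn k \<Longrightarrow> Zcoord k J (Zpt k J y) = y"
  by (rule ext) (simp add: Zcoord_def Zpt_def Cn_def)

lemma Zpt_Zcoord:
  assumes "p \<in> Zk_dom k J"
  shows "Zpt k J (Zcoord k J p) = p"
proof
  fix i
  have "p \<in> extensional {..<k}" by (rule Zk_ext[OF Zk_domD(1)[OF assms]])
  then show "Zpt k J (Zcoord k J p) i = p i"
    using affine_pt_coord[OF Zk_domD(2)[OF assms]] by (cases "i < k") (simp_all add: Zpt_def Zcoord_def extensional_def)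
qed

lemma Zcoord_in_img:
  assumes "p \<in> Zk_dom k J"
  shows "Zcoord k J p \<in> Zimg k J"
  unfolding Zimg_def mem_Collect_eq
proof (intro conjI ballI)
  show "Zcoord k J p \<in> Cn k" by (simp add: Zcoord_def Cn_def)
  fix q assume "q \<in> {q \<in> {..<k} \<times> {..<k}. fst q \<noteq> snd q}"
  then have q: "fst q < k" "snd q < k" "fst q \<noteq> snd q" by auto
  have "p (fst q) \<noteq> p (snd q)" by (rule Zk_0_distinct[OF Zk_domD(1)[OF assms] q])
  then have "affine_pt (fst q \<in> J) (Zcoord k J p (fst q)) \<noteq> affine_pt (snd q \<in> J) (Zcoord k J p (snd q))"
    using q affine_pt_coord[OF Zk_domD(2)[OF assms]] by (simp add: Zcoord_def)
  then show "cross J (Zcoord k J p) (fst q) (snd q) \<noteq> 0" unfolding affine_pt_neq_iff cross_def .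
qed

lemma Zcoord_image: "Zcoord k J ` Zk_dom k J = Zimg k J"
proof (intro equalityI subsetI)
  fix y assume y: "y \<in> Zimg k J"
  then have "y \<in> Cn k" by (simp add: Zimg_def)
  then show "y \<in> Zcoord k J ` Zk_dom k J"
    using Zpt_in_dom[OF y] Zcoord_Zpt by (metis image_eqI)
qed (auto simp: Zcoord_in_img)

lemma Zcoord_inj: "inj_on (Zcoord k J) (Zk_dom k J)"
  by (rule inj_on_inverseI) (rule Zpt_Zcoord)

lemma Zcoord_inv: "y \<in> Zimg k J \<Longrightarrow> inv_into (Zk_dom k J) (Zcoord k J) y = Zpt k J y"
  using Zcoord_inj Zcoord_image Zpt_Zcoord by (metis f_inv_into_f inv_into_into)

definition Ztrans :: "nat \<Rightarrow> nat set \<Rightarrow> nat set \<Rightarrow> (nat \<Rightarrow> complex) set" where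
  "Ztrans k J J' = {y \<in> Cn k. \<forall>i\<in>{..<k}. den (i \<in> J') (hx (i \<in> J) (y i)) (hy (i \<in> J) (y i)) \<noteq> 0}"

lemma Zcoord_image_Int: "Zcoord k J ` (Zk_dom k J \<inter> Zk_dom k J') = Zimg k J \<inter> Ztrans k J J'"
proof -
  have "Zcoord k J p \<in> Ztrans k J J' \<longleftrightarrow> p \<in> Zk_dom k J'" if p: "p \<in> Zk_dom k J" for p
  proof -
    have "den (i \<in> J') (hx (i \<in> J) (Zcoord k J p i)) (hy (i \<in> J) (Zcoord k J p i)) \<noteq> 0 \<longleftrightarrow>
        p i \<in> range (affine_pt (i \<in> J'))" if "i < k" for i
      using Zk_dom_rep[OF p that] pt_in_range_affine[of "Zx J p i" "Zy J p i" "i \<in> J'"] that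
      by (simp add: Zcoord_def Zx_def Zy_def)
    moreover have "Zcoord k J p \<in> Cn k" by (simp add: Zcoord_def Cn_def)
    ultimately show ?thesis using Zk_domD(1)[OF p] by (auto simp: Ztrans_def Zk_dom_def)
  qed
  then show ?thesis unfolding Zcoord_image[symmetric] by blast
qed

lemma openin_Zimg: "openin (top_of_set (Cn k)) (Zimg k J)"
  unfolding Zimg_def
proof (rule openin_Cn_nonzero)
  show "finite {q \<in> {..<k} \<times> {..<k}. fst q \<noteq> snd q}" by (rule finite_subset[of _ "{..<k} \<times> {..<k}"]) auto
  show "continuous_on (Cn k) (\<lambda>y. cross J y (fst q) (snd q))" for q
    unfolding cross_def by (intro continuous_on_diff continuous_on_mult continuous_on_h coord_continuous_on)
qed

lemma openin_Ztrans: "openin (top_of_set (Cn k)) (Ztrans k J J')"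
  unfolding Ztrans_def
  by (rule openin_Cn_nonzero) (simp, intro continuous_on_den continuous_on_h coord_continuous_on)

lemma Zk_atlas: "holo_atlas (Zk_mfd k)"
  unfolding holo_atlas_def
proof (intro conjI ballI)
  fix c assume "c \<in> charts (Zk_mfd k)"
  then obtain J where c: "c = (Zk_dom k J, Zcoord k J)" unfolding Zk_charts by blast
  show "case c of (U, \<phi>) \<Rightarrow> U \<subseteq> mpoints (Zk_mfd k) \<and> inj_on \<phi> U \<and> openin (top_of_set (Cn (mdim (Zk_mfd k)))) (\<phi> ` U)"
    unfolding c prod.case Zcoord_image using Zcoord_inj openin_Zimg Zk_domD(1) by auto
next
  fix c assume "c \<in> charts (Zk_mfd k)"
  then obtain J where c: "c = (Zk_dom k J, Zcoord k J)" unfolding Zk_charts by blast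
  have "openin (top_of_set (Cn k)) (Zcoord k J ` (Zk_dom k J \<inter> Zk_dom k J')) \<and>
      (\<forall>j<k. holo_Cn k (Zcoord k J ` (Zk_dom k J \<inter> Zk_dom k J')) (\<lambda>y. Zcoord k J' (inv_into (Zk_dom k J) (Zcoord k J) y) j))" for J'
    unfolding Zcoord_image_Int
  proof (intro conjI allI impI)
    show op: "openin (top_of_set (Cn k)) (Zimg k J \<inter> Ztrans k J J')"
      by (rule openin_Int[OF openin_Zimg openin_Ztrans])
    fix j assume j: "j < k"
    show "holo_Cn k (Zimg k J \<inter> Ztrans k J J') (\<lambda>y. Zcoord k J' (inv_into (Zk_dom k J) (Zcoord k J) y) j)"
    proof (rule holo_Cn_cong)
      fix y assume y: "y \<in> Zimg k J \<inter> Ztrans k J J'"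
      then have "den (j \<in> J') (hx (j \<in> J) (y j)) (hy (j \<in> J) (y j)) \<noteq> 0" using j by (simp add: Ztrans_def)
      from affine_coord_pt[OF this]
      show "rat (j \<in> J') (hx (j \<in> J) (y j)) (hy (j \<in> J) (y j)) = Zcoord k J' (inv_into (Zk_dom k J) (Zcoord k J) y) j"
        using y j by (simp add: Zcoord_inv Zcoord_def Zpt_def affine_pt_eq)
    next
      show "holo_Cn k (Zimg k J \<inter> Ztrans k J J') (\<lambda>y. rat (j \<in> J') (hx (j \<in> J) (y j)) (hy (j \<in> J) (y j)))"
        unfolding holo_Cn_iff
        by (intro conjI op ballI cdiff_rat cdiff_h cdiff_coord) (use j in \<open>auto simp: Zimg_def Ztrans_def\<close>)
    qed
  qed
  then show "case c of (U, \<phi>) \<Rightarrow> \<forall>(V, \<psi>) \<in> charts (Zk_mfd k).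
        openin (top_of_set (Cn (mdim (Zk_mfd k)))) (\<phi> ` (U \<inter> V)) \<and>
        (\<forall>j<mdim (Zk_mfd k). holo_Cn (mdim (Zk_mfd k)) (\<phi> ` (U \<inter> V)) (\<lambda>y. \<psi> (inv_into U \<phi> y) j))"
    unfolding c prod.case Zk_charts Zk_mfd_simps by (simp only: ball_simps prod.case) blast
next
  show "\<Union> (fst ` charts (Zk_mfd k)) = mpoints (Zk_mfd k)"
    unfolding Zk_charts image_image fst_conv Zk_mfd_simps
  proof (intro equalityI subsetI)
    fix p assume p: "p \<in> Zk k 0"
    \<comment> \<open>The coordinate z_2 is chosen wherever it is defined; every other point has the
      form \<open>affine_pt False w\<close>.\<close>
    define J where "J = {i. i < k \<and> p i \<in> range (affine_pt True)}"
    have "p i \<in> range (affine_pt (i \<in> J))" if i: "i < k" for i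
    proof -
      obtain b w where bw: "p i = affine_pt b w" by (rule P11_0_affine[OF Zk_0_P11[OF p i]])
      show ?thesis
      proof (cases "p i \<in> range (affine_pt True)")
        case True
        then show ?thesis using i by (simp add: J_def)
      next
        case False
        then have "\<not> b" using bw by (cases b) auto
        then show ?thesis using False bw by (simp add: J_def)
      qed
    qed
    then have "p \<in> Zk_dom k J" using p by (simp add: Zk_dom_def)
    moreover have "J \<subseteq> {..<k}" by (auto simp: J_def)
    ultimately show "p \<in> (\<Union>J\<in>{J. J \<subseteq> {..<k}}. Zk_dom k J)" by blast
  qed (use Zk_domD(1) in blast)
qed

text \<open>Only membership of i in J is changed, so one point of the configuration gets a
  prescribed affine chart while the others keep theirs.\<close>

lemma Zk_chart_at:
  assumes "p \<in> Zk k 0" "i < k" "p i = affine_pt b w"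
  obtains J where "J \<subseteq> {..<k}" "p \<in> Zk_dom k J" "(i \<in> J) = b"
proof -
  obtain U \<phi> where "(U, \<phi>) \<in> charts (Zk_mfd k)" "p \<in> U"
    using chart_at[OF Zk_atlas, of p k] assms(1) by (metis Zk_mfd_simps(2))
  then obtain J where J: "J \<subseteq> {..<k}" "p \<in> Zk_dom k J" unfolding Zk_charts by blast
  define J' where "J' = (if b then insert i J else J - {i})"
  have "p j \<in> range (affine_pt (j \<in> J'))" if j: "j < k" for j
  proof (cases "j = i")
    case True
    then show ?thesis using assms(3) by (simp add: J'_def)
  next
    case False
    then show ?thesis using Zk_domD(2)[OF J(2) j] by (simp add: J'_def)
  qed
  then have "p \<in> Zk_dom k J'" using assms(1) by (simp add: Zk_dom_def)
  moreover have "J' \<subseteq> {..<k}" "(i \<in> J') = b" using J(1) assms(2) by (auto simp: J'_def)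
  ultimately show ?thesis using that by blast
qed

lemma mopen_Zk_dom: "J \<subseteq> {..<k} \<Longrightarrow> mopen (Zk_mfd k) (Zk_dom k J)"
  by (rule mopen_chart[OF Zk_atlas Zk_chart_mem])

lemma holo_Zk_coord:
  assumes "J \<subseteq> {..<k}" "i < k"
  shows "holo_fun (Zk_mfd k) (Zk_dom k J) (\<lambda>p. affine_coord (i \<in> J) (p i))"
  using holo_fun_chart[OF Zk_atlas Zk_chart_mem[OF assms(1)], of i] assms(2) by (simp add: Zcoord_def)

lemma holo_fun_h:
  assumes X: "holo_atlas X" and f: "holo_fun X W f"
  shows "holo_fun X W (\<lambda>x. hx b (f x))" "holo_fun X W (\<lambda>x. hy b (f x))"
  using f holo_fun_uminus[OF X f] holo_fun_const[OF X holo_funD(1)[OF X f]]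
  by (cases b; simp add: hx_def hy_def)+

lemma holo_fun_den:
  assumes "holo_fun X W f" "holo_fun X W g"
  shows "holo_fun X W (\<lambda>x. den b (f x) (g x))"
  using assms by (cases b) (simp_all add: den_def)

lemma holo_fun_rat:
  assumes X: "holo_atlas X" and "holo_fun X W f" "holo_fun X W g" "\<And>x. x \<in> W \<Longrightarrow> den b (f x) (g x) \<noteq> 0"
  shows "holo_fun X W (\<lambda>x. rat b (f x) (g x))"
  using holo_fun_divide[OF X assms(2,3)] holo_fun_divide[OF X holo_fun_uminus[OF X assms(3)] assms(2)] assms(4)
  by (cases b) (simp_all add: den_def rat_def)

lemma holo_Zxy:
  assumes "J \<subseteq> {..<k}" "i < k"
  shows "holo_fun (Zk_mfd k) (Zk_dom k J) (\<lambda>p. Zx J p i)" "holo_fun (Zk_mfd k) (Zk_dom k J) (\<lambda>p. Zy J p i)"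
  unfolding Zx_def Zy_def by (rule holo_fun_h[OF Zk_atlas holo_Zk_coord[OF assms]])+

text \<open>The determinant of the two points is continuous in the pair of affine coordinates and
  nonzero, hence nonzero on a product neighbourhood.\<close>

lemma P1_separate:
  assumes "p \<in> P11 0" "q \<in> P11 0" "p \<noteq> q"
  obtains b w S b' w' S' where "open S" "open S'" "p = affine_pt b w" "w \<in> S" "q = affine_pt b' w'" "w' \<in> S'"
    "\<And>v v'. v \<in> S \<Longrightarrow> v' \<in> S' \<Longrightarrow> affine_pt b v \<noteq> affine_pt b' v'"
proof -
  obtain b w where p: "p = affine_pt b w" by (rule P11_0_affine[OF assms(1)])
  obtain b' w' where q: "q = affine_pt b' w'" by (rule P11_0_affine[OF assms(2)])
  define F where "F t = hx b (fst t) * hy b' (snd t) - hx b' (snd t) * hy b (fst t)" for t :: "complex \<times> complex"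
  have "continuous_on UNIV F"
    unfolding F_def by (intro continuous_on_diff continuous_on_mult continuous_on_h continuous_on_fst continuous_on_snd continuous_on_id)
  then have "open (F -` (- {0}))" by (intro open_vimage) auto
  moreover have "(w, w') \<in> F -` (- {0})"
    using assms(3) affine_pt_neq_iff[of b w b' w'] by (simp add: p q F_def)
  ultimately obtain S S' where S: "open S" "open S'" "w \<in> S" "w' \<in> S'" "S \<times> S' \<subseteq> F -` (- {0})"
    unfolding open_prod_def by (metis mem_Sigma_iff)
  have "affine_pt b v \<noteq> affine_pt b' v'" if "v \<in> S" "v' \<in> S'" for v v'
  proof -
    have "(v, v') \<in> F -` (- {0})" using S(5) that by blast
    then show ?thesis unfolding affine_pt_neq_iff by (simp add: F_def)
  qed
  then show ?thesis using that S p q by blast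
qed

lemma complex_manifoldI:
  assumes X: "holo_atlas X" and "finite (charts X)"
    and "\<forall>x\<in>mpoints X. \<forall>y\<in>mpoints X. x \<noteq> y \<longrightarrow>
        (\<exists>V W. mopen X V \<and> mopen X W \<and> x \<in> V \<and> y \<in> W \<and> V \<inter> W = {})"
  shows "complex_manifold X"
  unfolding complex_manifold_def
proof (intro conjI)
  show "\<exists>\<C>\<subseteq>charts X. countable \<C> \<and> \<Union> (fst ` \<C>) = mpoints X"
  proof (intro exI[of _ "charts X"] conjI)
    show "countable (charts X)" by (rule countable_finite[OF assms(2)])
    show "\<Union> (fst ` charts X) = mpoints X" using X unfolding holo_atlas_def by (elim conjE)
  qed simp
  show "\<forall>(U, \<phi>) \<in> charts X. U \<subseteq> mpoints X \<and> inj_on \<phi> U \<and> openin (top_of_set (Cn (mdim X))) (\<phi> ` U)"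
    using X unfolding holo_atlas_def by (elim conjE)
  show "\<forall>(U, \<phi>) \<in> charts X. \<forall>(V, \<psi>) \<in> charts X.
        openin (top_of_set (Cn (mdim X))) (\<phi> ` (U \<inter> V)) \<and>
        (\<forall>j<mdim X. holo_Cn (mdim X) (\<phi> ` (U \<inter> V)) (\<lambda>y. \<psi> (inv_into U \<phi> y) j))"
    using X unfolding holo_atlas_def by (elim conjE)
qed (rule assms(3))

text \<open>Distinct configurations differ at some index; neighbourhoods separating these two points
  of the projective line are pulled back along that coordinate.\<close>

lemma Zk_complex_manifold: "complex_manifold (Zk_mfd k)"
proof (rule complex_manifoldI[OF Zk_atlas])
  show "finite (charts (Zk_mfd k))" unfolding Zk_charts by (rule finite_imageI) (simp flip: Pow_def)
  show "\<forall>x\<in>mpoints (Zk_mfd k). \<forall>y\<in>mpoints (Zk_mfd k). x \<noteq> y \<longrightarrow>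
      (\<exists>V W. mopen (Zk_mfd k) V \<and> mopen (Zk_mfd k) W \<and> x \<in> V \<and> y \<in> W \<and> V \<inter> W = {})"
  proof (intro ballI impI)
    fix x y assume "x \<in> mpoints (Zk_mfd k)" "y \<in> mpoints (Zk_mfd k)" and ne: "x \<noteq> y"
    then have x: "x \<in> Zk k 0" and y: "y \<in> Zk k 0" by simp_all
    have "x \<in> extensional {..<k}" "y \<in> extensional {..<k}" by (rule Zk_ext[OF x], rule Zk_ext[OF y])
    then obtain i where i: "i < k" "x i \<noteq> y i" using ne by (metis extensionalityI lessThan_iff)
    obtain b w S b' w' S' where S: "open S" "open S'" "x i = affine_pt b w" "w \<in> S" "y i = affine_pt b' w'" "w' \<in> S'"
      "\<And>v v'. v \<in> S \<Longrightarrow> v' \<in> S' \<Longrightarrow> affine_pt b v \<noteq> affine_pt b' v'"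
      by (rule P1_separate[OF Zk_0_P11[OF x i(1)] Zk_0_P11[OF y i(1)] i(2)]) blast
    obtain J where J: "J \<subseteq> {..<k}" "x \<in> Zk_dom k J" "(i \<in> J) = b" by (rule Zk_chart_at[OF x i(1) S(3)])
    obtain J' where J': "J' \<subseteq> {..<k}" "y \<in> Zk_dom k J'" "(i \<in> J') = b'" by (rule Zk_chart_at[OF y i(1) S(5)])
    let ?V = "{p \<in> Zk_dom k J. affine_coord (i \<in> J) (p i) \<in> S}"
    let ?W = "{p \<in> Zk_dom k J'. affine_coord (i \<in> J') (p i) \<in> S'}"
    have "?V \<inter> ?W = {}"
    proof (rule ccontr)
      assume "?V \<inter> ?W \<noteq> {}"
      then obtain p where p: "p \<in> ?V" "p \<in> ?W" by blast
      then have "affine_pt b (affine_coord b (p i)) = p i" "affine_pt b' (affine_coord b' (p i)) = p i"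
        using affine_pt_coord[OF Zk_domD(2)[of p k J i]] affine_pt_coord[OF Zk_domD(2)[of p k J' i]] i(1) J(3) J'(3) by simp_all
      moreover have "affine_pt b (affine_coord b (p i)) \<noteq> affine_pt b' (affine_coord b' (p i))"
        by (rule S(7)) (use p J(3) J'(3) in simp_all)
      ultimately show False by simp
    qed
    moreover have "mopen (Zk_mfd k) ?V" "mopen (Zk_mfd k) ?W"
      by (rule mopen_preimage[OF Zk_atlas holo_Zk_coord[OF J(1) i(1)] S(1)],
          rule mopen_preimage[OF Zk_atlas holo_Zk_coord[OF J'(1) i(1)] S(2)])
    moreover have "x \<in> ?V" "y \<in> ?W" using J J' S by simp_all
    ultimately show "\<exists>V W. mopen (Zk_mfd k) V \<and> mopen (Zk_mfd k) W \<and> x \<in> V \<and> y \<in> W \<and> V \<inter> W = {}" by blast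
  qed
qed

text \<open>Lets a map be given by holomorphic homogeneous coordinates without choosing a chart of
  the target: the preimage of a chart domain is where the product of all denominators is
  nonzero.\<close>

lemma holo_map_to_Zk:
  assumes X: "holo_atlas X" and W: "mopen X W"
    and a: "\<And>i. i < k \<Longrightarrow> holo_fun X W (a i)" and b: "\<And>i. i < k \<Longrightarrow> holo_fun X W (b i)"
    and f: "\<And>x. x \<in> W \<Longrightarrow> f x \<in> Zk k 0" and rep: "\<And>x i. x \<in> W \<Longrightarrow> i < k \<Longrightarrow> f x i = pt (a i x) (b i x) 0"
  shows "holo_map X W (Zk_mfd k) f"
proof (rule holo_mapI[OF W])
  show "f x \<in> mpoints (Zk_mfd k)" if "x \<in> W" for x using f[OF that] by simp
  fix V \<psi> j assume "(V, \<psi>) \<in> charts (Zk_mfd k)"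
  then obtain J where J: "J \<subseteq> {..<k}" "V = Zk_dom k J" "\<psi> = Zcoord k J" unfolding Zk_charts by blast
  have dom: "x \<in> {x \<in> W. f x \<in> V} \<longleftrightarrow> x \<in> W \<and> (\<forall>i<k. den (i \<in> J) (a i x) (b i x) \<noteq> 0)" for x
    using f rep by (auto simp: J(2) Zk_dom_def pt_in_range_affine)
  have "{x \<in> W. f x \<in> V} = {x \<in> W. (\<Prod>i<k. den (i \<in> J) (a i x) (b i x)) \<in> - {0}}"
    using dom by auto
  moreover have "mopen X {x \<in> W. (\<Prod>i<k. den (i \<in> J) (a i x) (b i x)) \<in> - {0}}"
    by (rule mopen_preimage[OF X holo_fun_prod[OF X W holo_fun_den]]) (use a b in auto)
  ultimately show op: "mopen X {x \<in> W. f x \<in> V}" by simp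
  assume "j < mdim (Zk_mfd k)"
  then have j: "j < k" by simp
  have sub: "{x \<in> W. f x \<in> V} \<subseteq> W" by auto
  have "holo_fun X {x \<in> W. f x \<in> V} (\<lambda>x. rat (j \<in> J) (a j x) (b j x))"
    by (rule holo_fun_rat[OF X holo_fun_subset[OF X a[OF j] op sub] holo_fun_subset[OF X b[OF j] op sub]])
      (use dom j in blast)
  then show "holo_fun X {x \<in> W. f x \<in> V} (\<lambda>x. \<psi> (f x) j)"
  proof (rule holo_fun_cong[OF X])
    fix x assume x: "x \<in> {x \<in> W. f x \<in> V}"
    then have "den (j \<in> J) (a j x) (b j x) \<noteq> 0" using dom j by blast
    from affine_coord_pt[OF this] show "rat (j \<in> J) (a j x) (b j x) = \<psi> (f x) j"
      using x j rep by (simp add: J(3) Zcoord_def)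
  qed
qed

section \<open>The normal bundle of the configuration space\<close>

definition Ntriv :: "nat \<Rightarrow> nat set \<Rightarrow> (nat \<Rightarrow> spoint) \<Rightarrow> nat \<Rightarrow> complex" where
  "Ntriv k J v = (\<lambda>i. if i < k then spinor_coord (i \<in> J) (v i) else 0)"

lemma normal_Zk_simps [simp]:
  "base (normal_Zk k) = Zk_mfd k" "bproj (normal_Zk k) = tuple_red k" "vrank (normal_Zk k) = k"
  "vadd (normal_Zk k) = (\<lambda>v w. \<lambda>i\<in>{..<k}. S_add (v i) (w i))"
  "vscale (normal_Zk k) = (\<lambda>t v. \<lambda>i\<in>{..<k}. S_scale t (v i))"
  by (simp_all add: normal_Zk_def)

lemma normal_trivs: "trivs (normal_Zk k) = (\<lambda>J. (Zk_dom k J, Ntriv k J)) ` {J. J \<subseteq> {..<k}}"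
  unfolding normal_Zk_def Ntriv_def by auto

lemma normal_triv_mem: "J \<subseteq> {..<k} \<Longrightarrow> (Zk_dom k J, Ntriv k J) \<in> trivs (normal_Zk k)"
  unfolding normal_trivs by blast

lemma normal_Zk_total_iff: "v \<in> total (normal_Zk k) \<longleftrightarrow> v \<in> {..<k} \<rightarrow>\<^sub>E P11 1 \<and> tuple_red k v \<in> Zk k 0"
  by (auto simp: normal_Zk_def spinor_bundle_def)

lemma tuple_red_apply: "i < k \<Longrightarrow> tuple_red k v i = pt_red (v i)"
  by (simp add: tuple_red_def)

lemma normal_rep:
  assumes v: "v \<in> total (normal_Zk k)" and p: "tuple_red k v \<in> Zk_dom k J" and i: "i < k"
  shows "v i = pt (Zx J (tuple_red k v) i) (Zy J (tuple_red k v) i) (Ntriv k J v i)"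
proof -
  have "v i \<in> P11 1" using v i by (auto simp: normal_Zk_total_iff)
  moreover have "pt_red (v i) \<in> range (affine_pt (i \<in> J))"
    using Zk_domD(2)[OF p i] by (simp add: tuple_red_apply[OF i])
  ultimately show ?thesis
    using spinor_rep[of "v i" "i \<in> J"] i by (simp add: Zx_def Zy_def Ntriv_def tuple_red_apply)
qed

lemma normal_ZkI:
  assumes p: "p \<in> Zk k 0" and v: "v \<in> extensional {..<k}"
    and rep: "\<And>i. i < k \<Longrightarrow> (x i \<noteq> 0 \<or> y i \<noteq> 0) \<and> p i = pt (x i) (y i) 0 \<and> v i = pt (x i) (y i) (t i)"
  shows "v \<in> total (normal_Zk k)" "tuple_red k v = p"
proof -
  show 1: "tuple_red k v = p"
  proof (rule extensionalityI)
    show "tuple_red k v \<in> extensional {..<k}" by (simp add: tuple_red_def)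
    show "p \<in> extensional {..<k}" by (rule Zk_ext[OF p])
  qed (use rep in \<open>simp add: tuple_red_def\<close>)
  have "v \<in> {..<k} \<rightarrow>\<^sub>E P11 1"
    unfolding PiE_iff using rep v by simp
  then show "v \<in> total (normal_Zk k)" unfolding normal_Zk_total_iff 1 using p by simp
qed

text \<open>The odd coordinate is linear with coefficients h in an unnormalized representative;
  normalizing in chart J divides these coefficients by \<open>den\<close>.\<close>

lemma holo_matrix_to_normal:
  assumes X: "holo_atlas X" and W: "mopen X W" and J: "J \<subseteq> {..<k}"
    and a: "\<And>i. i < k \<Longrightarrow> holo_fun X W (a i)" and b: "\<And>i. i < k \<Longrightarrow> holo_fun X W (b i)"
    and h: "\<And>i j. i < k \<Longrightarrow> j < n \<Longrightarrow> holo_fun X W (h i j)"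
    and rep: "\<And>e i. e \<in> T \<Longrightarrow> \<pi> e \<in> W \<Longrightarrow> i < k \<Longrightarrow>
      F e i = pt (a i (\<pi> e)) (b i (\<pi> e)) (\<Sum>j<n. h i j (\<pi> e) * \<sigma> e j) \<and>
      den (i \<in> J) (a i (\<pi> e)) (b i (\<pi> e)) \<noteq> 0"
    and nz: "\<And>x i. x \<in> W \<Longrightarrow> i < k \<Longrightarrow> den (i \<in> J) (a i x) (b i x) \<noteq> 0"
  shows "holo_matrix X W k n T \<pi> \<sigma> (\<lambda>e. Ntriv k J (F e))"
proof (rule holo_matrixI[where h = "\<lambda>i j x. h i j x / den (i \<in> J) (a i x) (b i x)"])
  show "holo_fun X W (\<lambda>x. h i j x / den (i \<in> J) (a i x) (b i x))" if "i < k" "j < n" for i j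
    by (rule holo_fun_divide[OF X h[OF that] holo_fun_den[OF a[OF that(1)] b[OF that(1)]] nz[OF _ that(1)]])
  fix e i assume e: "e \<in> T" "\<pi> e \<in> W" and i: "i < k"
  show "Ntriv k J (F e) i = (\<Sum>j<n. h i j (\<pi> e) / den (i \<in> J) (a i (\<pi> e)) (b i (\<pi> e)) * \<sigma> e j)"
    using rep[OF e i] i by (simp add: Ntriv_def spinor_coord_pt sum_divide_distrib)
qed

lemma Zk_normal_fibre_iso: "fibre_iso (normal_Zk k) (Zk_dom k J) (Ntriv k J)"
  unfolding fibre_iso_def
proof (intro ballI conjI allI)
  fix p assume p: "p \<in> Zk_dom k J"
  have fib: "v \<in> bfibre (normal_Zk k) p \<longleftrightarrow> v \<in> total (normal_Zk k) \<and> tuple_red k v = p" for v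
    by (simp add: bfibre_def)
  have rep: "v i = pt (Zx J p i) (Zy J p i) (Ntriv k J v i)" if "v \<in> bfibre (normal_Zk k) p" "i < k" for v i
    using normal_rep[of v k J i] that p unfolding fib by blast
  have ext: "v \<in> extensional {..<k}" if "v \<in> bfibre (normal_Zk k) p" for v
    using that unfolding fib normal_Zk_total_iff by (auto simp: PiE_iff)
  have inI: "v \<in> bfibre (normal_Zk k) p" if "v \<in> extensional {..<k}" "\<And>i. i < k \<Longrightarrow> v i = pt (Zx J p i) (Zy J p i) (t i)" for v t
    unfolding fib
    using normal_ZkI[OF Zk_domD(1)[OF p] that(1), of "Zx J p" "Zy J p" t] that(2) Zk_dom_rep[OF p] Zxy_nonzero by simp
  have triv: "Ntriv k J v i = t i" if "\<And>i. i < k \<Longrightarrow> v i = pt (Zx J p i) (Zy J p i) (t i)" "i < k" for v t i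
    using that by (simp add: Ntriv_def Zx_def Zy_def)
  show "bij_betw (Ntriv k J) (bfibre (normal_Zk k) p) (Cn (vrank (normal_Zk k)))"
  proof (rule bij_betwI')
    fix v w assume v: "v \<in> bfibre (normal_Zk k) p" and w: "w \<in> bfibre (normal_Zk k) p"
    show "(Ntriv k J v = Ntriv k J w) = (v = w)"
    proof
      assume "Ntriv k J v = Ntriv k J w"
      then show "v = w" using rep[OF v] rep[OF w] by (intro extensionalityI[OF ext[OF v] ext[OF w]]) simp
    qed simp
  next
    show "Ntriv k J v \<in> Cn (vrank (normal_Zk k))" for v by (simp add: Ntriv_def Cn_def)
    fix t assume t: "t \<in> Cn (vrank (normal_Zk k))"
    let ?v = "\<lambda>i\<in>{..<k}. pt (Zx J p i) (Zy J p i) (t i)"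
    have v: "?v \<in> bfibre (normal_Zk k) p" by (rule inI[of _ t]) simp_all
    moreover have "t = Ntriv k J ?v"
    proof
      fix i show "t i = Ntriv k J ?v i"
      proof (cases "i < k")
        case True
        then show ?thesis using triv[of ?v t i] by simp
      qed (use t in \<open>simp add: Ntriv_def Cn_def\<close>)
    qed
    ultimately show "\<exists>v\<in>bfibre (normal_Zk k) p. t = Ntriv k J v" by blast
  qed
  fix v assume v: "v \<in> bfibre (normal_Zk k) p"
  show "vscale (normal_Zk k) c v \<in> bfibre (normal_Zk k) p" for c
    by (rule inI[of _ "\<lambda>i. c * Ntriv k J v i"]) (use rep[OF v] in simp_all)
  show "Ntriv k J (vscale (normal_Zk k) c v) = (\<lambda>j. c * Ntriv k J v j)" for c
  proof
    fix i show "Ntriv k J (vscale (normal_Zk k) c v) i = c * Ntriv k J v i"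
    proof (cases "i < k")
      case True
      have "vscale (normal_Zk k) c v i = pt (Zx J p i) (Zy J p i) (c * Ntriv k J v i)" if "i < k" for i
        using S_scale_pt[of c "Zx J p i" "Zy J p i" "Ntriv k J v i"] that
        unfolding rep[OF v that, symmetric] by simp
      then show ?thesis using triv[of "vscale (normal_Zk k) c v" "\<lambda>i. c * Ntriv k J v i"] True by simp
    qed (simp add: Ntriv_def)
  qed
  fix w assume w: "w \<in> bfibre (normal_Zk k) p"
  have add: "vadd (normal_Zk k) v w i = pt (Zx J p i) (Zy J p i) (Ntriv k J v i + Ntriv k J w i)" if "i < k" for i
    using S_add_pt[OF Zxy_nonzero, of J p i "Ntriv k J v i" "Ntriv k J w i"] that
    unfolding rep[OF v that, symmetric] rep[OF w that, symmetric] by simp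
  show "vadd (normal_Zk k) v w \<in> bfibre (normal_Zk k) p"
    by (rule inI[of _ "\<lambda>i. Ntriv k J v i + Ntriv k J w i"]) (simp, rule add)
  show "Ntriv k J (vadd (normal_Zk k) v w) = (\<lambda>j. Ntriv k J v j + Ntriv k J w j)"
  proof
    fix i show "Ntriv k J (vadd (normal_Zk k) v w) i = Ntriv k J v i + Ntriv k J w i"
      using triv[of "vadd (normal_Zk k) v w" "\<lambda>i. Ntriv k J v i + Ntriv k J w i", OF add]
      by (cases "i < k") (simp, simp add: Ntriv_def)
  qed
qed

text \<open>The transition functions come from the identity map: a vector described in the
  coordinates of J is renormalized for J', which gives a diagonal matrix with entries 1/den.\<close>

lemma holo_vbundle_normal: "holo_vbundle (normal_Zk k)"
  unfolding holo_vbundle_def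
proof (intro conjI ballI)
  show "complex_manifold (base (normal_Zk k))" by (simp add: Zk_complex_manifold)
  show "bproj (normal_Zk k) ` total (normal_Zk k) \<subseteq> mpoints (base (normal_Zk k))"
    by (auto simp: normal_Zk_total_iff)
  have "fst ` trivs (normal_Zk k) = fst ` charts (Zk_mfd k)" unfolding normal_trivs Zk_charts by (simp add: image_image)
  then show "\<Union> (fst ` trivs (normal_Zk k)) = mpoints (base (normal_Zk k))"
    using Zk_atlas[of k] unfolding holo_atlas_def by (elim conjE) simp
next
  fix c assume "c \<in> trivs (normal_Zk k)"
  then obtain J where J: "J \<subseteq> {..<k}" and c: "c = (Zk_dom k J, Ntriv k J)" unfolding normal_trivs by blast
  show "case c of (U, \<tau>) \<Rightarrow> mopen (base (normal_Zk k)) U \<and> fibre_iso (normal_Zk k) U \<tau>"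
    unfolding c prod.case using mopen_Zk_dom[OF J] Zk_normal_fibre_iso by simp
next
  fix c assume "c \<in> trivs (normal_Zk k)"
  then obtain J where J: "J \<subseteq> {..<k}" and c: "c = (Zk_dom k J, Ntriv k J)" unfolding normal_trivs by blast
  have "holo_matrix (Zk_mfd k) (Zk_dom k J \<inter> Zk_dom k J') k k (total (normal_Zk k)) (tuple_red k) (Ntriv k J) (Ntriv k J')"
    if J': "J' \<subseteq> {..<k}" for J'
  proof (rule holo_matrix_to_normal[where F = "\<lambda>e. e" and a = "\<lambda>i p. Zx J p i" and b = "\<lambda>i p. Zy J p i"
        and h = "\<lambda>i j _. if i = j then 1 else 0", OF Zk_atlas _ J'])
    show W: "mopen (Zk_mfd k) (Zk_dom k J \<inter> Zk_dom k J')"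
      by (rule mopen_Int[OF Zk_atlas mopen_Zk_dom[OF J] mopen_Zk_dom[OF J']])
    show "holo_fun (Zk_mfd k) (Zk_dom k J \<inter> Zk_dom k J') (\<lambda>p. Zx J p i)"
      "holo_fun (Zk_mfd k) (Zk_dom k J \<inter> Zk_dom k J') (\<lambda>p. Zy J p i)" if "i < k" for i
      by (rule holo_fun_subset[OF Zk_atlas holo_Zxy(1)[OF J that] W], simp,
          rule holo_fun_subset[OF Zk_atlas holo_Zxy(2)[OF J that] W], simp)
    show "holo_fun (Zk_mfd k) (Zk_dom k J \<inter> Zk_dom k J') (\<lambda>_. if i = j then 1 else 0)" for i j
      by (rule holo_fun_const[OF Zk_atlas W])
    show nz: "den (i \<in> J') (Zx J x i) (Zy J x i) \<noteq> 0" if x: "x \<in> Zk_dom k J \<inter> Zk_dom k J'" and i: "i < k" for x i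
      using Zk_dom_rep[of x k J i] Zk_domD(2)[of x k J' i] x i by (simp add: pt_in_range_affine)
    fix e i assume e: "e \<in> total (normal_Zk k)" "tuple_red k e \<in> Zk_dom k J \<inter> Zk_dom k J'" and i: "i < k"
    have "(\<Sum>j<k. (if i = j then 1 else 0) * Ntriv k J e j) = Ntriv k J e i"
      using i by (simp add: if_distrib[of "\<lambda>t. t * _"] cong: if_cong)
    then show "e i = pt (Zx J (tuple_red k e) i) (Zy J (tuple_red k e) i)
        (\<Sum>j<k. (if i = j then 1 else 0) * Ntriv k J e j) \<and> den (i \<in> J') (Zx J (tuple_red k e) i) (Zy J (tuple_red k e) i) \<noteq> 0"
      using normal_rep[OF e(1) _ i, of J] nz[OF e(2) i] e(2) by simp
  qed
  then show "case c of (U, \<sigma>) \<Rightarrow> \<forall>(V, \<tau>)\<in>trivs (normal_Zk k). holo_matrix (base (normal_Zk k)) (U \<inter> V)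
      (vrank (normal_Zk k)) (vrank (normal_Zk k)) (total (normal_Zk k)) (bproj (normal_Zk k)) \<sigma> \<tau>"
    unfolding c prod.case normal_trivs normal_Zk_simps by (simp only: ball_simps prod.case) blast
qed

section \<open>Bundle maps into the normal bundle\<close>

lemma holo_map_local:
  assumes X: "holo_atlas X" and loc: "\<And>x. x \<in> W \<Longrightarrow> \<exists>V. x \<in> V \<and> V \<subseteq> W \<and> holo_map X V Y f"
  shows "holo_map X W Y f"
proof (rule holo_mapI)
  show "mopen X W"
  proof (rule mopen_local[OF X])
    fix x assume "x \<in> W"
    from loc[OF this] show "\<exists>V. x \<in> V \<and> V \<subseteq> W \<and> mopen X V" by (elim exE conjE) (intro exI conjI holo_mapD(1))
  qed
  show "f x \<in> mpoints Y" if "x \<in> W" for x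
    using loc[OF that] by (elim exE conjE) (rule holo_mapD(2))
  fix V \<psi> j assume V: "(V, \<psi>) \<in> charts Y"
  have sub: "{x \<in> N. f x \<in> V} \<subseteq> {x \<in> W. f x \<in> V}" if "N \<subseteq> W" for N using that by auto
  show "mopen X {x \<in> W. f x \<in> V}"
  proof (rule mopen_local[OF X])
    fix x assume "x \<in> {x \<in> W. f x \<in> V}"
    then have fx: "x \<in> W" "f x \<in> V" by simp_all
    from loc[OF fx(1)] obtain N where N: "x \<in> N" "N \<subseteq> W" "holo_map X N Y f" by (elim exE conjE)
    from holo_mapD(3)[OF N(3) V] show "\<exists>N. x \<in> N \<and> N \<subseteq> {x \<in> W. f x \<in> V} \<and> mopen X N"
      using sub[OF N(2)] N(1) fx(2) by (intro exI[of _ "{x \<in> N. f x \<in> V}"]) simp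
  qed
  assume j: "j < mdim Y"
  show "holo_fun X {x \<in> W. f x \<in> V} (\<lambda>x. \<psi> (f x) j)"
  proof (rule holo_fun_local[OF X])
    fix x assume "x \<in> {x \<in> W. f x \<in> V}"
    then have fx: "x \<in> W" "f x \<in> V" by simp_all
    from loc[OF fx(1)] obtain N where N: "x \<in> N" "N \<subseteq> W" "holo_map X N Y f" by (elim exE conjE)
    from holo_mapD(4)[OF N(3) V j] show "\<exists>N. x \<in> N \<and> N \<subseteq> {x \<in> W. f x \<in> V} \<and> holo_fun X N (\<lambda>x. \<psi> (f x) j)"
      using sub[OF N(2)] N(1) fx(2) by (intro exI[of _ "{x \<in> N. f x \<in> V}"]) simp
  qed
qed

lemma vbundle_point:
  assumes E: "holo_vbundle E" and x: "x \<in> mpoints (base E)"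
  obtains U \<sigma> where "(U, \<sigma>) \<in> trivs E" "x \<in> U"
proof -
  obtain c where "c \<in> trivs E" "x \<in> fst c" using x unfolding holo_vbundleD(4)[OF E, symmetric] by blast
  then show ?thesis using that[of "fst c" "snd c"] by simp
qed

text \<open>A criterion free of target charts: even coordinates a, b holomorphic on the base, odd
  coordinate linear in a trivialization of the source. The neighbourhood may depend on the point
  because fibre matrices are unique and hence glue.\<close>

lemma bundle_map_to_normal:
  assumes E: "holo_vbundle E" and W: "mopen (base E) W"
    and F: "\<And>e. e \<in> total E \<Longrightarrow> bproj E e \<in> W \<Longrightarrow> F e \<in> total (normal_Zk k) \<and> tuple_red k (F e) = f (bproj E e)"
    and loc: "\<And>U \<sigma> x. (U, \<sigma>) \<in> trivs E \<Longrightarrow> x \<in> W \<inter> U \<Longrightarrow> \<exists>V a b h. x \<in> V \<and> V \<subseteq> W \<inter> U \<and> mopen (base E) V \<and>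
      (\<forall>i<k. holo_fun (base E) V (a i) \<and> holo_fun (base E) V (b i) \<and> (\<forall>j<vrank E. holo_fun (base E) V (h i j))) \<and>
      (\<forall>e\<in>total E. bproj E e \<in> V \<longrightarrow> (\<forall>i<k. F e i = pt (a i (bproj E e)) (b i (bproj E e)) (\<Sum>j<vrank E. h i j (bproj E e) * \<sigma> e j)))"
  shows "bundle_map_on W E (normal_Zk k) f F"
proof (rule bundle_map_onI)
  have X: "holo_atlas (base E)" by (rule holo_vbundleD(2)[OF E])
  have red: "f y \<in> Zk k 0 \<and> (\<forall>i<k. f y i = pt (a i y) (b i y) 0)"
    if U: "(U, \<sigma>) \<in> trivs E" and y: "y \<in> V" "V \<subseteq> W \<inter> U"
      and rep: "\<forall>e\<in>total E. bproj E e \<in> V \<longrightarrow> (\<forall>i<k. F e i = pt (a i (bproj E e)) (b i (bproj E e)) (h e i))"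
    for U \<sigma> V y a b h
  proof -
    \<comment> \<open>Some vector over y exists, namely the one with zero coordinates; reducing its
      image shows that a and b describe f.\<close>
    have "(\<lambda>_. 0) \<in> Cn (vrank E)" by (simp add: Cn_def)
    then obtain e where e: "e \<in> total E" "bproj E e = y"
      using fibre_iso_surj[OF holo_vbundleD(6)[OF E U]] y by blast
    then have "F e \<in> total (normal_Zk k)" "tuple_red k (F e) = f y" using F y by auto
    moreover have "\<forall>i<k. F e i = pt (a i y) (b i y) (h e i)" using rep e y by blast
    ultimately show ?thesis unfolding normal_Zk_total_iff using tuple_red_apply pt_red_pt by metis
  qed
  have map: "holo_map (base E) V (Zk_mfd k) f"
    if U: "(U, \<sigma>) \<in> trivs E" and V: "V \<subseteq> W \<inter> U" "mopen (base E) V"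
      and a: "\<And>i. i < k \<Longrightarrow> holo_fun (base E) V (a i)" and b: "\<And>i. i < k \<Longrightarrow> holo_fun (base E) V (b i)"
      and rep: "\<forall>e\<in>total E. bproj E e \<in> V \<longrightarrow> (\<forall>i<k. F e i = pt (a i (bproj E e)) (b i (bproj E e)) (h e i))"
    for U \<sigma> V a b h
    by (rule holo_map_to_Zk[OF X V(2) a b]) (use red[OF U _ V(1) rep] in auto)
  show "holo_map (base E) W (base (normal_Zk k)) f"
    unfolding normal_Zk_simps
  proof (rule holo_map_local[OF X])
    fix x assume x: "x \<in> W"
    then have "x \<in> mpoints (base E)" using mopenD(1)[OF X W] by blast
    then obtain U \<sigma> where U: "(U, \<sigma>) \<in> trivs E" "x \<in> U" by (rule vbundle_point[OF E])
    then have "x \<in> W \<inter> U" using x by simp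
    from loc[OF U(1) this] obtain V a b h where V: "x \<in> V" "V \<subseteq> W \<inter> U" "mopen (base E) V"
      "\<forall>i<k. holo_fun (base E) V (a i) \<and> holo_fun (base E) V (b i) \<and> (\<forall>j<vrank E. holo_fun (base E) V (h i j))"
      "\<forall>e\<in>total E. bproj E e \<in> V \<longrightarrow> (\<forall>i<k. F e i = pt (a i (bproj E e)) (b i (bproj E e)) (\<Sum>j<vrank E. h i j (bproj E e) * \<sigma> e j))"
      by (elim exE conjE)
    have "holo_map (base E) V (Zk_mfd k) f" by (rule map[OF U(1) V(2,3) _ _ V(5)]) (use V(4) in simp_all)
    then show "\<exists>V. x \<in> V \<and> V \<subseteq> W \<and> holo_map (base E) V (Zk_mfd k) f" using V(1,2) by (intro exI[of _ V]) simp
  qed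
  show "F e \<in> total (normal_Zk k) \<and> bproj (normal_Zk k) (F e) = f (bproj E e)" if "e \<in> total E" "bproj E e \<in> W" for e
    using F[OF that] by simp
  fix U \<sigma> V' \<tau> assume U: "(U, \<sigma>) \<in> trivs E" and "(V', \<tau>) \<in> trivs (normal_Zk k)"
  then obtain J where J: "J \<subseteq> {..<k}" "V' = Zk_dom k J" "\<tau> = Ntriv k J" unfolding normal_trivs by blast
  let ?D = "{x \<in> W \<inter> U. f x \<in> V'}"
  show "holo_matrix (base E) ?D (vrank (normal_Zk k)) (vrank E) (total E) (bproj E) \<sigma> (\<lambda>e. \<tau> (F e))"
    unfolding normal_Zk_simps
  proof (rule holo_matrix_local[OF X])
    show "\<exists>e\<in>total E. bproj E e = x \<and> \<sigma> e = y" if "x \<in> ?D" "y \<in> Cn (vrank E)" for x y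
      by (rule fibre_iso_surj[OF holo_vbundleD(6)[OF E U]]) (use that in auto)
    fix x assume x: "x \<in> ?D"
    then have "x \<in> W \<inter> U" by simp
    from loc[OF U this] obtain V a b h where V: "x \<in> V" "V \<subseteq> W \<inter> U" "mopen (base E) V"
      "\<forall>i<k. holo_fun (base E) V (a i) \<and> holo_fun (base E) V (b i) \<and> (\<forall>j<vrank E. holo_fun (base E) V (h i j))"
      "\<forall>e\<in>total E. bproj E e \<in> V \<longrightarrow> (\<forall>i<k. F e i = pt (a i (bproj E e)) (b i (bproj E e)) (\<Sum>j<vrank E. h i j (bproj E e) * \<sigma> e j))"
      by (elim exE conjE)
    let ?V = "{y \<in> V. f y \<in> V'}"
    have "holo_map (base E) V (Zk_mfd k) f" by (rule map[OF U V(2,3) _ _ V(5)]) (use V(4) in simp_all)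
    then have op: "mopen (base E) ?V"
      unfolding J(2) by (rule holo_map_preimage[OF X Zk_atlas _ mopen_Zk_dom[OF J(1)]])
    have sub: "?V \<subseteq> V" by auto
    have nz: "den (i \<in> J) (a i y) (b i y) \<noteq> 0" if "y \<in> ?V" "i < k" for y i
    proof -
      have "f y i = pt (a i y) (b i y) 0" using red[OF U _ V(2,5)] that by simp
      moreover have "f y i \<in> range (affine_pt (i \<in> J))" using that Zk_domD(2)[of "f y" k J i] by (simp add: J(2))
      ultimately show ?thesis by (simp add: pt_in_range_affine)
    qed
    have "holo_matrix (base E) ?V k (vrank E) (total E) (bproj E) \<sigma> (\<lambda>e. Ntriv k J (F e))"
    proof (rule holo_matrix_to_normal[OF X op J(1), where a = a and b = b and h = h])
      show "holo_fun (base E) ?V (a i)" "holo_fun (base E) ?V (b i)" if "i < k" for i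
        using V(4) that by (auto intro!: holo_fun_subset[OF X _ op sub])
      show "holo_fun (base E) ?V (h i j)" if "i < k" "j < vrank E" for i j
        by (rule holo_fun_subset[OF X _ op sub]) (use V(4) that in blast)
      show "F e i = pt (a i (bproj E e)) (b i (bproj E e)) (\<Sum>j<vrank E. h i j (bproj E e) * \<sigma> e j) \<and>
          den (i \<in> J) (a i (bproj E e)) (b i (bproj E e)) \<noteq> 0"
        if "e \<in> total E" "bproj E e \<in> ?V" "i < k" for e i
        using V(5) nz[OF that(2,3)] that sub by blast
    qed (rule nz)
    then show "\<exists>V. x \<in> V \<and> V \<subseteq> ?D \<and> holo_matrix (base E) V k (vrank E) (total E) (bproj E) \<sigma> (\<lambda>e. \<tau> (F e))"
      unfolding J(3) using x V(1,2) by (intro exI[of _ ?V]) auto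
  qed
qed

section \<open>The group actions\<close>

lemma sl2_matmul:
  "sc_matmul (sl2_mat a b c d) (sl2_mat a' b' c' d') =
    sl2_mat (a * a' + c * b') (b * a' + d * b') (a * c' + c * d') (b * c' + d * d')"
  by (simp add: sc_matmul_def sl2_mat_def gconst_add gconst_mult)

lemma sl2_one: "sc_one = sl2_mat 1 0 0 1"
  by (simp add: sc_one_def sl2_mat_def)

lemma SL2_simps [simp]: "mult SL2 M N = sc_matmul N M" "one SL2 = sc_one"
  by (simp_all add: SL2_def)

lemma SL2_cases:
  assumes "M \<in> carrier SL2"
  obtains a b c d where "M = sl2_mat a b c d" "a * d - b * c = 1"
  using assms by (auto simp: SL2_def)

lemma SL2_memI: "a * d - b * c = 1 \<Longrightarrow> sl2_mat a b c d \<in> carrier SL2"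
  by (auto simp: SL2_def)

lemma group_SL2: "group SL2"
proof (rule groupI)
  fix M N assume "M \<in> carrier SL2" "N \<in> carrier SL2"
  then obtain a b c d a' b' c' d' where M: "M = sl2_mat a b c d" "a * d - b * c = 1"
    and N: "N = sl2_mat a' b' c' d'" "a' * d' - b' * c' = 1" by (metis SL2_cases)
  have "(a' * a + c' * b) * (b' * c + d' * d) - (b' * a + d' * b) * (a' * c + c' * d) = (a * d - b * c) * (a' * d' - b' * c')"
    by (simp add: algebra_simps)
  then show "M \<otimes>\<^bsub>SL2\<^esub> N \<in> carrier SL2" using M N by (simp add: sl2_matmul SL2_memI)
next
  fix M N P assume "M \<in> carrier SL2" "N \<in> carrier SL2" "P \<in> carrier SL2"
  then show "M \<otimes>\<^bsub>SL2\<^esub> N \<otimes>\<^bsub>SL2\<^esub> P = M \<otimes>\<^bsub>SL2\<^esub> (N \<otimes>\<^bsub>SL2\<^esub> P)"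
    by (elim SL2_cases) (simp add: sl2_matmul algebra_simps)
next
  fix M assume "M \<in> carrier SL2"
  then obtain a b c d where M: "M = sl2_mat a b c d" "a * d - b * c = 1" by (rule SL2_cases)
  show "\<one>\<^bsub>SL2\<^esub> \<otimes>\<^bsub>SL2\<^esub> M = M" by (simp add: M(1) sl2_one sl2_matmul)
  have "sl2_mat d (-b) (-c) a \<in> carrier SL2" by (rule SL2_memI) (use M(2) in \<open>simp add: mult.commute\<close>)
  moreover have "sl2_mat d (-b) (-c) a \<otimes>\<^bsub>SL2\<^esub> M = \<one>\<^bsub>SL2\<^esub>"
    using M(2) by (simp add: M(1) sl2_one sl2_matmul mult.commute)
  ultimately show "\<exists>N\<in>carrier SL2. N \<otimes>\<^bsub>SL2\<^esub> M = \<one>\<^bsub>SL2\<^esub>" by blast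
qed (simp add: sl2_one SL2_memI)

text \<open>The product of \<open>SL2\<close> is composition of automorphisms, opposite to matrix
  multiplication; hence the order \<open>sc_matmul N M\<close> in \<open>comp\<close>. Bijectivity
  of each map comes from the inverses in the group.\<close>

lemma SL2_group_actionI:
  assumes closed: "\<And>M e. M \<in> carrier SL2 \<Longrightarrow> e \<in> E \<Longrightarrow> act M e \<in> E"
    and comp: "\<And>M N e. M \<in> carrier SL2 \<Longrightarrow> N \<in> carrier SL2 \<Longrightarrow> e \<in> E \<Longrightarrow> act (sc_matmul N M) e = act M (act N e)"
    and one: "\<And>e. e \<in> E \<Longrightarrow> act sc_one e = e"
  shows "group_action SL2 E (\<lambda>M. restrict (act M) E)"
proof -
  interpret group SL2 by (rule group_SL2)
  have bij: "restrict (act M) E \<in> Bij E" if M: "M \<in> carrier SL2" for M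
  proof -
    have i: "inv\<^bsub>SL2\<^esub> M \<in> carrier SL2" using M by simp
    have 1: "act (inv\<^bsub>SL2\<^esub> M) (act M e) = e" if "e \<in> E" for e
      using comp[OF i M that] one[OF that] l_inv[OF M] by simp
    have 2: "act M (act (inv\<^bsub>SL2\<^esub> M) e) = e" if "e \<in> E" for e
      using comp[OF M i that] one[OF that] r_inv[OF M] by simp
    have "bij_betw (restrict (act M) E) E E"
      by (rule bij_betw_byWitness[where f' = "act (inv\<^bsub>SL2\<^esub> M)"])
        (use 1 2 closed[OF M] closed[OF i] in auto)
    then show ?thesis by (simp add: Bij_def)
  qed
  have "(\<lambda>M. restrict (act M) E) \<in> hom SL2 (BijGroup E)"
  proof (rule homI)
    show "restrict (act M) E \<in> carrier (BijGroup E)" if "M \<in> carrier SL2" for M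
      using bij[OF that] by (simp add: BijGroup_def)
    fix M N assume M: "M \<in> carrier SL2" and N: "N \<in> carrier SL2"
    have "restrict (act (M \<otimes>\<^bsub>SL2\<^esub> N)) E = compose E (restrict (act M) E) (restrict (act N) E)"
      by (rule ext) (use comp[OF M N] closed[OF N] in \<open>simp add: compose_def\<close>)
    then show "restrict (act (M \<otimes>\<^bsub>SL2\<^esub> N)) E = restrict (act M) E \<otimes>\<^bsub>BijGroup E\<^esub> restrict (act N) E"
      using bij[OF M] bij[OF N] by (simp add: BijGroup_def)
  qed
  then show ?thesis
    by (intro group_action.intro group_hom.intro group_BijGroup group_SL2 group_hom_axioms.intro)
qed

lemma pt_act_closed:
  assumes "M \<in> carrier SL2" "p \<in> P11 1"
  shows "pt_act M p \<in> P11 1"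
proof -
  obtain a b c d where M: "M = sl2_mat a b c d" "a * d - b * c = 1" using assms(1) by (rule SL2_cases)
  obtain x y v where p: "p = pt x y v" "x \<noteq> 0 \<or> y \<noteq> 0" using assms(2) by (rule P11_1_cases)
  show ?thesis unfolding M(1) p(1) pt_act_sl2 by (rule pt_in_P11(1)[OF sl2_nonzero[OF M(2) p(2)]])
qed

lemma pt_act_red: "M \<in> carrier SL2 \<Longrightarrow> p \<in> P11 1 \<Longrightarrow> pt_red (pt_act M p) = pt_act M (pt_red p)"
  by (elim SL2_cases P11_1_cases) simp

lemma pt_act_comp:
  "M \<in> carrier SL2 \<Longrightarrow> N \<in> carrier SL2 \<Longrightarrow> p \<in> P11 1 \<Longrightarrow> pt_act (sc_matmul N M) p = pt_act M (pt_act N p)"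
  by (elim SL2_cases P11_1_cases) (simp add: sl2_matmul algebra_simps)

lemma pt_act_one: "p \<in> P11 1 \<Longrightarrow> pt_act sc_one p = p"
  by (elim P11_1_cases) (simp add: sl2_one)

lemma tuple_act_apply: "i < k \<Longrightarrow> tuple_act k M p i = pt_act M (p i)"
  by (simp add: tuple_act_def)

lemma tuple_act_ext: "tuple_act k M p \<in> extensional {..<k}"
  by (simp add: tuple_act_def)

lemma Zk_1_P11: "p \<in> Zk k 1 \<Longrightarrow> i < k \<Longrightarrow> p i \<in> P11 1"
  by (auto simp: Zk_def)

lemma Zk_0_subset_1: "p \<in> Zk k 0 \<Longrightarrow> p \<in> Zk k 1"
  using P11_01 by (auto simp: Zk_def PiE_iff)

lemma pt_act_inj:
  assumes "M \<in> carrier SL2" "p \<in> P11 1" "q \<in> P11 1" "pt_act M p = pt_act M q"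
  shows "p = q"
proof -
  interpret group SL2 by (rule group_SL2)
  have i: "inv\<^bsub>SL2\<^esub> M \<in> carrier SL2" using assms(1) by simp
  have "r = pt_act (inv\<^bsub>SL2\<^esub> M) (pt_act M r)" if "r \<in> P11 1" for r
    using pt_act_comp[OF i assms(1) that] l_inv[OF assms(1)] pt_act_one[OF that] by simp
  then show ?thesis using assms(2-4) by metis
qed

lemma tuple_act_Zk_1:
  assumes M: "M \<in> carrier SL2" and p: "p \<in> Zk k 1"
  shows "tuple_act k M p \<in> Zk k 1" "tuple_red k (tuple_act k M p) = tuple_act k M (tuple_red k p)"
proof -
  have "inj_on (\<lambda>i. pt_red (tuple_act k M p i)) {..<k}"
  proof (rule inj_onI)
    fix i j assume ij: "i \<in> {..<k}" "j \<in> {..<k}" "pt_red (tuple_act k M p i) = pt_red (tuple_act k M p j)"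
    then have "pt_act M (pt_red (p i)) = pt_act M (pt_red (p j))"
      using pt_act_red[OF M Zk_1_P11[OF p]] by (simp add: tuple_act_apply)
    then have "pt_red (p i) = pt_red (p j)"
      using pt_act_inj[OF M P11_01 P11_01] pt_red_P11[OF Zk_1_P11[OF p]] ij by simp
    then show "i = j" using p ij by (auto simp: Zk_def dest: inj_onD)
  qed
  then show "tuple_act k M p \<in> Zk k 1"
    using pt_act_closed[OF M Zk_1_P11[OF p]] by (auto simp: Zk_def tuple_act_def)
  show "tuple_red k (tuple_act k M p) = tuple_act k M (tuple_red k p)"
    by (rule ext) (use pt_act_red[OF M Zk_1_P11[OF p]] in \<open>simp add: tuple_red_def tuple_act_def\<close>)
qed

lemma tuple_red_Zk_0: "p \<in> Zk k 0 \<Longrightarrow> tuple_red k p = p"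
  by (rule extensionalityI[OF _ Zk_ext]) (auto simp: tuple_red_def pt_red_P11_0 Zk_0_P11)

lemma tuple_red_Zk_1: "p \<in> Zk k 1 \<Longrightarrow> tuple_red k p \<in> Zk k 0"
  using normal_Zk_total_iff[of p k] by (simp add: total_normal_Zk)

lemma tuple_act_Zk_0:
  assumes M: "M \<in> carrier SL2" and p: "p \<in> Zk k 0"
  shows "tuple_act k M p \<in> Zk k 0"
  using tuple_act_Zk_1[OF M Zk_0_subset_1[OF p]] tuple_red_Zk_1[of "tuple_act k M p" k] tuple_red_Zk_0[OF p] by simp

lemma tuple_act_comp:
  "M \<in> carrier SL2 \<Longrightarrow> N \<in> carrier SL2 \<Longrightarrow> p \<in> Zk k 1 \<Longrightarrow> tuple_act k (sc_matmul N M) p = tuple_act k M (tuple_act k N p)"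
  by (rule ext) (simp add: tuple_act_def pt_act_comp Zk_1_P11)

lemma tuple_act_one: "p \<in> Zk k 1 \<Longrightarrow> tuple_act k sc_one p = p"
  by (rule extensionalityI[OF _ Zk_ext]) (auto simp: tuple_act_def pt_act_one Zk_1_P11)

lemma Zk_group_action: "group_action SL2 (Zk k 0) (\<lambda>M. restrict (tuple_act k M) (Zk k 0))"
  by (rule SL2_group_actionI) (simp_all add: tuple_act_Zk_0 tuple_act_comp tuple_act_one Zk_0_subset_1)

lemma normal_group_action: "group_action SL2 (Zk k 1) (\<lambda>M. restrict (tuple_act k M) (Zk k 1))"
  by (rule SL2_group_actionI) (simp_all add: tuple_act_Zk_1 tuple_act_comp tuple_act_one)

lemma holo_fun_Zxy_lin:
  assumes "J \<subseteq> {..<k}" "i < k"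
  shows "holo_fun (Zk_mfd k) (Zk_dom k J) (\<lambda>p. Zx J p i * a + Zy J p i * b)"
  by (intro holo_fun_add[OF Zk_atlas] holo_fun_mult[OF Zk_atlas] holo_fun_const[OF Zk_atlas mopen_Zk_dom] holo_Zxy assms)

lemma Zk_dom_at:
  assumes "p \<in> Zk k 0"
  obtains J where "J \<subseteq> {..<k}" "p \<in> Zk_dom k J"
proof -
  obtain U \<phi> where "(U, \<phi>) \<in> charts (Zk_mfd k)" "p \<in> U"
    using chart_at[OF Zk_atlas, of p k] assms by (metis Zk_mfd_simps(2))
  then show ?thesis using that unfolding Zk_charts by blast
qed

text \<open>A matrix changes the even coordinates linearly and leaves the odd coordinate of the
  representative alone, so in these homogeneous coordinates the fibre matrix is the identity; the
  factor 1/(c z + d) appears only on normalizing.\<close>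

lemma tuple_act_normal_map:
  assumes M: "M \<in> carrier SL2"
  shows "bundle_map_on (Zk k 0) (normal_Zk k) (normal_Zk k) (tuple_act k M) (tuple_act k M)"
proof (rule bundle_map_to_normal[OF holo_vbundle_normal])
  obtain a b c d where M': "M = sl2_mat a b c d" "a * d - b * c = 1" using M by (rule SL2_cases)
  show "mopen (base (normal_Zk k)) (Zk k 0)" using mopen_mpoints[OF Zk_atlas, of k] by simp
  show "tuple_act k M e \<in> total (normal_Zk k) \<and> tuple_red k (tuple_act k M e) = tuple_act k M (bproj (normal_Zk k) e)"
    if "e \<in> total (normal_Zk k)" for e
    using that tuple_act_Zk_1[OF M, of e k] by (simp add: total_normal_Zk)
  fix U \<sigma> x assume "(U, \<sigma>) \<in> trivs (normal_Zk k)" and x: "x \<in> Zk k 0 \<inter> U"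
  then obtain J where J: "J \<subseteq> {..<k}" "U = Zk_dom k J" "\<sigma> = Ntriv k J" unfolding normal_trivs by blast
  have act: "tuple_act k M e i = pt (Zx J (tuple_red k e) i * a + Zy J (tuple_red k e) i * b)
      (Zx J (tuple_red k e) i * c + Zy J (tuple_red k e) i * d) (\<Sum>j<k. (if i = j then 1 else 0) * Ntriv k J e j)"
    if e: "e \<in> total (normal_Zk k)" "tuple_red k e \<in> Zk_dom k J" and i: "i < k" for e i
  proof -
    have "(\<Sum>j<k. (if i = j then 1 else 0) * Ntriv k J e j) = Ntriv k J e i"
      using i by (simp add: if_distrib[of "\<lambda>t. t * _"] cong: if_cong)
    moreover have "pt_act M (e i) = pt_act M (pt (Zx J (tuple_red k e) i) (Zy J (tuple_red k e) i) (Ntriv k J e i))"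
      by (rule arg_cong[OF normal_rep[OF e i]])
    ultimately show ?thesis by (simp add: tuple_act_apply[OF i] M'(1))
  qed
  show "\<exists>V a b h. x \<in> V \<and> V \<subseteq> Zk k 0 \<inter> U \<and> mopen (base (normal_Zk k)) V \<and>
      (\<forall>i<k. holo_fun (base (normal_Zk k)) V (a i) \<and> holo_fun (base (normal_Zk k)) V (b i) \<and>
        (\<forall>j<vrank (normal_Zk k). holo_fun (base (normal_Zk k)) V (h i j))) \<and>
      (\<forall>e\<in>total (normal_Zk k). bproj (normal_Zk k) e \<in> V \<longrightarrow> (\<forall>i<k. tuple_act k M e i =
        pt (a i (bproj (normal_Zk k) e)) (b i (bproj (normal_Zk k) e)) (\<Sum>j<vrank (normal_Zk k). h i j (bproj (normal_Zk k) e) * \<sigma> e j)))"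
    unfolding normal_Zk_simps
    by (rule exI[of _ U], rule exI[of _ "\<lambda>i p. Zx J p i * a + Zy J p i * b"], rule exI[of _ "\<lambda>i p. Zx J p i * c + Zy J p i * d"],
        rule exI[of _ "\<lambda>i j _. if i = j then 1 else 0"])
      (use x Zk_domD(1) in \<open>auto simp: J(2,3) act intro!: mopen_Zk_dom[OF J(1)] holo_fun_Zxy_lin[OF J(1)] holo_fun_const[OF Zk_atlas]\<close>)
qed

section \<open>The bundle of sections\<close>

lemma susy_simps [simp]:
  "base (susy_bundle k) = Zk_mfd k" "total (susy_bundle k) = Zk k 0 \<times> H0" "bproj (susy_bundle k) = fst"
  "vrank (susy_bundle k) = 2" "vscale (susy_bundle k) t (x, s) = (x, H0_scale t s)"
  "vadd (susy_bundle k) (x, s) (y, s') = (x, H0_add s s')"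
  by (simp_all add: susy_bundle_def)

lemma susy_trivs: "trivs (susy_bundle k) = (\<lambda>\<beta>. (Zk k 0, \<lambda>e. \<beta> (snd e))) ` H0_coordinates"
proof -
  have "(\<lambda>(x :: nat \<Rightarrow> spoint, s). \<beta> s) = (\<lambda>e. \<beta> (snd e))" for \<beta> :: "(spoint \<Rightarrow> spoint) \<Rightarrow> nat \<Rightarrow> complex"
    by (rule ext) (simp add: case_prod_beta)
  then show ?thesis unfolding susy_bundle_def by auto
qed

lemma spin_sec_in_H0 [simp]: "spin_sec g h \<in> H0"
  unfolding H0_eq by blast

lemma H0_cases:
  assumes "s \<in> H0"
  obtains g h where "s = spin_sec g h"
  using assms unfolding H0_eq by blast

lemma H0_coordinates_spin_sec:
  assumes "\<beta> \<in> H0_coordinates"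
  shows "\<beta> (spin_sec g h) j = \<beta> (spin_sec 1 0) j * g + \<beta> (spin_sec 0 1) j * h"
proof -
  have add: "\<And>s s'. s \<in> H0 \<Longrightarrow> s' \<in> H0 \<Longrightarrow> \<beta> (H0_add s s') = (\<lambda>j. \<beta> s j + \<beta> s' j)"
    and scale: "\<And>t s. s \<in> H0 \<Longrightarrow> \<beta> (H0_scale t s) = (\<lambda>j. t * \<beta> s j)"
    using assms unfolding H0_coordinates_def by simp_all
  have eq: "spin_sec g h = H0_add (H0_scale g (spin_sec 1 0)) (H0_scale h (spin_sec 0 1))"
    by (simp add: H0_add_spin_sec H0_scale_spin_sec)
  have "\<beta> (H0_add (H0_scale g (spin_sec 1 0)) (H0_scale h (spin_sec 0 1))) j =
      g * \<beta> (spin_sec 1 0) j + h * \<beta> (spin_sec 0 1) j"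
    using add[of "H0_scale g (spin_sec 1 0)" "H0_scale h (spin_sec 0 1)"]
      scale[of "spin_sec 1 0" g] scale[of "spin_sec 0 1" h] by (simp add: H0_scale_spin_sec)
  then show ?thesis unfolding eq[symmetric] by (simp add: mult.commute)
qed

text \<open>A linear map of (g, h) has constant entries in any linear coordinates: A is \<beta>'
  after the map after the inverse of \<beta>. It serves both the transition functions and the group
  action.\<close>

lemma susy_matrix:
  assumes W: "mopen (Zk_mfd k) W" and \<beta>: "\<beta> \<in> H0_coordinates" and \<beta>': "\<beta>' \<in> H0_coordinates"
    and F: "\<And>x g h. x \<in> Zk k 0 \<Longrightarrow> snd (F (x, spin_sec g h)) = spin_sec (a * g + b * h) (c * g + d * h)"
  shows "holo_matrix (Zk_mfd k) W 2 2 (Zk k 0 \<times> H0) fst (\<lambda>e. \<beta> (snd e)) (\<lambda>e. \<beta>' (snd (F e)))"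
proof -
  obtain g0 g1 h0 h1 where "\<forall>s\<in>H0. s = spin_sec (g0 * \<beta> s 0 + g1 * \<beta> s 1) (h0 * \<beta> s 0 + h1 * \<beta> s 1)"
    using H0_coordinates_inverse[OF \<beta>] by (elim exE)
  note inv = bspec[OF this]
  define A where "A i j = \<beta>' (spin_sec 1 0) i * (a * (if j = 0 then g0 else g1) + b * (if j = 0 then h0 else h1)) +
      \<beta>' (spin_sec 0 1) i * (c * (if j = 0 then g0 else g1) + d * (if j = 0 then h0 else h1))" for i and j :: nat
  show ?thesis
  proof (rule holo_matrixI[where h = "\<lambda>i j _. A i j"])
    show "holo_fun (Zk_mfd k) W (\<lambda>_. A i j)" for i j by (rule holo_fun_const[OF Zk_atlas W])
    fix e i assume e: "e \<in> Zk k 0 \<times> H0"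
    obtain x s where e': "e = (x, s)" "x \<in> Zk k 0" "s \<in> H0" using e by (elim SigmaE)
    obtain g h where gh: "g = g0 * \<beta> s 0 + g1 * \<beta> s 1" "h = h0 * \<beta> s 0 + h1 * \<beta> s 1" "s = spin_sec g h"
      using inv[OF e'(3)] by blast
    have "\<beta>' (snd (F e)) i = \<beta>' (spin_sec 1 0) i * (a * g + b * h) + \<beta>' (spin_sec 0 1) i * (c * g + d * h)"
      unfolding e'(1) gh(3) F[OF e'(2)] by (rule H0_coordinates_spin_sec[OF \<beta>'])
    also have "\<dots> = A i 0 * \<beta> s 0 + A i 1 * \<beta> s 1"
      unfolding gh(1,2) by (simp add: A_def algebra_simps)
    also have "\<dots> = (\<Sum>j<2. A i j * \<beta> (snd e) j)"
      by (simp add: e'(1) numeral_2_eq_2 One_nat_def)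
    finally show "\<beta>' (snd (F e)) i = (\<Sum>j<2. A i j * \<beta> (snd e) j)" .
  qed
qed

lemma holo_vbundle_susy: "holo_vbundle (susy_bundle k)"
  unfolding holo_vbundle_def
proof (intro conjI ballI)
  show "complex_manifold (base (susy_bundle k))" by (simp add: Zk_complex_manifold)
  show "bproj (susy_bundle k) ` total (susy_bundle k) \<subseteq> mpoints (base (susy_bundle k))" by auto
  show "\<Union> (fst ` trivs (susy_bundle k)) = mpoints (base (susy_bundle k))"
    unfolding susy_trivs image_image using H0_values_coordinates by auto
next
  have op: "mopen (Zk_mfd k) (Zk k 0)" using mopen_mpoints[OF Zk_atlas, of k] by simp
  fix c assume "c \<in> trivs (susy_bundle k)"
  then obtain \<beta> where \<beta>: "\<beta> \<in> H0_coordinates" and c: "c = (Zk k 0, \<lambda>e. \<beta> (snd e))" unfolding susy_trivs by blast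
  have bij: "bij_betw \<beta> H0 (Cn 2)"
    and add: "\<And>s s'. s \<in> H0 \<Longrightarrow> s' \<in> H0 \<Longrightarrow> \<beta> (H0_add s s') = (\<lambda>j. \<beta> s j + \<beta> s' j)"
    and scale: "\<And>t s. s \<in> H0 \<Longrightarrow> \<beta> (H0_scale t s) = (\<lambda>j. t * \<beta> s j)"
    using \<beta> unfolding H0_coordinates_def by simp_all
  have clos: "H0_add s s' \<in> H0" "H0_scale t s \<in> H0" if "s \<in> H0" "s' \<in> H0" for s s' t
    using that by (auto elim!: H0_cases simp: H0_add_spin_sec H0_scale_spin_sec)
  have "fibre_iso (susy_bundle k) (Zk k 0) (\<lambda>e. \<beta> (snd e))"
    unfolding fibre_iso_def
  proof (intro ballI)
    fix x assume x: "x \<in> Zk k 0"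
    have fib: "bfibre (susy_bundle k) x = Pair x ` H0" using x by (auto simp: bfibre_def)
    have "bij_betw (\<lambda>e. \<beta> (snd e)) (Pair x ` H0) (Cn 2)"
      using bij unfolding bij_betw_def inj_on_def by (simp add: image_image)
    then show "bij_betw (\<lambda>e. \<beta> (snd e)) (bfibre (susy_bundle k) x) (Cn (vrank (susy_bundle k))) \<and>
     (\<forall>e\<in>bfibre (susy_bundle k) x. \<forall>e'\<in>bfibre (susy_bundle k) x. vadd (susy_bundle k) e e' \<in> bfibre (susy_bundle k) x \<and>
        \<beta> (snd (vadd (susy_bundle k) e e')) = (\<lambda>j. \<beta> (snd e) j + \<beta> (snd e') j)) \<and>
     (\<forall>t. \<forall>e\<in>bfibre (susy_bundle k) x. vscale (susy_bundle k) t e \<in> bfibre (susy_bundle k) x \<and>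
        \<beta> (snd (vscale (susy_bundle k) t e)) = (\<lambda>j. t * \<beta> (snd e) j))"
      unfolding fib using add scale clos by (simp add: ball_simps image_iff)
  qed
  then show "case c of (U, \<tau>) \<Rightarrow> mopen (base (susy_bundle k)) U \<and> fibre_iso (susy_bundle k) U \<tau>"
    unfolding c prod.case using op by simp
  have "holo_matrix (Zk_mfd k) (Zk k 0 \<inter> Zk k 0) 2 2 (Zk k 0 \<times> H0) fst (\<lambda>e. \<beta> (snd e)) (\<lambda>e. \<beta>' (snd e))"
    if "\<beta>' \<in> H0_coordinates" for \<beta>'
    using susy_matrix[of k "Zk k 0" \<beta> \<beta>' "\<lambda>e. e" 1 0 0 1, OF op \<beta> that] by simp
  then show "case c of (U, \<sigma>) \<Rightarrow> \<forall>(V, \<tau>)\<in>trivs (susy_bundle k). holo_matrix (base (susy_bundle k)) (U \<inter> V)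
      (vrank (susy_bundle k)) (vrank (susy_bundle k)) (total (susy_bundle k)) (bproj (susy_bundle k)) \<sigma> \<tau>"
    unfolding c prod.case susy_trivs susy_simps by (simp only: ball_simps prod.case) blast
qed

lemma susy_act_map:
  assumes M: "M \<in> carrier SL2"
  shows "bundle_map_on (Zk k 0) (susy_bundle k) (susy_bundle k) (tuple_act k M) (susy_act k M)"
proof (rule bundle_map_onI)
  obtain a b c d where M': "M = sl2_mat a b c d" "a * d - b * c = 1" using M by (rule SL2_cases)
  have act: "susy_act k M (x, spin_sec g h) = (tuple_act k M x, spin_sec (d * g - c * h) (a * h - b * g))" for x g h
    unfolding susy_act_def M'(1) by (simp add: H0_act_spin_sec[OF M'(2)])
  show "holo_map (base (susy_bundle k)) (Zk k 0) (base (susy_bundle k)) (tuple_act k M)"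
    using bundle_map_onD(1)[OF tuple_act_normal_map[OF M, of k]] by simp
  show "susy_act k M e \<in> total (susy_bundle k) \<and> bproj (susy_bundle k) (susy_act k M e) = tuple_act k M (bproj (susy_bundle k) e)"
    if e: "e \<in> total (susy_bundle k)" for e
  proof -
    obtain x s where e': "e = (x, s)" "x \<in> Zk k 0" "s \<in> H0" using e by (cases e) simp
    obtain g h where "s = spin_sec g h" using e'(3) by (rule H0_cases)
    then show ?thesis using tuple_act_Zk_0[OF M e'(2)] by (simp add: e'(1) act)
  qed
  fix U \<sigma> V \<tau> assume "(U, \<sigma>) \<in> trivs (susy_bundle k)" "(V, \<tau>) \<in> trivs (susy_bundle k)"
  then obtain \<beta> \<beta>' where b: "\<beta> \<in> H0_coordinates" "U = Zk k 0" "\<sigma> = (\<lambda>e. \<beta> (snd e))"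
    "\<beta>' \<in> H0_coordinates" "V = Zk k 0" "\<tau> = (\<lambda>e. \<beta>' (snd e))" unfolding susy_trivs by blast
  have "mopen (Zk_mfd k) (Zk k 0)" using mopen_mpoints[OF Zk_atlas, of k] by simp
  moreover have "{x \<in> Zk k 0 \<inter> U. tuple_act k M x \<in> V} = Zk k 0" using tuple_act_Zk_0[OF M] b by auto
  ultimately show "holo_matrix (base (susy_bundle k)) {x \<in> Zk k 0 \<inter> U. tuple_act k M x \<in> V} (vrank (susy_bundle k))
      (vrank (susy_bundle k)) (total (susy_bundle k)) (bproj (susy_bundle k)) \<sigma> (\<lambda>e. \<tau> (susy_act k M e))"
    unfolding susy_simps b(3,6) using susy_matrix[of k "Zk k 0" \<beta> \<beta>' "susy_act k M" d "-c" "-b" a] b(1,4)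
    by (simp add: act)
qed

lemma susy_group_action: "group_action SL2 (Zk k 0 \<times> H0) (\<lambda>M. restrict (susy_act k M) (Zk k 0 \<times> H0))"
proof (rule SL2_group_actionI)
  have act: "susy_act k (sl2_mat a b c d) (x, spin_sec g h) =
      (tuple_act k (sl2_mat a b c d) x, spin_sec (d * g - c * h) (a * h - b * g))" if "a * d - b * c = 1" for a b c d x g h
    unfolding susy_act_def by (simp add: H0_act_spin_sec[OF that])
  show "susy_act k M e \<in> Zk k 0 \<times> H0" if "M \<in> carrier SL2" "e \<in> Zk k 0 \<times> H0" for M e
    using bundle_map_onD(2)[OF susy_act_map[OF that(1), of k], of e] that(2) by auto
  fix e assume "e \<in> Zk k 0 \<times> H0"
  then obtain x g h where e: "e = (x, spin_sec g h)" "x \<in> Zk k 0" by (auto elim!: H0_cases)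
  show "susy_act k sc_one e = e" unfolding e(1) sl2_one
    using act[of 1 1 0 0 x g h] tuple_act_one[OF Zk_0_subset_1[OF e(2)]] by (simp add: sl2_one)
  fix M N assume M: "M \<in> carrier SL2" and N: "N \<in> carrier SL2"
  obtain a b c d where M': "M = sl2_mat a b c d" "a * d - b * c = 1" using M by (rule SL2_cases)
  obtain a' b' c' d' where N': "N = sl2_mat a' b' c' d'" "a' * d' - b' * c' = 1" using N by (rule SL2_cases)
  have "(a' * a + c' * b) * (b' * c + d' * d) - (b' * a + d' * b) * (a' * c + c' * d) = (a * d - b * c) * (a' * d' - b' * c')"
    by (simp add: algebra_simps)
  then have det: "(a' * a + c' * b) * (b' * c + d' * d) - (b' * a + d' * b) * (a' * c + c' * d) = 1"
    using M'(2) N'(2) by simp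
  have t: "tuple_act k (sc_matmul N M) x = tuple_act k M (tuple_act k N x)"
    by (rule tuple_act_comp[OF M N Zk_0_subset_1[OF e(2)]])
  show "susy_act k (sc_matmul N M) e = susy_act k M (susy_act k N e)"
    using t unfolding e(1) M'(1) N'(1) sl2_matmul act[OF det] act[OF N'(2)] act[OF M'(2)]
    by (simp add: algebra_simps)
qed

lemma SUSY_apply: "i < k \<Longrightarrow> SUSY k (x, s) i = s (x i)"
  by (simp add: SUSY_def)

lemma SUSY_rep:
  assumes "x \<in> Zk_dom k J" "i < k"
  shows "SUSY k (x, spin_sec g h) i = pt (Zx J x i) (Zy J x i) (Zx J x i * g + Zy J x i * h)"
  unfolding SUSY_apply[OF assms(2)] Zk_dom_rep[OF assms] by (rule spin_sec_pt[OF Zxy_nonzero])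

lemma SUSY_normal:
  assumes "x \<in> Zk k 0" "s \<in> H0"
  shows "SUSY k (x, s) \<in> total (normal_Zk k)" "tuple_red k (SUSY k (x, s)) = x"
proof -
  obtain J where J: "J \<subseteq> {..<k}" "x \<in> Zk_dom k J" by (rule Zk_dom_at[OF assms(1)])
  obtain g h where s: "s = spin_sec g h" using assms(2) by (rule H0_cases)
  have "SUSY k (x, s) \<in> extensional {..<k}" by (simp add: SUSY_def)
  from normal_ZkI[OF assms(1) this, of "Zx J x" "Zy J x" "\<lambda>i. Zx J x i * g + Zy J x i * h"]
  show "SUSY k (x, s) \<in> total (normal_Zk k)" "tuple_red k (SUSY k (x, s)) = x"
    using SUSY_rep[OF J(2)] Zk_dom_rep[OF J(2)] Zxy_nonzero by (simp_all add: s)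
qed

lemma SUSY_map: "bundle_map_on (Zk k 0) (susy_bundle k) (normal_Zk k) id (SUSY k)"
proof (rule bundle_map_to_normal[OF holo_vbundle_susy])
  show "mopen (base (susy_bundle k)) (Zk k 0)" using mopen_mpoints[OF Zk_atlas, of k] by simp
  show "SUSY k e \<in> total (normal_Zk k) \<and> tuple_red k (SUSY k e) = id (bproj (susy_bundle k) e)"
    if "e \<in> total (susy_bundle k)" for e
    using that SUSY_normal[of "fst e" k "snd e"] by auto
  fix U \<sigma> x assume "(U, \<sigma>) \<in> trivs (susy_bundle k)" and x: "x \<in> Zk k 0 \<inter> U"
  then obtain \<beta> where \<beta>: "\<beta> \<in> H0_coordinates" "U = Zk k 0" "\<sigma> = (\<lambda>e. \<beta> (snd e))" unfolding susy_trivs by blast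
  obtain g0 g1 h0 h1 where "\<forall>s\<in>H0. s = spin_sec (g0 * \<beta> s 0 + g1 * \<beta> s 1) (h0 * \<beta> s 0 + h1 * \<beta> s 1)"
    using H0_coordinates_inverse[OF \<beta>(1)] by (elim exE)
  note inv = bspec[OF this]
  obtain J where J: "J \<subseteq> {..<k}" "x \<in> Zk_dom k J" by (rule Zk_dom_at[of x k]) (use x in auto)
  \<comment> \<open>Column j holds the values, at the i-th point, of the section whose
    \<beta>-coordinates are the j-th unit vector.\<close>
  define A where "A i j p = Zx J p i * (if j = 0 then g0 else g1) + Zy J p i * (if j = 0 then h0 else h1)" for i p and j :: nat
  have rep: "SUSY k e i = pt (Zx J (fst e) i) (Zy J (fst e) i) (\<Sum>j<2. A i j (fst e) * \<beta> (snd e) j)"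
    if e: "e \<in> Zk k 0 \<times> H0" "fst e \<in> Zk_dom k J" and i: "i < k" for e i
  proof -
    obtain y s where e': "e = (y, s)" "s \<in> H0" using e(1) by (elim SigmaE)
    have "SUSY k e i = SUSY k (y, spin_sec (g0 * \<beta> s 0 + g1 * \<beta> s 1) (h0 * \<beta> s 0 + h1 * \<beta> s 1)) i"
      using inv[OF e'(2)] e'(1) by simp
    also have "\<dots> = pt (Zx J y i) (Zy J y i) (Zx J y i * (g0 * \<beta> s 0 + g1 * \<beta> s 1) + Zy J y i * (h0 * \<beta> s 0 + h1 * \<beta> s 1))"
      by (rule SUSY_rep) (use e e'(1) i in auto)
    also have "Zx J y i * (g0 * \<beta> s 0 + g1 * \<beta> s 1) + Zy J y i * (h0 * \<beta> s 0 + h1 * \<beta> s 1) = (\<Sum>j<2. A i j y * \<beta> s j)"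
      by (simp add: A_def numeral_2_eq_2 One_nat_def algebra_simps)
    finally show ?thesis by (simp add: e'(1))
  qed
  have A: "holo_fun (Zk_mfd k) (Zk_dom k J) (A i j)" if "i < k" for i j
    unfolding A_def by (rule holo_fun_Zxy_lin[OF J(1) that])
  show "\<exists>V a b h. x \<in> V \<and> V \<subseteq> Zk k 0 \<inter> U \<and> mopen (base (susy_bundle k)) V \<and>
      (\<forall>i<k. holo_fun (base (susy_bundle k)) V (a i) \<and> holo_fun (base (susy_bundle k)) V (b i) \<and>
        (\<forall>j<vrank (susy_bundle k). holo_fun (base (susy_bundle k)) V (h i j))) \<and>
      (\<forall>e\<in>total (susy_bundle k). bproj (susy_bundle k) e \<in> V \<longrightarrow> (\<forall>i<k. SUSY k e i =
        pt (a i (bproj (susy_bundle k) e)) (b i (bproj (susy_bundle k) e)) (\<Sum>j<vrank (susy_bundle k). h i j (bproj (susy_bundle k) e) * \<sigma> e j)))"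
    unfolding susy_simps \<beta>(3)
    by (rule exI[of _ "Zk_dom k J"], rule exI[of _ "\<lambda>i p. Zx J p i"], rule exI[of _ "\<lambda>i p. Zy J p i"], rule exI[of _ A],
        intro conjI allI impI ballI rep)
      (use J(2) \<beta>(2) Zk_domD(1) in \<open>auto intro!: mopen_Zk_dom[OF J(1)] holo_Zxy[OF J(1)] A\<close>)
qed

section \<open>Inverses of holomorphic matrices\<close>

text \<open>The Leibniz formula is a polynomial in the entries.\<close>

lemma holo_fun_det:
  assumes X: "holo_atlas X" and W: "mopen X W"
    and f: "\<And>i j. i < n \<Longrightarrow> j < n \<Longrightarrow> holo_fun X W (f i j)"
  shows "holo_fun X W (\<lambda>x. det (mat n n (\<lambda>(i, j). f i j x)))"
proof -
  have "holo_fun X W (\<lambda>x. \<Sum>p\<in>{p. p permutes {0..<n}}. signof p * (\<Prod>i = 0..<n. f i (p i) x))"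
  proof (intro holo_fun_sum[OF X W] holo_fun_mult[OF X] holo_fun_const[OF X W] holo_fun_prod[OF X W])
    fix p i assume "p \<in> {p. p permutes {0..<n}}" "i \<in> {0..<n}"
    then show "holo_fun X W (f i (p i))" by (intro f) (auto simp: permutes_in_image)
  qed
  then show ?thesis
  proof (rule holo_fun_cong[OF X])
    fix x
    show "(\<Sum>p\<in>{p. p permutes {0..<n}}. signof p * (\<Prod>i = 0..<n. f i (p i) x)) = det (mat n n (\<lambda>(i, j). f i j x))"
      unfolding Determinant.det_def by (auto intro!: sum.cong prod.cong simp: permutes_in_image)
  qed
qed

text \<open>Cramer's rule: the cofactors are holomorphic, and the determinant cannot vanish because
  a kernel vector would contradict \<open>inj\<close>. The inverse is phrased as a solution formula,
  so that its uses can stay with sums.\<close>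

lemma holo_matrix_inverse:
  fixes n :: nat
  assumes X: "holo_atlas X" and W: "mopen X W"
    and A: "\<And>i j. i < n \<Longrightarrow> j < n \<Longrightarrow> holo_fun X W (A i j)"
    and inj: "\<And>x y. x \<in> W \<Longrightarrow> (\<And>i. i < n \<Longrightarrow> (\<Sum>j<n. A i j x * y j) = 0) \<Longrightarrow> (\<forall>j<n. y j = 0)"
  obtains B where "\<And>i j. i < n \<Longrightarrow> j < n \<Longrightarrow> holo_fun X W (B i j)"
    "\<And>x y z i. x \<in> W \<Longrightarrow> (\<And>i. i < n \<Longrightarrow> z i = (\<Sum>j<n. A i j x * y j)) \<Longrightarrow> i < n \<Longrightarrow> y i = (\<Sum>j<n. B i j x * z j)"
proof -
  define M where "M x = mat n n (\<lambda>(i, j). A i j x)" for x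
  have M: "M x \<in> carrier_mat n n" for x by (simp add: M_def)
  have Mij: "M x $$ (i, j) = A i j x" if "i < n" "j < n" for x i j using that by (simp add: M_def)
  have det: "det (M x) \<noteq> 0" if x: "x \<in> W" for x
  proof
    assume "det (M x) = 0"
    then obtain v where v: "v \<in> carrier_vec n" "v \<noteq> 0\<^sub>v n" "M x *\<^sub>v v = 0\<^sub>v n"
      unfolding det_0_iff_vec_prod_zero_field[OF M] by (elim exE conjE)
    have "(\<Sum>j<n. A i j x * v $ j) = 0" if i: "i < n" for i
    proof -
      have "(M x *\<^sub>v v) $ i = 0" using v(3) i by simp
      moreover have "(M x *\<^sub>v v) $ i = (\<Sum>j<n. A i j x * v $ j)"
        using i v(1) M[of x] unfolding mult_mat_vec_def scalar_prod_def
        by (auto simp: Mij atLeast0LessThan intro!: sum.cong)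
      ultimately show ?thesis by simp
    qed
    from inj[OF x this] have "\<forall>j<n. v $ j = 0" .
    then have "v = 0\<^sub>v n" using v(1) by (intro eq_vecI) auto
    then show False using v(2) by simp
  qed
  define B where "B i j x = cofactor (M x) j i / det (M x)" for i j x
  have del: "mat_delete (M x) j i = mat (n - 1) (n - 1)
      (\<lambda>(i', j'). A (if i' < j then i' else Suc i') (if j' < i then j' else Suc j') x)" if "i < n" "j < n" for i j x
    unfolding mat_delete_def by (rule eq_matI) (use that in \<open>auto simp: M_def\<close>)
  show ?thesis
  proof (rule that[of B])
    fix i j assume ij: "i < n" "j < n"
    have "holo_fun X W (\<lambda>x. det (mat_delete (M x) j i))"
      unfolding del[OF ij] by (rule holo_fun_det[OF X W], rule A) auto
    moreover have "holo_fun X W (\<lambda>x. det (M x))" unfolding M_def by (rule holo_fun_det[OF X W A])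
    ultimately show "holo_fun X W (B i j)"
      unfolding B_def cofactor_def
      by (intro holo_fun_divide[OF X] holo_fun_mult[OF X] holo_fun_const[OF X W] det)
  next
    fix x y z i assume x: "x \<in> W" and z: "\<And>i. i < n \<Longrightarrow> z i = (\<Sum>j<n. A i j x * y j)" and i: "i < n"
    have e: "(adj_mat (M x) * M x) $$ (i, l) = (\<Sum>j<n. cofactor (M x) j i * A j l x)" if l: "l < n" for l
      using i l M[of x] unfolding times_mat_def scalar_prod_def adj_mat_def
      by (auto simp: Mij atLeast0LessThan intro!: sum.cong)
    have adj: "(\<Sum>j<n. cofactor (M x) j i * A j l x) = (if i = l then det (M x) else 0)" if "l < n" for l
    proof -
      have "(adj_mat (M x) * M x) $$ (i, l) = (if i = l then det (M x) else 0)"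
        unfolding adj_mat(3)[OF M[of x]] using i that by simp
      then show ?thesis unfolding e[OF that] .
    qed
    have "(\<Sum>j<n. cofactor (M x) j i * z j) = (\<Sum>j<n. \<Sum>l<n. cofactor (M x) j i * A j l x * y l)"
      by (rule sum.cong) (auto simp: z sum_distrib_left mult.assoc)
    also have "\<dots> = (\<Sum>l<n. (\<Sum>j<n. cofactor (M x) j i * A j l x) * y l)"
      by (subst sum.swap) (simp add: sum_distrib_right)
    also have "\<dots> = (\<Sum>l<n. if i = l then det (M x) * y l else 0)"
      by (rule sum.cong) (auto simp: adj)
    also have "\<dots> = det (M x) * y i" using i by simp
    finally have "(\<Sum>j<n. cofactor (M x) j i * z j) = det (M x) * y i" .
    then show "y i = (\<Sum>j<n. B i j x * z j)"
      using det[OF x] by (simp add: B_def sum_divide_distrib[symmetric])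
  qed
qed

lemma holo_matrix_compose:
  assumes X: "holo_atlas X" and W: "mopen X W"
    and "holo_matrix X W m n T \<pi> \<sigma> \<tau>" "holo_matrix X W n p T \<pi> \<rho> \<sigma>"
  shows "holo_matrix X W m p T \<pi> \<rho> \<tau>"
proof -
  obtain h where h: "\<And>i j. i < m \<Longrightarrow> j < n \<Longrightarrow> holo_fun X W (h i j)"
    "\<And>e i. e \<in> T \<Longrightarrow> \<pi> e \<in> W \<Longrightarrow> i < m \<Longrightarrow> \<tau> e i = (\<Sum>j<n. h i j (\<pi> e) * \<sigma> e j)"
    by (rule holo_matrixE[OF assms(3)]) blast
  obtain l where l: "\<And>i j. i < n \<Longrightarrow> j < p \<Longrightarrow> holo_fun X W (l i j)"
    "\<And>e i. e \<in> T \<Longrightarrow> \<pi> e \<in> W \<Longrightarrow> i < n \<Longrightarrow> \<sigma> e i = (\<Sum>j<p. l i j (\<pi> e) * \<rho> e j)"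
    by (rule holo_matrixE[OF assms(4)]) blast
  show ?thesis
  proof (rule holo_matrixI[where h = "\<lambda>i j x. \<Sum>q<n. h i q x * l q j x"])
    show "holo_fun X W (\<lambda>x. \<Sum>q<n. h i q x * l q j x)" if "i < m" "j < p" for i j
      by (intro holo_fun_sum[OF X W] holo_fun_mult[OF X] h(1) l(1)) (use that in auto)
    fix e i assume e: "e \<in> T" "\<pi> e \<in> W" and i: "i < m"
    have "\<tau> e i = (\<Sum>q<n. \<Sum>j<p. h i q (\<pi> e) * l q j (\<pi> e) * \<rho> e j)"
      unfolding h(2)[OF e i] by (rule sum.cong) (simp_all add: l(2)[OF e] sum_distrib_left mult.assoc)
    also have "\<dots> = (\<Sum>j<p. (\<Sum>q<n. h i q (\<pi> e) * l q j (\<pi> e)) * \<rho> e j)"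
      by (subst sum.swap) (simp add: sum_distrib_right)
    finally show "\<tau> e i = (\<Sum>j<p. (\<Sum>q<n. h i q (\<pi> e) * l q j (\<pi> e)) * \<rho> e j)" .
  qed
qed

section \<open>The cokernel\<close>

text \<open>Translation of the odd coordinates by the section (g, h), taken as an element of
  \<open>SC 1\<close>; below it turns out to be addition of a vector in the image of
  \<open>SUSY\<close>. Cosets and superconformal orbits are compared through this double
  role.\<close>

definition shift :: "nat \<Rightarrow> complex \<Rightarrow> complex \<Rightarrow> (nat \<Rightarrow> spoint) \<Rightarrow> (nat \<Rightarrow> spoint)" where
  "shift k g h v = tuple_act k (sc1_mat 1 0 0 1 g h) v"

lemma pt_act_shift: "pt_act (sc1_mat 1 0 0 1 g h) (pt x y v) = pt x y (x * g + y * h + v)"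
  by simp

lemma shift_ext: "shift k g h v \<in> extensional {..<k}"
  unfolding shift_def by (rule tuple_act_ext)

lemma shift_rep:
  assumes "v \<in> total (normal_Zk k)" "tuple_red k v \<in> Zk_dom k J" "i < k"
  shows "shift k g h v i = pt (Zx J (tuple_red k v) i) (Zy J (tuple_red k v) i)
    (Zx J (tuple_red k v) i * g + Zy J (tuple_red k v) i * h + Ntriv k J v i)"
proof -
  have "shift k g h v i = pt_act (sc1_mat 1 0 0 1 g h) (pt (Zx J (tuple_red k v) i) (Zy J (tuple_red k v) i) (Ntriv k J v i))"
    unfolding shift_def tuple_act_apply[OF assms(3)] by (rule arg_cong[OF normal_rep[OF assms]])
  then show ?thesis unfolding pt_act_shift .
qed

lemma Ntriv_pt: "i < k \<Longrightarrow> v i = pt (Zx J x i) (Zy J x i) t \<Longrightarrow> Ntriv k J v i = t"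
  by (simp add: Ntriv_def Zx_def Zy_def)

lemma normal_red: "v \<in> total (normal_Zk k) \<Longrightarrow> tuple_red k v \<in> Zk k 0"
  by (simp add: normal_Zk_total_iff)

lemma normal_ext: "v \<in> total (normal_Zk k) \<Longrightarrow> v \<in> extensional {..<k}"
  by (simp add: normal_Zk_total_iff PiE_iff)

lemma normal_dom:
  assumes "v \<in> total (normal_Zk k)"
  obtains J where "J \<subseteq> {..<k}" "tuple_red k v \<in> Zk_dom k J"
  by (rule Zk_dom_at[OF normal_red[OF assms]])

lemma normal_ZkI':
  assumes "x \<in> Zk_dom k J" "v \<in> extensional {..<k}" "\<And>i. i < k \<Longrightarrow> v i = pt (Zx J x i) (Zy J x i) (t i)"
  shows "v \<in> total (normal_Zk k)" "tuple_red k v = x"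
  using normal_ZkI[OF Zk_domD(1)[OF assms(1)] assms(2), of "Zx J x" "Zy J x" t] Zk_dom_rep[OF assms(1)] assms(3) Zxy_nonzero
  by simp_all

lemma normal_eqI:
  assumes "v \<in> total (normal_Zk k)" "w \<in> total (normal_Zk k)" "tuple_red k v = tuple_red k w"
    "tuple_red k v \<in> Zk_dom k J" "\<And>i. i < k \<Longrightarrow> Ntriv k J v i = Ntriv k J w i"
  shows "v = w"
proof (rule extensionalityI[OF normal_ext[OF assms(1)] normal_ext[OF assms(2)]])
  fix i assume "i \<in> {..<k}"
  then have i: "i < k" by simp
  have "tuple_red k w \<in> Zk_dom k J" using assms(3,4) by simp
  from normal_rep[OF assms(2) this i] normal_rep[OF assms(1,4) i] show "v i = w i"
    unfolding assms(3) assms(5)[OF i] by (rule trans[OF _ sym, rotated])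
qed

lemma shift_normal:
  assumes "v \<in> total (normal_Zk k)"
  shows "shift k g h v \<in> total (normal_Zk k)" "tuple_red k (shift k g h v) = tuple_red k v"
proof -
  obtain J where J: "J \<subseteq> {..<k}" "tuple_red k v \<in> Zk_dom k J" by (rule normal_dom[OF assms])
  show "shift k g h v \<in> total (normal_Zk k)" "tuple_red k (shift k g h v) = tuple_red k v"
    using normal_ZkI'[OF J(2) shift_ext shift_rep[OF assms J(2)]] by blast+
qed

lemma Ntriv_shift:
  assumes "v \<in> total (normal_Zk k)" "tuple_red k v \<in> Zk_dom k J" "i < k"
  shows "Ntriv k J (shift k g h v) i = Zx J (tuple_red k v) i * g + Zy J (tuple_red k v) i * h + Ntriv k J v i"
  by (rule Ntriv_pt[OF assms(3), of "shift k g h v" J "tuple_red k v"]) (rule shift_rep[OF assms])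

lemma pt_act_shift_shift:
  "p \<in> P11 1 \<Longrightarrow> pt_act (sc1_mat 1 0 0 1 g h) (pt_act (sc1_mat 1 0 0 1 g' h') p) = pt_act (sc1_mat 1 0 0 1 (g + g') (h + h')) p"
  by (elim P11_1_cases) (simp add: algebra_simps)

lemma shift_shift:
  assumes "v \<in> total (normal_Zk k)"
  shows "shift k g h (shift k g' h' v) = shift k (g + g') (h + h') v"
  by (rule ext) (use assms in \<open>auto simp: shift_def tuple_act_def pt_act_shift_shift total_normal_Zk Zk_1_P11\<close>)

lemma shift_0:
  assumes "v \<in> total (normal_Zk k)"
  shows "shift k 0 0 v = v"
  using tuple_act_one[of v k] assms unfolding shift_def sl2_one sc1_mat_eq_sl2 total_normal_Zk by simp

text \<open>In a common representative of the base point both operations add x g + y h to the odd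
  coordinate.\<close>

lemma vadd_SUSY:
  assumes v: "v \<in> total (normal_Zk k)"
  shows "vadd (normal_Zk k) v (SUSY k (tuple_red k v, spin_sec g h)) = shift k g h v"
proof -
  obtain J where J: "J \<subseteq> {..<k}" "tuple_red k v \<in> Zk_dom k J" by (rule normal_dom[OF v])
  have "S_add (v i) (SUSY k (tuple_red k v, spin_sec g h) i) = shift k g h v i" if i: "i < k" for i
  proof -
    let ?x = "Zx J (tuple_red k v) i" and ?y = "Zy J (tuple_red k v) i"
    have "S_add (pt ?x ?y (Ntriv k J v i)) (pt ?x ?y (?x * g + ?y * h)) = pt ?x ?y (Ntriv k J v i + (?x * g + ?y * h))"
      by (rule S_add_pt[OF Zxy_nonzero])
    then show ?thesis
      unfolding normal_rep[OF v J(2) i, symmetric] SUSY_rep[OF J(2) i] shift_rep[OF v J(2) i] by (simp add: add.commute)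
  qed
  then show ?thesis
    by (intro extensionalityI[OF _ shift_ext, of _ k]) (simp_all)
qed

lemma Qproj_eq:
  assumes v: "v \<in> total (normal_Zk k)"
  shows "Qproj k v = {shift k g h v | g h. True}"
proof -
  have fib: "bfibre (susy_bundle k) (tuple_red k v) = {(tuple_red k v, spin_sec g h) | g h. True}"
    using normal_red[OF v] by (auto simp: bfibre_def elim!: H0_cases) blast
  have "Qproj k v = {vadd (normal_Zk k) v (SUSY k d) | d. d \<in> bfibre (susy_bundle k) (tuple_red k v)}"
    unfolding Qproj_def coker_proj_def by simp
  also have "\<dots> = {vadd (normal_Zk k) v (SUSY k (tuple_red k v, spin_sec g h)) | g h. True}"
    unfolding fib by blast
  finally show ?thesis unfolding vadd_SUSY[OF v] .
qed

lemma Qproj_self: "v \<in> total (normal_Zk k) \<Longrightarrow> v \<in> Qproj k v"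
  using shift_0[of v k] unfolding Qproj_eq by (metis (mono_tags, lifting) mem_Collect_eq)

lemma Qproj_memE:
  assumes "v \<in> total (normal_Zk k)" "w \<in> Qproj k v"
  obtains g h where "w = shift k g h v"
  using assms(2) unfolding Qproj_eq[OF assms(1)] by blast

lemma Qproj_mem:
  assumes "v \<in> total (normal_Zk k)" "w \<in> Qproj k v"
  shows "w \<in> total (normal_Zk k)" "tuple_red k w = tuple_red k v"
  by (rule Qproj_memE[OF assms], simp add: shift_normal[OF assms(1)])+

lemma Qproj_shift:
  assumes v: "v \<in> total (normal_Zk k)"
  shows "Qproj k (shift k g h v) = Qproj k v"
proof (intro equalityI subsetI)
  fix w assume "w \<in> Qproj k (shift k g h v)"
  then obtain g' h' where "w = shift k g' h' (shift k g h v)" by (rule Qproj_memE[OF shift_normal(1)[OF v]])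
  then show "w \<in> Qproj k v" unfolding shift_shift[OF v] Qproj_eq[OF v] by blast
next
  fix w assume "w \<in> Qproj k v"
  then obtain g' h' where "w = shift k g' h' v" by (rule Qproj_memE[OF v])
  then have "w = shift k (g' - g) (h' - h) (shift k g h v)" unfolding shift_shift[OF v] by simp
  then show "w \<in> Qproj k (shift k g h v)" unfolding Qproj_eq[OF shift_normal(1)[OF v]] by blast
qed

lemma Qproj_eq_iff:
  assumes "v \<in> total (normal_Zk k)" "w \<in> total (normal_Zk k)"
  shows "Qproj k w = Qproj k v \<longleftrightarrow> (\<exists>g h. w = shift k g h v)"
  using Qproj_self[OF assms(2)] Qproj_shift[OF assms(1)] unfolding Qproj_eq[OF assms(1)] by blast

section \<open>Fibre operations of the cokernel on representatives\<close>

lemma Q_simps [simp]: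
  "base (Qbundle k) = Zk_mfd k" "total (Qbundle k) = Qproj k ` total (normal_Zk k)" "vrank (Qbundle k) = k - 2"
  by (simp_all add: Qbundle_def cokernel_def coker_prebundle_def Qproj_def)

lemma bproj_Q:
  assumes v: "v \<in> total (normal_Zk k)"
  shows "bproj (Qbundle k) (Qproj k v) = tuple_red k v"
proof -
  have "tuple_red k ` Qproj k v = {tuple_red k v}" using Qproj_mem(2)[OF v] Qproj_self[OF v] by blast
  then show ?thesis by (simp add: Qbundle_def cokernel_def coker_prebundle_def)
qed

lemma vadd_shift:
  assumes v: "v \<in> total (normal_Zk k)" and w: "w \<in> total (normal_Zk k)" and eq: "tuple_red k v = tuple_red k w"
  shows "vadd (normal_Zk k) (shift k g h v) (shift k g' h' w) = shift k (g + g') (h + h') (vadd (normal_Zk k) v w)"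
proof -
  have "S_add (pt_act (sc1_mat 1 0 0 1 g h) (v i)) (pt_act (sc1_mat 1 0 0 1 g' h') (w i)) =
      pt_act (sc1_mat 1 0 0 1 (g + g') (h + h')) (S_add (v i) (w i))" if i: "i < k" for i
  proof -
    obtain J where J: "tuple_red k v \<in> Zk_dom k J" by (rule normal_dom[OF v])
    obtain t where t: "v i = pt (Zx J (tuple_red k v) i) (Zy J (tuple_red k v) i) t" using normal_rep[OF v J i] by blast
    obtain t' where t': "w i = pt (Zx J (tuple_red k v) i) (Zy J (tuple_red k v) i) t'"
      using normal_rep[OF w _ i, of J] J eq by auto
    show ?thesis unfolding t t' pt_act_shift S_add_pt[OF Zxy_nonzero] by (simp add: algebra_simps)
  qed
  then show ?thesis by (intro ext) (simp add: shift_def tuple_act_def)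
qed

lemma vscale_shift:
  assumes v: "v \<in> total (normal_Zk k)"
  shows "vscale (normal_Zk k) t (shift k g h v) = shift k (t * g) (t * h) (vscale (normal_Zk k) t v)"
proof -
  have "S_scale t (pt_act (sc1_mat 1 0 0 1 g h) p) = pt_act (sc1_mat 1 0 0 1 (t * g) (t * h)) (S_scale t p)" if "p \<in> P11 1" for p
    using that by (elim P11_1_cases) (simp add: algebra_simps)
  then show ?thesis using v by (intro ext) (simp add: shift_def tuple_act_def total_normal_Zk Zk_1_P11)
qed

lemma normal_ops:
  assumes v: "v \<in> total (normal_Zk k)"
  shows "vscale (normal_Zk k) t v \<in> total (normal_Zk k)" "tuple_red k (vscale (normal_Zk k) t v) = tuple_red k v"
    "w \<in> total (normal_Zk k) \<Longrightarrow> tuple_red k v = tuple_red k w \<Longrightarrow> vadd (normal_Zk k) v w \<in> total (normal_Zk k)"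
    "w \<in> total (normal_Zk k) \<Longrightarrow> tuple_red k v = tuple_red k w \<Longrightarrow> tuple_red k (vadd (normal_Zk k) v w) = tuple_red k v"
    "tuple_red k v \<in> Zk_dom k J \<Longrightarrow> Ntriv k J (vscale (normal_Zk k) t v) i = t * Ntriv k J v i"
    "w \<in> total (normal_Zk k) \<Longrightarrow> tuple_red k v = tuple_red k w \<Longrightarrow> tuple_red k v \<in> Zk_dom k J \<Longrightarrow>
      Ntriv k J (vadd (normal_Zk k) v w) i = Ntriv k J v i + Ntriv k J w i"
proof -
  obtain J' where J': "tuple_red k v \<in> Zk_dom k J'" by (rule normal_dom[OF v])
  have iso: "vscale (normal_Zk k) t v \<in> bfibre (normal_Zk k) (tuple_red k v) \<and>
      Ntriv k J (vscale (normal_Zk k) t v) = (\<lambda>j. t * Ntriv k J v j)" if "tuple_red k v \<in> Zk_dom k J" for J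
    using bspec[OF Zk_normal_fibre_iso[of k J, unfolded fibre_iso_def] that] v by (simp add: bfibre_def)
  have iso': "vadd (normal_Zk k) v w \<in> bfibre (normal_Zk k) (tuple_red k v) \<and>
      Ntriv k J (vadd (normal_Zk k) v w) = (\<lambda>j. Ntriv k J v j + Ntriv k J w j)"
    if "tuple_red k v \<in> Zk_dom k J" "w \<in> total (normal_Zk k)" "tuple_red k v = tuple_red k w" for J
    using bspec[OF Zk_normal_fibre_iso[of k J, unfolded fibre_iso_def] that(1)] v that(2,3) by (simp add: bfibre_def)
  show "vscale (normal_Zk k) t v \<in> total (normal_Zk k)" "tuple_red k (vscale (normal_Zk k) t v) = tuple_red k v"
    using iso[OF J'] by (simp_all add: bfibre_def)
  show "w \<in> total (normal_Zk k) \<Longrightarrow> tuple_red k v = tuple_red k w \<Longrightarrow> vadd (normal_Zk k) v w \<in> total (normal_Zk k)"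
    "w \<in> total (normal_Zk k) \<Longrightarrow> tuple_red k v = tuple_red k w \<Longrightarrow> tuple_red k (vadd (normal_Zk k) v w) = tuple_red k v"
    using iso'[OF J'] by (simp_all add: bfibre_def)
  show "tuple_red k v \<in> Zk_dom k J \<Longrightarrow> Ntriv k J (vscale (normal_Zk k) t v) i = t * Ntriv k J v i"
    using iso[of J] by simp
  show "w \<in> total (normal_Zk k) \<Longrightarrow> tuple_red k v = tuple_red k w \<Longrightarrow> tuple_red k v \<in> Zk_dom k J \<Longrightarrow>
      Ntriv k J (vadd (normal_Zk k) v w) i = Ntriv k J v i + Ntriv k J w i"
    using iso'[of J] by simp
qed

lemma vadd_Q:
  assumes v: "v \<in> total (normal_Zk k)" and w: "w \<in> total (normal_Zk k)" and eq: "tuple_red k v = tuple_red k w"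
  shows "vadd (Qbundle k) (Qproj k v) (Qproj k w) = Qproj k (vadd (normal_Zk k) v w)"
proof -
  have "vadd (Qbundle k) (Qproj k v) (Qproj k w) = {vadd (normal_Zk k) e e' | e e'. e \<in> Qproj k v \<and> e' \<in> Qproj k w}"
    by (simp add: Qbundle_def cokernel_def coker_prebundle_def)
  also have "\<dots> = {vadd (normal_Zk k) (shift k g h v) (shift k g' h' w) | g h g' h'. True}"
    unfolding Qproj_eq[OF v] Qproj_eq[OF w] by blast
  also have "\<dots> = {shift k (g + g') (h + h') (vadd (normal_Zk k) v w) | g h g' h'. True}"
    unfolding vadd_shift[OF v w eq] ..
  also have "\<dots> = {shift k g h (vadd (normal_Zk k) v w) | g h. True}"
  proof (intro equalityI subsetI)
    fix u assume "u \<in> {shift k g h (vadd (normal_Zk k) v w) | g h. True}"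
    then obtain g h where "u = shift k (g + 0) (h + 0) (vadd (normal_Zk k) v w)" by auto
    then show "u \<in> {shift k (g + g') (h + h') (vadd (normal_Zk k) v w) | g h g' h'. True}" by blast
  qed blast
  finally show ?thesis unfolding Qproj_eq[OF normal_ops(3)[OF v w eq]] .
qed

lemma vscale_Q:
  assumes v: "v \<in> total (normal_Zk k)"
  shows "vscale (Qbundle k) t (Qproj k v) = Qproj k (vscale (normal_Zk k) t v)"
proof -
  have "vscale (Qbundle k) t (Qproj k v) = (\<Union>e\<in>Qproj k v. Qproj k (vscale (normal_Zk k) t e))"
    by (simp add: Qbundle_def cokernel_def coker_prebundle_def Qproj_def)
  also have "\<dots> = (\<Union>e\<in>Qproj k v. Qproj k (vscale (normal_Zk k) t v))"
  proof (rule SUP_cong[OF refl])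
    fix e assume "e \<in> Qproj k v"
    then obtain g h where "e = shift k g h v" by (rule Qproj_memE[OF v])
    then show "Qproj k (vscale (normal_Zk k) t e) = Qproj k (vscale (normal_Zk k) t v)"
      by (simp only: vscale_shift[OF v] Qproj_shift[OF normal_ops(1)[OF v]])
  qed
  also have "\<dots> = Qproj k (vscale (normal_Zk k) t v)" using Qproj_self[OF v] by blast
  finally show ?thesis .
qed

lemma Q_trivs_iff:
  "(U, \<tau>) \<in> trivs (Qbundle k) \<longleftrightarrow> mopen (Zk_mfd k) U \<and> fibre_iso (Qbundle k) U \<tau> \<and>
    (\<forall>J\<subseteq>{..<k}. holo_matrix (Zk_mfd k) (U \<inter> Zk_dom k J) (k - 2) k (total (normal_Zk k)) (tuple_red k)
      (Ntriv k J) (\<lambda>e. \<tau> (Qproj k e)))"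
proof -
  have 1: "fibre_iso (Qbundle k) U \<tau> = fibre_iso (coker_prebundle (susy_bundle k) (normal_Zk k) (SUSY k)) U \<tau>"
    unfolding fibre_iso_def bfibre_def Qbundle_def cokernel_def by simp
  have 2: "(\<forall>(V, \<sigma>) \<in> trivs (normal_Zk k). holo_matrix (base (normal_Zk k)) (U \<inter> V) (vrank (normal_Zk k) - vrank (susy_bundle k)) (vrank (normal_Zk k))
        (total (normal_Zk k)) (bproj (normal_Zk k)) \<sigma> (\<lambda>e. \<tau> (coker_proj (susy_bundle k) (normal_Zk k) (SUSY k) e))) \<longleftrightarrow>
      (\<forall>J\<subseteq>{..<k}. holo_matrix (Zk_mfd k) (U \<inter> Zk_dom k J) (k - 2) k (total (normal_Zk k)) (tuple_red k)
      (Ntriv k J) (\<lambda>e. \<tau> (Qproj k e)))"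
    unfolding normal_trivs Qproj_def normal_Zk_simps susy_simps by (simp only: ball_simps prod.case mem_Collect_eq Ball_Collect) blast
  show ?thesis unfolding 1 2[symmetric] by (simp add: Qbundle_def cokernel_def)
qed

text \<open>A coset has a unique representative whose first two components vanish.\<close>

definition Qnf :: "nat \<Rightarrow> nat set \<Rightarrow> (nat \<Rightarrow> spoint) \<Rightarrow> (nat \<Rightarrow> complex) \<Rightarrow> (nat \<Rightarrow> spoint)" where
  "Qnf k J x y = (\<lambda>i\<in>{..<k}. pt (Zx J x i) (Zy J x i) (if i < 2 then 0 else y (i - 2)))"

definition Zdet :: "nat set \<Rightarrow> (nat \<Rightarrow> spoint) \<Rightarrow> nat \<Rightarrow> nat \<Rightarrow> complex" where
  "Zdet J x i j = Zx J x i * Zy J x j - Zx J x j * Zy J x i"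

text \<open>Row l is the linear relation among the values of a linear form at points 0, 1 and l + 2,
  divided by the determinant D(0,1): value(l+2) D(0,1) + value(0) D(1,l+2) + value(1) D(l+2,0) = 0.
  The rows thus annihilate the image of \<open>SUSY\<close>.\<close>

definition Qm :: "nat set \<Rightarrow> nat \<Rightarrow> nat \<Rightarrow> (nat \<Rightarrow> spoint) \<Rightarrow> complex" where
  "Qm J l j x = (if j = l + 2 then 1 else 0) + (if j = 0 then Zdet J x 1 (l + 2) / Zdet J x 0 1 else 0)
      + (if j = 1 then Zdet J x (l + 2) 0 / Zdet J x 0 1 else 0)"

definition Qc :: "nat \<Rightarrow> nat set \<Rightarrow> (nat \<Rightarrow> spoint) \<Rightarrow> nat \<Rightarrow> complex" where
  "Qc k J v l = (if l < k - 2 then \<Sum>j<k. Qm J l j (tuple_red k v) * Ntriv k J v j else 0)"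

lemma Zdet_nonzero:
  assumes "x \<in> Zk_dom k J" "i < k" "j < k" "i \<noteq> j"
  shows "Zdet J x i j \<noteq> 0"
proof
  assume "Zdet J x i j = 0"
  then have "pt (Zx J x i) (Zy J x i) 0 = pt (Zx J x j) (Zy J x j) 0"
    unfolding pt_zero_eq_iff[OF Zxy_nonzero Zxy_nonzero] Zdet_def by simp
  then show False
    using Zk_0_distinct[OF Zk_domD(1)[OF assms(1)] assms(2-4)] Zk_dom_rep[OF assms(1,2)] Zk_dom_rep[OF assms(1,3)] by simp
qed

lemma holo_Zdet:
  assumes "J \<subseteq> {..<k}" "i < k" "j < k"
  shows "holo_fun (Zk_mfd k) (Zk_dom k J) (\<lambda>x. Zdet J x i j)"
  unfolding Zdet_def by (intro holo_fun_diff[OF Zk_atlas] holo_fun_mult[OF Zk_atlas] holo_Zxy assms)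

lemma Zk_dom_cover:
  assumes "W \<subseteq> Zk k 0" "x \<in> W"
  obtains J where "J \<subseteq> {..<k}" "x \<in> W \<inter> Zk_dom k J"
proof -
  have "x \<in> Zk k 0" using assms by blast
  then obtain J where "J \<subseteq> {..<k}" "x \<in> Zk_dom k J" by (rule Zk_dom_at)
  then show ?thesis using that assms(2) by blast
qed

context
  fixes k :: nat
  assumes k: "k \<ge> 3"
begin

lemma Qm_sum:
  assumes "l < k - 2"
  shows "(\<Sum>j<k. Qm J l j x * t j) = t (l + 2) + Zdet J x 1 (l + 2) / Zdet J x 0 1 * t 0 + Zdet J x (l + 2) 0 / Zdet J x 0 1 * t 1"
proof -
  have 1: "(\<Sum>j<k. (if j = q then a else 0) * t j) = a * t q" if "q < k" for q and a :: complex
    using that by (simp add: if_distrib[of "\<lambda>u. u * _"] cong: if_cong)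
  show ?thesis unfolding Qm_def distrib_right sum.distrib
    by (subst (1 2 3) 1) (use assms k in auto)
qed

lemma Qc_eq:
  assumes "l < k - 2"
  shows "Qc k J v l = Ntriv k J v (l + 2) + Zdet J (tuple_red k v) 1 (l + 2) / Zdet J (tuple_red k v) 0 1 * Ntriv k J v 0
    + Zdet J (tuple_red k v) (l + 2) 0 / Zdet J (tuple_red k v) 0 1 * Ntriv k J v 1"
  using assms Qm_sum[OF assms] by (simp add: Qc_def)

lemma Zdet_01: "x \<in> Zk_dom k J \<Longrightarrow> Zdet J x 0 1 \<noteq> 0"
  by (rule Zdet_nonzero) (use k in auto)

lemma Qc_shift:
  assumes v: "v \<in> total (normal_Zk k)" and J: "tuple_red k v \<in> Zk_dom k J"
  shows "Qc k J (shift k g h v) = Qc k J v"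
proof
  fix l show "Qc k J (shift k g h v) l = Qc k J v l"
  proof (cases "l < k - 2")
    case True
    let ?x = "Zx J (tuple_red k v)" and ?y = "Zy J (tuple_red k v)" and ?D = "Zdet J (tuple_red k v)"
    have i: "0 < k" "1 < k" "l + 2 < k" using True k by auto
    have D: "?D 0 1 \<noteq> 0" by (rule Zdet_01[OF J])
    \<comment> \<open>The three-term relation for the values of the linear form (g, h) at points 0,
      1 and l + 2.\<close>
    have "(?x (l + 2) * g + ?y (l + 2) * h) * ?D 0 1 + ?D 1 (l + 2) * (?x 0 * g + ?y 0 * h) + ?D (l + 2) 0 * (?x 1 * g + ?y 1 * h) = 0"
      unfolding Zdet_def by (simp add: algebra_simps)
    then have eq: "(?x (l + 2) * g + ?y (l + 2) * h) + ?D 1 (l + 2) / ?D 0 1 * (?x 0 * g + ?y 0 * h) + ?D (l + 2) 0 / ?D 0 1 * (?x 1 * g + ?y 1 * h) = 0"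
      using D by (simp add: divide_simps)
    have gen: "(A + t) + c1 * (B + t0) + c2 * (C + t1) = (A + c1 * B + c2 * C) + (t + c1 * t0 + c2 * t1)"
      for A B C t t0 t1 c1 c2 :: complex by (simp add: algebra_simps)
    show ?thesis
      unfolding Qc_eq[OF True] shift_normal(2)[OF v] Ntriv_shift[OF v J i(1)] Ntriv_shift[OF v J i(2)] Ntriv_shift[OF v J i(3)]
      by (rule trans[OF gen]) (simp only: eq add_0_left)
  qed (simp add: Qc_def)
qed

lemma Qnf_normal:
  assumes "x \<in> Zk_dom k J"
  shows "Qnf k J x y \<in> total (normal_Zk k)" "tuple_red k (Qnf k J x y) = x"
    "i < k \<Longrightarrow> Ntriv k J (Qnf k J x y) i = (if i < 2 then 0 else y (i - 2))"
proof -
  have ext: "Qnf k J x y \<in> extensional {..<k}" by (simp add: Qnf_def)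
  have rep: "Qnf k J x y i = pt (Zx J x i) (Zy J x i) (if i < 2 then 0 else y (i - 2))" if "i < k" for i
    using that by (simp add: Qnf_def)
  show "Qnf k J x y \<in> total (normal_Zk k)" "tuple_red k (Qnf k J x y) = x"
    using normal_ZkI'[OF assms ext rep] by blast+
  show "i < k \<Longrightarrow> Ntriv k J (Qnf k J x y) i = (if i < 2 then 0 else y (i - 2))"
    by (rule Ntriv_pt[of i k "Qnf k J x y" J x], assumption, rule rep)
qed

lemma Qc_Qnf:
  assumes "x \<in> Zk_dom k J" "y \<in> Cn (k - 2)"
  shows "Qc k J (Qnf k J x y) = y"
proof
  fix l show "Qc k J (Qnf k J x y) l = y l"
  proof (cases "l < k - 2")
    case True
    have "0 < k" "1 < k" "l + 2 < k" using True k by auto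
    then show ?thesis unfolding Qc_eq[OF True] by (simp add: Qnf_normal(3)[OF assms(1)])
  qed (use assms in \<open>simp add: Qc_def Cn_def\<close>)
qed

lemma Qc_Cn: "Qc k J v \<in> Cn (k - 2)"
  by (simp add: Qc_def Cn_def)

lemma Q_normal_form:
  assumes v: "v \<in> total (normal_Zk k)" and J: "tuple_red k v \<in> Zk_dom k J"
  shows "Qproj k v = Qproj k (Qnf k J (tuple_red k v) (Qc k J v))"
proof -
  let ?x = "Zx J (tuple_red k v)" and ?y = "Zy J (tuple_red k v)" and ?D = "Zdet J (tuple_red k v)" and ?t = "Ntriv k J v"
  \<comment> \<open>Cramer's solution of the system asking the translated odd coordinates at points
    0 and 1 to vanish; it exists because these points differ.\<close>
  define g h where "g = (?t 1 * ?y 0 - ?t 0 * ?y 1) / ?D 0 1" and "h = (?x 1 * ?t 0 - ?x 0 * ?t 1) / ?D 0 1"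
  have D: "?D 0 1 \<noteq> 0" by (rule Zdet_01[OF J])
  have lin: "a * g + b * h = (a * (?t 1 * ?y 0 - ?t 0 * ?y 1) + b * (?x 1 * ?t 0 - ?x 0 * ?t 1)) / ?D 0 1" for a b
    by (simp add: g_def h_def add_divide_distrib)
  have t01: "?x 0 * g + ?y 0 * h + ?t 0 = 0" "?x 1 * g + ?y 1 * h + ?t 1 = 0"
    unfolding lin using D by (simp_all add: divide_simps) (simp_all add: Zdet_def algebra_simps)
  have tl: "?x (l + 2) * g + ?y (l + 2) * h + ?t (l + 2) = Qc k J v l" if "l < k - 2" for l
    unfolding lin Qc_eq[OF that] using D by (simp add: divide_simps) (simp add: Zdet_def algebra_simps)
  have "shift k g h v = Qnf k J (tuple_red k v) (Qc k J v)"
  proof (rule normal_eqI[of _ _ _ J])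
    fix i assume i: "i < k"
    consider "i = 0" | "i = 1" | "2 \<le> i" by linarith
    then show "Ntriv k J (shift k g h v) i = Ntriv k J (Qnf k J (tuple_red k v) (Qc k J v)) i"
      unfolding Ntriv_shift[OF v J i] Qnf_normal(3)[OF J i]
    proof cases
      case 3
      then have "i - 2 < k - 2" "i - 2 + 2 = i" using i by auto
      then show "?x i * g + ?y i * h + ?t i = (if i < 2 then 0 else Qc k J v (i - 2))" using tl[of "i - 2"] 3 by simp
    qed (simp_all add: t01)
  qed (use J in \<open>simp_all add: shift_normal[OF v] Qnf_normal[OF J]\<close>)
  then show ?thesis using Qproj_shift[OF v, of g h] by simp
qed

text \<open>The choice of a representative is harmless, because \<open>Qc\<close> is invariant under
  translations by \<open>Qc_shift\<close>.\<close>

definition Qtriv :: "nat set \<Rightarrow> (nat \<Rightarrow> spoint) set \<Rightarrow> nat \<Rightarrow> complex" where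
  "Qtriv J q = Qc k J (SOME e. e \<in> q)"

lemma Qtriv_Qproj:
  assumes v: "v \<in> total (normal_Zk k)" and J: "tuple_red k v \<in> Zk_dom k J"
  shows "Qtriv J (Qproj k v) = Qc k J v"
proof -
  have "(SOME e. e \<in> Qproj k v) \<in> Qproj k v" by (rule someI[of "\<lambda>e. e \<in> Qproj k v", OF Qproj_self[OF v]])
  then obtain g h where "(SOME e. e \<in> Qproj k v) = shift k g h v" by (rule Qproj_memE[OF v])
  then show ?thesis unfolding Qtriv_def using Qc_shift[OF v J] by simp
qed

text \<open>The coordinates of the normal form determine the coset and can be prescribed, which
  gives bijectivity; linearity is that of \<open>Qc\<close>.\<close>

lemma Qtriv_fibre_iso: "fibre_iso (Qbundle k) (Zk_dom k J) (Qtriv J)"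
  unfolding fibre_iso_def
proof (intro ballI conjI allI)
  fix x assume x: "x \<in> Zk_dom k J"
  have cases: "\<exists>v. v \<in> total (normal_Zk k) \<and> tuple_red k v = x \<and> q = Qproj k v" if "q \<in> bfibre (Qbundle k) x" for q
    using that bproj_Q unfolding bfibre_def Q_simps by fastforce
  have mem: "Qproj k v \<in> bfibre (Qbundle k) x" if "v \<in> total (normal_Zk k)" "tuple_red k v = x" for v
    using that bproj_Q[OF that(1)] by (simp add: bfibre_def)
  show "bij_betw (Qtriv J) (bfibre (Qbundle k) x) (Cn (vrank (Qbundle k)))"
  proof (rule bij_betwI')
    fix q q' assume "q \<in> bfibre (Qbundle k) x" "q' \<in> bfibre (Qbundle k) x"
    then obtain v v' where v: "v \<in> total (normal_Zk k)" "tuple_red k v = x" "q = Qproj k v"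
      and v': "v' \<in> total (normal_Zk k)" "tuple_red k v' = x" "q' = Qproj k v'" using cases by meson
    show "(Qtriv J q = Qtriv J q') = (q = q')"
    proof
      assume "Qtriv J q = Qtriv J q'"
      moreover have "Qtriv J q = Qc k J v" unfolding v(3) by (rule Qtriv_Qproj[OF v(1)]) (simp add: v(2) x)
      moreover have "Qtriv J q' = Qc k J v'" unfolding v'(3) by (rule Qtriv_Qproj[OF v'(1)]) (simp add: v'(2) x)
      ultimately have "Qc k J v = Qc k J v'" by simp
      then show "q = q'" using Q_normal_form[OF v(1), of J] Q_normal_form[OF v'(1), of J] v v' x by simp
    qed simp
  next
    show "Qtriv J q \<in> Cn (vrank (Qbundle k))" for q using Qc_Cn by (simp add: Qtriv_def)
    fix y assume y: "y \<in> Cn (vrank (Qbundle k))"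
    show "\<exists>q\<in>bfibre (Qbundle k) x. y = Qtriv J q"
    proof (rule bexI[OF _ mem[OF Qnf_normal(1,2)[OF x]]])
      show "y = Qtriv J (Qproj k (Qnf k J x y))"
      proof -
        have "Qtriv J (Qproj k (Qnf k J x y)) = Qc k J (Qnf k J x y)"
          by (rule Qtriv_Qproj[OF Qnf_normal(1)[OF x]]) (simp add: Qnf_normal(2)[OF x] x)
        also have "\<dots> = y" by (rule Qc_Qnf[OF x]) (use y in simp)
        finally show ?thesis by (rule sym)
      qed
    qed
  qed
  fix q assume "q \<in> bfibre (Qbundle k) x"
  then obtain v where v: "v \<in> total (normal_Zk k)" "tuple_red k v = x" "q = Qproj k v" using cases by blast
  have vJ: "tuple_red k v \<in> Zk_dom k J" using v(2) x by simp
  note ops = normal_ops[OF v(1)]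
  show "vscale (Qbundle k) t q \<in> bfibre (Qbundle k) x" for t
    unfolding v(3) vscale_Q[OF v(1)] by (rule mem) (use ops(1,2) v in auto)
  show "Qtriv J (vscale (Qbundle k) t q) = (\<lambda>j. t * Qtriv J q j)" for t
  proof
    fix l
    have "Qtriv J (vscale (Qbundle k) t q) = Qc k J (vscale (normal_Zk k) t v)"
      unfolding v(3) vscale_Q[OF v(1)] by (rule Qtriv_Qproj[OF ops(1)]) (use ops(2) vJ in simp)
    moreover have "Qc k J (vscale (normal_Zk k) t v) l = t * Qc k J v l"
      using ops(5)[OF vJ] ops(2) by (simp add: Qc_def sum_distrib_left mult.left_commute del: normal_Zk_simps)
    ultimately show "Qtriv J (vscale (Qbundle k) t q) l = t * Qtriv J q l"
      using Qtriv_Qproj[OF v(1) vJ] v(3) by simp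
  qed
  fix q' assume "q' \<in> bfibre (Qbundle k) x"
  then obtain v' where v': "v' \<in> total (normal_Zk k)" "tuple_red k v' = x" "q' = Qproj k v'" using cases by blast
  have v'J: "tuple_red k v' \<in> Zk_dom k J" using v'(2) x by simp
  have eq: "tuple_red k v = tuple_red k v'" using v v' by simp
  show "vadd (Qbundle k) q q' \<in> bfibre (Qbundle k) x"
    unfolding v(3) v'(3) vadd_Q[OF v(1) v'(1) eq] by (rule mem) (use ops(3,4)[OF v'(1) eq] v in auto)
  show "Qtriv J (vadd (Qbundle k) q q') = (\<lambda>j. Qtriv J q j + Qtriv J q' j)"
  proof
    fix l
    have "Qtriv J (vadd (Qbundle k) q q') = Qc k J (vadd (normal_Zk k) v v')"
      unfolding v(3) v'(3) vadd_Q[OF v(1) v'(1) eq] by (rule Qtriv_Qproj[OF ops(3)[OF v'(1) eq]]) (use ops(4)[OF v'(1) eq] vJ in simp)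
    moreover have "Qc k J (vadd (normal_Zk k) v v') l = Qc k J v l + Qc k J v' l"
      using ops(6)[OF v'(1) eq vJ] ops(4)[OF v'(1) eq] eq
      by (simp add: Qc_def sum.distrib distrib_left del: normal_Zk_simps)
    ultimately show "Qtriv J (vadd (Qbundle k) q q') l = Qtriv J q l + Qtriv J q' l"
      using Qtriv_Qproj[OF v(1) vJ] v(3) Qtriv_Qproj[OF v'(1) v'J] v'(3) by simp
  qed
qed

text \<open>In chart J the matrix is \<open>Qm\<close>; the cokernel asks for holomorphy against
  every chart J', which is reached by composing with the transition functions of the normal
  bundle.\<close>

lemma Qtriv_triv:
  assumes J: "J \<subseteq> {..<k}"
  shows "(Zk_dom k J, Qtriv J) \<in> trivs (Qbundle k)"
  unfolding Q_trivs_iff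
proof (intro conjI allI impI mopen_Zk_dom[OF J] Qtriv_fibre_iso)
  fix J' assume J': "J' \<subseteq> {..<k}"
  let ?W = "Zk_dom k J \<inter> Zk_dom k J'"
  have W: "mopen (Zk_mfd k) ?W" by (rule mopen_Int[OF Zk_atlas mopen_Zk_dom[OF J] mopen_Zk_dom[OF J']])
  have "holo_matrix (Zk_mfd k) ?W (k - 2) k (total (normal_Zk k)) (tuple_red k) (Ntriv k J) (\<lambda>e. Qtriv J (Qproj k e))"
  proof (rule holo_matrixI[where h = "Qm J"])
    fix l j assume l: "l < k - 2"
    then have i: "0 < k" "1 < k" "l + 2 < k" using k by auto
    have c: "holo_fun (Zk_mfd k) (Zk_dom k J) (\<lambda>x. if b then f x else 0)" if "holo_fun (Zk_mfd k) (Zk_dom k J) f" for b f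
      using that holo_fun_const[OF Zk_atlas mopen_Zk_dom[OF J]] by (cases b) simp_all
    have "holo_fun (Zk_mfd k) (Zk_dom k J) (Qm J l j)"
      unfolding Qm_def
      by (intro holo_fun_add[OF Zk_atlas] c holo_fun_const[OF Zk_atlas mopen_Zk_dom[OF J]] holo_fun_divide[OF Zk_atlas] holo_Zdet J i Zdet_01)
    then show "holo_fun (Zk_mfd k) ?W (Qm J l j)" by (rule holo_fun_subset[OF Zk_atlas _ W]) simp
  next
    fix e l assume "e \<in> total (normal_Zk k)" "tuple_red k e \<in> ?W" "l < k - 2"
    then show "Qtriv J (Qproj k e) l = (\<Sum>j<k. Qm J l j (tuple_red k e) * Ntriv k J e j)"
      using Qtriv_Qproj[of e J] by (simp add: Qc_def)
  qed
  moreover have "holo_matrix (Zk_mfd k) ?W k k (total (normal_Zk k)) (tuple_red k) (Ntriv k J') (Ntriv k J)"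
    using holo_vbundleD(7)[OF holo_vbundle_normal normal_triv_mem[OF J'] normal_triv_mem[OF J]] by (simp add: Int_commute)
  ultimately show "holo_matrix (Zk_mfd k) ?W (k - 2) k (total (normal_Zk k)) (tuple_red k) (Ntriv k J') (\<lambda>e. Qtriv J (Qproj k e))"
    by (rule holo_matrix_compose[OF Zk_atlas W])
qed

text \<open>
  In the normal form, a trivialization of \<open>Q\<close> is given by an invertible holomorphic matrix, so a
  fibrewise linear map out of \<open>Q\<close> is holomorphic as soon as its composition with the projection is.
\<close>

lemma Q_descent_matrix:
  assumes U: "(U, \<sigma>) \<in> trivs (Qbundle k)" and W: "mopen (Zk_mfd k) W" "W \<subseteq> U"
    and G: "\<And>J. J \<subseteq> {..<k} \<Longrightarrow> holo_matrix (Zk_mfd k) (W \<inter> Zk_dom k J) m k (total (normal_Zk k)) (tuple_red k) (Ntriv k J) (\<lambda>e. G (Qproj k e))"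
  shows "holo_matrix (Zk_mfd k) W m (k - 2) (total (Qbundle k)) (bproj (Qbundle k)) \<sigma> G"
proof (rule holo_matrix_local[OF Zk_atlas])
  have U': "mopen (Zk_mfd k) U" "fibre_iso (Qbundle k) U \<sigma>"
    "\<And>J. J \<subseteq> {..<k} \<Longrightarrow> holo_matrix (Zk_mfd k) (U \<inter> Zk_dom k J) (k - 2) k (total (normal_Zk k)) (tuple_red k) (Ntriv k J) (\<lambda>e. \<sigma> (Qproj k e))"
    using U unfolding Q_trivs_iff by blast+
  show "\<exists>e\<in>total (Qbundle k). bproj (Qbundle k) e = x \<and> \<sigma> e = y" if "x \<in> W" "y \<in> Cn (k - 2)" for x y
    using fibre_iso_surj[OF U'(2), of x y] that W(2) by auto
  fix x assume x: "x \<in> W"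
  have "W \<subseteq> Zk k 0" using mopenD(1)[OF Zk_atlas W(1)] by simp
  from Zk_dom_cover[OF this x] obtain J where J: "J \<subseteq> {..<k}" "x \<in> W \<inter> Zk_dom k J" by blast
  let ?W = "W \<inter> Zk_dom k J"
  have op: "mopen (Zk_mfd k) ?W" by (rule mopen_Int[OF Zk_atlas W(1) mopen_Zk_dom[OF J(1)]])
  have "?W \<subseteq> U \<inter> Zk_dom k J" using W(2) by blast
  from holo_matrixE[OF holo_matrix_subset[OF Zk_atlas U'(3)[OF J(1)] op this]]
  obtain H where H: "\<And>i j. i < k - 2 \<Longrightarrow> j < k \<Longrightarrow> holo_fun (Zk_mfd k) ?W (H i j)"
    "\<And>e i. e \<in> total (normal_Zk k) \<Longrightarrow> tuple_red k e \<in> ?W \<Longrightarrow> i < k - 2 \<Longrightarrow> \<sigma> (Qproj k e) i = (\<Sum>j<k. H i j (tuple_red k e) * Ntriv k J e j)"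
    by blast
  from holo_matrixE[OF G[OF J(1)]]
  obtain L where L: "\<And>i j. i < m \<Longrightarrow> j < k \<Longrightarrow> holo_fun (Zk_mfd k) ?W (L i j)"
    "\<And>e i. e \<in> total (normal_Zk k) \<Longrightarrow> tuple_red k e \<in> ?W \<Longrightarrow> i < m \<Longrightarrow> G (Qproj k e) i = (\<Sum>j<k. L i j (tuple_red k e) * Ntriv k J e j)"
    by blast
  have k2: "k = (k - 2) + 2" using k by simp
  \<comment> \<open>On a normal form the first two columns drop out, and the remaining ones are
    renumbered by 2.\<close>
  have nf: "(\<Sum>j<k. a j * Ntriv k J (Qnf k J z y) j) = (\<Sum>j<k - 2. a (j + 2) * y j)" if z: "z \<in> Zk_dom k J" for a z y
  proof -
    have "(\<Sum>j<k. a j * Ntriv k J (Qnf k J z y) j) = (\<Sum>j<k. if j < 2 then 0 else a j * y (j - 2))"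
      by (rule sum.cong) (simp_all add: Qnf_normal(3)[OF z])
    also have "\<dots> = (\<Sum>j\<in>{2..<k}. a j * y (j - 2))"
      by (rule sum.mono_neutral_cong_right) (use k in auto)
    also have "\<dots> = (\<Sum>j<k - 2. a (j + 2) * y j)"
      by (rule sum.reindex_bij_witness[where i = "\<lambda>j. j + 2" and j = "\<lambda>j. j - 2"])
        (auto simp: le_add_diff_inverse2 simp del: add_2_eq_Suc')
    finally show ?thesis .
  qed
  have \<sigma>_nf: "\<sigma> (Qproj k (Qnf k J z y)) i = (\<Sum>j<k - 2. H i (j + 2) z * y j)" if "z \<in> ?W" "i < k - 2" for z y i
    using H(2)[OF Qnf_normal(1)[of z J y]] that nf[of z "\<lambda>j. H i j z" y] Qnf_normal(2)[of z J y] by simp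
  have G_nf: "G (Qproj k (Qnf k J z y)) i = (\<Sum>j<k - 2. L i (j + 2) z * y j)" if "z \<in> ?W" "i < m" for z y i
    using L(2)[OF Qnf_normal(1)[of z J y]] that nf[of z "\<lambda>j. L i j z" y] Qnf_normal(2)[of z J y] by simp
  \<comment> \<open>The square block of H acting on normal forms is injective because \<sigma> is
    injective on fibres; its inverse B expresses normal form coordinates through \<sigma>.\<close>
  have "\<exists>B. (\<forall>i<k - 2. \<forall>j<k - 2. holo_fun (Zk_mfd k) ?W (B i j)) \<and>
    (\<forall>z\<in>?W. \<forall>y w. (\<forall>i<k - 2. w i = (\<Sum>j<k - 2. H i (j + 2) z * y j)) \<longrightarrow> (\<forall>i<k - 2. y i = (\<Sum>j<k - 2. B i j z * w j)))"
  proof (rule holo_matrix_inverse[OF Zk_atlas op, where A = "\<lambda>i j. H i (j + 2)" and n = "k - 2"])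
    show "holo_fun (Zk_mfd k) ?W (H i (j + 2))" if "i < k - 2" "j < k - 2" for i j
      by (rule H(1)) (use that in auto)
    fix z y assume z: "z \<in> ?W" and 0: "\<And>i. i < k - 2 \<Longrightarrow> (\<Sum>j<k - 2. H i (j + 2) z * y j) = 0"
    \<comment> \<open>Cutting y off from k - 2 on puts it into \<open>Cn (k - 2)\<close> without
      changing the sums.\<close>
    define y' where "y' j = (if j < k - 2 then y j else 0)" for j
    have y': "y' \<in> Cn (k - 2)" by (simp add: y'_def Cn_def)
    have zJ: "z \<in> Zk_dom k J" using z by blast
    have zU: "z \<in> U" using z W(2) by blast
    let ?q = "Qproj k (Qnf k J z y')" and ?r = "Qproj k (Qnf k J z (\<lambda>_. 0))"
    have q: "?q \<in> total (Qbundle k)" "?r \<in> total (Qbundle k)" "bproj (Qbundle k) ?q = z" "bproj (Qbundle k) ?r = z"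
      using Qnf_normal(1,2)[OF zJ] bproj_Q[OF Qnf_normal(1)[OF zJ]] by simp_all
    have "\<sigma> ?q = \<sigma> ?r"
    proof
      fix i show "\<sigma> ?q i = \<sigma> ?r i"
      proof (cases "i < k - 2")
        case True
        have "(\<Sum>j<k - 2. H i (j + 2) z * y' j) = (\<Sum>j<k - 2. H i (j + 2) z * y j)"
          by (rule sum.cong) (simp_all add: y'_def)
        then show ?thesis using \<sigma>_nf[OF z True] 0[OF True] by simp
      next
        case False
        have "\<sigma> ?q \<in> Cn (k - 2)" "\<sigma> ?r \<in> Cn (k - 2)"
          using fibre_iso_Cn[OF U'(2) _ q(1)] fibre_iso_Cn[OF U'(2) _ q(2)] q(3,4) zU by simp_all
        then show ?thesis using False by (simp add: Cn_def)
      qed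
    qed
    then have "?q = ?r" using fibre_iso_inj[OF U'(2) _ q(1,2)] q(3,4) zU by simp
    then have "Qc k J (Qnf k J z y') = Qc k J (Qnf k J z (\<lambda>_. 0))"
      using Qtriv_Qproj[of "Qnf k J z y'" J] Qtriv_Qproj[of "Qnf k J z (\<lambda>_. 0)" J] Qnf_normal(1,2)[OF zJ] zJ by simp
    then have "y' = (\<lambda>_. 0)" using Qc_Qnf[OF zJ y'] Qc_Qnf[OF zJ, of "\<lambda>_. 0"] by (simp add: Cn_def)
    then have z: "y' j = 0" for j by simp
    show "\<forall>j<k - 2. y j = 0"
    proof (intro allI impI)
      fix j assume "j < k - 2"
      then show "y j = 0" using z[of j] by (simp add: y'_def)
    qed
  next
    fix B
    assume B: "\<And>i j. i < k - 2 \<Longrightarrow> j < k - 2 \<Longrightarrow> holo_fun (Zk_mfd k) ?W (B i j)"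
      "\<And>x y z i. x \<in> ?W \<Longrightarrow> (\<And>i. i < k - 2 \<Longrightarrow> z i = (\<Sum>j<k - 2. H i (j + 2) x * y j)) \<Longrightarrow> i < k - 2 \<Longrightarrow> y i = (\<Sum>j<k - 2. B i j x * z j)"
    show ?thesis by (rule exI[of _ B], intro conjI allI impI ballI) (rule B(1), assumption+, rule B(2), auto)
  qed
  then obtain B where B: "\<forall>i<k - 2. \<forall>j<k - 2. holo_fun (Zk_mfd k) ?W (B i j)"
    "\<forall>z\<in>?W. \<forall>y w. (\<forall>i<k - 2. w i = (\<Sum>j<k - 2. H i (j + 2) z * y j)) \<longrightarrow> (\<forall>i<k - 2. y i = (\<Sum>j<k - 2. B i j z * w j))"
    by (elim exE conjE)
  have "holo_matrix (Zk_mfd k) ?W m (k - 2) (total (Qbundle k)) (bproj (Qbundle k)) \<sigma> G"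
  proof (rule holo_matrixI[where h = "\<lambda>i j z. \<Sum>p<k - 2. L i (p + 2) z * B p j z"])
    show "holo_fun (Zk_mfd k) ?W (\<lambda>z. \<Sum>p<k - 2. L i (p + 2) z * B p j z)" if "i < m" "j < k - 2" for i j
      by (intro holo_fun_sum[OF Zk_atlas op] holo_fun_mult[OF Zk_atlas] L(1)) (use that B(1) in auto)
    fix q i assume "q \<in> total (Qbundle k)" and qW: "bproj (Qbundle k) q \<in> ?W" and i: "i < m"
    then obtain v where v: "v \<in> total (normal_Zk k)" "q = Qproj k v" by auto
    define z y where "z = tuple_red k v" and "y = Qc k J v"
    have bz: "bproj (Qbundle k) q = z" unfolding v(2) z_def by (rule bproj_Q[OF v(1)])
    then have zW: "z \<in> ?W" using qW by simp
    then have q: "q = Qproj k (Qnf k J z y)" using Q_normal_form[OF v(1), of J] v(2) by (simp add: z_def y_def)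
    have "\<forall>i<k - 2. \<sigma> q i = (\<Sum>j<k - 2. H i (j + 2) z * y j)" unfolding q using \<sigma>_nf[OF zW] by blast
    then have y: "\<forall>i<k - 2. y i = (\<Sum>j<k - 2. B i j z * \<sigma> q j)" using B(2) zW by blast
    have "G q i = (\<Sum>p<k - 2. L i (p + 2) z * y p)" unfolding q by (rule G_nf[OF zW i])
    also have "\<dots> = (\<Sum>p<k - 2. \<Sum>j<k - 2. L i (p + 2) z * B p j z * \<sigma> q j)"
      by (rule sum.cong) (use y in \<open>simp_all add: sum_distrib_left mult.assoc\<close>)
    also have "\<dots> = (\<Sum>j<k - 2. (\<Sum>p<k - 2. L i (p + 2) z * B p j z) * \<sigma> q j)"
      by (subst sum.swap) (simp add: sum_distrib_right)
    finally show "G q i = (\<Sum>j<k - 2. (\<Sum>p<k - 2. L i (p + 2) (bproj (Qbundle k) q) * B p j (bproj (Qbundle k) q)) * \<sigma> q j)"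
      unfolding bz .
  qed
  then show "\<exists>V. x \<in> V \<and> V \<subseteq> W \<and> holo_matrix (Zk_mfd k) V m (k - 2) (total (Qbundle k)) (bproj (Qbundle k)) \<sigma> G"
    using J(2) by (intro exI[of _ ?W]) simp
qed

text \<open>The transition from \<sigma> to \<tau> is \<open>Q_descent_matrix\<close> with \<tau> in
  the place of G: being a trivialization already means that \<tau> after the projection is
  holomorphic.\<close>

lemma holo_vbundle_Q: "holo_vbundle (Qbundle k)"
  unfolding holo_vbundle_def
proof (intro conjI ballI)
  show "complex_manifold (base (Qbundle k))" by (simp add: Zk_complex_manifold)
  show "bproj (Qbundle k) ` total (Qbundle k) \<subseteq> mpoints (base (Qbundle k))"
    using bproj_Q normal_red by fastforce
  show "\<Union> (fst ` trivs (Qbundle k)) = mpoints (base (Qbundle k))"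
    unfolding Q_simps Zk_mfd_simps
  proof (intro equalityI subsetI)
    fix x assume "x \<in> \<Union> (fst ` trivs (Qbundle k))"
    then obtain U \<tau> where "(U, \<tau>) \<in> trivs (Qbundle k)" "x \<in> U" by auto
    then show "x \<in> Zk k 0" using mopenD(1)[OF Zk_atlas, of k U] unfolding Q_trivs_iff by auto
  next
    fix x assume "x \<in> Zk k 0"
    then obtain J where J: "J \<subseteq> {..<k}" "x \<in> Zk_dom k J" by (rule Zk_dom_at)
    then have "Zk_dom k J \<in> fst ` trivs (Qbundle k)" using Qtriv_triv[OF J(1)] by (rule_tac image_eqI) simp_all
    then show "x \<in> \<Union> (fst ` trivs (Qbundle k))" using J(2) by blast
  qed
next
  fix c assume c: "c \<in> trivs (Qbundle k)"
  obtain U \<sigma> where c': "c = (U, \<sigma>)" by (cases c)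
  have U: "(U, \<sigma>) \<in> trivs (Qbundle k)" using c c' by simp
  have op: "mopen (Zk_mfd k) U" "fibre_iso (Qbundle k) U \<sigma>" using U unfolding Q_trivs_iff by blast+
  show "case c of (U, \<tau>) \<Rightarrow> mopen (base (Qbundle k)) U \<and> fibre_iso (Qbundle k) U \<tau>"
    unfolding c' prod.case using op by simp
  show "case c of (U, \<sigma>) \<Rightarrow> \<forall>(V, \<tau>)\<in>trivs (Qbundle k). holo_matrix (base (Qbundle k)) (U \<inter> V)
      (vrank (Qbundle k)) (vrank (Qbundle k)) (total (Qbundle k)) (bproj (Qbundle k)) \<sigma> \<tau>"
    unfolding c' prod.case
  proof
    fix d assume d: "d \<in> trivs (Qbundle k)"
    obtain V \<tau> where d': "d = (V, \<tau>)" by (cases d)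
    have V: "mopen (Zk_mfd k) V"
      "\<And>J. J \<subseteq> {..<k} \<Longrightarrow> holo_matrix (Zk_mfd k) (V \<inter> Zk_dom k J) (k - 2) k (total (normal_Zk k)) (tuple_red k) (Ntriv k J) (\<lambda>e. \<tau> (Qproj k e))"
      using d unfolding d' Q_trivs_iff by blast+
    have UV: "mopen (Zk_mfd k) (U \<inter> V)" by (rule mopen_Int[OF Zk_atlas op(1) V(1)])
    have "holo_matrix (Zk_mfd k) (U \<inter> V) (k - 2) (k - 2) (total (Qbundle k)) (bproj (Qbundle k)) \<sigma> \<tau>"
    proof (rule Q_descent_matrix[OF U UV])
      fix J assume J: "J \<subseteq> {..<k}"
      show "holo_matrix (Zk_mfd k) (U \<inter> V \<inter> Zk_dom k J) (k - 2) k (total (normal_Zk k)) (tuple_red k) (Ntriv k J) (\<lambda>e. \<tau> (Qproj k e))"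
        by (rule holo_matrix_subset[OF Zk_atlas V(2)[OF J] mopen_Int[OF Zk_atlas UV mopen_Zk_dom[OF J]]]) blast
    qed simp
    then show "case d of (V, \<tau>) \<Rightarrow> holo_matrix (base (Qbundle k)) (U \<inter> V)
      (vrank (Qbundle k)) (vrank (Qbundle k)) (total (Qbundle k)) (bproj (Qbundle k)) \<sigma> \<tau>"
      unfolding d' prod.case by (simp del: Q_simps(2))
  qed
qed

text \<open>Universal property of the quotient; the group action on Q and the retraction onto the
  slice are obtained through it from maps on the normal bundle.\<close>

lemma Q_descent:
  assumes Y: "holo_atlas (base E')" and V: "\<And>V \<tau>. (V, \<tau>) \<in> trivs E' \<Longrightarrow> mopen (base E') V"
    and F: "bundle_map_on W (normal_Zk k) E' f (\<lambda>e. F (Qproj k e))"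
  shows "bundle_map_on W (Qbundle k) E' f F"
proof (rule bundle_map_onI)
  have fm: "holo_map (Zk_mfd k) W (base E') f" using bundle_map_onD(1)[OF F] by simp
  then show "holo_map (base (Qbundle k)) W (base E') f" by simp
  show "F q \<in> total E' \<and> bproj E' (F q) = f (bproj (Qbundle k) q)"
    if q: "q \<in> total (Qbundle k)" "bproj (Qbundle k) q \<in> W" for q
  proof -
    obtain v where v: "v \<in> total (normal_Zk k)" "q = Qproj k v" using q(1) by auto
    show ?thesis using bundle_map_onD(2,3)[OF F v(1)] q(2) by (simp add: v(2) bproj_Q[OF v(1)])
  qed
  fix U \<sigma> V' \<tau> assume U: "(U, \<sigma>) \<in> trivs (Qbundle k)" and V': "(V', \<tau>) \<in> trivs E'"
  let ?D = "{x \<in> W \<inter> U. f x \<in> V'}"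
  have Um: "mopen (Zk_mfd k) U" using U unfolding Q_trivs_iff by (elim conjE)
  have "mopen (Zk_mfd k) (U \<inter> {x \<in> W. f x \<in> V'})"
    by (rule mopen_Int[OF Zk_atlas Um holo_map_preimage[OF Zk_atlas Y fm V[OF V']]])
  moreover have "U \<inter> {x \<in> W. f x \<in> V'} = ?D" by blast
  ultimately have D: "mopen (Zk_mfd k) ?D" by simp
  have "holo_matrix (Zk_mfd k) ?D (vrank E') (k - 2) (total (Qbundle k)) (bproj (Qbundle k)) \<sigma> (\<lambda>q. \<tau> (F q))"
  proof (rule Q_descent_matrix[OF U D])
    fix J assume J: "J \<subseteq> {..<k}"
    have "holo_matrix (Zk_mfd k) {x \<in> W \<inter> Zk_dom k J. f x \<in> V'} (vrank E') k (total (normal_Zk k)) (tuple_red k) (Ntriv k J) (\<lambda>e. \<tau> (F (Qproj k e)))"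
      using bundle_map_onD(4)[OF F normal_triv_mem[OF J] V'] by simp
    then show "holo_matrix (Zk_mfd k) (?D \<inter> Zk_dom k J) (vrank E') k (total (normal_Zk k)) (tuple_red k) (Ntriv k J) (\<lambda>e. \<tau> (F (Qproj k e)))"
      by (rule holo_matrix_subset[OF Zk_atlas _ mopen_Int[OF Zk_atlas D mopen_Zk_dom[OF J]]]) blast
  qed blast
  then show "holo_matrix (base (Qbundle k)) ?D (vrank E') (vrank (Qbundle k)) (total (Qbundle k)) (bproj (Qbundle k)) \<sigma> (\<lambda>q. \<tau> (F q))"
    by (simp del: Q_simps(2))
qed

section \<open>Exactness and equivariance of the sequence\<close>

lemma Qproj_map: "bundle_map_on (Zk k 0) (normal_Zk k) (Qbundle k) id (Qproj k)"
proof (rule bundle_map_onI)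
  show "holo_map (base (normal_Zk k)) (Zk k 0) (base (Qbundle k)) id"
    using holo_map_id[OF Zk_atlas mopen_mpoints[OF Zk_atlas, of k]] by (simp add: id_def)
  show "Qproj k e \<in> total (Qbundle k) \<and> bproj (Qbundle k) (Qproj k e) = id (bproj (normal_Zk k) e)"
    if "e \<in> total (normal_Zk k)" for e
    using that bproj_Q[OF that] by simp
  fix U \<sigma> V \<tau> assume "(U, \<sigma>) \<in> trivs (normal_Zk k)" and V: "(V, \<tau>) \<in> trivs (Qbundle k)"
  then obtain J where J: "J \<subseteq> {..<k}" "U = Zk_dom k J" "\<sigma> = Ntriv k J" unfolding normal_trivs by blast
  have "{x \<in> Zk k 0 \<inter> U. id x \<in> V} = V \<inter> Zk_dom k J" using Zk_domD(1) by (auto simp: J(2))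
  then show "holo_matrix (base (normal_Zk k)) {x \<in> Zk k 0 \<inter> U. id x \<in> V} (vrank (Qbundle k)) (vrank (normal_Zk k))
      (total (normal_Zk k)) (bproj (normal_Zk k)) \<sigma> (\<lambda>e. \<tau> (Qproj k e))"
    using V J unfolding Q_trivs_iff by simp
qed

text \<open>For injectivity the values at points 0 and 1 suffice, since they determine a linear
  form. A vector with zero class lies in the coset of the zero vector over its base point, and
  translating that zero vector produces exactly the image of \<open>SUSY\<close>.\<close>

lemma susy_exact: "short_exact (susy_bundle k) (normal_Zk k) (Qbundle k) (SUSY k) (Qproj k)"
  unfolding short_exact_def
proof (intro conjI)
  show "bundle_map_on (mpoints (base (normal_Zk k))) (susy_bundle k) (normal_Zk k) id (SUSY k)" using SUSY_map[of k] by simp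
  show "bundle_map_on (mpoints (base (normal_Zk k))) (normal_Zk k) (Qbundle k) id (Qproj k)" using Qproj_map by simp
  show "inj_on (SUSY k) (total (susy_bundle k))"
  proof (rule inj_onI)
    fix d d' assume d: "d \<in> total (susy_bundle k)" "d' \<in> total (susy_bundle k)" and eq: "SUSY k d = SUSY k d'"
    obtain x g h where dx: "d = (x, spin_sec g h)" "x \<in> Zk k 0" using d(1) by (auto elim!: H0_cases)
    obtain x' g' h' where dx': "d' = (x', spin_sec g' h')" "x' \<in> Zk k 0" using d(2) by (auto elim!: H0_cases)
    have x: "x = x'" using SUSY_normal(2)[OF dx(2) spin_sec_in_H0] SUSY_normal(2)[OF dx'(2) spin_sec_in_H0] eq dx(1) dx'(1) by metis
    obtain J where J: "x \<in> Zk_dom k J" by (rule Zk_dom_at[OF dx(2)])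
    have "Zx J x i * g + Zy J x i * h = Zx J x i * g' + Zy J x i * h'" if "i < k" for i
      using SUSY_rep[OF J that, of g h] SUSY_rep[OF J that, of g' h'] eq unfolding dx(1) dx'(1) x[symmetric]
      by (metis pt_eqD[OF _ Zxy_nonzero])
    then have i: "Zx J x 0 * (g - g') + Zy J x 0 * (h - h') = 0" "Zx J x 1 * (g - g') + Zy J x 1 * (h - h') = 0"
      using k by (simp_all add: algebra_simps)
    \<comment> \<open>Eliminating one unknown from the two equations leaves the determinant of
      points 0 and 1 as coefficient of the other.\<close>
    have "Zdet J x 0 1 * (g - g') = (Zx J x 0 * (g - g') + Zy J x 0 * (h - h')) * Zy J x 1 - (Zx J x 1 * (g - g') + Zy J x 1 * (h - h')) * Zy J x 0"
      "Zdet J x 0 1 * (h - h') = (Zx J x 1 * (g - g') + Zy J x 1 * (h - h')) * Zx J x 0 - (Zx J x 0 * (g - g') + Zy J x 0 * (h - h')) * Zx J x 1"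
      unfolding Zdet_def by (simp_all add: algebra_simps)
    then have "g = g'" "h = h'" unfolding i using Zdet_01[OF J] by simp_all
    then show "d = d'" using x by (simp add: dx dx')
  qed
  show "SUSY k ` total (susy_bundle k) = {e \<in> total (normal_Zk k). is_vzero (Qbundle k) (Qproj k e)}"
  proof (intro equalityI subsetI)
    have zero: "shift k g h (vscale (normal_Zk k) 0 v) = SUSY k (tuple_red k v, spin_sec g h)" if v: "v \<in> total (normal_Zk k)" for v g h
    proof -
      obtain J where J: "tuple_red k v \<in> Zk_dom k J" by (rule normal_dom[OF v])
      let ?v = "vscale (normal_Zk k) 0 v"
      have red: "tuple_red k ?v = tuple_red k v" by (rule normal_ops(2)[OF v])
      have "shift k g h ?v i = SUSY k (tuple_red k v, spin_sec g h) i" if i: "i < k" for i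
        using shift_rep[OF normal_ops(1)[OF v, of 0], of J i g h] J SUSY_rep[OF J i, of g h] i
        unfolding red normal_ops(5)[OF v J] by simp
      then have "\<And>i. i \<in> {..<k} \<Longrightarrow> shift k g h ?v i = SUSY k (tuple_red k v, spin_sec g h) i" by simp
      moreover have "SUSY k (tuple_red k v, spin_sec g h) \<in> extensional {..<k}" by (simp add: SUSY_def)
      ultimately show ?thesis using extensionalityI[OF shift_ext] by blast
    qed
    {
      fix e assume "e \<in> SUSY k ` total (susy_bundle k)"
      then obtain x g h where x: "x \<in> Zk k 0" "e = SUSY k (x, spin_sec g h)" by (auto elim!: H0_cases)
      have e: "e \<in> total (normal_Zk k)" "tuple_red k e = x" using SUSY_normal[OF x(1) spin_sec_in_H0] x(2) by blast+
      have "e = shift k g h (vscale (normal_Zk k) 0 e)" unfolding zero[OF e(1)] e(2) by (rule x(2))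
      then have eq: "Qproj k e = Qproj k (vscale (normal_Zk k) 0 e)"
        using Qproj_shift[OF normal_ops(1)[OF e(1), of 0], of g h] by simp
      show "e \<in> {e \<in> total (normal_Zk k). is_vzero (Qbundle k) (Qproj k e)}"
        by (simp only: mem_Collect_eq is_vzero_def vscale_Q[OF e(1)] eq[symmetric] e(1) simp_thms)
    next
      fix e assume "e \<in> {e \<in> total (normal_Zk k). is_vzero (Qbundle k) (Qproj k e)}"
      then have e: "e \<in> total (normal_Zk k)" and vz: "vscale (Qbundle k) 0 (Qproj k e) = Qproj k e"
        unfolding is_vzero_def by blast+
      from vz have "Qproj k (vscale (normal_Zk k) 0 e) = Qproj k e" unfolding vscale_Q[OF e] .
      then obtain g h where "e = shift k g h (vscale (normal_Zk k) 0 e)"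
        using Qproj_eq_iff[OF normal_ops(1)[OF e, of 0] e] by metis
      then have "e = SUSY k (tuple_red k e, spin_sec g h)" unfolding zero[OF e] .
      then show "e \<in> SUSY k ` total (susy_bundle k)"
        by (rule image_eqI) (use normal_red[OF e] in simp)
    }
  qed
qed (simp_all add: holo_vbundle_susy holo_vbundle_normal holo_vbundle_Q)

text \<open>Conjugating a translation by a matrix gives the translation by the transformed section,
  with the same formula as for \<open>H0_act\<close>. This is why matrices permute the
  cosets.\<close>

lemma tuple_act_shift:
  assumes M: "a * d - b * c = 1" and v: "v \<in> total (normal_Zk k)"
  shows "tuple_act k (sl2_mat a b c d) (shift k g h v) = shift k (d * g - c * h) (a * h - b * g) (tuple_act k (sl2_mat a b c d) v)"
proof -
  have "pt_act (sl2_mat a b c d) (pt_act (sc1_mat 1 0 0 1 g h) p) =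
      pt_act (sc1_mat 1 0 0 1 (d * g - c * h) (a * h - b * g)) (pt_act (sl2_mat a b c d) p)" if p1: "p \<in> P11 1" for p
  proof -
    obtain x y t where p: "p = pt x y t" using p1 by (rule P11_1_cases)
    have "(x * a + y * b) * (d * g - c * h) + (x * c + y * d) * (a * h - b * g) = (a * d - b * c) * (x * g + y * h)"
      by (simp add: algebra_simps)
    then show ?thesis unfolding p pt_act_shift pt_act_sl2 using M by simp
  qed
  then show ?thesis using v by (intro ext) (simp add: shift_def tuple_act_def total_normal_Zk Zk_1_P11)
qed

lemma normal_act: "M \<in> carrier SL2 \<Longrightarrow> v \<in> total (normal_Zk k) \<Longrightarrow> tuple_act k M v \<in> total (normal_Zk k)"
  unfolding total_normal_Zk by (rule tuple_act_Zk_1)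

lemma Q_act_Qproj:
  assumes "M \<in> carrier SL2" and v: "v \<in> total (normal_Zk k)"
  shows "Q_act k M (Qproj k v) = Qproj k (tuple_act k M v)"
proof -
  obtain a b c d where M: "M = sl2_mat a b c d" "a * d - b * c = 1" using assms(1) by (rule SL2_cases)
  have v': "tuple_act k M v \<in> total (normal_Zk k)" by (rule normal_act[OF assms])
  show ?thesis
  proof (intro equalityI subsetI)
    fix w assume "w \<in> Q_act k M (Qproj k v)"
    then obtain g h where "w = tuple_act k M (shift k g h v)" unfolding Q_act_def Qproj_eq[OF v] by blast
    then show "w \<in> Qproj k (tuple_act k M v)"
      unfolding Qproj_eq[OF v'] unfolding M(1) tuple_act_shift[OF M(2) v] by blast
  next
    fix w assume "w \<in> Qproj k (tuple_act k M v)"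
    then obtain g h where w: "w = shift k g h (tuple_act k M v)" by (rule Qproj_memE[OF v'])
    \<comment> \<open>The inverse of the transformation of (g, h): the translation that becomes (g,
      h) after passing through the matrix.\<close>
    have "d * (a * g + c * h) - c * (b * g + d * h) = (a * d - b * c) * g" "a * (b * g + d * h) - b * (a * g + c * h) = (a * d - b * c) * h"
      by (simp_all add: algebra_simps)
    then have "w = tuple_act k M (shift k (a * g + c * h) (b * g + d * h) v)"
      using w M(2) unfolding M(1) tuple_act_shift[OF M(2) v] by simp
    then show "w \<in> Q_act k M (Qproj k v)" unfolding Q_act_def Qproj_eq[OF v] by blast
  qed
qed

lemma Q_group_action: "group_action SL2 (total (Qbundle k)) (\<lambda>M. restrict (Q_act k M) (total (Qbundle k)))"
proof (rule SL2_group_actionI)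
  interpret group SL2 by (rule group_SL2)
  fix q assume "q \<in> total (Qbundle k)"
  then obtain v where v: "v \<in> total (normal_Zk k)" "q = Qproj k v" by auto
  then have v1: "v \<in> Zk k 1" by (simp add: total_normal_Zk)
  show "Q_act k M q \<in> total (Qbundle k)" if "M \<in> carrier SL2" for M
    unfolding v(2) Q_act_Qproj[OF that v(1)] using normal_act[OF that v(1)] by simp
  show "Q_act k sc_one q = q"
    using Q_act_Qproj[OF one_closed v(1)] tuple_act_one[OF v1] by (simp add: v(2))
  show "Q_act k (sc_matmul N M) q = Q_act k M (Q_act k N q)" if M: "M \<in> carrier SL2" and N: "N \<in> carrier SL2" for M N
  proof -
    have "sc_matmul N M \<in> carrier SL2" using m_closed[OF M N] by simp
    from Q_act_Qproj[OF this v(1)] show ?thesis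
      unfolding v(2) Q_act_Qproj[OF N v(1)] Q_act_Qproj[OF M normal_act[OF N v(1)]] tuple_act_comp[OF M N v1] .
  qed
qed

lemma Q_act_map:
  assumes M: "M \<in> carrier SL2"
  shows "bundle_map_on (Zk k 0) (Qbundle k) (Qbundle k) (tuple_act k M) (Q_act k M)"
proof (rule Q_descent)
  have op: "mopen (base (Qbundle k)) V" if "(V, \<tau>) \<in> trivs (Qbundle k)" for V \<tau>
    by (rule holo_vbundleD(5)[OF holo_vbundle_Q that])
  have "bundle_map_on {x \<in> Zk k 0. tuple_act k M x \<in> Zk k 0} (normal_Zk k) (Qbundle k) (\<lambda>x. id (tuple_act k M x)) (\<lambda>e. Qproj k (tuple_act k M e))"
    by (rule bundle_map_compose[OF holo_vbundle_normal holo_vbundle_normal _ op tuple_act_normal_map[OF M] Qproj_map]) (simp_all add: Zk_atlas)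
  moreover have "{x \<in> Zk k 0. tuple_act k M x \<in> Zk k 0} = Zk k 0" using tuple_act_Zk_0[OF M] by blast
  ultimately have "bundle_map_on (Zk k 0) (normal_Zk k) (Qbundle k) (\<lambda>x. id (tuple_act k M x)) (\<lambda>e. Qproj k (tuple_act k M e))" by simp
  then show "bundle_map_on (Zk k 0) (normal_Zk k) (Qbundle k) (tuple_act k M) (\<lambda>e. Q_act k M (Qproj k e))"
    by (rule bundle_map_on_cong) (simp_all add: Q_act_Qproj[OF M] Zk_atlas)
qed (simp_all add: Zk_atlas Q_trivs_iff)

lemma SL2_action_susy: "SL2_action (susy_bundle k) (tuple_act k) (susy_act k)"
  using Zk_group_action[of k] susy_group_action[of k] susy_act_map[of _ k] by (simp add: SL2_action_def)

lemma SL2_action_normal: "SL2_action (normal_Zk k) (tuple_act k) (tuple_act k)"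
  using Zk_group_action[of k] normal_group_action[of k] tuple_act_normal_map[of _ k] by (simp add: SL2_action_def total_normal_Zk)

lemma SL2_action_Q: "SL2_action (Qbundle k) (tuple_act k) (Q_act k)"
  using Zk_group_action[of k] Q_group_action Q_act_map by (simp add: SL2_action_def)

lemma SUSY_equivariant: "SL2_equivariant (susy_bundle k) (susy_act k) (tuple_act k) (SUSY k)"
  unfolding SL2_equivariant_def
proof (intro ballI)
  fix M e assume M: "M \<in> carrier SL2" and "e \<in> total (susy_bundle k)"
  then obtain x g h where e: "e = (x, spin_sec g h)" "x \<in> Zk k 0" by (auto elim!: H0_cases)
  obtain a b c d where M': "M = sl2_mat a b c d" "a * d - b * c = 1" using M by (rule SL2_cases)
  show "SUSY k (susy_act k M e) = tuple_act k M (SUSY k e)"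
  proof
    fix i
    show "SUSY k (susy_act k M e) i = tuple_act k M (SUSY k e) i"
    proof (cases "i < k")
      case True
      obtain y z where p: "x i = pt y z 0" "y \<noteq> 0 \<or> z \<noteq> 0" by (rule P11_0_cases[OF Zk_0_P11[OF e(2) True]])
      have "(y * a + z * b) * (d * g - c * h) + (y * c + z * d) * (a * h - b * g) = (a * d - b * c) * (y * g + z * h)"
        by (simp add: algebra_simps)
      then show ?thesis using True M'(2) p(2) sl2_nonzero[OF M'(2) p(2)]
        unfolding e(1) susy_act_def prod.case M'(1) H0_act_spin_sec[OF M'(2)] SUSY_apply[OF True] tuple_act_apply[OF True] p(1) pt_act_sl2
        by (simp add: spin_sec_pt)
    qed (simp add: SUSY_def susy_act_def e tuple_act_def)
  qed
qed

lemma Qproj_equivariant: "SL2_equivariant (normal_Zk k) (tuple_act k) (Q_act k) (Qproj k)"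
  unfolding SL2_equivariant_def by (simp add: Q_act_Qproj)

lemma SUSY_Cstar: "Cstar_equivariant (susy_bundle k) (normal_Zk k) (SUSY k)"
  unfolding Cstar_equivariant_def
proof (intro allI impI ballI)
  fix t e assume "e \<in> total (susy_bundle k)"
  then obtain x g h where e: "e = (x, spin_sec g h)" "x \<in> Zk k 0" by (auto elim!: H0_cases)
  show "SUSY k (vscale (susy_bundle k) t e) = vscale (normal_Zk k) t (SUSY k e)"
  proof
    fix i
    show "SUSY k (vscale (susy_bundle k) t e) i = vscale (normal_Zk k) t (SUSY k e) i"
    proof (cases "i < k")
      case True
      obtain y z where p: "x i = pt y z 0" "y \<noteq> 0 \<or> z \<noteq> 0" by (rule P11_0_cases[OF Zk_0_P11[OF e(2) True]])
      then show ?thesis using True by (simp add: e(1) SUSY_apply H0_scale_spin_sec algebra_simps)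
    qed (simp add: SUSY_def e)
  qed
qed

lemma Qproj_Cstar: "Cstar_equivariant (normal_Zk k) (Qbundle k) (Qproj k)"
  unfolding Cstar_equivariant_def using vscale_Q by metis

lemma susy_commute: "actions_commute (susy_bundle k) (susy_act k)"
  unfolding actions_commute_def
proof (intro ballI allI impI)
  fix M t e assume "M \<in> carrier SL2" and "e \<in> total (susy_bundle k)"
  then obtain x g h a b c d where e: "e = (x, spin_sec g h)" and M': "M = sl2_mat a b c d" "a * d - b * c = 1"
    by (auto elim!: H0_cases SL2_cases)
  show "susy_act k M (vscale (susy_bundle k) t e) = vscale (susy_bundle k) t (susy_act k M e)"
    by (simp add: e M'(1) susy_act_def H0_scale_spin_sec H0_act_spin_sec[OF M'(2)] algebra_simps)
qed

lemma pt_act_scale: "M \<in> carrier SL2 \<Longrightarrow> p \<in> P11 1 \<Longrightarrow> pt_act M (S_scale t p) = S_scale t (pt_act M p)"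
  by (elim SL2_cases P11_1_cases) simp

lemma tuple_act_scale:
  "M \<in> carrier SL2 \<Longrightarrow> v \<in> total (normal_Zk k) \<Longrightarrow> tuple_act k M (vscale (normal_Zk k) t v) = vscale (normal_Zk k) t (tuple_act k M v)"
  by (rule ext) (simp add: tuple_act_def pt_act_scale total_normal_Zk Zk_1_P11)

lemma normal_commute: "actions_commute (normal_Zk k) (tuple_act k)"
  unfolding actions_commute_def using tuple_act_scale by blast

lemma Q_commute: "actions_commute (Qbundle k) (Q_act k)"
  unfolding actions_commute_def
proof (intro ballI allI impI)
  fix M t q assume M: "M \<in> carrier SL2" and "q \<in> total (Qbundle k)"
  then obtain v where v: "v \<in> total (normal_Zk k)" "q = Qproj k v" by auto
  show "Q_act k M (vscale (Qbundle k) t q) = vscale (Qbundle k) t (Q_act k M q)"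
    unfolding v(2) vscale_Q[OF v(1)] Q_act_Qproj[OF M v(1)] Q_act_Qproj[OF M normal_ops(1)[OF v(1)]]
      vscale_Q[OF normal_act[OF M v(1)]] tuple_act_scale[OF M v(1)] ..
qed

end

section \<open>The slice and its normal bundle\<close>

lemma sp_zero_pt: "s \<le> 1 \<Longrightarrow> sp_zero s = pt 0 1 0"
  using spt_eq_pt_0[of s 0 1] by (simp add: sp_zero_def)

lemma sp_infinity_pt: "s \<le> 1 \<Longrightarrow> sp_infinity s = pt 1 0 0"
  using spt_eq_pt_0[of s 1 0] by (simp add: sp_infinity_def)

lemma sp_one_pt: "s \<le> 1 \<Longrightarrow> sp_one s (godd e) = pt 1 1 e"
  using spt_eq_pt[of s 1 1 e] by (simp add: sp_one_def)

lemma sp_one_pt_0: "s \<le> 1 \<Longrightarrow> sp_one s 0 = pt 1 1 0"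
  using sp_one_pt[of s 0] by (simp add: godd_simps)

text \<open>Avoiding infinity puts every point into the z_1 chart, whence the index set {}; avoiding
  0 and 1 becomes nonvanishing of z(z - 1).\<close>

lemma Ztilde_0_iff:
  "z \<in> Ztilde m 0 \<longleftrightarrow> z \<in> Zk_dom m {} \<and> (\<forall>i\<in>{..<m}. affine_coord False (z i) * (affine_coord False (z i) - 1) \<noteq> 0)"
proof -
  have "(pt_red (z i) \<notin> {pt 0 1 0, pt 1 1 0, pt 1 0 0}) \<longleftrightarrow>
      (z i \<in> range (affine_pt False) \<and> affine_coord False (z i) * (affine_coord False (z i) - 1) \<noteq> 0)"
    if z: "z \<in> Zk m 0" and i: "i < m" for i
  proof -
    obtain x y where p: "z i = pt x y 0" "x \<noteq> 0 \<or> y \<noteq> 0" by (rule P11_0_cases[OF Zk_0_P11[OF z i]])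
    have eqs: "pt x y 0 = pt 0 1 0 \<longleftrightarrow> x = 0" "pt x y 0 = pt 1 1 0 \<longleftrightarrow> x = y" "pt x y 0 = pt 1 0 0 \<longleftrightarrow> y = 0"
      using pt_zero_eq_iff[OF p(2), of 0 1] pt_zero_eq_iff[OF p(2), of 1 1] pt_zero_eq_iff[OF p(2), of 1 0] by auto
    have r: "pt x y 0 \<in> range (affine_pt False) \<longleftrightarrow> y \<noteq> 0" by (simp add: pt_in_range_affine den_def)
    show ?thesis
    proof (cases "y = 0")
      case True
      then show ?thesis using r eqs by (simp add: p(1))
    next
      case False
      then have "affine_coord False (pt x y 0) = x / y" using affine_coord_pt[of False x y] by (simp add: den_def rat_def)
      then show ?thesis using r eqs False by (simp add: p(1))
    qed
  qed
  then have "z \<in> Zk m 0 \<Longrightarrow> (\<forall>i<m. pt_red (z i) \<notin> {pt 0 1 0, pt 1 1 0, pt 1 0 0}) \<longleftrightarrow>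
      (\<forall>i<m. z i \<in> range (affine_pt False)) \<and> (\<forall>i\<in>{..<m}. affine_coord False (z i) * (affine_coord False (z i) - 1) \<noteq> 0)"
    by (simp only: lessThan_iff Ball_def) blast
  then show ?thesis
    unfolding Ztilde_def mem_Collect_eq sp_zero_pt[OF zero_le] sp_one_pt_0[OF zero_le] sp_infinity_pt[OF zero_le]
    by (auto simp: Zk_dom_def)
qed

lemma Ztilde_1_iff: "z \<in> Ztilde m 1 \<longleftrightarrow> z \<in> total (normal_Zk m) \<and> tuple_red m z \<in> Ztilde m 0"
proof -
  have "z \<in> Zk m 1 \<Longrightarrow> i < m \<Longrightarrow> pt_red (tuple_red m z i) = pt_red (z i)" for i
    using pt_red_P11_0[OF pt_red_P11[OF Zk_1_P11]] by (simp add: tuple_red_apply)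
  then show ?thesis
    unfolding total_normal_Zk Ztilde_def mem_Collect_eq using tuple_red_Zk_1[of z m] by auto
qed

definition slice_coord :: "nat \<Rightarrow> slicept \<Rightarrow> nat \<Rightarrow> complex" where
  "slice_coord k x = Zcoord (k - 3) {} (snd x)"

text \<open>Coordinate 0 is the parameter of 1_\<epsilon>, and coordinate i > 0 belongs to the point
  with index i - 1 of the tuple.\<close>

definition slice_triv :: "nat \<Rightarrow> slicept \<Rightarrow> nat \<Rightarrow> complex" where
  "slice_triv k e i = (if i = 0 then gcoeff (fst e) {0} else Ntriv (k - 3) {} (snd e) (i - 1))"

lemma slice_mfd_simps [simp]:
  "mdim (slice_mfd k) = k - 3" "mpoints (slice_mfd k) = slice k 0" "charts (slice_mfd k) = {(slice k 0, slice_coord k)}"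
proof -
  have "(\<lambda>(\<epsilon> :: grassmann, z) i. if i < k - 3 then affine_coord False (z i) else 0) = slice_coord k"
    by (intro ext) (auto simp: slice_coord_def Zcoord_def)
  then show "charts (slice_mfd k) = {(slice k 0, slice_coord k)}" by (simp add: slice_mfd_def)
qed (simp_all add: slice_mfd_def)

lemma slice_0: "slice k 0 = {0} \<times> Ztilde (k - 3) 0"
  by (simp add: slice_def gr_odd_0)

lemma slice_1: "slice k 1 = range godd \<times> Ztilde (k - 3) 1"
  by (simp add: slice_def gr_odd_1)

lemma slice_coord_image:
  "slice_coord k ` slice k 0 = {y \<in> Zimg (k - 3) {}. \<forall>i\<in>{..<k - 3}. y i * (y i - 1) \<noteq> 0}"
proof -
  have "slice_coord k ` slice k 0 = Zcoord (k - 3) {} ` Ztilde (k - 3) 0"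
    unfolding slice_0 by (auto simp: slice_coord_def image_iff)
  also have "Ztilde (k - 3) 0 = {z \<in> Zk_dom (k - 3) {}. \<forall>i\<in>{..<k - 3}. Zcoord (k - 3) {} z i * (Zcoord (k - 3) {} z i - 1) \<noteq> 0}"
    using Ztilde_0_iff[of _ "k - 3"] by (auto simp: Zcoord_def)
  also have "Zcoord (k - 3) {} ` \<dots> = {y \<in> Zcoord (k - 3) {} ` Zk_dom (k - 3) {}. \<forall>i\<in>{..<k - 3}. y i * (y i - 1) \<noteq> 0}" by blast
  finally show ?thesis unfolding Zcoord_image .
qed

lemma slice_coord_inj: "inj_on (slice_coord k) (slice k 0)"
proof (rule inj_onI)
  fix x y assume x: "x \<in> slice k 0" and y: "y \<in> slice k 0" and eq: "slice_coord k x = slice_coord k y"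
  have "snd x \<in> Zk_dom (k - 3) {}" "snd y \<in> Zk_dom (k - 3) {}" "fst x = 0" "fst y = 0"
    using x y Ztilde_0_iff[of _ "k - 3"] unfolding slice_0 by auto
  moreover from this have "snd x = snd y" using eq inj_onD[OF Zcoord_inj[of "k - 3" "{}"]] by (simp add: slice_coord_def)
  ultimately show "x = y" by (simp add: prod_eq_iff)
qed

lemma slice_atlas: "holo_atlas (slice_mfd k)"
proof -
  have "{y \<in> Zimg (k - 3) {}. \<forall>i\<in>{..<k - 3}. y i * (y i - 1) \<noteq> 0} =
      Zimg (k - 3) {} \<inter> {y \<in> Cn (k - 3). \<forall>i\<in>{..<k - 3}. y i * (y i - 1) \<noteq> 0}" by (auto simp: Zimg_def)
  moreover have "openin (top_of_set (Cn (k - 3))) {y \<in> Cn (k - 3). \<forall>i\<in>{..<k - 3}. y i * (y i - 1) \<noteq> 0}"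
    by (rule openin_Cn_nonzero) (simp, intro continuous_on_mult continuous_on_diff coord_continuous_on continuous_on_const)
  ultimately have op: "openin (top_of_set (Cn (k - 3))) (slice_coord k ` slice k 0)"
    unfolding slice_coord_image using openin_Int[OF openin_Zimg] by simp
  have "holo_Cn (k - 3) (slice_coord k ` slice k 0) (\<lambda>y. slice_coord k (inv_into (slice k 0) (slice_coord k) y) j)" for j
  proof (rule holo_Cn_cong)
    show "y j = slice_coord k (inv_into (slice k 0) (slice_coord k) y) j" if "y \<in> slice_coord k ` slice k 0" for y
      using f_inv_into_f[OF that] by simp
    have "slice_coord k ` slice k 0 \<subseteq> Cn (k - 3)" by (auto simp: slice_coord_image Zimg_def)
    then show "holo_Cn (k - 3) (slice_coord k ` slice k 0) (\<lambda>y. y j)"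
      unfolding holo_Cn_iff using op cdiff_coord by blast
  qed
  then show ?thesis unfolding holo_atlas_def slice_mfd_simps by (simp add: op slice_coord_inj)
qed

lemma mopen_slice: "mopen (slice_mfd k) (slice k 0)"
  using mopen_mpoints[OF slice_atlas, of k] by simp

lemma holo_slice_coord: "holo_fun (slice_mfd k) (slice k 0) (\<lambda>x. slice_coord k x j)"
  by (rule holo_fun_chart[OF slice_atlas]) simp

lemma slice_complex_manifold: "complex_manifold (slice_mfd k)"
proof (rule complex_manifoldI[OF slice_atlas])
  show "\<forall>x\<in>mpoints (slice_mfd k). \<forall>y\<in>mpoints (slice_mfd k). x \<noteq> y \<longrightarrow>
      (\<exists>V W. mopen (slice_mfd k) V \<and> mopen (slice_mfd k) W \<and> x \<in> V \<and> y \<in> W \<and> V \<inter> W = {})"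
  proof (intro ballI impI)
    fix x y assume "x \<in> mpoints (slice_mfd k)" "y \<in> mpoints (slice_mfd k)" and ne: "x \<noteq> y"
    then have x: "x \<in> slice k 0" and y: "y \<in> slice k 0" by simp_all
    then have "slice_coord k x \<noteq> slice_coord k y" using ne inj_onD[OF slice_coord_inj] by blast
    then obtain j where "slice_coord k x j \<noteq> slice_coord k y j" by (auto simp: fun_eq_iff)
    then obtain S S' where S: "open S" "open S'" "slice_coord k x j \<in> S" "slice_coord k y j \<in> S'" "S \<inter> S' = {}"
      using separation_t2 by metis
    show "\<exists>V W. mopen (slice_mfd k) V \<and> mopen (slice_mfd k) W \<and> x \<in> V \<and> y \<in> W \<and> V \<inter> W = {}"
      by (rule exI[of _ "{p \<in> slice k 0. slice_coord k p j \<in> S}"], rule exI[of _ "{p \<in> slice k 0. slice_coord k p j \<in> S'}"],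
          intro conjI mopen_preimage[OF slice_atlas holo_slice_coord])
        (use S x y in auto)
  qed
qed simp

lemma normal_slice_simps [simp]:
  "base (normal_slice k) = slice_mfd k" "total (normal_slice k) = slice k 1" "bproj (normal_slice k) = slice_red k"
  "vrank (normal_slice k) = k - 2"
  "vadd (normal_slice k) e e' = (fst e + fst e', vadd (normal_Zk (k - 3)) (snd e) (snd e'))"
  "vscale (normal_slice k) t e = (gconst t * fst e, vscale (normal_Zk (k - 3)) t (snd e))"
  by (simp_all add: normal_slice_def case_prod_beta)

lemma slice_red_eq: "slice_red k e = (0, tuple_red (k - 3) (snd e))"
  by (simp add: slice_red_def case_prod_beta)

context
  fixes k :: nat
  assumes k: "k \<ge> 3"
begin

lemma slice_trivs: "trivs (normal_slice k) = {(slice k 0, slice_triv k)}"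
proof -
  have "(\<lambda>(\<epsilon>, z) i. if i = 0 then gcoeff \<epsilon> {0} else if i < k - 2 then spinor_coord False (z (i - 1)) else 0) = slice_triv k"
    by (intro ext) (use k in \<open>auto simp: slice_triv_def Ntriv_def case_prod_beta\<close>)
  then show ?thesis by (simp add: normal_slice_def)
qed

lemma slice_1_cases:
  assumes "e \<in> slice k 1"
  obtains t z where "e = (godd t, z)" "z \<in> total (normal_Zk (k - 3))" "tuple_red (k - 3) z \<in> Ztilde (k - 3) 0"
  using assms Ztilde_1_iff[of _ "k - 3"] unfolding slice_1 by auto

lemma slice_fibre_iso: "fibre_iso (normal_slice k) (slice k 0) (slice_triv k)"
  unfolding fibre_iso_def
proof (intro ballI conjI allI)
  let ?m = "k - 3"
  fix x assume "x \<in> slice k 0"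
  then obtain p where x: "x = (0, p)" "p \<in> Ztilde ?m 0" unfolding slice_0 by auto
  have p: "p \<in> Zk_dom ?m {}" using x(2) Ztilde_0_iff by blast
  note iso = bspec[OF Zk_normal_fibre_iso[of ?m "{}", unfolded fibre_iso_def] p]
  have fib: "bfibre (normal_slice k) x = range godd \<times> bfibre (normal_Zk ?m) p"
    using x(2) Ztilde_1_iff[of _ ?m] unfolding bfibre_def normal_slice_simps slice_1 slice_red_eq x(1) by auto
  have bij: "bij_betw (Ntriv ?m {}) (bfibre (normal_Zk ?m) p) (Cn ?m)" using iso by simp
  have trv: "slice_triv k (godd t, z) = (\<lambda>i. if i = 0 then t else Ntriv ?m {} z (i - 1))" for t z
    by (rule ext) (simp add: slice_triv_def)
  show "bij_betw (slice_triv k) (bfibre (normal_slice k) x) (Cn (vrank (normal_slice k)))"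
    unfolding fib normal_slice_simps
  proof (rule bij_betwI')
    fix e e' assume "e \<in> range godd \<times> bfibre (normal_Zk ?m) p" "e' \<in> range godd \<times> bfibre (normal_Zk ?m) p"
    then obtain t z t' z' where e: "e = (godd t, z)" "z \<in> bfibre (normal_Zk ?m) p" "e' = (godd t', z')" "z' \<in> bfibre (normal_Zk ?m) p" by auto
    show "(slice_triv k e = slice_triv k e') = (e = e')"
    proof
      assume eq: "slice_triv k e = slice_triv k e'"
      have "Ntriv ?m {} z i = Ntriv ?m {} z' i" for i using fun_cong[OF eq, of "i + 1"] by (simp add: e trv)
      then have "Ntriv ?m {} z = Ntriv ?m {} z'" by (rule ext)
      then have "z = z'" using bij e by (auto simp: bij_betw_def dest: inj_onD)
      moreover have "t = t'" using fun_cong[OF eq, of 0] by (simp add: e trv)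
      ultimately show "e = e'" by (simp add: e)
    qed simp
  next
    fix e assume "e \<in> range godd \<times> bfibre (normal_Zk ?m) p"
    then obtain t z where e: "e = (godd t, z)" by auto
    show "slice_triv k e \<in> Cn (k - 2)" unfolding e trv Cn_def using k by (auto simp: Ntriv_def)
  next
    fix y assume y: "y \<in> Cn (k - 2)"
    have "(\<lambda>i. y (i + 1)) \<in> Cn ?m" using y k by (auto simp: Cn_def)
    then have "(\<lambda>i. y (i + 1)) \<in> Ntriv ?m {} ` bfibre (normal_Zk ?m) p" using bij by (simp add: bij_betw_def)
    then obtain z where z: "z \<in> bfibre (normal_Zk ?m) p" "Ntriv ?m {} z = (\<lambda>i. y (i + 1))" by auto
    have "y = slice_triv k (godd (y 0), z)" unfolding trv by (rule ext) (simp add: z(2))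
    then show "\<exists>e\<in>range godd \<times> bfibre (normal_Zk ?m) p. y = slice_triv k e" using z(1) by blast
  qed
  fix e assume "e \<in> bfibre (normal_slice k) x"
  then obtain s z where e: "e = (godd s, z)" "z \<in> bfibre (normal_Zk ?m) p" unfolding fib by auto
  show "vscale (normal_slice k) t e \<in> bfibre (normal_slice k) x" for t
    unfolding fib e(1) normal_slice_simps fst_conv snd_conv godd_simps using iso e(2) by blast
  show "slice_triv k (vscale (normal_slice k) t e) = (\<lambda>j. t * slice_triv k e j)" for t
    unfolding e(1) normal_slice_simps(6) fst_conv snd_conv godd_simps trv using iso e(2) by (auto simp del: normal_Zk_simps)
  fix e' assume "e' \<in> bfibre (normal_slice k) x"
  then obtain s' z' where e': "e' = (godd s', z')" "z' \<in> bfibre (normal_Zk ?m) p" unfolding fib by auto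
  show "vadd (normal_slice k) e e' \<in> bfibre (normal_slice k) x"
    unfolding fib e(1) e'(1) normal_slice_simps fst_conv snd_conv godd_simps(2)[symmetric] using iso e(2) e'(2) by blast
  show "slice_triv k (vadd (normal_slice k) e e') = (\<lambda>j. slice_triv k e j + slice_triv k e' j)"
    unfolding e(1) e'(1) normal_slice_simps(5) fst_conv snd_conv godd_simps(2)[symmetric] trv
    using iso e(2) e'(2) by (auto simp del: normal_Zk_simps)
qed

lemma holo_vbundle_slice: "holo_vbundle (normal_slice k)"
proof -
  have "slice_red k ` slice k 1 \<subseteq> slice k 0"
    unfolding slice_0 by (auto simp: slice_red_eq elim!: slice_1_cases)
  moreover have "holo_matrix (slice_mfd k) (slice k 0 \<inter> slice k 0) (k - 2) (k - 2) (slice k 1) (slice_red k) (slice_triv k) (slice_triv k)"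
    by (rule holo_matrixI[where h = "\<lambda>i j _. if i = j then 1 else 0"])
      (simp_all add: holo_fun_const[OF slice_atlas] mopen_slice if_distrib[of "\<lambda>t. t * _"] cong: if_cong)
  ultimately show ?thesis
    unfolding holo_vbundle_def slice_trivs normal_slice_simps slice_mfd_simps
    by (simp add: slice_complex_manifold mopen_slice slice_fibre_iso)
qed

section \<open>The embedding of the slice into the configuration space\<close>

lemma embed_simps:
  assumes "s \<le> 1"
  shows "slice_embed k s (godd t, z) 0 = pt 0 1 0" "slice_embed k s (godd t, z) 1 = pt 1 1 t"
    "slice_embed k s (godd t, z) 2 = pt 1 0 0" "3 \<le> i \<Longrightarrow> i < k \<Longrightarrow> slice_embed k s (godd t, z) i = z (i - 3)"
  using k by (simp_all add: slice_embed_def sp_zero_pt[OF assms] sp_one_pt[OF assms] sp_infinity_pt[OF assms])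

lemma embed_ext: "slice_embed k s n \<in> extensional {..<k}"
  by (simp add: slice_embed_def case_prod_beta)

lemma index_cases:
  assumes "i < k"
  obtains "i = 0" | "i = 1" | "i = 2" | "3 \<le> i" "i - 3 < k - 3"
  using assms k by linarith

text \<open>Avoiding 0, 1 and infinity is exactly distinctness from the three inserted points; by
  symmetry pairs i < j suffice.\<close>

lemma embed_0:
  assumes "x \<in> slice k 0"
  shows "slice_embed k 0 x \<in> Zk k 0"
proof -
  obtain z where x: "x = (godd 0, z)" "z \<in> Ztilde (k - 3) 0" using assms unfolding slice_0 by (auto simp: godd_simps)
  have zd: "z \<in> Zk_dom (k - 3) {}" "\<And>i. i < k - 3 \<Longrightarrow> affine_coord False (z i) \<noteq> 0 \<and> affine_coord False (z i) \<noteq> 1"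
    using x(2) Ztilde_0_iff[of z "k - 3"] by auto
  define w where "w i = affine_coord False (z i)" for i
  have zr: "z i = pt (w i) 1 0" "w i \<noteq> 0" "w i \<noteq> 1" if "i < k - 3" for i
    using Zk_dom_rep[OF zd(1) that] zd(2)[OF that] by (simp_all add: w_def Zx_def Zy_def hx_def hy_def)
  note E = embed_simps[OF zero_le, where z = z and t = 0]
  have mem: "slice_embed k 0 x i \<in> P11 0" if "i < k" for i
    unfolding x(1) using that by (cases rule: index_cases[OF that]) (simp_all add: E zr)
  have less: "slice_embed k 0 x i \<noteq> slice_embed k 0 x j" if ij: "i < j" "j < k" for i j
  proof -
    have "i < k" using ij by simp
    have ne: "pt (w l) 1 0 \<noteq> pt 0 1 0" "pt (w l) 1 0 \<noteq> pt 1 1 0" "pt (w l) 1 0 \<noteq> pt 1 0 0" if "l < k - 3" for l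
      using zr(2,3)[OF that] by (simp_all add: pt_zero_eq_iff)
    have ne': "pt 0 1 0 \<noteq> pt 1 1 0" "pt 0 1 0 \<noteq> pt 1 0 0" "pt 1 1 0 \<noteq> pt 1 0 0" by (simp_all add: pt_zero_eq_iff)
    show ?thesis
    proof (cases rule: index_cases[OF ij(2)])
      case j4: 4
      have j: "slice_embed k 0 (godd 0, z) j = pt (w (j - 3)) 1 0" using j4 ij(2) zr(1)[OF j4(2)] by (simp add: E)
      show ?thesis
      proof (cases rule: index_cases[OF \<open>i < k\<close>])
        case i4: 4
        have "z (i - 3) \<noteq> z (j - 3)"
          using Zk_0_distinct[OF Zk_domD(1)[OF zd(1)], of "i - 3" "j - 3"] ij i4 by simp
        then show ?thesis using i4 j4 ij unfolding x(1) by (simp add: E)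
      qed (use ne[OF j4(2), THEN not_sym] in \<open>simp_all add: j x(1) E\<close>)
    next
      case j2: 3
      then have "i = 0 \<or> i = 1" using ij by auto
      then show ?thesis using j2 ne'(2,3) unfolding x(1) by (elim disjE) (simp_all only: E not_False_eq_True)
    next
      case j1: 2
      then have "i = 0" using ij by auto
      then show ?thesis using j1 ne'(1) unfolding x(1) by (simp only: E not_False_eq_True)
    qed (use ij in simp)
  qed
  have "inj_on (slice_embed k 0 x) {..<k}"
    by (rule linorder_inj_onI) (use less in \<open>auto\<close>)
  then show ?thesis unfolding Zk_0_iff PiE_iff using mem embed_ext by simp
qed

lemma embed_1:
  assumes "e \<in> slice k 1"
  shows "slice_embed k 1 e \<in> Zk k 1" "tuple_red k (slice_embed k 1 e) = slice_embed k 0 (slice_red k e)"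
proof -
  obtain t z where e: "e = (godd t, z)" "z \<in> total (normal_Zk (k - 3))" "tuple_red (k - 3) z \<in> Ztilde (k - 3) 0"
    using assms by (rule slice_1_cases)
  have red: "slice_red k (godd t, z) = (godd 0, tuple_red (k - 3) z)" by (simp add: slice_red_eq godd_simps)
  note E = embed_simps[OF order_refl, where z = z and t = t] and E0 = embed_simps[OF zero_le, where z = "tuple_red (k - 3) z" and t = 0]
  have z: "z i \<in> P11 1" if "i < k - 3" for i using e(2) that Zk_1_P11 by (simp add: total_normal_Zk)
  show 1: "tuple_red k (slice_embed k 1 e) = slice_embed k 0 (slice_red k e)"
  proof (rule extensionalityI[OF _ embed_ext])
    show "tuple_red k (slice_embed k 1 e) \<in> extensional {..<k}" by (simp add: tuple_red_def)
    fix i assume "i \<in> {..<k}"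
    then have i: "i < k" by simp
    show "tuple_red k (slice_embed k 1 e) i = slice_embed k 0 (slice_red k e) i"
      unfolding tuple_red_apply[OF i] e(1) red by (cases rule: index_cases[OF i]) (use i in \<open>simp_all add: E E0 tuple_red_apply\<close>)
  qed
  have "slice_embed k 1 e i \<in> P11 1" if i: "i < k" for i
    unfolding e(1) by (cases rule: index_cases[OF i]) (use i in \<open>simp_all add: E z\<close>)
  then have "slice_embed k 1 e \<in> {..<k} \<rightarrow>\<^sub>E P11 1" unfolding PiE_iff using embed_ext by simp
  moreover have "slice_red k e \<in> slice k 0" using e(3) unfolding slice_0 by (simp add: slice_red_eq e(1))
  ultimately show "slice_embed k 1 e \<in> Zk k 1"
    using embed_0 normal_Zk_total_iff[of "slice_embed k 1 e" k] unfolding 1 total_normal_Zk by simp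
qed

lemma embed_map: "bundle_map_on (slice k 0) (normal_slice k) (normal_Zk k) (slice_embed k 0) (slice_embed k 1)"
proof (rule bundle_map_to_normal[OF holo_vbundle_slice])
  show "mopen (base (normal_slice k)) (slice k 0)" using mopen_slice by simp
  show "slice_embed k 1 e \<in> total (normal_Zk k) \<and> tuple_red k (slice_embed k 1 e) = slice_embed k 0 (bproj (normal_slice k) e)"
    if "e \<in> total (normal_slice k)" for e
    using that embed_1[of e] by (simp add: total_normal_Zk)
  fix U \<sigma> x assume "(U, \<sigma>) \<in> trivs (normal_slice k)" and x: "x \<in> slice k 0 \<inter> U"
  then have U: "U = slice k 0" "\<sigma> = slice_triv k" by (simp_all add: slice_trivs)
  define a b where "a i x = (if i = 0 then 0 else if i = 1 \<or> i = 2 then 1 else slice_coord k x (i - 3))"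
    and "b i x = (if i = 2 then 0 else 1 :: complex)" for i and x :: slicept
  \<comment> \<open>The fibre matrix of the embedding: \<epsilon> goes to point 1, fibre coordinate
    i - 2 goes to point i from 3 on, and points 0 and 2 have no odd part.\<close>
  define h where "h i j x = (if i = 1 \<and> j = 0 \<or> 3 \<le> i \<and> j = i - 2 then 1 else 0 :: complex)" for i j :: nat and x :: slicept
  have c: "holo_fun (slice_mfd k) (slice k 0) (\<lambda>_. c)" for c by (rule holo_fun_const[OF slice_atlas mopen_slice])
  have "holo_fun (slice_mfd k) (slice k 0) (a i)" for i
  proof -
    consider "i = 0" | "i = 1" | "i = 2" | "i \<noteq> 0" "i \<noteq> 1" "i \<noteq> 2" by blast
    then show ?thesis unfolding a_def by cases (simp_all add: c holo_slice_coord)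
  qed
  moreover have "holo_fun (slice_mfd k) (slice k 0) (b i)" "holo_fun (slice_mfd k) (slice k 0) (h i j)" for i j
    unfolding b_def h_def by (rule c)+
  moreover have "slice_embed k 1 e i = pt (a i (slice_red k e)) (b i (slice_red k e)) (\<Sum>j<k - 2. h i j (slice_red k e) * slice_triv k e j)"
    if e': "e \<in> slice k 1" and i: "i < k" for e i
  proof -
    obtain t z where e: "e = (godd t, z)" "z \<in> total (normal_Zk (k - 3))" "tuple_red (k - 3) z \<in> Ztilde (k - 3) 0"
      using e' by (rule slice_1_cases)
    have sum: "(\<Sum>j<k - 2. h i j y * slice_triv k e j) =
        (if i = 1 then slice_triv k e 0 else if 3 \<le> i then slice_triv k e (i - 2) else 0)" for y
    proof -
      have d: "(\<Sum>j<k - 2. (if j = l then 1 else 0) * slice_triv k e j) = slice_triv k e l" if "l < k - 2" for l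
        using that by (simp add: if_distrib[of "\<lambda>t. t * _"] cong: if_cong)
      consider "i = 1" | "3 \<le> i" | "i \<noteq> 1" "\<not> 3 \<le> i" by blast
      then show ?thesis
      proof cases
        case 1
        then have "h i j y = (if j = 0 then 1 else 0)" for j by (simp add: h_def)
        then show ?thesis using 1 d[of 0] k by simp
      next
        case 2
        then have "h i j y = (if j = i - 2 then 1 else 0)" for j by (simp add: h_def)
        then show ?thesis using 2 d[of "i - 2"] i by simp
      qed (simp add: h_def)
    qed
    note E = embed_simps[OF order_refl, where z = z and t = t]
    show ?thesis unfolding sum
    proof (cases rule: index_cases[OF i])
      case 4
      then have i2: "i - 2 - 1 = i - 3" "i - 2 \<noteq> 0" by auto
      have zd: "tuple_red (k - 3) z \<in> Zk_dom (k - 3) {}" using e(3) Ztilde_0_iff by blast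
      have "slice_embed k 1 e i = z (i - 3)" unfolding e(1) using 4 i by (simp add: E)
      also have "\<dots> = pt (Zx {} (tuple_red (k - 3) z) (i - 3)) (Zy {} (tuple_red (k - 3) z) (i - 3)) (Ntriv (k - 3) {} z (i - 3))"
        by (rule normal_rep[OF e(2) zd 4(2)])
      also have "\<dots> = pt (slice_coord k (slice_red k e) (i - 3)) 1 (slice_triv k e (i - 2))"
        using 4 i2 by (simp add: Zx_def Zy_def hx_def hy_def slice_coord_def Zcoord_def slice_red_eq slice_triv_def e(1))
      finally show "slice_embed k 1 e i = pt (a i (slice_red k e)) (b i (slice_red k e))
          (if i = 1 then slice_triv k e 0 else if 3 \<le> i then slice_triv k e (i - 2) else 0)"
        using 4 by (simp add: a_def b_def)
    qed (simp_all add: e(1) E a_def b_def slice_triv_def)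
  qed
  ultimately show "\<exists>V a b h. x \<in> V \<and> V \<subseteq> slice k 0 \<inter> U \<and> mopen (base (normal_slice k)) V \<and>
      (\<forall>i<k. holo_fun (base (normal_slice k)) V (a i) \<and> holo_fun (base (normal_slice k)) V (b i) \<and>
        (\<forall>j<vrank (normal_slice k). holo_fun (base (normal_slice k)) V (h i j))) \<and>
      (\<forall>e\<in>total (normal_slice k). bproj (normal_slice k) e \<in> V \<longrightarrow> (\<forall>i<k. slice_embed k 1 e i =
        pt (a i (bproj (normal_slice k) e)) (b i (bproj (normal_slice k) e)) (\<Sum>j<vrank (normal_slice k). h i j (bproj (normal_slice k) e) * \<sigma> e j)))"
    unfolding normal_slice_simps U
    by (intro exI[of _ "slice k 0"] exI[of _ a] exI[of _ b] exI[of _ h]) (use x U mopen_slice in simp)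
qed

text \<open>Converse of the embedding: distinctness of the reduced points keeps those from index 3
  on away from 0, 1 and infinity.\<close>

lemma slice_recover:
  assumes w: "w \<in> Zk k 1" "w 0 = pt 0 1 0" "w 1 = pt 1 1 t" "w 2 = pt 1 0 0"
  shows "(godd t, \<lambda>i\<in>{..<k - 3}. w (i + 3)) \<in> slice k 1" "slice_embed k 1 (godd t, \<lambda>i\<in>{..<k - 3}. w (i + 3)) = w"
proof -
  let ?z = "\<lambda>i\<in>{..<k - 3}. w (i + 3)"
  have inj: "i = j" if "i < k" "j < k" "pt_red (w i) = pt_red (w j)" for i j
    using w(1) that by (auto simp: Zk_def dest: inj_onD)
  have "inj_on (\<lambda>i. pt_red (?z i)) {..<k - 3}"
  proof (rule inj_onI)
    fix i j assume "i \<in> {..<k - 3}" "j \<in> {..<k - 3}" "pt_red (?z i) = pt_red (?z j)"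
    then show "i = j" using inj[of "i + 3" "j + 3"] by simp
  qed
  then have "?z \<in> Zk (k - 3) 1" using Zk_1_P11[OF w(1)] by (auto simp: Zk_def)
  moreover have "pt_red (?z i) \<notin> {sp_zero 0, sp_one 0 0, sp_infinity 0}" if i: "i < k - 3" for i
  proof -
    have "i + 3 < k" using i by simp
    then have "pt_red (w (i + 3)) \<noteq> pt_red (w 0)" "pt_red (w (i + 3)) \<noteq> pt_red (w 1)" "pt_red (w (i + 3)) \<noteq> pt_red (w 2)"
      using inj[of "i + 3" 0] inj[of "i + 3" 1] inj[of "i + 3" 2] by auto
    then show ?thesis
      unfolding sp_zero_pt[OF zero_le] sp_one_pt_0[OF zero_le] sp_infinity_pt[OF zero_le] using i by (simp add: w)
  qed
  ultimately have "?z \<in> Ztilde (k - 3) 1" by (simp add: Ztilde_def)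
  then show "(godd t, ?z) \<in> slice k 1" unfolding slice_1 by simp
  note E = embed_simps[OF order_refl, where z = ?z and t = t]
  show "slice_embed k 1 (godd t, ?z) = w"
  proof (rule extensionalityI[OF embed_ext Zk_ext[OF w(1)]])
    fix i assume "i \<in> {..<k}"
    then have i: "i < k" by simp
    show "slice_embed k 1 (godd t, ?z) i = w i"
      by (cases rule: index_cases[OF i]) (use i in \<open>simp_all add: E w\<close>)
  qed
qed

section \<open>Moving configurations into the slice\<close>

text \<open>
  The matrix is determined by \<open>(p\<^sub>0, p\<^sub>1, p\<^sub>2) \<mapsto> (0, 1, \<infinity>)\<close> up to the square root \<open>n\<close> that normalizes
  its determinant; the shift then kills the odd parts at \<open>0\<close> and \<open>\<infinity>\<close>.
\<close>

definition mob :: "nat set \<Rightarrow> complex \<Rightarrow> (nat \<Rightarrow> spoint) \<Rightarrow> scmat" where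
  "mob J n x = sl2_mat (n * Zdet J x 1 2 * Zy J x 0) (- (n * Zdet J x 1 2 * Zx J x 0))
     (n * Zdet J x 1 0 * Zy J x 2) (- (n * Zdet J x 1 0 * Zx J x 2))"

text \<open>\<open>kill_g\<close> and \<open>kill_h\<close> are Cramer's solution of x_i g + y_i h =
  -t_i at the points i = 0 and i = 2, where t_i are the odd coordinates: the section whose
  translation removes the odd parts there.\<close>

definition kill_g :: "nat set \<Rightarrow> (nat \<Rightarrow> spoint) \<Rightarrow> complex" where
  "kill_g J v = (Ntriv k J v 2 * Zy J (tuple_red k v) 0 - Ntriv k J v 0 * Zy J (tuple_red k v) 2) / Zdet J (tuple_red k v) 0 2"

definition kill_h :: "nat set \<Rightarrow> (nat \<Rightarrow> spoint) \<Rightarrow> complex" where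
  "kill_h J v = (Ntriv k J v 0 * Zx J (tuple_red k v) 2 - Ntriv k J v 2 * Zx J (tuple_red k v) 0) / Zdet J (tuple_red k v) 0 2"

definition wmap :: "nat set \<Rightarrow> complex \<Rightarrow> (nat \<Rightarrow> spoint) \<Rightarrow> (nat \<Rightarrow> spoint)" where
  "wmap J n v = tuple_act k (mob J n (tuple_red k v)) (shift k (kill_g J v) (kill_h J v) v)"

definition retr :: "nat set \<Rightarrow> complex \<Rightarrow> (nat \<Rightarrow> spoint) \<Rightarrow> slicept" where
  "retr J n v = (godd (spinor_coord False (wmap J n v 1)), \<lambda>i\<in>{..<k - 3}. wmap J n v (i + 3))"

text \<open>The determinant of the matrix in \<open>mob\<close> for n = 1, so that n has to be an
  inverse square root of it.\<close>

definition disc :: "nat set \<Rightarrow> (nat \<Rightarrow> spoint) \<Rightarrow> complex" where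
  "disc J x = Zdet J x 1 2 * Zdet J x 1 0 * Zdet J x 0 2"

lemma idx: "0 < k" "1 < k" "2 < k"
  using k by auto

lemma Zdet_02: "x \<in> Zk_dom k J \<Longrightarrow> Zdet J x 0 2 \<noteq> 0"
  by (rule Zdet_nonzero) (use idx in auto)

lemma disc_nonzero: "x \<in> Zk_dom k J \<Longrightarrow> disc J x \<noteq> 0"
  unfolding disc_def using Zdet_nonzero[of x k J] idx by simp

lemma mob_SL2:
  assumes "n * n * disc J x = 1"
  shows "mob J n x \<in> carrier SL2"
  unfolding mob_def
proof (rule SL2_memI)
  show "n * Zdet J x 1 2 * Zy J x 0 * - (n * Zdet J x 1 0 * Zx J x 2) -
      - (n * Zdet J x 1 2 * Zx J x 0) * (n * Zdet J x 1 0 * Zy J x 2) = 1"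
    using assms unfolding disc_def by (simp add: Zdet_def[of J x 0 2] algebra_simps)
qed

lemma kill_lin: "a * kill_g J v + b * kill_h J v =
    (a * (Ntriv k J v 2 * Zy J (tuple_red k v) 0 - Ntriv k J v 0 * Zy J (tuple_red k v) 2) +
     b * (Ntriv k J v 0 * Zx J (tuple_red k v) 2 - Ntriv k J v 2 * Zx J (tuple_red k v) 0)) / Zdet J (tuple_red k v) 0 2"
  by (simp add: kill_g_def kill_h_def add_divide_distrib)

definition odd_part :: "nat set \<Rightarrow> (nat \<Rightarrow> spoint) \<Rightarrow> nat \<Rightarrow> complex" where
  "odd_part J v i = Zx J (tuple_red k v) i * kill_g J v + Zy J (tuple_red k v) i * kill_h J v + Ntriv k J v i"

text \<open>Exhibits the odd part as a linear combination of fibre coordinates whose coefficients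
  are quotients of determinants; this is the matrix of the local retraction before
  normalization.\<close>

lemma odd_part_eq:
  "odd_part J v i = Ntriv k J v i + Zdet J (tuple_red k v) 2 i / Zdet J (tuple_red k v) 0 2 * Ntriv k J v 0
     + Zdet J (tuple_red k v) i 0 / Zdet J (tuple_red k v) 0 2 * Ntriv k J v 2"
proof -
  have "Zx J (tuple_red k v) i * (Ntriv k J v 2 * Zy J (tuple_red k v) 0 - Ntriv k J v 0 * Zy J (tuple_red k v) 2) +
     Zy J (tuple_red k v) i * (Ntriv k J v 0 * Zx J (tuple_red k v) 2 - Ntriv k J v 2 * Zx J (tuple_red k v) 0) =
     Zdet J (tuple_red k v) 2 i * Ntriv k J v 0 + Zdet J (tuple_red k v) i 0 * Ntriv k J v 2"
    by (simp add: Zdet_def algebra_simps)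
  then show ?thesis unfolding odd_part_def kill_lin by (simp add: add_divide_distrib)
qed

lemma odd_part_kill:
  assumes "tuple_red k v \<in> Zk_dom k J"
  shows "odd_part J v 0 = 0" "odd_part J v 2 = 0"
proof -
  have D: "Zdet J (tuple_red k v) 0 2 \<noteq> 0" by (rule Zdet_02[OF assms])
  have "Zdet J (tuple_red k v) 2 0 = - Zdet J (tuple_red k v) 0 2" "Zdet J (tuple_red k v) i i = 0" for i
    by (simp_all add: Zdet_def)
  then show "odd_part J v 0 = 0" "odd_part J v 2 = 0" unfolding odd_part_eq using D by simp_all
qed

text \<open>Multiplication by the matrix pairs the i-th point with p_0 and with p_2, so the first
  even coordinate vanishes at i = 0 and the second at i = 2; the constant factors are chosen so that
  the two agree at i = 1.\<close>

lemma wmap_rep: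
  assumes v: "v \<in> total (normal_Zk k)" and J: "tuple_red k v \<in> Zk_dom k J" and i: "i < k"
  shows "wmap J n v i = pt (n * Zdet J (tuple_red k v) 1 2 * Zdet J (tuple_red k v) i 0)
    (n * Zdet J (tuple_red k v) 1 0 * Zdet J (tuple_red k v) i 2) (odd_part J v i)"
proof -
  let ?x = "Zx J (tuple_red k v)" and ?y = "Zy J (tuple_red k v)"
  have "?x i * (a * ?y 0) + ?y i * - (a * ?x 0) = a * Zdet J (tuple_red k v) i 0"
    "?x i * (a * ?y 2) + ?y i * - (a * ?x 2) = a * Zdet J (tuple_red k v) i 2" for a
    by (simp_all add: Zdet_def algebra_simps)
  then show ?thesis
    unfolding wmap_def tuple_act_apply[OF i] shift_rep[OF v J i] mob_def pt_act_sl2 odd_part_def by simp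
qed

lemma wmap_normal:
  assumes v: "v \<in> total (normal_Zk k)" and n: "n * n * disc J (tuple_red k v) = 1"
  shows "wmap J n v \<in> Zk k 1"
  unfolding wmap_def using normal_act[OF k mob_SL2[OF n] shift_normal(1)[OF v]] by (simp add: total_normal_Zk)

lemma wmap_slice:
  assumes v: "v \<in> total (normal_Zk k)" and J: "tuple_red k v \<in> Zk_dom k J" and n: "n * n * disc J (tuple_red k v) = 1"
  shows "wmap J n v 0 = pt 0 1 0" "wmap J n v 2 = pt 1 0 0" "wmap J n v 1 = pt 1 1 (spinor_coord False (wmap J n v 1))"
proof -
  let ?D = "Zdet J (tuple_red k v)"
  have n0: "n \<noteq> 0" using n by auto
  have D: "?D i j \<noteq> 0" if "i < k" "j < k" "i \<noteq> j" for i j using Zdet_nonzero[OF J that] .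
  have ii: "?D i i = 0" for i by (simp add: Zdet_def)
  show "wmap J n v 0 = pt 0 1 0"
    unfolding wmap_rep[OF v J idx(1)] odd_part_kill(1)[OF J] ii
    by (rule pt_eqI[of "1 / (n * ?D 1 0 * ?D 0 2)"]) (use n0 D idx in auto)
  show "wmap J n v 2 = pt 1 0 0"
    unfolding wmap_rep[OF v J idx(3)] odd_part_kill(2)[OF J] ii
    by (rule pt_eqI[of "1 / (n * ?D 1 2 * ?D 2 0)"]) (use n0 D idx in auto)
  have nz: "n * ?D 1 2 * ?D 1 0 \<noteq> 0" using n0 D idx by simp
  have 1: "wmap J n v 1 = pt (n * ?D 1 2 * ?D 1 0) (n * ?D 1 2 * ?D 1 0) (odd_part J v 1)"
    unfolding wmap_rep[OF v J idx(2)] by (simp add: mult_ac)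
  then have "spinor_coord False (wmap J n v 1) = odd_part J v 1 / (n * ?D 1 2 * ?D 1 0)"
    using nz by (simp add: spinor_coord_pt den_def)
  then show "wmap J n v 1 = pt 1 1 (spinor_coord False (wmap J n v 1))"
    unfolding 1 by (intro pt_eqI[of "1 / (n * ?D 1 2 * ?D 1 0)"]) (use nz in auto)
qed

lemma retr_slice:
  assumes v: "v \<in> total (normal_Zk k)" and J: "tuple_red k v \<in> Zk_dom k J" and n: "n * n * disc J (tuple_red k v) = 1"
  shows "retr J n v \<in> slice k 1" "slice_embed k 1 (retr J n v) = wmap J n v"
  unfolding retr_def
  using slice_recover[OF wmap_normal[OF v n] wmap_slice(1)[OF v J n] wmap_slice(3)[OF v J n] wmap_slice(2)[OF v J n]] by blast+

text \<open>Points 0 and 2 are distinct, so the translation removing the odd parts there is unique;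
  it therefore compensates any earlier translation.\<close>

lemma kill_shift:
  assumes v: "v \<in> total (normal_Zk k)" and J: "tuple_red k v \<in> Zk_dom k J"
  shows "kill_g J (shift k g h v) = kill_g J v - g" "kill_h J (shift k g h v) = kill_h J v - h"
proof -
  have D: "Zdet J (tuple_red k v) 0 2 \<noteq> 0" by (rule Zdet_02[OF J])
  show "kill_g J (shift k g h v) = kill_g J v - g" "kill_h J (shift k g h v) = kill_h J v - h"
    unfolding kill_g_def kill_h_def shift_normal(2)[OF v] Ntriv_shift[OF v J idx(1)] Ntriv_shift[OF v J idx(3)]
    using D by (simp_all add: divide_simps) (simp_all add: Zdet_def algebra_simps)
qed

text \<open>Makes the retraction a function of the coset, so that it descends to Q.\<close>

lemma retr_shift:
  assumes v: "v \<in> total (normal_Zk k)" and J: "tuple_red k v \<in> Zk_dom k J"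
  shows "retr J n (shift k g h v) = retr J n v"
proof -
  have "wmap J n (shift k g h v) = wmap J n v"
    unfolding wmap_def shift_normal(2)[OF v] kill_shift[OF v J] shift_shift[OF v] by simp
  then show ?thesis by (simp add: retr_def)
qed

text \<open>Off the nonpositive reals the principal root is holomorphic; near a negative real the
  root i times \<open>csqrt (- z)\<close> is used, which is holomorphic off the nonnegative
  reals.\<close>

lemma local_sqrt:
  assumes "w \<noteq> (0 :: complex)"
  obtains S r where "open S" "w \<in> S" "\<And>z. z \<in> S \<Longrightarrow> z \<noteq> 0 \<and> r z * r z = z \<and> r field_differentiable at z"
proof (cases "w \<in> \<real>\<^sub>\<le>\<^sub>0")
  case False
  show ?thesis
  proof (rule that[of "- \<real>\<^sub>\<le>\<^sub>0" csqrt])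
    show "z \<noteq> 0 \<and> csqrt z * csqrt z = z \<and> csqrt field_differentiable at z" if z: "z \<in> - \<real>\<^sub>\<le>\<^sub>0" for z
      using z field_differentiable_at_csqrt[of z] power2_csqrt[of z] by (auto simp: power2_eq_square)
  qed (use False in \<open>simp_all add: open_Compl closed_nonpos_Reals_complex\<close>)
next
  case True
  define S where "S = uminus -` (- \<real>\<^sub>\<le>\<^sub>0 :: complex set)"
  have "open S" unfolding S_def
    by (rule open_vimage) (simp_all add: open_Compl closed_nonpos_Reals_complex continuous_on_minus)
  moreover have "w \<in> S" using True assms unfolding S_def by (auto simp: complex_nonpos_Reals_iff complex_eq_iff)
  moreover have "z \<noteq> 0 \<and> (\<i> * csqrt (- z)) * (\<i> * csqrt (- z)) = z \<and> (\<lambda>z. \<i> * csqrt (- z)) field_differentiable at z" if z: "z \<in> S" for z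
  proof (intro conjI)
    have nz: "- z \<notin> \<real>\<^sub>\<le>\<^sub>0" using z by (simp add: S_def)
    then show "z \<noteq> 0" by auto
    have "csqrt (- z) * csqrt (- z) = - z" using power2_csqrt[of "- z"] by (simp add: power2_eq_square)
    moreover have "(\<i> * c) * (\<i> * c) = \<i> * \<i> * (c * c)" for c by (simp only: ac_simps)
    then have "(\<i> * c) * (\<i> * c) = - (c * c)" for c by (simp only: complex_i_mult_minus i_squared mult_minus1)
    ultimately show "(\<i> * csqrt (- z)) * (\<i> * csqrt (- z)) = z" by (simp only: minus_minus)
    have "(csqrt \<circ> uminus) field_differentiable at z"
      by (rule field_differentiable_compose) (auto intro!: field_differentiable_minus field_differentiable_ident field_differentiable_at_csqrt[OF nz])
    then show "(\<lambda>z. \<i> * csqrt (- z)) field_differentiable at z"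
      by (intro field_differentiable_mult field_differentiable_const) (simp add: o_def)
  qed
  ultimately show ?thesis by (rule that)
qed

text \<open>Index of the configuration point whose odd part gives fibre coordinate i of the slice:
  point 1 for \<epsilon>, otherwise i + 2, since coordinate i belongs to tuple index i - 1 and the
  tuple starts at point 3.\<close>

definition slice_index :: "nat \<Rightarrow> nat" where
  "slice_index i = (if i = 0 then 1 else i + 2)"

text \<open>W is the set where \<open>disc\<close> stays in the domain of a local square root, so
  that n is holomorphic on it. The map is constructed on the normal bundle; the superconformal
  quotient uses it directly, and Q uses it after descent.\<close>

lemma local_retraction:
  assumes x0: "x0 \<in> Zk k 0"
  obtains W J n where "x0 \<in> W" "W \<subseteq> Zk_dom k J" "\<forall>x\<in>W. n x * n x * disc J x = 1"
    "bundle_map_on W (normal_Zk k) (normal_slice k)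
      (\<lambda>x. (0, \<lambda>i\<in>{..<k - 3}. tuple_act k (mob J (n x) x) x (i + 3))) (\<lambda>v. retr J (n (tuple_red k v)) v)"
proof -
  obtain J where J: "J \<subseteq> {..<k}" "x0 \<in> Zk_dom k J" by (rule Zk_dom_at[OF x0])
  obtain S r where S: "open S" "disc J x0 \<in> S" "\<And>z. z \<in> S \<Longrightarrow> z \<noteq> 0 \<and> r z * r z = z \<and> r field_differentiable at z"
    using local_sqrt[OF disc_nonzero[OF J(2)]] by blast
  define W where "W = {x \<in> Zk_dom k J. disc J x \<in> S}"
  define n where "n x = 1 / r (disc J x)" for x
  have hd: "holo_fun (Zk_mfd k) (Zk_dom k J) (disc J)"
    unfolding disc_def by (intro holo_fun_mult[OF Zk_atlas] holo_Zdet J idx)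
  have W: "mopen (Zk_mfd k) W" unfolding W_def by (rule mopen_preimage[OF Zk_atlas hd S(1)])
  have WJ: "W \<subseteq> Zk_dom k J" by (auto simp: W_def)
  have nn: "n x * n x * disc J x = 1" if "x \<in> W" for x
  proof -
    have "disc J x \<noteq> 0" "r (disc J x) * r (disc J x) = disc J x" using S(3)[of "disc J x"] that by (simp_all add: W_def)
    then show ?thesis by (simp add: n_def)
  qed
  have hdet: "holo_fun (Zk_mfd k) W (\<lambda>x. Zdet J x i j)" if "i < k" "j < k" for i j
    by (rule holo_fun_subset[OF Zk_atlas holo_Zdet[OF J(1) that] W WJ])
  have rd: "r field_differentiable at (disc J x)" "r (disc J x) \<noteq> 0" if "x \<in> W" for x
    using S(3)[of "disc J x"] that by (auto simp: W_def)
  have "holo_fun (Zk_mfd k) W (\<lambda>x. 1 / r (disc J x))"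
    by (rule holo_fun_divide[OF Zk_atlas holo_fun_const[OF Zk_atlas W]
      holo_fun_comp1[OF Zk_atlas holo_fun_subset[OF Zk_atlas hd W WJ]]]) (fact rd)+
  then have hn: "holo_fun (Zk_mfd k) W n" unfolding n_def[abs_def] .
  have n0: "n x \<noteq> 0" if "x \<in> W" for x using nn[OF that] by auto
  have D: "Zdet J x i j \<noteq> 0" if "x \<in> W" "i < k" "j < k" "i \<noteq> j" for x i j
    using Zdet_nonzero[of x k J i j] that WJ by blast
  let ?f = "\<lambda>x. (0 :: grassmann, \<lambda>i\<in>{..<k - 3}. tuple_act k (mob J (n x) x) x (i + 3))"
  let ?F = "\<lambda>v. retr J (n (tuple_red k v)) v"
  have F: "?F v \<in> slice k 1 \<and> slice_red k (?F v) = ?f (tuple_red k v)"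
    if v: "v \<in> total (normal_Zk k)" and vW: "tuple_red k v \<in> W" for v
  proof -
    let ?n = "n (tuple_red k v)"
    have J': "tuple_red k v \<in> Zk_dom k J" using vW WJ by blast
    have M: "mob J ?n (tuple_red k v) \<in> carrier SL2" by (rule mob_SL2[OF nn[OF vW]])
    have wr: "pt_red (wmap J ?n v i) = tuple_act k (mob J ?n (tuple_red k v)) (tuple_red k v) i" if i: "i < k" for i
      using fun_cong[OF tuple_act_Zk_1(2)[OF M, of "shift k (kill_g J v) (kill_h J v) v" k], of i] shift_normal[OF v] i
      by (simp add: tuple_red_apply wmap_def total_normal_Zk)
    then have "slice_red k (?F v) = ?f (tuple_red k v)"
      unfolding slice_red_eq retr_def snd_conv tuple_red_def[of "k - 3"]
      by (intro arg_cong[of _ _ "Pair 0"] restrict_ext) (simp add: wr)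
    then show ?thesis using retr_slice(1)[OF v J' nn[OF vW]] by blast
  qed
  have fW: "?f x \<in> slice k 0" if x: "x \<in> W" for x
  proof -
    have "x \<in> Zk k 0" using x WJ Zk_domD(1) by blast
    then have xn: "x \<in> total (normal_Zk k)" and red: "tuple_red k x = x"
      using Zk_0_subset_1 tuple_red_Zk_0 by (simp_all only: total_normal_Zk)
    have "?F x \<in> slice k 1 \<and> slice_red k (?F x) = ?f (tuple_red k x)" by (rule F[OF xn]) (simp only: red x)
    then have "?F x \<in> slice k 1" "slice_red k (?F x) = ?f x" by (simp_all only: red)
    moreover have "slice_red k e \<in> slice k 0" if "e \<in> slice k 1" for e
      using holo_vbundleD(3)[OF holo_vbundle_slice] that by simp
    ultimately show ?thesis by metis
  qed
  \<comment> \<open>The z_1 coordinate of the moved point is a cross-ratio of p_0, p_1, p_2 and the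
    point j + 3, since n cancels.\<close>
  have fcoord: "slice_coord k (?f x) j = n x * Zdet J x 1 2 * Zdet J x (j + 3) 0 / (n x * Zdet J x 1 0 * Zdet J x (j + 3) 2)"
    if x: "x \<in> W" and j: "j < k - 3" for x j
  proof -
    have xJ: "x \<in> Zk_dom k J" using x WJ by blast
    have j3: "j + 3 < k" using j by simp
    have "Zx J x i * (a * Zy J x 0) + Zy J x i * - (a * Zx J x 0) = a * Zdet J x i 0"
      "Zx J x i * (a * Zy J x 2) + Zy J x i * - (a * Zx J x 2) = a * Zdet J x i 2" for a i
      by (simp_all add: Zdet_def algebra_simps)
    then have "tuple_act k (mob J (n x) x) x (j + 3) = pt (n x * Zdet J x 1 2 * Zdet J x (j + 3) 0) (n x * Zdet J x 1 0 * Zdet J x (j + 3) 2) 0"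
      unfolding tuple_act_apply[OF j3] Zk_dom_rep[OF xJ j3] mob_def pt_act_sl2 by simp
    moreover have "n x * Zdet J x 1 0 * Zdet J x (j + 3) 2 \<noteq> 0" using n0[OF x] D[OF x] idx j3 by simp
    ultimately show ?thesis
      using affine_coord_pt[of False] j by (simp add: slice_coord_def Zcoord_def den_def rat_def)
  qed
  have map: "holo_map (Zk_mfd k) W (slice_mfd k) ?f"
  proof (rule holo_mapI[OF W])
    fix V \<psi> j assume "(V, \<psi>) \<in> charts (slice_mfd k)"
    then have V: "V = slice k 0" "\<psi> = slice_coord k" by simp_all
    have eq: "{x \<in> W. ?f x \<in> V} = W" using fW by (auto simp: V(1))
    show "mopen (Zk_mfd k) {x \<in> W. ?f x \<in> V}" unfolding eq by (rule W)
    assume "j < mdim (slice_mfd k)"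
    then have j: "j < k - 3" by simp
    have "holo_fun (Zk_mfd k) W (\<lambda>x. n x * Zdet J x 1 2 * Zdet J x (j + 3) 0 / (n x * Zdet J x 1 0 * Zdet J x (j + 3) 2))"
      by (intro holo_fun_divide[OF Zk_atlas] holo_fun_mult[OF Zk_atlas] hn hdet) (use idx j n0 D in auto)
    then show "holo_fun (Zk_mfd k) {x \<in> W. ?f x \<in> V} (\<lambda>x. \<psi> (?f x) j)"
      unfolding eq V(2) by (rule holo_fun_cong[OF Zk_atlas]) (simp add: fcoord j)
  qed (use fW in simp)
  have triv: "slice_triv k (?F v) i = odd_part J v (slice_index i) /
      (n (tuple_red k v) * Zdet J (tuple_red k v) 1 0 * Zdet J (tuple_red k v) (slice_index i) 2)"
    if v: "v \<in> total (normal_Zk k)" and vW: "tuple_red k v \<in> W" and i: "i < k - 2" for v i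
  proof -
    have vJ: "tuple_red k v \<in> Zk_dom k J" using vW WJ by blast
    have l: "slice_index i < k" "slice_index i \<noteq> 2" using i idx by (auto simp: slice_index_def)
    have "slice_triv k (?F v) i = spinor_coord False (wmap J (n (tuple_red k v)) v (slice_index i))"
      using i by (auto simp: slice_triv_def retr_def Ntriv_def slice_index_def numeral_3_eq_3 numeral_2_eq_2 One_nat_def)
    also have "\<dots> = odd_part J v (slice_index i) / (n (tuple_red k v) * Zdet J (tuple_red k v) 1 0 * Zdet J (tuple_red k v) (slice_index i) 2)"
      unfolding wmap_rep[OF v vJ l(1)] using n0[OF vW] D[OF vW] idx l by (simp add: spinor_coord_pt den_def)
    finally show ?thesis .
  qed
  have "bundle_map_on W (normal_Zk k) (normal_slice k) ?f ?F"
  proof (rule bundle_map_onI)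
    show "holo_map (base (normal_Zk k)) W (base (normal_slice k)) ?f" using map by simp
    show "?F e \<in> total (normal_slice k) \<and> bproj (normal_slice k) (?F e) = ?f (bproj (normal_Zk k) e)"
      if "e \<in> total (normal_Zk k)" "bproj (normal_Zk k) e \<in> W" for e using F[OF that(1)] that(2) by simp
    fix U \<sigma> V \<tau> assume "(U, \<sigma>) \<in> trivs (normal_Zk k)" "(V, \<tau>) \<in> trivs (normal_slice k)"
    then obtain J' where J': "J' \<subseteq> {..<k}" "U = Zk_dom k J'" "\<sigma> = Ntriv k J'" and V: "V = slice k 0" "\<tau> = slice_triv k"
      unfolding normal_trivs slice_trivs by blast
    let ?W = "W \<inter> Zk_dom k J'"
    have eq: "{x \<in> W \<inter> U. ?f x \<in> V} = ?W" using fW by (auto simp: V(1) J'(2))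
    have op: "mopen (Zk_mfd k) ?W" by (rule mopen_Int[OF Zk_atlas W mopen_Zk_dom[OF J'(1)]])
    \<comment> \<open>Coefficients of \<open>odd_part_eq\<close>; dividing them by the second even
      coordinate of the moved point gives the matrix of its spinor coordinate.\<close>
    define u where "u l j x = (if j = l then 1 else 0) + (if j = 0 then Zdet J x 2 l / Zdet J x 0 2 else 0)
      + (if j = 2 then Zdet J x l 0 / Zdet J x 0 2 else 0)" for l j :: nat and x
    have usum: "(\<Sum>j<k. u l j (tuple_red k v) * Ntriv k J v j) = odd_part J v l" if "l < k" for l v
    proof -
      have 1: "(\<Sum>j<k. (if j = q then a else 0) * Ntriv k J v j) = a * Ntriv k J v q" if "q < k" for q and a :: complex
        using that by (simp add: if_distrib[of "\<lambda>u. u * _"] cong: if_cong)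
      show ?thesis unfolding u_def distrib_right sum.distrib odd_part_eq
        by (subst (1 2 3) 1) (use that idx in auto)
    qed
    have "holo_matrix (Zk_mfd k) ?W (k - 2) k (total (normal_Zk k)) (tuple_red k) (Ntriv k J) (\<lambda>e. slice_triv k (?F e))"
    proof (rule holo_matrixI[where h = "\<lambda>i j x. u (slice_index i) j x / (n x * Zdet J x 1 0 * Zdet J x (slice_index i) 2)"])
      fix i j assume i: "i < k - 2"
      have l: "slice_index i < k" "slice_index i \<noteq> 2" using i idx by (auto simp: slice_index_def)
      have c: "holo_fun (Zk_mfd k) W (\<lambda>x. if b then f x else 0)" if "holo_fun (Zk_mfd k) W f" for b f
        using that holo_fun_const[OF Zk_atlas W] by (cases b) simp_all
      have "holo_fun (Zk_mfd k) W (\<lambda>x. u (slice_index i) j x / (n x * Zdet J x 1 0 * Zdet J x (slice_index i) 2))"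
        unfolding u_def
        by (intro holo_fun_divide[OF Zk_atlas] holo_fun_add[OF Zk_atlas] holo_fun_mult[OF Zk_atlas] c holo_fun_const[OF Zk_atlas W] hn hdet)
          (use idx l n0 D in auto)
      then show "holo_fun (Zk_mfd k) ?W (\<lambda>x. u (slice_index i) j x / (n x * Zdet J x 1 0 * Zdet J x (slice_index i) 2))"
        by (rule holo_fun_subset[OF Zk_atlas _ op]) simp
    next
      fix v i assume v: "v \<in> total (normal_Zk k)" "tuple_red k v \<in> ?W" and i: "i < k - 2"
      have l: "slice_index i < k" using i idx by (auto simp: slice_index_def)
      have vW: "tuple_red k v \<in> W" using v(2) by blast
      show "slice_triv k (?F v) i = (\<Sum>j<k. u (slice_index i) j (tuple_red k v) /
          (n (tuple_red k v) * Zdet J (tuple_red k v) 1 0 * Zdet J (tuple_red k v) (slice_index i) 2) * Ntriv k J v j)"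
        unfolding triv[OF v(1) vW i] usum[OF l, symmetric] by (simp add: sum_divide_distrib)
    qed
    \<comment> \<open>W was built in chart J; other charts of the source are reached through the
      transition functions of the normal bundle.\<close>
    moreover have "holo_matrix (Zk_mfd k) ?W k k (total (normal_Zk k)) (tuple_red k) (Ntriv k J') (Ntriv k J)"
    proof (rule holo_matrix_subset[OF Zk_atlas _ op])
      show "holo_matrix (Zk_mfd k) (Zk_dom k J' \<inter> Zk_dom k J) k k (total (normal_Zk k)) (tuple_red k) (Ntriv k J') (Ntriv k J)"
        using holo_vbundleD(7)[OF holo_vbundle_normal normal_triv_mem[OF J'(1)] normal_triv_mem[OF J(1)]] by simp
    qed (use WJ in blast)
    ultimately have "holo_matrix (Zk_mfd k) ?W (k - 2) k (total (normal_Zk k)) (tuple_red k) (Ntriv k J') (\<lambda>e. slice_triv k (?F e))"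
      by (rule holo_matrix_compose[OF Zk_atlas op])
    then show "holo_matrix (base (normal_Zk k)) {x \<in> W \<inter> U. ?f x \<in> V} (vrank (normal_slice k)) (vrank (normal_Zk k))
        (total (normal_Zk k)) (bproj (normal_Zk k)) \<sigma> (\<lambda>e. \<tau> (?F e))"
      unfolding eq J'(3) V(2) by simp
  qed
  moreover have "x0 \<in> W" using J(2) S(2) by (simp add: W_def)
  ultimately show ?thesis using that WJ nn by blast
qed

end

section \<open>Superconformal orbits\<close>

text \<open>Over \<open>\<real>\<^bsup>0|1\<^esup>\<close>, every element of \<open>SC\<close> is a shift followed by an element of \<open>SL\<^sub>\<complex>(2)\<close>.\<close>

definition sc_rel :: "nat \<Rightarrow> (nat \<Rightarrow> spoint) \<Rightarrow> (nat \<Rightarrow> spoint) \<Rightarrow> bool" where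
  "sc_rel k v w \<longleftrightarrow> (\<exists>M\<in>carrier SL2. \<exists>g h. w = tuple_act k M (shift k g h v))"

definition sc_class :: "nat \<Rightarrow> (nat \<Rightarrow> spoint) \<Rightarrow> (nat \<Rightarrow> spoint) set" where
  "sc_class k v = {w. sc_rel k v w}"

definition Q_orbit :: "nat \<Rightarrow> (nat \<Rightarrow> spoint) \<Rightarrow> (nat \<Rightarrow> spoint) set set" where
  "Q_orbit k v = orbit SL2 (Q_act k) (Qproj k v)"

definition sgn_class :: "nat \<Rightarrow> slicept \<Rightarrow> slicept set" where
  "sgn_class k n = {n, slice_neg k n}"

lemma slice_classes_eq: "slice_classes k s = sgn_class k ` slice k s"
  by (auto simp: slice_classes_def sgn_class_def)

lemma sc_relI: "M \<in> carrier SL2 \<Longrightarrow> w = tuple_act k M (shift k g h v) \<Longrightarrow> sc_rel k v w"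
  unfolding sc_rel_def by blast

lemma sc_relE:
  assumes "sc_rel k v w"
  obtains M g h where "M \<in> carrier SL2" "w = tuple_act k M (shift k g h v)"
  using assms unfolding sc_rel_def by blast

lemma SL2_closed: "sc_one \<in> carrier SL2" "M \<in> carrier SL2 \<Longrightarrow> N \<in> carrier SL2 \<Longrightarrow> sc_matmul N M \<in> carrier SL2"
  using monoid.one_closed[OF group.is_monoid[OF group_SL2]] monoid.m_closed[OF group.is_monoid[OF group_SL2]] by simp_all

lemma SL2_inverse:
  assumes "M \<in> carrier SL2"
  obtains N where "N \<in> carrier SL2" "\<And>k v. v \<in> Zk k 1 \<Longrightarrow> tuple_act k N (tuple_act k M v) = v"
proof -
  interpret group SL2 by (rule group_SL2)
  have i: "inv\<^bsub>SL2\<^esub> M \<in> carrier SL2" using assms by simp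
  have "tuple_act k (inv\<^bsub>SL2\<^esub> M) (tuple_act k M v) = v" if "v \<in> Zk k 1" for k v
    using tuple_act_comp[OF i assms that] l_inv[OF assms] tuple_act_one[OF that] by simp
  then show ?thesis using i that by blast
qed

lemma vscale_vscale:
  assumes "v \<in> total (normal_Zk k)"
  shows "vscale (normal_Zk k) t (vscale (normal_Zk k) u v) = vscale (normal_Zk k) (t * u) v" "vscale (normal_Zk k) 1 v = v"
proof -
  have "v \<in> Zk k 1" using assms by (simp only: total_normal_Zk)
  note p = Zk_1_P11[OF this] and e = Zk_ext[OF this]
  have "S_scale t (S_scale u p) = S_scale (t * u) p" "S_scale 1 p = p" if "p \<in> P11 1" for p
    using that by (auto elim!: P11_1_cases simp: mult.assoc)
  then show "vscale (normal_Zk k) t (vscale (normal_Zk k) u v) = vscale (normal_Zk k) (t * u) v" "vscale (normal_Zk k) 1 v = v"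
    using p by (auto simp: fun_eq_iff extensional_arb[OF e])
qed

lemma slice_embed_inj: 
  assumes k: "k \<ge> 3" and n: "n \<in> slice k 1" "n' \<in> slice k 1" and eq: "slice_embed k 1 n = slice_embed k 1 n'"
  shows "n = n'"
proof -
  obtain t z where e: "n = (godd t, z)" "z \<in> total (normal_Zk (k - 3))" by (rule slice_1_cases[OF k n(1)])
  obtain t' z' where e': "n' = (godd t', z')" "z' \<in> total (normal_Zk (k - 3))" by (rule slice_1_cases[OF k n(2)])
  note E = embed_simps[OF k order_refl, where z = z and t = t] and E' = embed_simps[OF k order_refl, where z = z' and t = t']
  have "pt 1 1 t = pt 1 1 t'" using fun_cong[OF eq, of 1] unfolding e(1) e'(1) E E' .
  then have "t = t'" by (auto simp: pt_eq_iff)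
  moreover have "z = z'"
  proof (rule extensionalityI[OF normal_ext[OF e(2)] normal_ext[OF e'(2)]])
    fix i assume "i \<in> {..<k - 3}"
    then have "i + 3 < k" by simp
    then show "z i = z' i" using fun_cong[OF eq, of "i + 3"] E(4)[of "i + 3"] E'(4)[of "i + 3"] unfolding e(1) e'(1) by simp
  qed
  ultimately show ?thesis by (simp add: e(1) e'(1))
qed

context
  fixes k :: nat
  assumes k: "k \<ge> 3"
begin

lemma sc_rel_normal:
  assumes "sc_rel k v w" "v \<in> total (normal_Zk k)"
  shows "w \<in> total (normal_Zk k)"
  using assms(1) by (rule sc_relE) (simp only: normal_act[OF k _ shift_normal(1)[OF assms(2)]])

lemma sc_rel_refl:
  assumes "v \<in> total (normal_Zk k)"
  shows "sc_rel k v v"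
proof (rule sc_relI[OF SL2_closed(1)])
  show "v = tuple_act k sc_one (shift k 0 0 v)"
    using tuple_act_one[of v k] assms unfolding shift_0[OF assms] by (simp only: total_normal_Zk)
qed

text \<open>A translation can be moved past a matrix at the cost of transforming its section; this
  is what makes \<open>sc_rel\<close> transitive and symmetric.\<close>

lemma shift_tuple_act:
  assumes "M \<in> carrier SL2" and v: "v \<in> total (normal_Zk k)"
  obtains g' h' where "shift k g h (tuple_act k M v) = tuple_act k M (shift k g' h' v)"
proof -
  obtain a b c d where M: "M = sl2_mat a b c d" "a * d - b * c = 1" using assms(1) by (rule SL2_cases)
  have "d * (a * g + c * h) - c * (b * g + d * h) = (a * d - b * c) * g" "a * (b * g + d * h) - b * (a * g + c * h) = (a * d - b * c) * h"
    by (simp_all add: algebra_simps)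
  then have "shift k g h (tuple_act k M v) = tuple_act k M (shift k (a * g + c * h) (b * g + d * h) v)"
    unfolding M(1) tuple_act_shift[OF k M(2) v] M(2) by simp
  then show ?thesis by (rule that)
qed

lemma sc_rel_trans:
  assumes u: "u \<in> total (normal_Zk k)" and "sc_rel k u v" "sc_rel k v w"
  shows "sc_rel k u w"
proof -
  obtain M g h where M: "M \<in> carrier SL2" "v = tuple_act k M (shift k g h u)" using assms(2) by (rule sc_relE)
  obtain N g' h' where N: "N \<in> carrier SL2" "w = tuple_act k N (shift k g' h' v)" using assms(3) by (rule sc_relE)
  note s = shift_normal(1)[OF u]
  obtain a b where ab: "shift k g' h' v = tuple_act k M (shift k a b (shift k g h u))"
    unfolding M(2) by (rule shift_tuple_act[OF M(1) s])
  have "w = tuple_act k (sc_matmul M N) (shift k (a + g) (b + h) u)"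
    using tuple_act_comp[OF N(1) M(1)] s[unfolded total_normal_Zk] unfolding N(2) ab shift_shift[OF u] by simp
  then show ?thesis by (rule sc_relI[OF SL2_closed(2)[OF N(1) M(1)]])
qed

lemma sc_rel_sym:
  assumes v: "v \<in> total (normal_Zk k)" and "sc_rel k v w"
  shows "sc_rel k w v"
proof -
  obtain M g h where M: "M \<in> carrier SL2" "w = tuple_act k M (shift k g h v)" using assms(2) by (rule sc_relE)
  have w: "w \<in> total (normal_Zk k)" by (rule sc_rel_normal[OF assms(2) v])
  obtain N where N: "N \<in> carrier SL2" "\<And>k v. v \<in> Zk k 1 \<Longrightarrow> tuple_act k N (tuple_act k M v) = v" by (rule SL2_inverse[OF M(1)]) blast
  have eq: "tuple_act k N w = shift k g h v"
    unfolding M(2) by (rule N(2)) (use shift_normal(1)[OF v] in \<open>simp only: total_normal_Zk\<close>)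
  obtain a b where "shift k (- g) (- h) (tuple_act k N w) = tuple_act k N (shift k a b w)" by (rule shift_tuple_act[OF N(1) w])
  then have "v = tuple_act k N (shift k a b w)" unfolding eq shift_shift[OF v] using shift_0[OF v] by simp
  then show ?thesis by (rule sc_relI[OF N(1)])
qed

lemma sc_class_eq_iff:
  assumes "v \<in> total (normal_Zk k)" "w \<in> total (normal_Zk k)"
  shows "sc_class k v = sc_class k w \<longleftrightarrow> sc_rel k v w"
proof
  assume "sc_class k v = sc_class k w"
  moreover have "w \<in> sc_class k w" using sc_rel_refl[OF assms(2)] by (simp add: sc_class_def)
  ultimately show "sc_rel k v w" by (auto simp: sc_class_def)
next
  assume r: "sc_rel k v w"
  show "sc_class k v = sc_class k w"
    unfolding sc_class_def
    using sc_rel_trans[OF assms(2) sc_rel_sym[OF assms(1) r]] sc_rel_trans[OF assms(1) r] by (intro Collect_cong iffI)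
qed

section \<open>Superconformal orbits, orbits on Q and points of the classical moduli space\<close>

lemma SC_orbit: "orbit (SC 1) (tuple_act k) v = sc_class k v" if v: "v \<in> total (normal_Zk k)"
proof -
  have at: "pt_act (sc1_mat a b c d g h) p = pt_act (sl2_mat a b c d) (pt_act (sc1_mat 1 0 0 1 g h) p)" if "p \<in> P11 1" for a b c d g h p
    using that by (elim P11_1_cases) simp
  have eq: "tuple_act k (sc1_mat a b c d g h) v = tuple_act k (sl2_mat a b c d) (shift k g h v)" for a b c d g h
  proof (rule extensionalityI[OF tuple_act_ext tuple_act_ext])
    fix i assume "i \<in> {..<k}"
    then have i: "i < k" by simp
    have "v i \<in> P11 1" using v i by (simp only: total_normal_Zk Zk_1_P11)
    then show "tuple_act k (sc1_mat a b c d g h) v i = tuple_act k (sl2_mat a b c d) (shift k g h v) i"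
      unfolding shift_def tuple_act_apply[OF i] by (rule at)
  qed
  show ?thesis
  proof (intro equalityI subsetI)
    fix w assume "w \<in> orbit (SC 1) (tuple_act k) v"
    then obtain a b c d g h where "a * d - b * c = 1" "w = tuple_act k (sc1_mat a b c d g h) v"
      unfolding orbit_def SC_1_carrier by blast
    then show "w \<in> sc_class k v" unfolding sc_class_def eq using sc_relI[OF SL2_memI] by blast
  next
    fix w assume "w \<in> sc_class k v"
    then have "sc_rel k v w" by (simp add: sc_class_def)
    then obtain M g h where M: "M \<in> carrier SL2" "w = tuple_act k M (shift k g h v)" by (rule sc_relE)
    obtain a b c d where abcd: "M = sl2_mat a b c d" "a * d - b * c = 1" using M(1) by (rule SL2_cases)
    have "w = tuple_act k (sc1_mat a b c d g h) v" unfolding M(2) abcd(1) eq ..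
    moreover have "sc1_mat a b c d g h \<in> carrier (SC 1)" unfolding SC_1_carrier using abcd(2) by blast
    ultimately show "w \<in> orbit (SC 1) (tuple_act k) v" unfolding orbit_def by blast
  qed
qed

lemma moduli_pts_1: "moduli_pts k 1 = sc_class k ` total (normal_Zk k)"
  unfolding moduli_pts_def orbits_def total_normal_Zk[symmetric] Setcompr_eq_image
  using SC_orbit by (rule image_cong[OF refl])

lemma Q_orbit_mem:
  assumes v: "v \<in> total (normal_Zk k)" and "q \<in> Q_orbit k v"
  obtains w where "sc_rel k v w" "q = Qproj k w"
proof -
  obtain M where M: "M \<in> carrier SL2" "q = Q_act k M (Qproj k v)" using assms(2) unfolding Q_orbit_def orbit_def by blast
  show ?thesis
  proof (rule that)
    show "sc_rel k v (tuple_act k M v)" by (rule sc_relI[OF M(1), of _ _ 0 0]) (simp only: shift_0[OF v])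
    show "q = Qproj k (tuple_act k M v)" unfolding M(2) by (rule Q_act_Qproj[OF k M(1) v])
  qed
qed

lemma Q_orbit_rel:
  assumes v: "v \<in> total (normal_Zk k)" and "sc_rel k v w"
  shows "Qproj k w \<in> Q_orbit k v"
proof -
  obtain M g h where M: "M \<in> carrier SL2" "w = tuple_act k M (shift k g h v)" using assms(2) by (rule sc_relE)
  have "Qproj k w = Q_act k M (Qproj k v)"
    unfolding M(2) Q_act_Qproj[OF k M(1) shift_normal(1)[OF v], symmetric] Qproj_shift[OF v] ..
  then show ?thesis using M(1) unfolding Q_orbit_def orbit_def by blast
qed

text \<open>Flattening an orbit of cosets gives a single superconformal class. This bridges the
  difference in type between orbits on Q and moduli points and lets the isomorphism be defined
  without choices.\<close>

lemma Union_Q_orbit: "\<Union>(Q_orbit k v) = sc_class k v" if v: "v \<in> total (normal_Zk k)"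
proof (intro equalityI subsetI)
  fix u assume "u \<in> \<Union>(Q_orbit k v)"
  then obtain q where q: "q \<in> Q_orbit k v" "u \<in> q" by blast
  obtain w where w: "sc_rel k v w" "q = Qproj k w" by (rule Q_orbit_mem[OF v q(1)])
  have wt: "w \<in> total (normal_Zk k)" by (rule sc_rel_normal[OF w(1) v])
  obtain g h where u: "u = shift k g h w" using q(2) unfolding w(2) by (rule Qproj_memE[OF wt])
  have "u = tuple_act k sc_one (shift k g h w)"
    unfolding u using tuple_act_one[of "shift k g h w" k] shift_normal(1)[OF wt] by (simp only: total_normal_Zk)
  then have "sc_rel k w u" by (rule sc_relI[OF SL2_closed(1)])
  then show "u \<in> sc_class k v" using sc_rel_trans[OF v w(1)] by (simp add: sc_class_def)
next
  fix u assume "u \<in> sc_class k v"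
  then have r: "sc_rel k v u" by (simp add: sc_class_def)
  then show "u \<in> \<Union>(Q_orbit k v)" using Q_orbit_rel[OF v r] Qproj_self[OF sc_rel_normal[OF r v]] by blast
qed

lemma Q_orbit_eq_iff:
  assumes v: "v \<in> total (normal_Zk k)" and w: "w \<in> total (normal_Zk k)"
  shows "Q_orbit k v = Q_orbit k w \<longleftrightarrow> sc_rel k v w"
proof
  assume "Q_orbit k v = Q_orbit k w"
  then show "sc_rel k v w" using Union_Q_orbit[OF v] Union_Q_orbit[OF w] sc_class_eq_iff[OF v w] by simp
next
  have sub: "Q_orbit k v \<subseteq> Q_orbit k w" if v: "v \<in> total (normal_Zk k)" and w: "w \<in> total (normal_Zk k)" and r: "sc_rel k v w" for v w
  proof
    fix q assume "q \<in> Q_orbit k v"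
    then obtain u where u: "sc_rel k v u" "q = Qproj k u" by (rule Q_orbit_mem[OF v])
    show "q \<in> Q_orbit k w" unfolding u(2) by (rule Q_orbit_rel[OF w sc_rel_trans[OF w sc_rel_sym[OF v r] u(1)]])
  qed
  assume r: "sc_rel k v w"
  show "Q_orbit k v = Q_orbit k w" by (intro equalityI sub[OF v w r] sub[OF w v sc_rel_sym[OF v r]])
qed

lemma Q_orbits: "orbits SL2 (total (Qbundle k)) (Q_act k) = Q_orbit k ` total (normal_Zk k)"
  unfolding orbits_def Q_simps Q_orbit_def by blast

lemma vscale_rel:
  assumes "v \<in> total (normal_Zk k)" "sc_rel k v w"
  shows "sc_rel k (vscale (normal_Zk k) t v) (vscale (normal_Zk k) t w)"
proof -
  obtain M g h where M: "M \<in> carrier SL2" "w = tuple_act k M (shift k g h v)" using assms(2) by (rule sc_relE)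
  show ?thesis
    by (rule sc_relI[OF M(1)], unfold M(2) tuple_act_scale[OF k M(1) shift_normal(1)[OF assms(1)], symmetric] vscale_shift[OF assms(1)], rule refl)
qed

text \<open>Scaling preserves the relation, and scaling by 1/t gives the reverse inclusion.\<close>

lemma vscale_class:
  assumes v: "v \<in> total (normal_Zk k)" and t: "t \<noteq> 0"
  shows "vscale (normal_Zk k) t ` sc_class k v = sc_class k (vscale (normal_Zk k) t v)"
proof (intro equalityI subsetI)
  fix w assume "w \<in> vscale (normal_Zk k) t ` sc_class k v"
  then obtain u where "sc_rel k v u" "w = vscale (normal_Zk k) t u" unfolding sc_class_def by blast
  then show "w \<in> sc_class k (vscale (normal_Zk k) t v)" using vscale_rel[OF v] by (simp only: sc_class_def mem_Collect_eq)
next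
  fix w assume "w \<in> sc_class k (vscale (normal_Zk k) t v)"
  then have r: "sc_rel k (vscale (normal_Zk k) t v) w" by (simp only: sc_class_def mem_Collect_eq)
  have vt: "vscale (normal_Zk k) t v \<in> total (normal_Zk k)" by (rule normal_ops(1)[OF v])
  have "1 / t * t = 1" "t * (1 / t) = 1" using t by simp_all
  then have "sc_rel k v (vscale (normal_Zk k) (1 / t) w)" "w = vscale (normal_Zk k) t (vscale (normal_Zk k) (1 / t) w)"
    using vscale_rel[OF vt r, of "1 / t"] vscale_vscale[OF v] vscale_vscale[OF sc_rel_normal[OF r vt]] by metis+
  then show "w \<in> vscale (normal_Zk k) t ` sc_class k v" unfolding sc_class_def by blast
qed

lemma M0_pt_act:
  assumes "M \<in> carrier SL2" "x \<in> Zk k 0"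
  shows "M0_pt k (tuple_act k M x) = M0_pt k x"
proof -
  have x1: "x \<in> Zk k 1" by (rule Zk_0_subset_1[OF assms(2)])
  obtain N where N: "N \<in> carrier SL2" "\<And>k v. v \<in> Zk k 1 \<Longrightarrow> tuple_act k N (tuple_act k M v) = v" by (rule SL2_inverse[OF assms(1)]) blast
  show ?thesis
  proof (intro equalityI subsetI)
    fix y assume "y \<in> M0_pt k (tuple_act k M x)"
    then obtain L where L: "L \<in> carrier SL2" "y = tuple_act k L (tuple_act k M x)" unfolding M0_pt_def orbit_def by blast
    have "y = tuple_act k (sc_matmul M L) x" unfolding L(2) by (rule tuple_act_comp[OF L(1) assms(1) x1, symmetric])
    then show "y \<in> M0_pt k x" using SL2_closed(2)[OF L(1) assms(1)] unfolding M0_pt_def orbit_def by blast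
  next
    fix y assume "y \<in> M0_pt k x"
    then obtain L where L: "L \<in> carrier SL2" "y = tuple_act k L x" unfolding M0_pt_def orbit_def by blast
    have "y = tuple_act k L (tuple_act k N (tuple_act k M x))" unfolding L(2) N(2)[OF x1] ..
    also have "\<dots> = tuple_act k (sc_matmul N L) (tuple_act k M x)"
      by (rule tuple_act_comp[OF L(1) N(1) tuple_act_Zk_1(1)[OF assms(1) x1], symmetric])
    finally show "y \<in> M0_pt k (tuple_act k M x)" using SL2_closed(2)[OF L(1) N(1)] unfolding M0_pt_def orbit_def by blast
  qed
qed

text \<open>Translations do not move reduced points, so only the matrix part of the relation acts on
  the base.\<close>

lemma M0_pt_rel:
  assumes v: "v \<in> total (normal_Zk k)" and "sc_rel k v w"
  shows "M0_pt k (tuple_red k w) = M0_pt k (tuple_red k v)"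
proof -
  obtain M g h where M: "M \<in> carrier SL2" "w = tuple_act k M (shift k g h v)" using assms(2) by (rule sc_relE)
  have "shift k g h v \<in> Zk k 1" using shift_normal(1)[OF v] by (simp only: total_normal_Zk)
  then have "tuple_red k w = tuple_act k M (tuple_red k v)"
    unfolding M(2) shift_normal(2)[OF v, of g h, symmetric] by (rule tuple_act_Zk_1(2)[OF M(1)])
  then show ?thesis using M0_pt_act[OF M(1) normal_red[OF v]] by simp
qed

section \<open>The quotient isomorphisms\<close>

lemma embed_normal: "n \<in> slice k 1 \<Longrightarrow> slice_embed k 1 n \<in> total (normal_Zk k)"
  using embed_1(1)[OF k] by (simp only: total_normal_Zk)

lemma neg_SL2: "sl2_mat (-1) 0 0 (-1) \<in> carrier SL2"
  by (rule SL2_memI) simp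

text \<open>The matrix -1 negates the even coordinates and keeps the odd one; rescaling the
  representative by -1 shows that it only reverses odd parts. This element of \<open>SL2\<close> is
  the source of the sign action on the slice.\<close>

lemma slice_neg_embed:
  assumes n: "n \<in> slice k 1"
  shows "slice_neg k n \<in> slice k 1" "slice_embed k 1 (slice_neg k n) = tuple_act k (sl2_mat (-1) 0 0 (-1)) (slice_embed k 1 n)"
proof -
  obtain t z where e: "n = (godd t, z)" "z \<in> total (normal_Zk (k - 3))" by (rule slice_1_cases[OF k n])
  let ?w = "tuple_act k (sl2_mat (-1) 0 0 (-1)) (slice_embed k 1 n)"
  note E = embed_simps[OF k order_refl, where z = z and t = t]
  have w: "?w \<in> Zk k 1" by (rule tuple_act_Zk_1(1)[OF neg_SL2 embed_1(1)[OF k n]])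
  have neg: "pt_act (sl2_mat (-1) 0 0 (-1)) (pt x y v) = pt x y (- v)" for x y v
    unfolding pt_act_sl2 by (rule pt_eqI[of "-1"]) simp_all
  have "?w 0 = pt 0 1 0" "?w 1 = pt 1 1 (- t)" "?w 2 = pt 1 0 0"
    using k by (simp_all add: tuple_act_apply e(1) E neg del: pt_act_sl2)
  note rec = slice_recover[OF k w this]
  have "slice_neg k n = (godd (- t), \<lambda>i\<in>{..<k - 3}. ?w (i + 3))"
  proof -
    have "odd_neg (z i) = ?w (i + 3)" if i: "i < k - 3" for i
    proof -
      have "z i \<in> P11 1" using e(2) i Zk_1_P11 by (simp add: total_normal_Zk)
      then obtain x y v where "z i = pt x y v" by (rule P11_1_cases)
      moreover have "i + 3 < k" using i by simp
      ultimately show ?thesis using E(4)[of "i + 3"] by (simp add: tuple_act_apply e(1) neg del: pt_act_sl2)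
    qed
    then show ?thesis by (simp add: slice_neg_def e(1) godd_simps cong: restrict_cong)
  qed
  then show "slice_neg k n \<in> slice k 1" "slice_embed k 1 (slice_neg k n) = ?w" using rec by simp_all
qed

text \<open>Computes what is left after normalizing three points: keeping 0 and infinity free of odd
  parts forces b = h = 0 and c = g = 0, keeping the reduced point 1 forces a = d, and the
  determinant leaves a = 1 or a = -1.\<close>

lemma embed_rel_iff:
  assumes n: "n \<in> slice k 1" and n': "n' \<in> slice k 1"
  shows "sc_rel k (slice_embed k 1 n) (slice_embed k 1 n') \<longleftrightarrow> n' \<in> sgn_class k n"
proof
  assume "n' \<in> sgn_class k n"
  then consider "n' = n" | "n' = slice_neg k n" by (auto simp: sgn_class_def)
  then show "sc_rel k (slice_embed k 1 n) (slice_embed k 1 n')"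
  proof cases
    case 1
    then show ?thesis using sc_rel_refl[OF embed_normal[OF n]] by simp
  next
    case 2
    then show ?thesis unfolding 2 slice_neg_embed(2)[OF n]
      by (intro sc_relI[OF neg_SL2, of _ k 0 0]) (simp only: shift_0[OF embed_normal[OF n]])
  qed
next
  assume "sc_rel k (slice_embed k 1 n) (slice_embed k 1 n')"
  then obtain M g h where MS: "M \<in> carrier SL2" and eq: "slice_embed k 1 n' = tuple_act k M (shift k g h (slice_embed k 1 n))"
    by (rule sc_relE)
  from MS obtain a b c d where M: "M = sl2_mat a b c d" "a * d - b * c = 1" by (rule SL2_cases)
  obtain t z where e: "n = (godd t, z)" by (rule slice_1_cases[OF k n])
  obtain t' z' where e': "n' = (godd t', z')" by (rule slice_1_cases[OF k n'])
  note E = embed_simps[OF k order_refl, where z = z and t = t] and E' = embed_simps[OF k order_refl, where z = z' and t = t']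
  have at: "slice_embed k 1 n' i = pt_act M (pt_act (sc1_mat 1 0 0 1 g h) (slice_embed k 1 n i))" if "i < k" for i
    unfolding eq shift_def tuple_act_apply[OF that] ..
  have "pt 0 1 0 = pt b d h" using at[of 0] k unfolding e e' E E' M(1) by simp
  then have bh: "b = 0" "h = 0" by (auto simp: pt_eq_iff)
  have "pt 1 0 0 = pt a c g" using at[of 2] k unfolding e e' E E' M(1) by simp
  then have cg: "c = 0" "g = 0" by (auto simp: pt_eq_iff)
  have "pt 1 1 t' = pt a d t" using at[of 1] k unfolding e e' E E' M(1) by (simp add: bh cg)
  then have "a = d" by (auto simp: pt_eq_iff)
  then have "a * a = 1" using M(2) bh by simp
  then have "a = 1 \<or> a = -1" by (simp add: square_eq_1_iff)
  then show "n' \<in> sgn_class k n"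
  proof
    assume "a = 1"
    then have "M = sc_one" using M(1) bh cg \<open>a = d\<close> by (simp add: sl2_one)
    then have "slice_embed k 1 n' = slice_embed k 1 n"
      using eq tuple_act_one[OF embed_1(1)[OF k n]] shift_0[OF embed_normal[OF n]] bh cg by simp
    then have "n' = n" by (rule slice_embed_inj[OF k n' n])
    then show ?thesis by (simp add: sgn_class_def)
  next
    assume "a = -1"
    then have "slice_embed k 1 n' = slice_embed k 1 (slice_neg k n)"
      using eq M(1) shift_0[OF embed_normal[OF n]] slice_neg_embed(2)[OF n] bh cg \<open>a = d\<close> by simp
    then have "n' = slice_neg k n" by (rule slice_embed_inj[OF k n' slice_neg_embed(1)[OF n]])
    then show ?thesis by (simp add: sgn_class_def)
  qed
qed

lemma sgn_class_eq_iff: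
  assumes n: "n \<in> slice k 1" and n': "n' \<in> slice k 1"
  shows "sgn_class k n = sgn_class k n' \<longleftrightarrow> sc_rel k (slice_embed k 1 n) (slice_embed k 1 n')"
proof
  assume "sgn_class k n = sgn_class k n'"
  moreover have "n' \<in> sgn_class k n'" by (simp add: sgn_class_def)
  ultimately show "sc_rel k (slice_embed k 1 n) (slice_embed k 1 n')" using embed_rel_iff[OF n n'] by simp
next
  assume r: "sc_rel k (slice_embed k 1 n) (slice_embed k 1 n')"
  \<comment> \<open>The sign change is an involution because the matrix -1 squares to the identity;
    injectivity of the embedding carries this over to the slice.\<close>
  have nn: "slice_neg k (slice_neg k n) = n"
  proof (rule slice_embed_inj[OF k _ n])
    note n1 = slice_neg_embed(1)[OF n]
    show "slice_neg k (slice_neg k n) \<in> slice k 1" by (rule slice_neg_embed(1)[OF n1])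
    have "sc_matmul (sl2_mat (-1) 0 0 (-1)) (sl2_mat (-1) 0 0 (-1)) = sc_one" by (simp add: sl2_matmul sl2_one)
    then show "slice_embed k 1 (slice_neg k (slice_neg k n)) = slice_embed k 1 n"
      unfolding slice_neg_embed(2)[OF n1] slice_neg_embed(2)[OF n]
      using tuple_act_comp[OF neg_SL2 neg_SL2 embed_1(1)[OF k n]] tuple_act_one[OF embed_1(1)[OF k n]] by simp
  qed
  have "n' = n \<or> n' = slice_neg k n" using r embed_rel_iff[OF n n'] by (simp add: sgn_class_def)
  then show "sgn_class k n = sgn_class k n'" unfolding sgn_class_def using nn by (elim disjE) (simp_all add: insert_commute)
qed

lemma sgn_class_mem:
  assumes "n \<in> slice k 1" "e \<in> sgn_class k n"
  shows "e \<in> slice k 1" "sgn_class k n = sgn_class k e"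
proof -
  show e: "e \<in> slice k 1" using assms slice_neg_embed(1)[OF assms(1)] by (auto simp: sgn_class_def)
  show "sgn_class k n = sgn_class k e" using sgn_class_eq_iff[OF assms(1) e] embed_rel_iff[OF assms(1) e] assms(2) by simp
qed

lemma slice_to_moduli_1:
  assumes n: "n \<in> slice k 1"
  shows "slice_to_moduli k 1 (sgn_class k n) = sc_class k (slice_embed k 1 n)"
proof -
  have "orbit (SC 1) (tuple_act k) (slice_embed k 1 e) = sc_class k (slice_embed k 1 n)" if "e \<in> sgn_class k n" for e
    using SC_orbit[OF embed_normal[OF sgn_class_mem(1)[OF n that]]] embed_rel_iff[OF n sgn_class_mem(1)[OF n that]] that
      sc_class_eq_iff[OF embed_normal[OF n] embed_normal[OF sgn_class_mem(1)[OF n that]]] by simp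
  moreover have "n \<in> sgn_class k n" by (simp add: sgn_class_def)
  ultimately show ?thesis unfolding slice_to_moduli_def by blast
qed

text \<open>For a single vector any square root of \<open>disc\<close> does, so the principal one is
  taken; holomorphic dependence is the business of \<open>local_retraction\<close>.\<close>

lemma slice_surj:
  assumes v: "v \<in> total (normal_Zk k)"
  obtains n where "n \<in> slice k 1" "sc_rel k v (slice_embed k 1 n)"
proof -
  obtain J where J: "J \<subseteq> {..<k}" "tuple_red k v \<in> Zk_dom k J" by (rule normal_dom[OF v])
  define u where "u = 1 / csqrt (disc J (tuple_red k v))"
  have "csqrt (disc J (tuple_red k v)) * csqrt (disc J (tuple_red k v)) = disc J (tuple_red k v)"
    using power2_csqrt[of "disc J (tuple_red k v)"] by (simp only: power2_eq_square)
  then have u: "u * u * disc J (tuple_red k v) = 1" using disc_nonzero[OF k J(2)] unfolding u_def by simp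
  have "sc_rel k v (wmap k J u v)" unfolding wmap_def[OF k] by (rule sc_relI[OF mob_SL2[OF k u] refl])
  then show ?thesis using that retr_slice[OF k v J(2) u] by metis
qed

lemma retr_rel:
  assumes v: "v \<in> total (normal_Zk k)" and J: "tuple_red k v \<in> Zk_dom k J" and u: "u * u * disc J (tuple_red k v) = 1"
  shows "sc_rel k v (slice_embed k 1 (retr k J u v))"
  unfolding retr_slice(2)[OF k v J u] wmap_def[OF k] by (rule sc_relI[OF mob_SL2[OF k u] refl])

text \<open>Without odd parts the sign acts trivially, so the statements about
  \<open>slice k 1\<close> specialize to the reduced slice with singleton classes.\<close>

lemma slice_0_1:
  assumes x: "x \<in> slice k 0"
  shows "x \<in> slice k 1" "slice_embed k 1 x = slice_embed k 0 x" "sgn_class k x = {x}"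
proof -
  obtain z where e: "x = (godd 0, z)" "z \<in> Ztilde (k - 3) 0" using x unfolding slice_0 by (auto simp: godd_simps)
  have z: "z \<in> Zk (k - 3) 0" using e(2) by (simp add: Ztilde_def)
  have "z \<in> Ztilde (k - 3) 1"
    using Ztilde_1_iff[of z "k - 3"] Zk_0_subset_1[OF z] tuple_red_Zk_0[OF z] e(2) by (simp only: total_normal_Zk)
  then show "x \<in> slice k 1" unfolding slice_1 e(1) by blast
  note E = embed_simps[OF k order_refl, where z = z and t = 0] and E0 = embed_simps[OF k zero_le, where z = z and t = 0]
  show "slice_embed k 1 x = slice_embed k 0 x"
  proof (rule extensionalityI[OF embed_ext[OF k] embed_ext[OF k]])
    fix i assume "i \<in> {..<k}"
    then have i: "i < k" by simp
    show "slice_embed k 1 x i = slice_embed k 0 x i"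
      unfolding e(1) by (cases rule: index_cases[OF k i]) (use i in \<open>simp_all add: E E0\<close>)
  qed
  have "odd_neg p = p" if "p \<in> P11 0" for p using that by (rule P11_0_cases) simp
  then have "(\<lambda>i\<in>{..<k - 3}. odd_neg (z i)) = z"
    using Zk_0_P11[OF z] by (intro extensionalityI[OF _ Zk_ext[OF z]]) simp_all
  then show "sgn_class k x = {x}" by (simp add: sgn_class_def slice_neg_def e(1) godd_simps)
qed

lemma slice_red_0: "n \<in> slice k 1 \<Longrightarrow> slice_red k n \<in> slice k 0"
  using holo_vbundleD(3)[OF holo_vbundle_slice[OF k]] by simp

lemma M0_moduli: "M0 k = moduli_pts k 0"
  unfolding M0_def moduli_pts_def orbits_def orbit_def SC_0_carrier ..

text \<open>Reduced configurations are treated as vectors with zero odd part, so uniqueness comes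
  from \<open>embed_rel_iff\<close> and existence from \<open>slice_surj\<close>.\<close>

lemma slice_M0_bij: "bij_betw (\<lambda>x. M0_pt k (slice_embed k 0 x)) (slice k 0) (M0 k)"
  unfolding bij_betw_def
proof (intro conjI inj_onI equalityI subsetI)
  fix x y assume x: "x \<in> slice k 0" and y: "y \<in> slice k 0"
    and eq: "M0_pt k (slice_embed k 0 x) = M0_pt k (slice_embed k 0 y)"
  note x1 = slice_0_1[OF x] and y1 = slice_0_1[OF y]
  have "slice_embed k 0 y = tuple_act k sc_one (slice_embed k 0 y)"
    using tuple_act_one[OF Zk_0_subset_1[OF embed_0[OF k y]]] by simp
  then have "slice_embed k 0 y \<in> M0_pt k (slice_embed k 0 y)" using SL2_closed(1) unfolding M0_pt_def orbit_def by blast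
  then have "slice_embed k 0 y \<in> M0_pt k (slice_embed k 0 x)" unfolding eq .
  then obtain M where M: "M \<in> carrier SL2" "slice_embed k 0 y = tuple_act k M (slice_embed k 0 x)"
    unfolding M0_pt_def orbit_def by blast
  have "slice_embed k 1 y = tuple_act k M (shift k 0 0 (slice_embed k 1 x))"
    unfolding shift_0[OF embed_normal[OF x1(1)]] unfolding x1(2) y1(2) by (rule M(2))
  then have "sc_rel k (slice_embed k 1 x) (slice_embed k 1 y)" by (rule sc_relI[OF M(1)])
  then show "x = y" using embed_rel_iff[OF x1(1) y1(1)] x1(3) by simp
next
  fix q assume "q \<in> (\<lambda>x. M0_pt k (slice_embed k 0 x)) ` slice k 0"
  then obtain x where "x \<in> slice k 0" "q = M0_pt k (slice_embed k 0 x)" by blast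
  then show "q \<in> M0 k" unfolding M0_def orbits_def M0_pt_def using embed_0[OF k] by blast
next
  fix q assume "q \<in> M0 k"
  then obtain x where x: "x \<in> Zk k 0" "q = M0_pt k x" unfolding M0_def orbits_def M0_pt_def by blast
  have xn: "x \<in> total (normal_Zk k)" using Zk_0_subset_1[OF x(1)] by (simp only: total_normal_Zk)
  obtain n where n: "n \<in> slice k 1" "sc_rel k x (slice_embed k 1 n)" by (rule slice_surj[OF xn])
  have "q = M0_pt k (slice_embed k 0 (slice_red k n))"
    using M0_pt_rel[OF xn n(2)] unfolding embed_1(2)[OF k n(1)] tuple_red_Zk_0[OF x(1)] x(2) ..
  then show "q \<in> (\<lambda>x. M0_pt k (slice_embed k 0 x)) ` slice k 0" using slice_red_0[OF n(1)] by blast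
qed

text \<open>The inserted points 0 and infinity have zero odd part and are fixed by scaling, so
  scaling \<epsilon> and the tuple scales the whole configuration.\<close>

lemma embed_scale:
  assumes n: "n \<in> slice k 1"
  shows "vscale (normal_slice k) t n \<in> slice k 1"
    "slice_embed k 1 (vscale (normal_slice k) t n) = vscale (normal_Zk k) t (slice_embed k 1 n)"
proof -
  have "slice_red k n \<in> slice k 0" by (rule slice_red_0[OF n])
  moreover have "n \<in> bfibre (normal_slice k) (slice_red k n)" using n by (simp add: bfibre_def)
  ultimately have "vscale (normal_slice k) t n \<in> bfibre (normal_slice k) (slice_red k n)"
    using slice_fibre_iso[OF k] unfolding fibre_iso_def by blast
  then show "vscale (normal_slice k) t n \<in> slice k 1" by (simp add: bfibre_def del: normal_slice_simps(6))
  obtain s z where e: "n = (godd s, z)" "z \<in> total (normal_Zk (k - 3))" by (rule slice_1_cases[OF k n])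
  let ?z = "vscale (normal_Zk (k - 3)) t z"
  have v: "vscale (normal_slice k) t n = (godd (t * s), ?z)" unfolding e(1) normal_slice_simps(6) fst_conv snd_conv godd_simps ..
  note E = embed_simps[OF k order_refl, where z = z and t = s] and E' = embed_simps[OF k order_refl, where z = ?z and t = "t * s"]
  have at: "vscale (normal_Zk l) t w i = S_scale t (w i)" if "i < l" for l w i using that by simp
  show "slice_embed k 1 (vscale (normal_slice k) t n) = vscale (normal_Zk k) t (slice_embed k 1 n)"
  proof (rule extensionalityI[OF embed_ext[OF k] normal_ext[OF normal_ops(1)[OF embed_normal[OF n]]]])
    fix i assume "i \<in> {..<k}"
    then have i: "i < k" by simp
    show "slice_embed k 1 (vscale (normal_slice k) t n) i = vscale (normal_Zk k) t (slice_embed k 1 n) i"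
      unfolding v at[OF i] unfolding e(1) by (cases rule: index_cases[OF k i]) (use i in \<open>simp_all add: E E' at del: normal_Zk_simps\<close>)
  qed
qed

lemma scale_class:
  assumes n: "n \<in> slice k 1"
  shows "vscale (normal_slice k) t ` sgn_class k n = sgn_class k (vscale (normal_slice k) t n)"
proof -
  let ?t = "vscale (normal_slice k) t"
  have "?t (slice_neg k n) = slice_neg k (?t n)"
  proof (rule slice_embed_inj[OF k])
    note n' = slice_neg_embed[OF n] and tn = embed_scale[OF n, of t]
    show "?t (slice_neg k n) \<in> slice k 1" by (rule embed_scale(1)[OF n'(1)])
    show "slice_neg k (?t n) \<in> slice k 1" by (rule slice_neg_embed(1)[OF tn(1)])
    show "slice_embed k 1 (?t (slice_neg k n)) = slice_embed k 1 (slice_neg k (?t n))"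
      unfolding embed_scale(2)[OF n'(1)] n'(2) slice_neg_embed(2)[OF tn(1)] tn(2)
      by (rule tuple_act_scale[OF k neg_SL2 embed_normal[OF n], symmetric])
  qed
  then show ?thesis unfolding sgn_class_def image_insert image_empty by (simp only:)
qed

lemma slice_moduli_bij: "bij_betw (slice_to_moduli k 1) (slice_classes k 1) (moduli_pts k 1)"
  unfolding slice_classes_eq
proof (rule bij_betw_imageI)
  show "inj_on (slice_to_moduli k 1) (sgn_class k ` slice k 1)"
  proof (rule inj_onI)
    fix C C' assume "C \<in> sgn_class k ` slice k 1" "C' \<in> sgn_class k ` slice k 1" and eq: "slice_to_moduli k 1 C = slice_to_moduli k 1 C'"
    then obtain n n' where n: "n \<in> slice k 1" "n' \<in> slice k 1" "C = sgn_class k n" "C' = sgn_class k n'" by blast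
    show "C = C'"
      using eq unfolding n(3,4) slice_to_moduli_1[OF n(1)] slice_to_moduli_1[OF n(2)]
        sc_class_eq_iff[OF embed_normal[OF n(1)] embed_normal[OF n(2)]] sgn_class_eq_iff[OF n(1,2)] .
  qed
  show "slice_to_moduli k 1 ` (sgn_class k ` slice k 1) = moduli_pts k 1"
  proof (intro equalityI subsetI)
    fix D assume "D \<in> slice_to_moduli k 1 ` sgn_class k ` slice k 1"
    then obtain n where "n \<in> slice k 1" "D = sc_class k (slice_embed k 1 n)" using slice_to_moduli_1 by auto
    then show "D \<in> moduli_pts k 1" unfolding moduli_pts_1 using embed_normal by blast
  next
    fix D assume "D \<in> moduli_pts k 1"
    then obtain v where v: "v \<in> total (normal_Zk k)" "D = sc_class k v" unfolding moduli_pts_1 by blast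
    obtain n where n: "n \<in> slice k 1" "sc_rel k v (slice_embed k 1 n)" by (rule slice_surj[OF v(1)])
    have "D = slice_to_moduli k 1 (sgn_class k n)"
      unfolding v(2) slice_to_moduli_1[OF n(1)] using n(2) sc_class_eq_iff[OF v(1) embed_normal[OF n(1)]] by simp
    then show "D \<in> slice_to_moduli k 1 ` sgn_class k ` slice k 1" using n(1) by blast
  qed
qed

text \<open>Any slice vector in the superconformal class determines the sign class, so the inverse
  can be evaluated at whichever representative a local lift supplies.\<close>

lemma slice_moduli_inv:
  assumes v: "v \<in> total (normal_Zk k)" and n: "n \<in> slice k 1" and r: "sc_rel k v (slice_embed k 1 n)"
  shows "inv_into (slice_classes k 1) (slice_to_moduli k 1) (sc_class k v) = sgn_class k n"
proof (rule inv_into_f_eq[OF bij_betw_imp_inj_on[OF slice_moduli_bij]])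
  show "sgn_class k n \<in> slice_classes k 1" unfolding slice_classes_eq using n by blast
  show "slice_to_moduli k 1 (sgn_class k n) = sc_class k v"
    unfolding slice_to_moduli_1[OF n] using r sc_class_eq_iff[OF v embed_normal[OF n]] by simp
qed

text \<open>One direction is lifted by the embedding over the whole slice, the other by the local
  retractions, each tied to a branch of the square root.\<close>

lemma slice_moduli_iso:
  "quotient_bundle_iso
     (normal_slice k) (slice_classes k 1) (\<lambda>n. M0_pt k (slice_embed k 0 (bproj (normal_slice k) n)))
     (normal_Zk k) (moduli_pts k 1) (\<lambda>v. M0_pt k (bproj (normal_Zk k) v)) (slice_to_moduli k 1)"
  unfolding quotient_bundle_iso_def
proof (intro conjI allI impI ballI)
  show "bij_betw (slice_to_moduli k 1) (slice_classes k 1) (moduli_pts k 1)" by (rule slice_moduli_bij)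
  fix C assume "C \<in> slice_classes k 1"
  then obtain n where n: "n \<in> slice k 1" "C = sgn_class k n" unfolding slice_classes_eq by blast
  show "M0_pt k (slice_embed k 0 (bproj (normal_slice k) e)) = M0_pt k (bproj (normal_Zk k) e')"
    if e: "e \<in> C" and e': "e' \<in> slice_to_moduli k 1 C" for e e'
  proof -
    note m = sgn_class_mem[OF n(1) e[unfolded n(2)]]
    have "sc_rel k (slice_embed k 1 e) e'"
      using e' unfolding n(2) m(2) slice_to_moduli_1[OF m(1)] sc_class_def by simp
    from M0_pt_rel[OF embed_normal[OF m(1)] this] show ?thesis by (simp add: embed_1(2)[OF k m(1)])
  qed
  show "slice_to_moduli k 1 (vscale (normal_slice k) t ` C) = vscale (normal_Zk k) t ` slice_to_moduli k 1 C"
    if t: "t \<noteq> 0" for t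
    unfolding n(2) scale_class[OF n(1)] slice_to_moduli_1[OF n(1)] slice_to_moduli_1[OF embed_scale(1)[OF n(1)]]
      embed_scale(2)[OF n(1)] vscale_class[OF embed_normal[OF n(1)] t] ..
next
  show "locally_lifts (normal_slice k) (normal_Zk k) (slice_classes k 1) (slice_to_moduli k 1)"
    unfolding locally_lifts_def
  proof
    fix x assume "x \<in> mpoints (base (normal_slice k))"
    then have x: "x \<in> slice k 0" by simp
    have "slice_embed k 1 e \<in> slice_to_moduli k 1 C" if CC: "C \<in> slice_classes k 1" and e: "e \<in> C" for C e
    proof -
      obtain n where n: "n \<in> slice k 1" "C = sgn_class k n" using CC unfolding slice_classes_eq by blast
      note m = sgn_class_mem[OF n(1) e[unfolded n(2)]]
      show ?thesis unfolding n(2) m(2) slice_to_moduli_1[OF m(1)] sc_class_def using sc_rel_refl[OF embed_normal[OF m(1)]] by simp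
    qed
    then show "\<exists>W f F. x \<in> W \<and> bundle_map_on W (normal_slice k) (normal_Zk k) f F \<and>
        (\<forall>C\<in>slice_classes k 1. \<forall>e\<in>C. bproj (normal_slice k) e \<in> W \<longrightarrow> F e \<in> slice_to_moduli k 1 C)"
      using x embed_map[OF k] by blast
  qed
  show "locally_lifts (normal_Zk k) (normal_slice k) (moduli_pts k 1) (inv_into (slice_classes k 1) (slice_to_moduli k 1))"
    unfolding locally_lifts_def
  proof
    fix x assume "x \<in> mpoints (base (normal_Zk k))"
    then have x: "x \<in> Zk k 0" by simp
    obtain W J u where W: "x \<in> W" "W \<subseteq> Zk_dom k J" "\<forall>x\<in>W. u x * u x * disc J x = 1"
      and F: "bundle_map_on W (normal_Zk k) (normal_slice k)
        (\<lambda>x. (0, \<lambda>i\<in>{..<k - 3}. tuple_act k (mob J (u x) x) x (i + 3))) (\<lambda>v. retr k J (u (tuple_red k v)) v)"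
      by (rule local_retraction[OF k x])
    have "retr k J (u (tuple_red k e)) e \<in> inv_into (slice_classes k 1) (slice_to_moduli k 1) C"
      if CC: "C \<in> moduli_pts k 1" and e: "e \<in> C" and eW: "bproj (normal_Zk k) e \<in> W" for C e
    proof -
      obtain v where v: "v \<in> total (normal_Zk k)" "C = sc_class k v" using CC unfolding moduli_pts_1 by blast
      have r: "sc_rel k v e" using e unfolding v(2) sc_class_def by simp
      have et: "e \<in> total (normal_Zk k)" by (rule sc_rel_normal[OF r v(1)])
      have eW': "tuple_red k e \<in> W" using eW by simp
      have eJ: "tuple_red k e \<in> Zk_dom k J" using eW' W(2) by blast
      have C: "C = sc_class k e" unfolding v(2) using r sc_class_eq_iff[OF v(1) et] by simp
      show ?thesis
        unfolding C slice_moduli_inv[OF et retr_slice(1)[OF k et eJ bspec[OF W(3) eW']] retr_rel[OF et eJ bspec[OF W(3) eW']]]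
        by (simp add: sgn_class_def)
    qed
    then show "\<exists>W f F. x \<in> W \<and> bundle_map_on W (normal_Zk k) (normal_slice k) f F \<and>
        (\<forall>C\<in>moduli_pts k 1. \<forall>e\<in>C. bproj (normal_Zk k) e \<in> W \<longrightarrow>
          F e \<in> inv_into (slice_classes k 1) (slice_to_moduli k 1) C)"
      using W(1) F by blast
  qed
qed

text \<open>Flattens an orbit of cosets to its superconformal class and applies the inverse of the
  bijection from sign classes to moduli points; no square root has to be chosen.\<close>

definition Q_to_slice :: "(nat \<Rightarrow> spoint) set set \<Rightarrow> slicept set" where
  "Q_to_slice O' = inv_into (slice_classes k 1) (slice_to_moduli k 1) (\<Union>O')"

lemma Q_to_slice_eq:
  assumes "v \<in> total (normal_Zk k)" "n \<in> slice k 1" "sc_rel k v (slice_embed k 1 n)"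
  shows "Q_to_slice (Q_orbit k v) = sgn_class k n"
  unfolding Q_to_slice_def Union_Q_orbit[OF assms(1)] by (rule slice_moduli_inv[OF assms])

lemma Q_to_slice_bij: "bij_betw Q_to_slice (Q_orbit k ` total (normal_Zk k)) (slice_classes k 1)"
  unfolding slice_classes_eq
proof (rule bij_betw_imageI)
  show "inj_on Q_to_slice (Q_orbit k ` total (normal_Zk k))"
  proof (rule inj_onI)
    fix C C' assume "C \<in> Q_orbit k ` total (normal_Zk k)" "C' \<in> Q_orbit k ` total (normal_Zk k)" and eq: "Q_to_slice C = Q_to_slice C'"
    then obtain v v' where v: "v \<in> total (normal_Zk k)" "v' \<in> total (normal_Zk k)" "C = Q_orbit k v" "C' = Q_orbit k v'" by blast
    obtain n where n: "n \<in> slice k 1" "sc_rel k v (slice_embed k 1 n)" by (rule slice_surj[OF v(1)])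
    obtain n' where n': "n' \<in> slice k 1" "sc_rel k v' (slice_embed k 1 n')" by (rule slice_surj[OF v(2)])
    have "sc_rel k (slice_embed k 1 n) (slice_embed k 1 n')"
      using eq unfolding v(3,4) Q_to_slice_eq[OF v(1) n] Q_to_slice_eq[OF v(2) n'] sgn_class_eq_iff[OF n(1) n'(1)] .
    from sc_rel_trans[OF v(1) sc_rel_trans[OF v(1) n(2) this] sc_rel_sym[OF v(2) n'(2)]]
    show "C = C'" unfolding v(3,4) Q_orbit_eq_iff[OF v(1,2)] .
  qed
  show "Q_to_slice ` (Q_orbit k ` total (normal_Zk k)) = sgn_class k ` slice k 1"
  proof (intro equalityI subsetI)
    fix D assume "D \<in> Q_to_slice ` Q_orbit k ` total (normal_Zk k)"
    then obtain v where v: "v \<in> total (normal_Zk k)" "D = Q_to_slice (Q_orbit k v)" by blast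
    obtain n where n: "n \<in> slice k 1" "sc_rel k v (slice_embed k 1 n)" by (rule slice_surj[OF v(1)])
    show "D \<in> sgn_class k ` slice k 1" unfolding v(2) Q_to_slice_eq[OF v(1) n] using n(1) by blast
  next
    fix D assume "D \<in> sgn_class k ` slice k 1"
    then obtain n where n: "n \<in> slice k 1" "D = sgn_class k n" by blast
    note e = embed_normal[OF n(1)]
    have "D = Q_to_slice (Q_orbit k (slice_embed k 1 n))" unfolding n(2) Q_to_slice_eq[OF e n(1) sc_rel_refl[OF e]] ..
    then show "D \<in> Q_to_slice ` Q_orbit k ` total (normal_Zk k)" using e by blast
  qed
qed

text \<open>The local retraction is constant on cosets, so it descends to Q; by
  \<open>retr_shift\<close> the representative chosen in G does not affect the value over W.\<close>

lemma Q_slice_lifts: "locally_lifts (Qbundle k) (normal_slice k) (Q_orbit k ` total (normal_Zk k)) Q_to_slice"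
  unfolding locally_lifts_def
proof
  fix x assume "x \<in> mpoints (base (Qbundle k))"
  then have x: "x \<in> Zk k 0" by simp
  obtain W J u where W: "x \<in> W" "W \<subseteq> Zk_dom k J" "\<forall>x\<in>W. u x * u x * disc J x = 1"
    and F: "bundle_map_on W (normal_Zk k) (normal_slice k)
      (\<lambda>x. (0, \<lambda>i\<in>{..<k - 3}. tuple_act k (mob J (u x) x) x (i + 3))) (\<lambda>v. retr k J (u (tuple_red k v)) v)"
    by (rule local_retraction[OF k x])
  define G where "G q = retr k J (u (bproj (Qbundle k) q)) (SOME v. v \<in> q)" for q
  have G: "G (Qproj k v) = retr k J (u (tuple_red k v)) v" if v: "v \<in> total (normal_Zk k)" and vW: "tuple_red k v \<in> W" for v
  proof -
    have "(SOME w. w \<in> Qproj k v) \<in> Qproj k v" by (rule someI[of "\<lambda>w. w \<in> Qproj k v", OF Qproj_self[OF v]])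
    then obtain g h where gh: "(SOME w. w \<in> Qproj k v) = shift k g h v" by (rule Qproj_memE[OF v])
    show ?thesis unfolding G_def bproj_Q[OF v] gh by (rule retr_shift[OF k v]) (use vW W(2) in blast)
  qed
  have "bundle_map_on W (normal_Zk k) (normal_slice k)
      (\<lambda>x. (0, \<lambda>i\<in>{..<k - 3}. tuple_act k (mob J (u x) x) x (i + 3))) (\<lambda>v. G (Qproj k v))"
    by (rule bundle_map_on_cong[OF F]) (simp_all add: G Zk_atlas)
  then have GQ: "bundle_map_on W (Qbundle k) (normal_slice k)
      (\<lambda>x. (0, \<lambda>i\<in>{..<k - 3}. tuple_act k (mob J (u x) x) x (i + 3))) G"
    by (rule Q_descent[OF k, rotated 2]) (simp_all add: slice_atlas slice_trivs[OF k] mopen_slice)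
  have "G q \<in> Q_to_slice C" if CC: "C \<in> Q_orbit k ` total (normal_Zk k)" and q: "q \<in> C" "bproj (Qbundle k) q \<in> W" for C q
  proof -
    obtain v where v: "v \<in> total (normal_Zk k)" "C = Q_orbit k v" using CC by blast
    obtain w where w: "sc_rel k v w" "q = Qproj k w" using q(1) unfolding v(2) by (rule Q_orbit_mem[OF v(1)])
    have wt: "w \<in> total (normal_Zk k)" by (rule sc_rel_normal[OF w(1) v(1)])
    have wW: "tuple_red k w \<in> W" using q(2) unfolding w(2) bproj_Q[OF wt] .
    have wJ: "tuple_red k w \<in> Zk_dom k J" using wW W(2) by blast
    have C: "C = Q_orbit k w" unfolding v(2) Q_orbit_eq_iff[OF v(1) wt] by (rule w(1))
    show ?thesis
      unfolding C w(2) G[OF wt wW] Q_to_slice_eq[OF wt retr_slice(1)[OF k wt wJ bspec[OF W(3) wW]] retr_rel[OF wt wJ bspec[OF W(3) wW]]]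
      by (simp add: sgn_class_def)
  qed
  then show "\<exists>W f F. x \<in> W \<and> bundle_map_on W (Qbundle k) (normal_slice k) f F \<and>
      (\<forall>C\<in>Q_orbit k ` total (normal_Zk k). \<forall>e\<in>C. bproj (Qbundle k) e \<in> W \<longrightarrow> F e \<in> Q_to_slice C)"
    using W(1) GQ by blast
qed

text \<open>The inverse is lifted over the whole slice by the embedding followed by the projection
  to Q.\<close>

lemma slice_Q_lifts:
  "locally_lifts (normal_slice k) (Qbundle k) (slice_classes k 1) (inv_into (Q_orbit k ` total (normal_Zk k)) Q_to_slice)"
  unfolding locally_lifts_def
proof
  fix x assume "x \<in> mpoints (base (normal_slice k))"
  then have x: "x \<in> slice k 0" by simp
  have B: "bundle_map_on {x \<in> slice k 0. slice_embed k 0 x \<in> Zk k 0} (normal_slice k) (Qbundle k)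
      (\<lambda>x. id (slice_embed k 0 x)) (\<lambda>e. Qproj k (slice_embed k 1 e))"
  proof (rule bundle_map_compose[OF holo_vbundle_slice[OF k] holo_vbundle_normal _ _ embed_map[OF k] Qproj_map[OF k]])
    show "holo_atlas (base (Qbundle k))" by (simp add: Zk_atlas)
    show "mopen (base (Qbundle k)) V" if "(V, \<tau>) \<in> trivs (Qbundle k)" for V \<tau>
      using holo_vbundleD(5)[OF holo_vbundle_Q[OF k] that] .
  qed
  have R: "Qproj k (slice_embed k 1 e) \<in> inv_into (Q_orbit k ` total (normal_Zk k)) Q_to_slice C"
    if CC: "C \<in> slice_classes k 1" and e: "e \<in> C" for C e
  proof -
    obtain n where n: "n \<in> slice k 1" "C = sgn_class k n" using CC unfolding slice_classes_eq by blast
    note m = sgn_class_mem[OF n(1) e[unfolded n(2)]]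
    note em = embed_normal[OF m(1)]
    have "inv_into (Q_orbit k ` total (normal_Zk k)) Q_to_slice C = Q_orbit k (slice_embed k 1 e)"
      by (rule inv_into_f_eq[OF bij_betw_imp_inj_on[OF Q_to_slice_bij]])
        (use em Q_to_slice_eq[OF em m(1) sc_rel_refl[OF em]] in \<open>simp_all only: n(2) m(2) imageI\<close>)
    then show ?thesis using Q_orbit_rel[OF em sc_rel_refl[OF em]] by simp
  qed
  have X: "x \<in> {x \<in> slice k 0. slice_embed k 0 x \<in> Zk k 0}" using x embed_0[OF k x] by simp
  show "\<exists>W f F. x \<in> W \<and> bundle_map_on W (normal_slice k) (Qbundle k) f F \<and>
      (\<forall>C\<in>slice_classes k 1. \<forall>e\<in>C. bproj (normal_slice k) e \<in> W \<longrightarrow>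
        F e \<in> inv_into (Q_orbit k ` total (normal_Zk k)) Q_to_slice C)"
    by (intro exI conjI ballI impI) (rule X, rule B, rule R, assumption+)
qed

lemma vscale_Q_orbit:
  assumes v: "v \<in> total (normal_Zk k)"
  shows "vscale (Qbundle k) t ` Q_orbit k v = Q_orbit k (vscale (normal_Zk k) t v)"
proof -
  have "vscale (Qbundle k) t (Q_act k M (Qproj k v)) = Q_act k M (Qproj k (vscale (normal_Zk k) t v))" if M: "M \<in> carrier SL2" for M
    unfolding Q_act_Qproj[OF k M v] Q_act_Qproj[OF k M normal_ops(1)[OF v]] tuple_act_scale[OF k M v]
    by (rule vscale_Q[OF normal_act[OF k M v]])
  then show ?thesis unfolding Q_orbit_def orbit_def Setcompr_eq_image image_image by (rule image_cong[OF refl])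
qed

text \<open>Compatibility with the maps to \<open>M0\<close> holds because all vectors involved are
  superconformally related, and compatibility with scaling because scaling respects that
  relation.\<close>

lemma Q_slice_iso:
  "quotient_bundle_iso
     (Qbundle k) (orbits SL2 (total (Qbundle k)) (Q_act k)) (\<lambda>q. M0_pt k (bproj (Qbundle k) q))
     (normal_slice k) (slice_classes k 1) (\<lambda>n. M0_pt k (slice_embed k 0 (bproj (normal_slice k) n))) Q_to_slice"
  unfolding quotient_bundle_iso_def Q_orbits
proof (intro conjI allI impI ballI)
  show "bij_betw Q_to_slice (Q_orbit k ` total (normal_Zk k)) (slice_classes k 1)" by (rule Q_to_slice_bij)
  show "locally_lifts (Qbundle k) (normal_slice k) (Q_orbit k ` total (normal_Zk k)) Q_to_slice" by (rule Q_slice_lifts)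
  show "locally_lifts (normal_slice k) (Qbundle k) (slice_classes k 1) (inv_into (Q_orbit k ` total (normal_Zk k)) Q_to_slice)"
    by (rule slice_Q_lifts)
  fix C assume "C \<in> Q_orbit k ` total (normal_Zk k)"
  then obtain v where v: "v \<in> total (normal_Zk k)" "C = Q_orbit k v" by blast
  obtain n where n: "n \<in> slice k 1" "sc_rel k v (slice_embed k 1 n)" by (rule slice_surj[OF v(1)])
  show "M0_pt k (bproj (Qbundle k) q) = M0_pt k (slice_embed k 0 (bproj (normal_slice k) e))"
    if q: "q \<in> C" and e: "e \<in> Q_to_slice C" for q e
  proof -
    obtain w where w: "sc_rel k v w" "q = Qproj k w" using q unfolding v(2) by (rule Q_orbit_mem[OF v(1)])
    have wt: "w \<in> total (normal_Zk k)" by (rule sc_rel_normal[OF w(1) v(1)])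
    have e': "e \<in> sgn_class k n" using e unfolding v(2) Q_to_slice_eq[OF v(1) n] .
    note m = sgn_class_mem(1)[OF n(1) e']
    have "sc_rel k v (slice_embed k 1 e)"
      using sc_rel_trans[OF v(1) n(2)] embed_rel_iff[OF n(1) m] e' by blast
    from M0_pt_rel[OF v(1) this] M0_pt_rel[OF v(1) w(1)] show ?thesis
      unfolding w(2) bproj_Q[OF wt] normal_slice_simps embed_1(2)[OF k m] by simp
  qed
  show "Q_to_slice (vscale (Qbundle k) t ` C) = vscale (normal_slice k) t ` Q_to_slice C" if "t \<noteq> 0" for t
  proof -
    have "sc_rel k (vscale (normal_Zk k) t v) (slice_embed k 1 (vscale (normal_slice k) t n))"
      unfolding embed_scale(2)[OF n(1)] by (rule vscale_rel[OF v(1) n(2)])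
    then show ?thesis
      unfolding v(2) vscale_Q_orbit[OF v(1)] Q_to_slice_eq[OF v(1) n] scale_class[OF n(1)]
      by (rule Q_to_slice_eq[OF normal_ops(1)[OF v(1)] embed_scale(1)[OF n(1)]])
  qed
qed

end

theorem mainTheorem14:
  fixes k :: nat
  assumes "k \<ge> 3"
  shows
    "total (normal_Zk k) = Zk k 1 \<and>
     short_exact (susy_bundle k) (normal_Zk k) (Qbundle k) (SUSY k) (Qproj k) \<and>
     SL2_action (susy_bundle k) (tuple_act k) (susy_act k) \<and>
     SL2_action (normal_Zk k) (tuple_act k) (tuple_act k) \<and>
     SL2_action (Qbundle k) (tuple_act k) (Q_act k) \<and>
     SL2_equivariant (susy_bundle k) (susy_act k) (tuple_act k) (SUSY k) \<and>
     SL2_equivariant (normal_Zk k) (tuple_act k) (Q_act k) (Qproj k) \<and>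
     Cstar_equivariant (susy_bundle k) (normal_Zk k) (SUSY k) \<and>
     Cstar_equivariant (normal_Zk k) (Qbundle k) (Qproj k) \<and>
     actions_commute (susy_bundle k) (susy_act k) \<and>
     actions_commute (normal_Zk k) (tuple_act k) \<and>
     actions_commute (Qbundle k) (Q_act k) \<and>
     M0 k = moduli_pts k 0 \<and>
     bij_betw (\<lambda>x. M0_pt k (slice_embed k 0 x)) (slice k 0) (M0 k) \<and>
     holo_vbundle (normal_slice k) \<and>
     quotient_bundle_iso
       (normal_slice k) (slice_classes k 1) (\<lambda>n. M0_pt k (slice_embed k 0 (bproj (normal_slice k) n)))
       (normal_Zk k) (moduli_pts k 1) (\<lambda>v. M0_pt k (bproj (normal_Zk k) v))
       (slice_to_moduli k 1) \<and>
     (\<exists>\<Phi>. quotient_bundle_iso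
       (Qbundle k) (orbits SL2 (total (Qbundle k)) (Q_act k)) (\<lambda>q. M0_pt k (bproj (Qbundle k) q))
       (normal_slice k) (slice_classes k 1) (\<lambda>n. M0_pt k (slice_embed k 0 (bproj (normal_slice k) n)))
       \<Phi>)"
\<comment> \<open>The witness \<Phi> stays schematic here and is fixed to \<open>Q_to_slice\<close>
  by the last of the cited facts.\<close>
proof (intro conjI exI)
  show "total (normal_Zk k) = Zk k 1" by (rule total_normal_Zk)
qed (fact susy_exact[OF assms] SL2_action_susy[OF assms] SL2_action_normal[OF assms] SL2_action_Q[OF assms]
    SUSY_equivariant[OF assms] Qproj_equivariant[OF assms] SUSY_Cstar[OF assms] Qproj_Cstar[OF assms]
    susy_commute[OF assms] normal_commute[OF assms] Q_commute[OF assms] M0_moduli[OF assms]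
    slice_M0_bij[OF assms] holo_vbundle_slice[OF assms] slice_moduli_iso[OF assms] Q_slice_iso[OF assms])+

end
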